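(* Let $\alpha=(a,b;x,y,z)\in\mathbb{N}^5$ with $n=a+b=x+y+z$, $a\geq b$ and $x=\max(x,y,z)$, and suppose that the component $\mathrm{iss}_\alpha B_3$ contains simple representations. Then the involution $\tau$ acts as the identity on $\mathrm{iss}_\alpha B_3$ if and only if $\alpha$ is equal to one of the following: \begin{itemize} \item $(1,0;1,0,0)$ or $(4,2;2,2,2)$, \item $(k,k;k,k-1,1)$ or $(k,k;k,1,k-1)$ for some integer $k\geq 1$, \item $(k+1,k;k,k,1)$ or $(k+1,k;k,1,k)$ for some integer $k\geq 1$. \end{itemize} In all these cases, $\dim \mathrm{iss}_\alpha B_3=n$. In all other cases, $\mathrm{iss}_\alpha B_3$ contains simple representations $\phi$ such that $\mathrm{Tr}_\phi(w)\neq \mathrm{Tr}_\phi(w')$, where $w=\sigma_1^{-2}\sigma_2\sigma_1^{-1}\sigma_2\sigma_1^{-1}\sigma_2^2$ and $w'=\sigma_2^2\sigma_1^{-1}\sigma_2\sigma_1^{-1}\sigma_2\sigma_1^{-2}$ is its reversed braid; that is, $\mathrm{iss}_\alpha B_3$ can detect braid-reversion.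
   Context: All representations are finite dimensional over $\mathbb{C}$. $B_3=\langle \sigma_1,\sigma_2\mid \sigma_1\sigma_2\sigma_1=\sigma_2\sigma_1\sigma_2\rangle$ is the three string braid group. An $n$-dimensional representation is a pair $\phi=(X_1,X_2)$ of invertible $n\times n$ matrices (images of $\sigma_1,\sigma_2$) satisfying the braid relation; $\mathrm{Tr}_\phi(g)$ is the trace of the image of $g$. $\mathrm{rep}_nB_3$ is the affine variety of all such pairs and $\mathrm{iss}_n B_3$ is its quotient variety under simultaneous conjugation, whose points are the isomorphism classes of semi-simple $n$-dimensional representations. The involution $\tau$ on $\mathrm{iss}_nB_3$ is induced by $\tau(X_1,X_2)=(X_1^{tr},X_2^{tr})$. The element $c=(\sigma_1\sigma_2)^3=(\sigma_1\sigma_2\sigma_1)^2$ is central, and $B_3/\langle c\rangle=\langle s,t\mid s^2=t^3=e\rangle\simeq C_2*C_3=:\Gamma$, where $s,t$ are the images of $\sigma_1\sigma_2\sigma_1$ and $\sigma_1\sigma_2$. Fix a primitive third root of unity $\rho$. The dimension vector of a $\Gamma$-representation $V$ is $(a,b;x,y,z)$, where $a,b$ are the dimensions of the eigenspaces of $s$ for the eigenvalues $1,-1$, and $x,y,z$ those of the eigenspaces of $t$ for the eigenvalues $1,\rho,\rho^2$. On a simple $B_3$-representation $\phi=(X_1,X_2)$, $c$ acts by a scalar $\lambda\neq0$, and $\lambda^{-1/6}\phi=(\lambda^{-1/6}X_1,\lambda^{-1/6}X_2)$ (for any choice of sixth root) is a simple $\Gamma$-representation. For $\alpha$ the dimension vector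 of a simple $\Gamma$-representation, $\mathrm{iss}_\alpha B_3$ is the irreducible component of $\mathrm{iss}_nB_3$ that is the Zariski closure of the set of classes of simple representations $\mu\phi'=(\mu X_1',\mu X_2')$ with $\mu\in\mathbb{C}^*$ and $\phi'=(X_1',X_2')$ a simple $\Gamma$-representation (viewed as a $B_3$-representation) of dimension vector $\alpha$; "$\mathrm{iss}_\alpha B_3$ contains simple representations" means that $\alpha$ is such a dimension vector. Since multiplying by sixth roots of unity permutes the dimension vectors, every component containing simple representations is $\mathrm{iss}_\alpha B_3$ for some $\alpha$ with $a\geq b$ and $x=\max(x,y,z)$. *)

theory Defs
  imports
    "HOL-Analysis.Abstract_Topology"
    "HOL-Library.Extended_Nat"
    "Jordan_Normal_Form.Jordan_Normal_Form"
    "Jordan_Normal_Form.Matrix_Kernel"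
begin

text \<open>An $n$-dimensional representation is the pair of images of the two standard generators.\<close>

type_synonym rep = "complex mat \<times> complex mat"

definition rep_B3 :: "nat \<Rightarrow> rep set" where
  "rep_B3 n = {(X1, X2). X1 \<in> carrier_mat n n \<and> X2 \<in> carrier_mat n n \<and>
     invertible_mat X1 \<and> invertible_mat X2 \<and> X1 * X2 * X1 = X2 * X1 * X2}"

definition rep_iso :: "rep \<Rightarrow> rep \<Rightarrow> bool" where
  "rep_iso \<phi> \<psi> \<longleftrightarrow> (\<exists>P Q. similar_mat_wit (fst \<phi>) (fst \<psi>) P Q \<and> similar_mat_wit (snd \<phi>) (snd \<psi>) P Q)"

text \<open>In finite dimension a subspace stable under an invertible matrix is also stable under its
  inverse, so stability under the two generators suffices.\<close>

definition invariant_subspace :: "nat \<Rightarrow> rep \<Rightarrow> complex vec set \<Rightarrow> bool" where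
  "invariant_subspace n \<phi> W \<longleftrightarrow>
     VectorSpace.subspace class_ring W (module_vec TYPE(complex) n) \<and>
     (\<forall>v\<in>W. fst \<phi> *\<^sub>v v \<in> W \<and> snd \<phi> *\<^sub>v v \<in> W)"

definition simple_rep :: "nat \<Rightarrow> rep \<Rightarrow> bool" where
  "simple_rep n \<phi> \<longleftrightarrow> \<phi> \<in> rep_B3 n \<and> n > 0 \<and>
     (\<forall>W. invariant_subspace n \<phi> W \<longrightarrow> W = {0\<^sub>v n} \<or> W = carrier_vec n)"

definition direct_sum_rep :: "rep list \<Rightarrow> rep" where
  "direct_sum_rep \<phi>s = (diag_block_mat (map fst \<phi>s), diag_block_mat (map snd \<phi>s))"

definition semisimple_rep :: "nat \<Rightarrow> rep \<Rightarrow> bool" where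
  "semisimple_rep n \<phi> \<longleftrightarrow> \<phi> \<in> rep_B3 n \<and>
     (\<exists>\<phi>s. (\<forall>\<psi>\<in>set \<phi>s. \<exists>m. simple_rep m \<psi>) \<and> rep_iso \<phi> (direct_sum_rep \<phi>s))"

definition scale_rep :: "complex \<Rightarrow> rep \<Rightarrow> rep" where
  "scale_rep \<mu> \<phi> = (\<mu> \<cdot>\<^sub>m fst \<phi>, \<mu> \<cdot>\<^sub>m snd \<phi>)"

definition transpose_rep :: "rep \<Rightarrow> rep" where
  "transpose_rep \<phi> = (transpose_mat (fst \<phi>), transpose_mat (snd \<phi>))"

datatype braid_gen = Sigma1 | Sigma2

type_synonym braid_word = "(braid_gen \<times> int) list"

fun gen_image :: "rep \<Rightarrow> braid_gen \<Rightarrow> complex mat" where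
  "gen_image \<phi> Sigma1 = fst \<phi>"
| "gen_image \<phi> Sigma2 = snd \<phi>"

definition mat_int_pow :: "complex mat \<Rightarrow> int \<Rightarrow> complex mat" where
  "mat_int_pow A k = (if k \<ge> 0 then A ^\<^sub>m nat k else the (mat_inverse A) ^\<^sub>m nat (- k))"

definition word_image :: "nat \<Rightarrow> rep \<Rightarrow> braid_word \<Rightarrow> complex mat" where
  "word_image n \<phi> u = foldr (\<lambda>(g, k) M. mat_int_pow (gen_image \<phi> g) k * M) u (1\<^sub>m n)"

definition word_trace :: "nat \<Rightarrow> rep \<Rightarrow> braid_word \<Rightarrow> complex" where
  "word_trace n \<phi> u = (\<Sum>i<n. word_image n \<phi> u $$ (i, i))"

definition braid_w :: braid_word where
  "braid_w = [(Sigma1, -2), (Sigma2, 1), (Sigma1, -1), (Sigma2, 1), (Sigma1, -1), (Sigma2, 2)]"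

definition braid_w' :: braid_word where
  "braid_w' = [(Sigma2, 2), (Sigma1, -1), (Sigma2, 1), (Sigma1, -1), (Sigma2, 1), (Sigma1, -2)]"

lemma braid_w'_eq_rev: "braid_w' = rev braid_w"
  by (simp add: braid_w_def braid_w'_def)

definition iso_class :: "nat \<Rightarrow> rep \<Rightarrow> rep set" where
  "iso_class n \<phi> = {\<psi> \<in> rep_B3 n. rep_iso \<phi> \<psi>}"

definition iss_B3 :: "nat \<Rightarrow> rep set set" where
  "iss_B3 n = iso_class n ` {\<phi>. semisimple_rep n \<phi>}"

definition tau :: "rep set \<Rightarrow> rep set" where
  "tau C = transpose_rep ` C"

text \<open>Polynomial functions in the matrix entries and the inverses of the two determinants; their
  restrictions form the coordinate ring of the affine variety of n-dimensional representations.\<close>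

inductive_set regular_fun :: "nat \<Rightarrow> (rep \<Rightarrow> complex) set" for n :: nat where
  const: "(\<lambda>_. c) \<in> regular_fun n"
| entry1: "i < n \<Longrightarrow> j < n \<Longrightarrow> (\<lambda>\<phi>. fst \<phi> $$ (i, j)) \<in> regular_fun n"
| entry2: "i < n \<Longrightarrow> j < n \<Longrightarrow> (\<lambda>\<phi>. snd \<phi> $$ (i, j)) \<in> regular_fun n"
| inv_det1: "(\<lambda>\<phi>. inverse (det (fst \<phi>))) \<in> regular_fun n"
| inv_det2: "(\<lambda>\<phi>. inverse (det (snd \<phi>))) \<in> regular_fun n"
| add: "f \<in> regular_fun n \<Longrightarrow> g \<in> regular_fun n \<Longrightarrow> (\<lambda>\<phi>. f \<phi> + g \<phi>) \<in> regular_fun n"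
| mult: "f \<in> regular_fun n \<Longrightarrow> g \<in> regular_fun n \<Longrightarrow> (\<lambda>\<phi>. f \<phi> * g \<phi>) \<in> regular_fun n"

definition invariant_fun :: "nat \<Rightarrow> (rep \<Rightarrow> complex) set" where
  "invariant_fun n = {f \<in> regular_fun n.
     \<forall>\<phi>\<in>rep_B3 n. \<forall>\<psi>\<in>rep_B3 n. rep_iso \<phi> \<psi> \<longrightarrow> f \<phi> = f \<psi>}"

text \<open>The coordinate ring of the quotient variety is the ring of invariant regular functions, so the
  Zariski topology is generated by their non-vanishing loci. An invariant function is constant on
  each class, so the bounded quantifier merely evaluates it there.\<close>

definition zariski_iss :: "nat \<Rightarrow> rep set topology" where
  "zariski_iss n = topology_generated_by
     ((\<lambda>f. {C \<in> iss_B3 n. \<forall>\<phi>\<in>C. f \<phi> \<noteq> 0}) ` invariant_fun n)"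

definition irreducible_in :: "'a topology \<Rightarrow> 'a set \<Rightarrow> bool" where
  "irreducible_in T Z \<longleftrightarrow> Z \<subseteq> topspace T \<and> Z \<noteq> {} \<and>
     (\<forall>A B. closedin T A \<and> closedin T B \<and> Z \<subseteq> A \<union> B \<longrightarrow> Z \<subseteq> A \<or> Z \<subseteq> B)"

text \<open>Krull dimension: the supremum of the lengths of strict chains of irreducible closed subsets.
  The empty space, whose dimension is a matter of convention, gets 0.\<close>

definition krull_dim :: "'a topology \<Rightarrow> enat" where
  "krull_dim T = Sup {enat d | d Z. (\<forall>i\<le>d. closedin T (Z i) \<and> irreducible_in T (Z i)) \<and>
     (\<forall>i<d. Z i \<subset> Z (Suc i))}"

text \<open>A representation of $\Gamma = B_3/\langle c\rangle$ is a representation of $B_3$ on which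
  $c = (\sigma_1\sigma_2)^3$ acts trivially.\<close>

definition simple_Gamma_rep :: "nat \<Rightarrow> rep \<Rightarrow> bool" where
  "simple_Gamma_rep n \<phi> \<longleftrightarrow> simple_rep n \<phi> \<and> (fst \<phi> * snd \<phi>) ^\<^sub>m 3 = 1\<^sub>m n"

definition eigenspace_dim :: "complex mat \<Rightarrow> complex \<Rightarrow> nat" where
  "eigenspace_dim A e = kernel_dim (char_matrix A e)"

type_synonym dim_vec5 = "nat \<times> nat \<times> nat \<times> nat \<times> nat"

text \<open>Here $s$ and $t$ act as $\sigma_1\sigma_2\sigma_1$ and $\sigma_1\sigma_2$; the parameter is
  the chosen primitive third root of unity.\<close>

definition dim_vector :: "complex \<Rightarrow> rep \<Rightarrow> dim_vec5" where
  "dim_vector \<rho> \<phi> = (let s = fst \<phi> * snd \<phi> * fst \<phi>; t = fst \<phi> * snd \<phi> in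
     (eigenspace_dim s 1, eigenspace_dim s (-1),
      eigenspace_dim t 1, eigenspace_dim t \<rho>, eigenspace_dim t (\<rho>\<^sup>2)))"

definition simple_Gamma_dim :: "complex \<Rightarrow> nat \<Rightarrow> dim_vec5 \<Rightarrow> bool" where
  "simple_Gamma_dim \<rho> n \<alpha> \<longleftrightarrow> (\<exists>\<phi>. simple_Gamma_rep n \<phi> \<and> dim_vector \<rho> \<phi> = \<alpha>)"

definition iss_comp :: "complex \<Rightarrow> nat \<Rightarrow> dim_vec5 \<Rightarrow> rep set set" where
  "iss_comp \<rho> n \<alpha> = zariski_iss n closure_of
     {iso_class n (scale_rep \<mu> \<phi>) | \<mu> \<phi>. \<mu> \<noteq> 0 \<and> simple_Gamma_rep n \<phi> \<and> dim_vector \<rho> \<phi> = \<alpha>}"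

definition tau_trivial_list :: "dim_vec5 set" where
  "tau_trivial_list = {(1, 0, 1, 0, 0), (4, 2, 2, 2, 2)} \<union>
     (\<Union>k\<in>{1..}. {(k, k, k, k - 1, 1), (k, k, k, 1, k - 1),
                   (k + 1, k, k, k, 1), (k + 1, k, k, 1, k)})"

end

theory Submission
 imports Defs "Jordan_Normal_Form.Spectral_Radius" "Jordan_Normal_Form.Jordan_Normal_Form_Uniqueness"
begin

text \<open>
 A simple representation of the braid group is, up to a scalar, a representation of
 \<open>C\<^sub>2 * C\<^sub>3\<close>, that is a pair \<open>S, T\<close> of matrices with \<open>S\<^sup>2 = T\<^sup>3 = 1\<close>; the braid generators are then
 \<open>T\<^sup>2 S\<close> and \<open>S T\<^sup>2\<close> (\<open>stp\<close>). The pairs with a prescribed dimension vector form one family (\<open>FG\<close>), and any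
 two of its members are joined by a rational curve inside it: both conjugating matrices may be moved
 along a straight line (\<open>FGM_rconn\<close>). So two non-zero regular functions on the family are
 simultaneously non-zero somewhere, and since simplicity is an open condition (\<open>simple_open\<close>), a
 statement about a component may be tested on a generic simple member (\<open>FG_density\<close>,
 \<open>FG_generic_simple\<close>).

 Points of the quotient are compared by traces. Burnside's theorem (\<open>burnside\<close>) makes the traces of
 noncommutative polynomials in the two generators separate semisimple representations
 (\<open>characters_determine\<close>), and transposition reverses these polynomials. Hence the involution is
 trivial on a component as soon as reversal changes no trace on its generic simple members
 (\<open>tau_trivial_if_traces\<close>).

 For a listed dimension vector, either one eigenspace of \<open>T\<close> is a line or the vector is \<open>(4,2;2,2,2)\<close>.
 In the first case the vectors obtained from that line by applying alternately \<open>S\<close> and the projector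
 to a second eigenspace of \<open>T\<close> generically form a basis (\<open>rank_one_form.normal_form_exists\<close>). In the
 second case \<open>S\<close> has a two-dimensional \<open>-1\<close>-eigenspace, and \<open>T\<close> induces on it three \<open>2 \<times> 2\<close> matrices with
 sum \<open>1\<close>; an eigenvector of one of them gives a basis (\<open>normal_form6\<close>). Either way a generic member is
 isomorphic to a member \<open>N(c)\<close> of an explicit family that depends polynomially on \<open>n - 1\<close> parameters. On
 \<open>N(c)\<close> there is a non-zero symmetric bilinear form for which \<open>S\<close> and \<open>T\<close> are self-adjoint. By Schur's
 lemma such a form identifies a simple representation with its transpose (\<open>self_adjoint_reversal\<close>), so
 the involution is trivial.

 The same families give the dimension. Together with the scalar there are \<open>n\<close> parameters, so any
 \<open>n + 1\<close> invariants satisfy an algebraic relation on the component (\<open>invariants_dependent\<close>), whereas a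
 chain of \<open>d\<close> strict inclusions of irreducible closed sets yields \<open>d\<close> algebraically independent
 invariants (\<open>chain_independent\<close>): this bounds the dimension by \<open>n\<close>. Conversely, invariants that
 depend on one further parameter at a time show that freeing the parameters one at a time produces
 strictly increasing closures (\<open>chain_exists\<close>), and the scalar accounts for the last step.

 For any other dimension vector of a simple representation, \<open>a\<close> and \<open>b\<close> are at least \<open>3\<close> and \<open>x\<close>, \<open>y\<close>, \<open>z\<close>
 are at least \<open>2\<close>: otherwise eigenspaces of \<open>S\<close> and \<open>T\<close> meet, or \<open>T\<close> has two eigenvalues only
 (\<open>simple_non_list\<close>). Then the family contains the direct sum of one explicit
 six-dimensional representation, on which the braid and its reverse have different traces, and
 one-dimensional representations (\<open>detects_large\<close>). The traces still differ on a generic simple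
 member, and this member is not fixed by the involution (\<open>detects_simple\<close>).
\<close>

section \<open>Matrix preliminaries\<close>

abbreviation mats :: "nat => complex mat set" where "mats n \<equiv> carrier_mat n n"

definition mtr :: "complex mat => complex" where
 "mtr A = (\<Sum>i<dim_row A. A $$ (i,i))"

lemma mult_idx:
 assumes "A \<in> carrier_mat n m" "B \<in> carrier_mat m k" "i < n" "j < k"
 shows "(A * B) $$ (i,j) = (\<Sum>l<m. A $$ (i,l) * B $$ (l,j))"
 using assms by (simp add: scalar_prod_def atLeast0LessThan)

lemma mult_vec_idx:
 assumes "A \<in> carrier_mat n m" "v \<in> carrier_vec m" "i < n"
 shows "(A *\<^sub>v v) $ i = (\<Sum>l<m. A $$ (i,l) * v $ l)"
 using assms by (simp add: scalar_prod_def atLeast0LessThan)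

lemma mtr_comm:
 assumes "A \<in> carrier_mat n m" "B \<in> carrier_mat m n"
 shows "mtr (A * B) = mtr (B * A)"
proof -
 have "mtr (A * B) = (\<Sum>i<n. \<Sum>l<m. A $$ (i,l) * B $$ (l,i))"
  unfolding mtr_def using assms by (intro sum.cong) (auto simp: mult_idx simp del: index_mult_mat(1))
 also have "\<dots> = (\<Sum>l<m. \<Sum>i<n. B $$ (l,i) * A $$ (i,l))"
  by (subst sum.swap) (simp add: mult.commute)
 also have "\<dots> = mtr (B * A)"
  unfolding mtr_def using assms by (intro sum.cong) (auto simp: mult_idx simp del: index_mult_mat(1))
 finally show ?thesis .
qed

lemma mtr_add: "A \<in> mats n ==> B \<in> mats n ==> mtr (A + B) = mtr A + mtr B"
 by (auto simp: mtr_def sum.distrib)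

lemma mtr_smult: "A \<in> mats n ==> mtr (c \<cdot>\<^sub>m A) = c * mtr A"
 by (auto simp: mtr_def sum_distrib_left)

lemma mtr_one [simp]: "mtr (1\<^sub>m n) = of_nat n"
 by (simp add: mtr_def)

lemma mtr_transpose: "A \<in> mats n ==> mtr (transpose_mat A) = mtr A"
 by (auto simp: mtr_def)

lemma mtr_conj:
 assumes "P \<in> mats n" "Q \<in> mats n" "Q * P = 1\<^sub>m n" "B \<in> mats n"
 shows "mtr (P * B * Q) = mtr B"
 using assms mtr_comm[of P n n "B * Q"] by (simp add: assoc_mult_mat[of _ n n _ n _ n])

text \<open>Fewer equations than unknowns: one unknown is eliminated with the help of the equation that is
 removed.\<close>
lemma homogeneous_system:
 fixes a :: "'i => 'j => 'k::field"
 assumes "finite R" "finite E" "card R < card E"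
 shows "\<exists>c. (\<exists>e\<in>E. c e \<noteq> 0) \<and> (\<forall>r\<in>R. (\<Sum>e\<in>E. c e * a e r) = 0)"
 using assms
proof (induction R arbitrary: E a rule: finite_induct)
 case empty
 then obtain e where "e \<in> E" by fastforce
 then show ?case by (intro exI[of _ "\<lambda>_. 1"]) auto
next
 case (insert r R)
 show ?case
 proof (cases "\<forall>e\<in>E. a e r = 0")
  case True
  with insert.IH[of E a] insert.prems insert.hyps show ?thesis by auto
 next
  case False
  then obtain e0 where e0: "e0 \<in> E" "a e0 r \<noteq> 0" by auto
  let ?E = "E - {e0}"
  have "card R < card ?E" using insert e0 by simp
  from insert.IH[OF _ this, of "\<lambda>e s. a e s - a e r / a e0 r * a e0 s"] insert.prems
  obtain c where c: "\<exists>e\<in>?E. c e \<noteq> 0"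
   "\<forall>s\<in>R. (\<Sum>e\<in>?E. c e * (a e s - a e r / a e0 r * a e0 s)) = 0" by auto
  define d where "d = c(e0 := - (\<Sum>e\<in>?E. c e * a e r) / a e0 r)"
  have split: "(\<Sum>e\<in>E. d e * a e s) = d e0 * a e0 s + (\<Sum>e\<in>?E. c e * a e s)" for s
   using e0 insert.prems by (subst sum.remove[of E e0]) (auto simp: d_def intro!: sum.cong)
  have "(\<Sum>e\<in>E. d e * a e r) = 0" using e0 by (simp add: split) (simp add: d_def)
  moreover have "(\<Sum>e\<in>E. d e * a e s) = 0" if "s \<in> R" for s
  proof -
   have "0 = (\<Sum>e\<in>?E. c e * a e s) - (\<Sum>e\<in>?E. c e * a e r) / a e0 r * a e0 s"
    using c(2)[rule_format, OF that]
    by (simp add: algebra_simps sum_subtractf sum_distrib_left sum_distrib_right sum_divide_distrib)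
   then show ?thesis by (simp add: split) (simp add: d_def)
  qed
  moreover have "\<exists>e\<in>E. d e \<noteq> 0" using c(1) by (auto simp: d_def)
  ultimately show ?thesis by (intro exI[of _ d]) auto
 qed
qed

section \<open>Noncommutative polynomials evaluated at a representation\<close>

text \<open>Syntax trees for noncommutative polynomials in the two generators. Inverses of the generators
 need no syntax of their own: on the representations that matter below they are polynomials in the
 generators.\<close>
datatype ncp = NC complex | NX | NY | NAdd ncp ncp | NMul ncp ncp

text \<open>The generators are read off entry by entry, so that the value is an \<open>n \<times> n\<close> matrix for every
 argument.\<close>
primrec nev :: "nat => rep => ncp => complex mat" where
 "nev n \<phi> (NC c) = c \<cdot>\<^sub>m 1\<^sub>m n"
| "nev n \<phi> NX = mat n n (\<lambda>ij. fst \<phi> $$ ij)"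
| "nev n \<phi> NY = mat n n (\<lambda>ij. snd \<phi> $$ ij)"
| "nev n \<phi> (NAdd p q) = nev n \<phi> p + nev n \<phi> q"
| "nev n \<phi> (NMul p q) = nev n \<phi> p * nev n \<phi> q"

primrec nrev :: "ncp => ncp" where
 "nrev (NC c) = NC c"
| "nrev NX = NX"
| "nrev NY = NY"
| "nrev (NAdd p q) = NAdd (nrev p) (nrev q)"
| "nrev (NMul p q) = NMul (nrev q) (nrev p)"

abbreviation pairs :: "nat => rep set" where
 "pairs n \<equiv> mats n \<times> mats n"

lemma nev_carrier [simp]: "nev n \<phi> p \<in> mats n"
 by (induction p) auto

lemma nev_dim [simp]: "dim_row (nev n \<phi> p) = n" "dim_col (nev n \<phi> p) = n"
 using nev_carrier[of n \<phi> p] by blast+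

lemma nev_gen: "\<phi> \<in> pairs n ==> nev n \<phi> NX = fst \<phi>" "\<phi> \<in> pairs n ==> nev n \<phi> NY = snd \<phi>"
 by (auto intro!: eq_matI)

lemma rep_pairs: "\<phi> \<in> rep_B3 n ==> \<phi> \<in> pairs n"
 by (auto simp: rep_B3_def)

lemma nev_intertwine:
 assumes "\<phi> \<in> pairs d" "\<psi> \<in> pairs e" "L \<in> carrier_mat d e"
  and "fst \<phi> * L = L * fst \<psi>" "snd \<phi> * L = L * snd \<psi>"
 shows "nev d \<phi> p * L = L * nev e \<psi> p"
proof (induction p)
 case (NC c)
 then show ?case using assms(3) by (auto simp: mult_smult_distrib mult_smult_assoc_mat[of _ d d])
next
 case (NAdd p q)
 then show ?case using assms(3)
  by (simp add: add_mult_distrib_mat[of _ d d _ _ e] mult_add_distrib_mat[of _ d e _ e])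
next
 case (NMul p q)
 have "nev d \<phi> p * nev d \<phi> q * L = nev d \<phi> p * (L * nev e \<psi> q)"
  using assms(3) NMul by (simp add: assoc_mult_mat[of _ d d _ d _ e])
 also have "\<dots> = L * nev e \<psi> p * nev e \<psi> q"
  using assms(3) NMul by (simp add: assoc_mult_mat[of _ d d _ e _ e, symmetric])
 finally show ?case using assms(3) by (simp add: assoc_mult_mat[of _ d e _ e _ e])
qed (use assms nev_gen[of \<phi> d] nev_gen[of \<psi> e] in \<open>simp_all del: nev.simps\<close>)

lemma nev_transpose:
 assumes "\<phi> \<in> pairs n"
 shows "nev n (transpose_rep \<phi>) p = transpose_mat (nev n \<phi> (nrev p))"
proof (induction p)
 case (NMul p q)
 then show ?case by (simp add: transpose_mult[of _ n n _ n])
next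
 case (NAdd p q)
 then show ?case by (simp add: transpose_add[of _ n n])
next
 case (NC c)
 then show ?case by (auto intro!: eq_matI)
qed (use assms in \<open>auto simp: transpose_rep_def intro!: eq_matI\<close>)

text \<open>One polynomial serves all representations of all dimensions simultaneously; \<open>separate\<close> below
 evaluates it at two representations.\<close>
lemma nev_lincomb:
 fixes m :: nat
 shows "\<exists>p. \<forall>n \<phi>. \<forall>i<n. \<forall>j<n. nev n \<phi> p $$ (i,j) = (\<Sum>k<m. c k * nev n \<phi> (f k) $$ (i,j))"
proof (induction m)
 case 0
 show ?case by (rule exI[of _ "NC 0"]) simp
next
 case (Suc m)
 then obtain p where p: "\<And>n \<phi> i j. i < n ==> j < n ==> nev n \<phi> p $$ (i,j) = (\<Sum>k<m. c k * nev n \<phi> (f k) $$ (i,j))" by blast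
 show ?case by (intro exI[of _ "NAdd p (NMul (NC (c m)) (f m))"] allI impI)
   (simp add: p mult_smult_assoc_mat[OF one_carrier_mat nev_carrier])
qed

definition full_rep :: "nat => rep => bool" where
 "full_rep n \<phi> \<longleftrightarrow> (\<forall>M\<in>mats n. \<exists>p. nev n \<phi> p = M)"

section \<open>Simple representations\<close>

lemma subspace_iff:
 "VectorSpace.subspace class_ring W (module_vec TYPE(complex) n) \<longleftrightarrow>
   W \<subseteq> carrier_vec n \<and> 0\<^sub>v n \<in> W \<and> (\<forall>v\<in>W. \<forall>w\<in>W. v + w \<in> W) \<and> (\<forall>c. \<forall>v\<in>W. c \<cdot>\<^sub>v v \<in> W)"
proof -
 interpret V: vec_space "TYPE(complex)" n .
 show ?thesis
  unfolding VectorSpace.subspace_def submodule_def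
  using V.vectorspace_axioms V.module_axioms
  by (auto simp: module_vec_simps)
qed

lemma simple_repD: "simple_rep n \<phi> ==> \<phi> \<in> pairs n" "simple_rep n \<phi> ==> n > 0"
 "simple_rep n \<phi> ==> \<phi> \<in> rep_B3 n"
 by (auto simp: simple_rep_def rep_B3_def)

lemma simple_invariant:
 assumes "simple_rep n \<phi>" "W \<subseteq> carrier_vec n" "0\<^sub>v n \<in> W"
  "\<And>v w. v \<in> W ==> w \<in> W ==> v + w \<in> W" "\<And>c v. v \<in> W ==> c \<cdot>\<^sub>v v \<in> W"
  "\<And>v. v \<in> W ==> fst \<phi> *\<^sub>v v \<in> W" "\<And>v. v \<in> W ==> snd \<phi> *\<^sub>v v \<in> W"
 shows "W = {0\<^sub>v n} \<or> W = carrier_vec n"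
proof -
 have "invariant_subspace n \<phi> W"
  unfolding invariant_subspace_def subspace_iff using assms(2-7) by simp
 then show ?thesis using assms(1) unfolding simple_rep_def by simp
qed

lemma simple_transitive:
 assumes s: "simple_rep n \<phi>" and v: "v \<in> carrier_vec n" "v \<noteq> 0\<^sub>v n" and w: "w \<in> carrier_vec n"
 shows "\<exists>p. nev n \<phi> p *\<^sub>v v = w"
proof -
 note ph = simple_repD(1)[OF s]
 let ?W = "range (\<lambda>p. nev n \<phi> p *\<^sub>v v)"
 have "?W = {0\<^sub>v n} \<or> ?W = carrier_vec n"
 proof (rule simple_invariant[OF s])
  show "?W \<subseteq> carrier_vec n" using v by (auto intro!: mult_mat_vec_carrier[of _ n n])
  show "0\<^sub>v n \<in> ?W" by (rule image_eqI[of _ _ "NC 0"]) (use v in auto)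
  show "a + b \<in> ?W" if ab: "a \<in> ?W" "b \<in> ?W" for a b
  proof -
   obtain p q where "a = nev n \<phi> p *\<^sub>v v" "b = nev n \<phi> q *\<^sub>v v" using ab by auto
   then show ?thesis using v by (intro image_eqI[of _ _ "NAdd p q"]) (auto simp: add_mult_distrib_mat_vec[of _ n n])
  qed
  show "c \<cdot>\<^sub>v a \<in> ?W" if a: "a \<in> ?W" for a c
  proof -
   obtain p where "a = nev n \<phi> p *\<^sub>v v" using a by auto
   then show ?thesis using v
    by (intro image_eqI[of _ _ "NMul (NC c) p"]) (auto simp: mult_smult_assoc_mat[of _ n n _ n] intro!: eq_vecI)
  qed
  show "fst \<phi> *\<^sub>v a \<in> ?W" if a: "a \<in> ?W" for a
  proof -
   obtain p where "a = nev n \<phi> p *\<^sub>v v" using a by auto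
   then show ?thesis using v nev_gen[OF ph] ph
    by (intro image_eqI[of _ _ "NMul NX p"]) (auto simp del: nev.simps(2,3) simp: assoc_mult_mat_vec[of _ n n _ n])
  qed
  show "snd \<phi> *\<^sub>v a \<in> ?W" if a: "a \<in> ?W" for a
  proof -
   obtain p where "a = nev n \<phi> p *\<^sub>v v" using a by auto
   then show ?thesis using v nev_gen[OF ph] ph
    by (intro image_eqI[of _ _ "NMul NY p"]) (auto simp del: nev.simps(2,3) simp: assoc_mult_mat_vec[of _ n n _ n])
  qed
 qed
 moreover have "v \<in> ?W" by (rule image_eqI[of _ _ "NC 1"]) (use v in auto)
 ultimately have "?W = carrier_vec n" using v by auto
 then show ?thesis using w by (metis (mono_tags, lifting) rangeE)
qed

text \<open>An eigenspace of \<open>T\<close> is an invariant subspace.\<close>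
lemma simple_schur:
 assumes s: "simple_rep n \<phi>" and T: "T \<in> mats n"
  and c: "fst \<phi> * T = T * fst \<phi>" "snd \<phi> * T = T * snd \<phi>"
 shows "\<exists>c. T = c \<cdot>\<^sub>m 1\<^sub>m n"
proof -
 note ph = simple_repD(1)[OF s]
 obtain k where "k \<in> spectrum T" using spectrum_non_empty[OF T simple_repD(2)[OF s]] by auto
 then obtain v where v: "v \<in> carrier_vec n" "v \<noteq> 0\<^sub>v n" "T *\<^sub>v v = k \<cdot>\<^sub>v v"
  using T unfolding spectrum_def eigenvalue_def eigenvector_def by auto
 let ?W = "{w \<in> carrier_vec n. T *\<^sub>v w = k \<cdot>\<^sub>v w}"
 have cl: "X *\<^sub>v w \<in> ?W" if X: "X \<in> mats n" "X * T = T * X" and w: "w \<in> ?W" for X w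
 proof -
  have "T *\<^sub>v (X *\<^sub>v w) = (T * X) *\<^sub>v w" using X w T by (intro assoc_mult_mat_vec[symmetric, of _ n n _ n]) auto
  also have "\<dots> = X *\<^sub>v (T *\<^sub>v w)" using X w T by (simp flip: X(2))
  finally have "T *\<^sub>v (X *\<^sub>v w) = X *\<^sub>v (T *\<^sub>v w)" .
  then show ?thesis using X w by (auto simp: mult_mat_vec[of _ n n])
 qed
 have "?W = {0\<^sub>v n} \<or> ?W = carrier_vec n"
 proof (rule simple_invariant[OF s])
  show "fst \<phi> *\<^sub>v w \<in> ?W" if "w \<in> ?W" for w using cl[OF _ c(1) that] ph by auto
  show "snd \<phi> *\<^sub>v w \<in> ?W" if "w \<in> ?W" for w using cl[OF _ c(2) that] ph by auto
 qed (use T in \<open>auto simp: mult_add_distrib_mat_vec[of _ n n] mult_mat_vec[of _ n n] smult_add_distrib_vec smult_smult_assoc mult.commute\<close>)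
 then have W: "?W = carrier_vec n" using v by auto
 have "T = k \<cdot>\<^sub>m 1\<^sub>m n"
 proof (rule eq_matI)
  fix i j assume ij: "i < dim_row (k \<cdot>\<^sub>m 1\<^sub>m n)" "j < dim_col (k \<cdot>\<^sub>m 1\<^sub>m n)"
  have "unit_vec n j \<in> ?W" unfolding W by simp
  then have "(T *\<^sub>v unit_vec n j) $ i = (k \<cdot>\<^sub>v unit_vec n j) $ i" by simp
  then show "T $$ (i,j) = (k \<cdot>\<^sub>m 1\<^sub>m n) $$ (i,j)" using ij T
   by (auto split: if_splits)
 qed (use T in auto)
 then show ?thesis ..
qed

text \<open>The columns are prescribed one after the other. If the first \<open>m\<close> columns of a value determined
 the next one, then that column would be a combination of the first \<open>m\<close> columns under matrices that
 commute with the representation. These matrices are scalar by Schur's lemma, which contradicts the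
 existence of the unit matrix.\<close>
theorem burnside:
 assumes s: "simple_rep n \<phi>"
 shows "full_rep n \<phi>"
proof -
 note ph = simple_repD(1)[OF s]
 let ?N = "nev n \<phi>"
 have "\<forall>M\<in>mats n. \<exists>p. \<forall>j<m. \<forall>i<n. ?N p $$ (i,j) = M $$ (i,j)" if "m \<le> n" for m
  using that
 proof (induction m)
  case 0
  then show ?case by auto
 next
  case (Suc m)
  then have IH: "\<And>M. M\<in>mats n ==> \<exists>p. \<forall>j<m. \<forall>i<n. ?N p $$ (i,j) = M $$ (i,j)" and m: "m < n" by auto
  have "\<exists>q. (\<forall>j<m. \<forall>i<n. ?N q $$ (i,j) = 0) \<and> (\<exists>i<n. ?N q $$ (i,m) \<noteq> 0)"
  proof (rule ccontr)
   assume "\<not> ?thesis"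
   then have kill: "\<And>q r. (\<forall>j<m. \<forall>i<n. ?N q $$ (i,j) = 0) ==> r < n ==> ?N q $$ (r,m) = 0" by blast
   have "\<exists>p. \<forall>l<m. \<forall>r<n. ?N p $$ (r,l) = (if l = i \<and> r = j then 1 else 0)" for i j
   proof -
    from IH[of "mat n n (\<lambda>(r,l). if l = i \<and> r = j then 1 else 0)"] m
    show ?thesis by (auto)
   qed
   then obtain pp where pp: "\<And>i j l r. l < m ==> r < n ==> ?N (pp i j) $$ (r,l) = (if l = i \<and> r = j then 1 else 0)"
    by metis
   define \<theta> where "\<theta> i = mat n n (\<lambda>(r,j). ?N (pp i j) $$ (r,m))" for i
   have \<theta>C: "\<theta> i \<in> mats n" for i by (simp add: \<theta>_def)
   have claim: "?N q $$ (r,m) = (\<Sum>j<n. \<theta> i $$ (r,j) * ?N q $$ (j,i))"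
    if i: "i < m" and q: "\<And>l t. l < m ==> l \<noteq> i ==> t < n ==> ?N q $$ (t,l) = 0" and r: "r < n" for q i r
   proof -
    obtain p where p: "\<And>t l. t<n ==> l<n ==> ?N p $$ (t,l) = (\<Sum>j<n. - ?N q $$ (j,i) * ?N (pp i j) $$ (t,l))"
     using nev_lincomb[where m = n and c = "\<lambda>j. - ?N q $$ (j,i)" and f = "pp i"] by blast
    have "?N (NAdd q p) $$ (r,m) = 0"
    proof (rule kill[OF _ r], intro allI impI)
     fix l t assume lt: "l < m" "t < n"
     have "(\<Sum>j<n. - ?N q $$ (j,i) * ?N (pp i j) $$ (t,l)) = (if l = i then - ?N q $$ (t,i) else 0)"
      using lt pp by (auto simp: if_distrib[of "\<lambda>x. _ * x"] cong: if_cong)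
     then show "?N (NAdd q p) $$ (t,l) = 0" using lt m q[of l t] by (auto simp: p)
    qed
    then show ?thesis using r m
     by (simp add: p \<theta>_def sum_negf mult.commute)
   qed
   have comm: "?N X * \<theta> i = \<theta> i * ?N X" if i: "i < m" for X i
   proof (rule eq_matI)
    fix r j assume "r < dim_row (\<theta> i * ?N X)" "j < dim_col (\<theta> i * ?N X)"
    then have rj: "r < n" "j < n" using \<theta>C[of i] by auto
    have e: "?N (NMul X (pp i j)) $$ (s,l) = (if l = i then ?N X $$ (s,j) else 0)" if "l < m" "s < n" for l s
     using that m rj pp by (simp add: mult_idx[of _ n n _ n] if_distrib[of "\<lambda>x. _ * x"] del: index_mult_mat(1) cong: if_cong)
    have "?N (NMul X (pp i j)) $$ (r,m) = (\<Sum>s<n. \<theta> i $$ (r,s) * ?N (NMul X (pp i j)) $$ (s,i))"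
     by (rule claim[OF i _ rj(1)]) (use e in auto)
    also have "\<dots> = (\<theta> i * ?N X) $$ (r,j)"
     unfolding mult_idx[OF \<theta>C nev_carrier rj]
     by (rule sum.cong) (use e i in auto)
    also have "?N (NMul X (pp i j)) $$ (r,m) = (?N X * \<theta> i) $$ (r,j)"
     using rj m \<theta>C[of i] by (simp add: mult_idx[of _ n n _ n] \<theta>_def del: index_mult_mat(1))
    finally show "(?N X * \<theta> i) $$ (r,j) = (\<theta> i * ?N X) $$ (r,j)" .
   qed (use \<theta>C[of i] in auto)
   have "\<exists>c. \<theta> i = c \<cdot>\<^sub>m 1\<^sub>m n" if i: "i < m" for i
    by (rule simple_schur[OF s \<theta>C])
     (use comm[OF i, of NX] comm[OF i, of NY] nev_gen[OF ph] in \<open>simp_all del: nev.simps\<close>)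
   then have off: "\<theta> i $$ (m,i) = 0" if "i < m" for i using m that by fastforce
   obtain p where p: "\<And>t l. t<n ==> l<n ==> ?N p $$ (t,l) = (\<Sum>i<m. (- 1) * ?N (pp i i) $$ (t,l))"
    using nev_lincomb[where m = m and c = "\<lambda>_. - 1" and f = "\<lambda>i. pp i i"] by blast
   have "?N (NAdd (NC 1) p) $$ (m,m) = 0"
   proof (rule kill[OF _ m], intro allI impI)
    fix l t assume lt: "l < m" "t < n"
    have "(\<Sum>i<m. (- 1) * ?N (pp i i) $$ (t,l)) = (\<Sum>i<m. if l = i then (if t = l then - 1 else 0) else 0)"
     using lt pp by (intro sum.cong) auto
    also have "\<dots> = (if t = l then - 1 else 0)" using lt by simp
    finally show "?N (NAdd (NC 1) p) $$ (t,l) = 0" using lt m by (auto simp: p)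
   qed
   moreover have "(\<Sum>i<m. (- 1) * ?N (pp i i) $$ (m,m)) = 0"
    using off m by (intro sum.neutral) (auto simp: \<theta>_def)
   ultimately show False using m by (simp add: p)
  qed
  then obtain q where q: "\<And>j i. j<m ==> i<n ==> ?N q $$ (i,j) = 0" "\<exists>i<n. ?N q $$ (i,m) \<noteq> 0" by blast
  show ?case
  proof
   fix M :: "complex mat" assume M: "M \<in> mats n"
   from IH[OF M] obtain p where p: "\<And>j i. j<m ==> i<n ==> ?N p $$ (i,j) = M $$ (i,j)" by blast
   have "col (?N q) m \<noteq> 0\<^sub>v n" using q(2) m by (metis index_col index_zero_vec(1) nev_dim)
   then obtain t where t: "?N t *\<^sub>v col (?N q) m = col M m - col (?N p) m"
    using simple_transitive[OF s, of "col (?N q) m" "col M m - col (?N p) m"] M m by fastforce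
   have "?N (NAdd p (NMul t q)) $$ (i,j) = M $$ (i,j)" if ij: "j < Suc m" "i < n" for i j
   proof (cases "j = m")
    case True
    have "(?N t * ?N q) $$ (i,m) = (?N t *\<^sub>v col (?N q) m) $ i" using ij m by simp
    then show ?thesis using True ij M m t by simp
   next
    case False
    then show ?thesis using ij m p q by (simp add: mult_idx[of _ n n _ n] del: index_mult_mat(1))
   qed
   then show "\<exists>p. \<forall>j<Suc m. \<forall>i<n. ?N p $$ (i,j) = M $$ (i,j)" by blast
  qed
 qed
 from this[OF order_refl] show ?thesis
  unfolding full_rep_def by (metis (no_types, lifting) carrier_matD eq_matI nev_carrier)
qed

text \<open>All matrices act, so that any non-zero vector generates everything.\<close>
lemma full_imp_simple:
 assumes ph: "\<phi> \<in> rep_B3 n" and n: "n > 0" and f: "full_rep n \<phi>"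
 shows "simple_rep n \<phi>"
 unfolding simple_rep_def
proof (intro conjI allI impI ph n)
 fix W assume "invariant_subspace n \<phi> W"
 then have W: "W \<subseteq> carrier_vec n" "0\<^sub>v n \<in> W" "\<And>v w. v\<in>W ==> w\<in>W ==> v + w \<in> W" "\<And>c v. v\<in>W ==> c \<cdot>\<^sub>v v \<in> W"
   "\<And>v. v\<in>W ==> fst \<phi> *\<^sub>v v \<in> W" "\<And>v. v\<in>W ==> snd \<phi> *\<^sub>v v \<in> W"
  unfolding invariant_subspace_def subspace_iff by blast+
 note gen = nev_gen[OF rep_pairs[OF ph]]
 have cl: "nev n \<phi> p *\<^sub>v v \<in> W" if "v \<in> W" for p v
  using that
 proof (induction p arbitrary: v)
  case (NC c)
  have "(c \<cdot>\<^sub>m 1\<^sub>m n) *\<^sub>v v = c \<cdot>\<^sub>v v" using NC W(1) by (intro eq_vecI) auto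
  then show ?case using W NC by auto
 next
  case (NAdd p q)
  then show ?case using W(1,3) by (auto simp: add_mult_distrib_mat_vec[of _ n n])
 next
  case (NMul p q)
  have v: "v \<in> carrier_vec n" using NMul W by auto
  show ?case using NMul v by (simp add: assoc_mult_mat_vec[of _ n n _ n])
 qed (use W gen in \<open>simp_all del: nev.simps(2,3)\<close>)
 show "W = {0\<^sub>v n} \<or> W = carrier_vec n"
 proof (cases "W = {0\<^sub>v n}")
  case False
  then obtain v where v: "v \<in> W" "v \<noteq> 0\<^sub>v n" using W by blast
  then have vC: "v \<in> carrier_vec n" using W by auto
  obtain k where k: "k < n" "v $ k \<noteq> 0" using v vC by (metis carrier_vecD eq_vecI index_zero_vec)
  have "w \<in> W" if w: "w \<in> carrier_vec n" for w
  proof -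
   define M where "M = mat n n (\<lambda>(i,j). if j = k then w $ i / v $ k else 0)"
   have "M \<in> mats n" by (simp add: M_def)
   then obtain p where p: "nev n \<phi> p = M" using f unfolding full_rep_def by blast
   have "M *\<^sub>v v = w"
   proof (rule eq_vecI)
    fix i assume "i < dim_vec w"
    then have i: "i < n" using w by auto
    have "(M *\<^sub>v v) $ i = (\<Sum>l<n. if l = k then w $ i else 0)"
     unfolding mult_vec_idx[OF \<open>M \<in> _\<close> vC i] using i k by (intro sum.cong) (auto simp: M_def)
    then show "(M *\<^sub>v v) $ i = w $ i" using k by simp
   qed (use w in \<open>simp add: M_def\<close>)
   then show ?thesis using cl[OF v(1), of p] p by simp
  qed
  then show ?thesis using W by blast
 qed auto
qed

section \<open>Isomorphism of representations\<close>

lemma rep_iso_refl: "\<phi> \<in> pairs n ==> rep_iso \<phi> \<phi>"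
 unfolding rep_iso_def by (auto intro!: exI[of _ "1\<^sub>m n"] similar_mat_wit_refl)

lemma rep_iso_sym: "rep_iso \<phi> \<psi> ==> rep_iso \<psi> \<phi>"
 unfolding rep_iso_def using similar_mat_wit_sym by blast

lemma rep_iso_trans: "rep_iso \<phi> \<psi> ==> rep_iso \<psi> \<chi> ==> rep_iso \<phi> \<chi>"
 unfolding rep_iso_def using similar_mat_wit_trans by blast

lemma rep_isoE:
 assumes "rep_iso \<phi> \<psi>" "\<phi> \<in> pairs n"
 obtains P Q where "P \<in> mats n" "Q \<in> mats n" "P * Q = 1\<^sub>m n" "Q * P = 1\<^sub>m n"
  "\<psi> \<in> pairs n" "fst \<phi> = P * fst \<psi> * Q" "snd \<phi> = P * snd \<psi> * Q"
proof -
 obtain P Q where w: "similar_mat_wit (fst \<phi>) (fst \<psi>) P Q" "similar_mat_wit (snd \<phi>) (snd \<psi>) P Q"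
  using assms(1) unfolding rep_iso_def by blast
 have "fst \<phi> \<in> mats n" "snd \<phi> \<in> mats n" using assms(2) by auto
 from similar_mat_witD2[OF this(1) w(1)] similar_mat_witD2[OF this(2) w(2)]
 show ?thesis by (intro that[of P Q]) (auto simp: mem_Times_iff)
qed

lemma rep_isoI:
 assumes "P \<in> mats n" "Q \<in> mats n" "P * Q = 1\<^sub>m n" "Q * P = 1\<^sub>m n"
  "\<phi> \<in> pairs n" "\<psi> \<in> pairs n" "fst \<phi> * P = P * fst \<psi>" "snd \<phi> * P = P * snd \<psi>"
 shows "rep_iso \<phi> \<psi>"
proof -
 have "X = P * Y * Q" if "X * P = P * Y" "X \<in> mats n" for X Y
 proof -
  have "P * Y * Q = X * (P * Q)" using that assms by (simp flip: that(1))
  then show ?thesis using that assms by simp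
 qed
 then show ?thesis using assms unfolding rep_iso_def
  by (intro exI[of _ P] exI[of _ Q] conjI similar_mat_witI[of _ _ n]) (auto simp: mem_Times_iff)
qed

lemma nev_iso:
 assumes "P \<in> mats n" "Q \<in> mats n" "Q * P = 1\<^sub>m n" "P * Q = 1\<^sub>m n"
  "\<phi> \<in> pairs n" "\<psi> \<in> pairs n" "fst \<phi> = P * fst \<psi> * Q" "snd \<phi> = P * snd \<psi> * Q"
 shows "nev n \<phi> p = P * nev n \<psi> p * Q"
proof -
 have 1: "X * P = P * Y" if "X = P * Y * Q" "Y \<in> mats n" for X Y
  using that assms by (simp add: assoc_mult_mat[of _ n n _ n _ n])
 have "nev n \<phi> p * P = P * nev n \<psi> p"
  by (rule nev_intertwine[of _ n _ n]) (use assms 1 in auto)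
 note e = this
 have "nev n \<phi> p = nev n \<phi> p * (P * Q)" by (simp add: assms(4))
 also have "\<dots> = nev n \<phi> p * P * Q" by (rule assoc_mult_mat[symmetric, OF nev_carrier assms(1,2)])
 finally show ?thesis unfolding e .
qed

definition ntr :: "rep => ncp => complex" where
 "ntr \<phi> p = mtr (nev (dim_row (fst \<phi>)) \<phi> p)"

lemma ntr_pairs: "\<phi> \<in> pairs n ==> ntr \<phi> p = mtr (nev n \<phi> p)"
 by (auto simp: ntr_def)

lemma ntr_iso: assumes "rep_iso \<phi> \<psi>" "\<phi> \<in> pairs n" shows "ntr \<phi> p = ntr \<psi> p"
proof -
 obtain P Q where P: "P \<in> mats n" "Q \<in> mats n" "P * Q = 1\<^sub>m n" "Q * P = 1\<^sub>m n"
  "\<psi> \<in> pairs n" "fst \<phi> = P * fst \<psi> * Q" "snd \<phi> = P * snd \<psi> * Q" using rep_isoE[OF assms] .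
 show ?thesis using nev_iso[OF P(1,2,4,3) assms(2) P(5-7)] P assms(2)
  by (simp add: ntr_pairs[of _ n] mtr_conj)
qed

lemma simple_iso:
 assumes "simple_rep n \<phi>" "rep_iso \<phi> \<psi>" "\<psi> \<in> rep_B3 n"
 shows "simple_rep n \<psi>"
proof (rule full_imp_simple[OF assms(3)])
 show "n > 0" using simple_repD[OF assms(1)] by simp
 obtain P Q where P: "P \<in> mats n" "Q \<in> mats n" "P * Q = 1\<^sub>m n" "Q * P = 1\<^sub>m n"
  "\<phi> \<in> pairs n" "fst \<psi> = P * fst \<phi> * Q" "snd \<psi> = P * snd \<phi> * Q"
  using rep_isoE[OF rep_iso_sym[OF assms(2)] rep_pairs[OF assms(3)]] .
 show "full_rep n \<psi>" unfolding full_rep_def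
 proof
  fix M :: "complex mat" assume M: "M \<in> mats n"
  then have "Q * M * P \<in> mats n" using P by auto
  then obtain p where p: "nev n \<phi> p = Q * M * P" using burnside[OF assms(1)] unfolding full_rep_def by blast
  have "nev n \<psi> p = P * (Q * M * P) * Q"
   using nev_iso[OF P(1,2,4,3) rep_pairs[OF assms(3)] P(5-7)] p by simp
  also have "\<dots> = (P * Q) * M * (P * Q)" using P(1,2) M by (simp add: assoc_mult_mat[of _ n n _ n _ n])
  also have "\<dots> = M" using P M by simp
  finally show "\<exists>p. nev n \<psi> p = M" ..
 qed
qed

text \<open>Kernel and image of an intertwiner are invariant, so a non-zero one is bijective; comparing
 the traces of \<open>L R\<close> and \<open>R L\<close> shows that the two dimensions agree.\<close>
lemma schur_iso:
 assumes s: "simple_rep d \<phi>" and t: "simple_rep e \<psi>" and L: "L \<in> carrier_mat d e" "L \<noteq> 0\<^sub>m d e"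
  and c: "fst \<phi> * L = L * fst \<psi>" "snd \<phi> * L = L * snd \<psi>"
 shows "rep_iso \<phi> \<psi>"
proof -
 note ph = simple_repD(1)[OF s] note ps = simple_repD(1)[OF t]
 let ?K = "{v \<in> carrier_vec e. L *\<^sub>v v = 0\<^sub>v d}"
 have Kcl: "Y *\<^sub>v v \<in> ?K" if "v \<in> ?K" "Y \<in> mats e" "X \<in> mats d" "X * L = L * Y" for X Y v
 proof -
  have "L *\<^sub>v (Y *\<^sub>v v) = (X * L) *\<^sub>v v" using that L by (simp add: that(4) assoc_mult_mat_vec[of _ d e _ e])
  also have "\<dots> = 0\<^sub>v d" using that L by (subst assoc_mult_mat_vec[of _ d d _ e]) auto
  finally show ?thesis using that by auto
 qed
 have "?K = {0\<^sub>v e} \<or> ?K = carrier_vec e"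
 proof (rule simple_invariant[OF t])
  show "fst \<psi> *\<^sub>v v \<in> ?K" if "v \<in> ?K" for v using Kcl[OF that _ _ c(1)] ph ps by auto
  show "snd \<psi> *\<^sub>v v \<in> ?K" if "v \<in> ?K" for v using Kcl[OF that _ _ c(2)] ph ps by auto
 qed (use L in \<open>auto simp: mult_add_distrib_mat_vec[of _ d e] mult_mat_vec[of _ d e]\<close>)
 moreover have "?K \<noteq> carrier_vec e"
 proof
  assume K: "?K = carrier_vec e"
  have "L = 0\<^sub>m d e"
  proof (rule eq_matI)
   fix i j assume ij: "i < dim_row (0\<^sub>m d e)" "j < dim_col (0\<^sub>m d e)"
   have "unit_vec e j \<in> ?K" unfolding K by simp
   then have "(L *\<^sub>v unit_vec e j) $ i = 0" using ij by simp
   then show "L $$ (i,j) = 0\<^sub>m d e $$ (i,j)" using ij L by auto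
  qed (use L in auto)
  with L show False by simp
 qed
 ultimately have inj: "\<And>v. v \<in> carrier_vec e ==> L *\<^sub>v v = 0\<^sub>v d ==> v = 0\<^sub>v e" by blast
 let ?I = "(\<lambda>v. L *\<^sub>v v) ` carrier_vec e"
 have Icl: "X *\<^sub>v w \<in> ?I" if wI: "w \<in> ?I" and "Y \<in> mats e" "X \<in> mats d" "X * L = L * Y" for X Y w
 proof -
  obtain v where v: "v \<in> carrier_vec e" "w = L *\<^sub>v v" using wI by blast
  have "X *\<^sub>v w = (X * L) *\<^sub>v v" using v that L by (subst assoc_mult_mat_vec[of _ d d _ e]) auto
  also have "\<dots> = L *\<^sub>v (Y *\<^sub>v v)" using v that L by (simp add: that(4) assoc_mult_mat_vec[of _ d e _ e])
  finally show ?thesis using v that by auto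
 qed
 have "?I = {0\<^sub>v d} \<or> ?I = carrier_vec d"
 proof (rule simple_invariant[OF s])
  show "?I \<subseteq> carrier_vec d" using L by auto
  show "0\<^sub>v d \<in> ?I" by (rule image_eqI[of _ _ "0\<^sub>v e"]) (use L in auto)
  show "a + b \<in> ?I" if ab: "a \<in> ?I" "b \<in> ?I" for a b
  proof -
   obtain v w where "v \<in> carrier_vec e" "w \<in> carrier_vec e" "a = L *\<^sub>v v" "b = L *\<^sub>v w" using ab by auto
   then show ?thesis using L by (intro image_eqI[of _ _ "v + w"]) (auto simp: mult_add_distrib_mat_vec[of _ d e])
  qed
  show "c \<cdot>\<^sub>v a \<in> ?I" if a: "a \<in> ?I" for c a
  proof -
   obtain v where "v \<in> carrier_vec e" "a = L *\<^sub>v v" using a by auto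
   then show ?thesis using L by (intro image_eqI[of _ _ "c \<cdot>\<^sub>v v"]) (auto simp: mult_mat_vec[of _ d e])
  qed
  show "fst \<phi> *\<^sub>v v \<in> ?I" if "v \<in> ?I" for v using Icl[OF that _ _ c(1)] ph ps by auto
  show "snd \<phi> *\<^sub>v v \<in> ?I" if "v \<in> ?I" for v using Icl[OF that _ _ c(2)] ph ps by auto
 qed
 moreover have "?I \<noteq> {0\<^sub>v d}"
 proof
  assume I: "?I = {0\<^sub>v d}"
  have e: "e > 0" using simple_repD[OF t] by simp
  have "L *\<^sub>v unit_vec e 0 \<in> ?I" by (intro imageI) simp
  then have "L *\<^sub>v unit_vec e 0 = 0\<^sub>v d" unfolding I by simp
  then have "unit_vec e 0 = (0\<^sub>v e :: complex vec)" by (rule inj[rotated]) simp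
  then have "(unit_vec e 0 :: complex vec) $ 0 = 0\<^sub>v e $ 0" by simp
  then show False using e by simp
 qed
 ultimately have I: "?I = carrier_vec d" by blast
 have "\<forall>j. \<exists>v. v \<in> carrier_vec e \<and> L *\<^sub>v v = unit_vec d j"
 proof
  fix j have "unit_vec d j \<in> ?I" unfolding I by simp
  then show "\<exists>v. v \<in> carrier_vec e \<and> L *\<^sub>v v = unit_vec d j" by (metis imageE)
 qed
 then obtain r where r: "\<And>j. r j \<in> carrier_vec e" "\<And>j. L *\<^sub>v r j = unit_vec d j" by metis
 define R where "R = mat e d (\<lambda>(i,j). r j $ i)"
 have RC: "R \<in> carrier_mat e d" by (simp add: R_def)
 have colR: "col R j = r j" if "j < d" for j using that r(1)[of j] by (auto simp: R_def)
 have LR: "L * R = 1\<^sub>m d"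
 proof (rule eq_matI)
  fix i j assume ij: "i < dim_row (1\<^sub>m d)" "j < dim_col (1\<^sub>m d)"
  then have "(L * R) $$ (i,j) = (L *\<^sub>v r j) $ i" using L RC colR by auto
  then show "(L * R) $$ (i,j) = 1\<^sub>m d $$ (i,j)" using ij by (auto simp: r)
 qed (use L RC in auto)
 have RL: "R * L = 1\<^sub>m e"
 proof -
  define D where "D = R * L - 1\<^sub>m e"
  have DC: "D \<in> mats e" by (simp add: D_def minus_carrier_mat)
  have "L * D = L * R * L - L"
   unfolding D_def using L RC by (subst mult_minus_distrib_mat[of _ d e _ e]) (auto simp: assoc_mult_mat[of _ d e _ d _ e])
  then have LD: "L * D = 0\<^sub>m d e" using L LR by simp
  have "R * L = D + 1\<^sub>m e" using L RC by (auto simp: D_def intro!: eq_matI)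
  moreover have "D = 0\<^sub>m e e"
  proof (rule eq_matI)
   fix i j assume ij: "i < dim_row (0\<^sub>m e e)" "j < dim_col (0\<^sub>m e e)"
   have "L *\<^sub>v col D j = col (L * D) j" using ij L DC by (subst col_mult2[of _ d e _ e]) auto
   then have "L *\<^sub>v col D j = 0\<^sub>v d" using LD ij by simp
   then have "col D j = 0\<^sub>v e" using inj DC ij by auto
   then have "col D j $ i = 0\<^sub>v e $ i" by simp
   then show "D $$ (i,j) = 0\<^sub>m e e $$ (i,j)" using ij DC by auto
  qed (use DC in auto)
  ultimately show ?thesis by simp
 qed
 have "of_nat d = (of_nat e :: complex)" using mtr_comm[OF L(1) RC] LR RL by simp
 then have de: "d = e" by simp
 show ?thesis by (rule rep_isoI[of L d R]) (use L RC LR RL ph ps c de in auto)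
qed

section \<open>Separating simple representations, characters\<close>

abbreviation E00 :: "nat => complex mat" where
 "E00 d \<equiv> mat d d (\<lambda>(i,j). if i = 0 \<and> j = 0 then 1 else 0)"

text \<open>If every polynomial that vanishes at \<open>\<psi>\<close> vanished at \<open>\<phi>\<close>, then sending the first column of a
 value at \<open>\<psi>\<close> to a fixed column of the value at \<open>\<phi>\<close> would be a well-defined intertwiner, and
 \<open>schur_iso\<close> would apply.\<close>
lemma separate:
 assumes s: "simple_rep d \<phi>" and t: "simple_rep e \<psi>" and ni: "\<not> rep_iso \<phi> \<psi>"
 shows "\<exists>p. nev d \<phi> p = E00 d \<and> nev e \<psi> p = 0\<^sub>m e e"
proof -
 note ph = simple_repD(1)[OF s] note ps = simple_repD(1)[OF t]
 have fph: "\<And>M. M \<in> mats d ==> \<exists>p. nev d \<phi> p = M" using burnside[OF s] unfolding full_rep_def by blast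
 have fps: "\<And>M. M \<in> mats e ==> \<exists>p. nev e \<psi> p = M" using burnside[OF t] unfolding full_rep_def by blast
 have "\<exists>p. nev e \<psi> p = 0\<^sub>m e e \<and> nev d \<phi> p \<noteq> 0\<^sub>m d d"
 proof (rule ccontr)
  assume "\<not> ?thesis"
  then have ker: "\<And>p. nev e \<psi> p = 0\<^sub>m e e ==> nev d \<phi> p = 0\<^sub>m d d" by blast
  have "\<forall>j. \<exists>p. nev e \<psi> p = mat e e (\<lambda>(r,s). if r = j \<and> s = 0 then 1 else 0)"
   by (intro allI fps) simp
  then obtain pj where pj: "\<And>j. nev e \<psi> (pj j) = mat e e (\<lambda>(r,s). if r = j \<and> s = 0 then 1 else 0)" by metis
  have "\<forall>j. \<exists>p. nev e \<psi> p = mat e e (\<lambda>(r,s). if r = 0 \<and> s = j then 1 else 0)"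
   by (intro allI fps) simp
  then obtain rj where rj: "\<And>j. nev e \<psi> (rj j) = mat e e (\<lambda>(r,s). if r = 0 \<and> s = j then 1 else 0)" by metis
  have e0: "e > 0" and d0: "d > 0" using simple_repD[OF t] simple_repD[OF s] by auto
  have "\<exists>j<e. nev d \<phi> (pj j) \<noteq> 0\<^sub>m d d"
  proof (rule ccontr)
   assume "\<not> ?thesis"
   then have z: "\<And>j. j < e ==> nev d \<phi> (pj j) = 0\<^sub>m d d" by blast
   obtain q where q: "\<And>n \<phi> i j. i < n ==> j < n ==> nev n \<phi> q $$ (i,j) = (\<Sum>k<e. 1 * nev n \<phi> (NMul (pj k) (rj k)) $$ (i,j))"
    using nev_lincomb[where m = e and c = "\<lambda>_. 1" and f = "\<lambda>k. NMul (pj k) (rj k)"] by blast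
   have "nev e \<psi> (NMul (pj k) (rj k)) $$ (r,s) = (if s = k then (if r = k then 1 else 0) else 0)" if rs: "r < e" "s < e" for k r s
   proof -
    have "nev e \<psi> (NMul (pj k) (rj k)) $$ (r,s) = (\<Sum>l<e. if l = 0 then (if r = k \<and> s = k then 1 else 0) else 0)"
     unfolding nev.simps(5) mult_idx[OF nev_carrier nev_carrier rs] using rs by (intro sum.cong) (auto simp: pj rj)
    then show ?thesis using e0 by simp
   qed
   then have "nev e \<psi> q = 1\<^sub>m e" by (intro eq_matI) (auto simp: q simp del: nev.simps)
   moreover have "nev d \<phi> q = 0\<^sub>m d d" by (intro eq_matI) (auto simp: q z)
   ultimately have q: "nev e \<psi> q = 1\<^sub>m e" "nev d \<phi> q = 0\<^sub>m d d" .
   have "nev e \<psi> (NAdd q (NC (-1))) = 0\<^sub>m e e" using q(1) by (auto intro!: eq_matI)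
   then have "nev d \<phi> (NAdd q (NC (-1))) = 0\<^sub>m d d" by (rule ker)
   then have "(0\<^sub>m d d + (-1) \<cdot>\<^sub>m 1\<^sub>m d) $$ (0,0) = (0\<^sub>m d d $$ (0,0) :: complex)" using q(2) by simp
   then show False using d0 by simp
  qed
  then obtain j0 r0 c0 where j0: "j0 < e" and rc: "r0 < d" "c0 < d" "nev d \<phi> (pj j0) $$ (r0,c0) \<noteq> 0"
   by (metis (no_types, lifting) eq_matI index_zero_mat nev_dim)
  define L where "L = mat d e (\<lambda>(r,j). nev d \<phi> (pj j) $$ (r,c0))"
  have LC: "L \<in> carrier_mat d e" by (simp add: L_def)
  have "L $$ (r0,j0) \<noteq> 0" using rc j0 by (simp add: L_def)
  then have L0: "L \<noteq> 0\<^sub>m d e" using rc j0 by auto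
  have int: "nev d \<phi> X * L = L * nev e \<psi> X" for X
  proof (rule eq_matI)
   fix r j assume "r < dim_row (L * nev e \<psi> X)" "j < dim_col (L * nev e \<psi> X)"
   then have rj': "r < d" "j < e" using LC by auto
   obtain p where p: "\<And>a b. a<e ==> b<e ==> nev e \<psi> p $$ (a,b) = (\<Sum>i<e. - nev e \<psi> X $$ (i,j) * nev e \<psi> (pj i) $$ (a,b))"
    "\<And>a b. a<d ==> b<d ==> nev d \<phi> p $$ (a,b) = (\<Sum>i<e. - nev e \<psi> X $$ (i,j) * nev d \<phi> (pj i) $$ (a,b))"
    using nev_lincomb[where m = e and c = "\<lambda>i. - nev e \<psi> X $$ (i,j)" and f = pj] by blast
   have "nev e \<psi> (NAdd (NMul X (pj j)) p) = 0\<^sub>m e e"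
   proof (rule eq_matI)
    fix a b assume "a < dim_row (0\<^sub>m e e)" "b < dim_col (0\<^sub>m e e)"
    then have ab: "a < e" "b < e" by auto
    have 1: "(nev e \<psi> X * nev e \<psi> (pj j)) $$ (a,b) = (\<Sum>l<e. if l = j then (if b = 0 then nev e \<psi> X $$ (a,j) else 0) else 0)"
     by (subst mult_idx[OF nev_carrier nev_carrier ab], intro sum.cong) (use ab in \<open>auto simp: pj\<close>)
    have 2: "nev e \<psi> p $$ (a,b) = (\<Sum>i<e. if i = a then (if b = 0 then - nev e \<psi> X $$ (a,j) else 0) else 0)"
     unfolding p(1)[OF ab] using ab by (intro sum.cong) (auto simp: pj)
    show "nev e \<psi> (NAdd (NMul X (pj j)) p) $$ (a,b) = 0\<^sub>m e e $$ (a,b)"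
     using ab rj' 1 2 by (simp del: index_mult_mat(1))
   qed auto
   then have "nev d \<phi> (NAdd (NMul X (pj j)) p) = 0\<^sub>m d d" by (rule ker)
   then have "nev d \<phi> (NAdd (NMul X (pj j)) p) $$ (r,c0) = 0" using rj' rc by simp
   then have "(\<Sum>l<d. nev d \<phi> X $$ (r,l) * nev d \<phi> (pj j) $$ (l,c0)) = (\<Sum>i<e. nev e \<psi> X $$ (i,j) * nev d \<phi> (pj i) $$ (r,c0))"
    using rj' rc by (simp add: p(2) mult_idx[of _ d d _ d] sum_negf del: index_mult_mat(1))
   then show "(nev d \<phi> X * L) $$ (r,j) = (L * nev e \<psi> X) $$ (r,j)"
    using rj' unfolding mult_idx[OF nev_carrier LC rj'] mult_idx[OF LC nev_carrier rj']
    by (simp add: L_def mult.commute)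
  qed (use LC in auto)
  have "rep_iso \<phi> \<psi>"
   by (rule schur_iso[OF s t LC L0])
     (use int[of NX] int[of NY] nev_gen[OF ph] nev_gen[OF ps] in \<open>simp_all del: nev.simps\<close>)
  with ni show False ..
 qed
 then obtain p where p: "nev e \<psi> p = 0\<^sub>m e e" "nev d \<phi> p \<noteq> 0\<^sub>m d d" by blast
 then obtain r c where rc: "r < d" "c < d" "nev d \<phi> p $$ (r,c) \<noteq> 0"
  by (metis (no_types, lifting) eq_matI index_zero_mat nev_dim)
 obtain a where a: "nev d \<phi> a = mat d d (\<lambda>(i,j). if i = 0 \<and> j = r then 1 / nev d \<phi> p $$ (r,c) else 0)"
  using fph[of "mat d d (\<lambda>(i,j). if i = 0 \<and> j = r then 1 / nev d \<phi> p $$ (r,c) else 0)"] by auto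
 obtain b where b: "nev d \<phi> b = mat d d (\<lambda>(i,j). if i = c \<and> j = 0 then 1 else 0)"
  using fph[of "mat d d (\<lambda>(i,j). if i = c \<and> j = 0 then 1 else 0)"] by auto
 have "nev d \<phi> (NMul a (NMul p b)) = E00 d"
 proof (rule eq_matI)
  fix i j assume "i < dim_row (E00 d)" "j < dim_col (E00 d)"
  then have ij: "i < d" "j < d" by auto
  have 1: "(nev d \<phi> p * nev d \<phi> b) $$ (l,j) = (if j = 0 then nev d \<phi> p $$ (l,c) else 0)" if "l < d" for l
  proof -
   have "(nev d \<phi> p * nev d \<phi> b) $$ (l,j) = (\<Sum>k<d. if k = c then (if j = 0 then nev d \<phi> p $$ (l,c) else 0) else 0)"
    by (subst mult_idx[OF nev_carrier nev_carrier that ij(2)], intro sum.cong) (use ij in \<open>auto simp: b\<close>)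
   then show ?thesis using rc by simp
  qed
  have "nev d \<phi> (NMul a (NMul p b)) $$ (i,j) = (\<Sum>l<d. nev d \<phi> a $$ (i,l) * (nev d \<phi> p * nev d \<phi> b) $$ (l,j))"
   using ij unfolding nev.simps by (intro mult_idx[of _ d d _ d]) auto
  also have "\<dots> = (\<Sum>l<d. if l = r then (if i = 0 \<and> j = 0 then 1 else 0) else 0)"
   using ij rc 1 by (intro sum.cong) (auto simp: a simp del: index_mult_mat(1))
  finally show "nev d \<phi> (NMul a (NMul p b)) $$ (i,j) = E00 d $$ (i,j)" using ij rc by simp
 qed auto
 moreover have "nev e \<psi> (NMul a (NMul p b)) = 0\<^sub>m e e" using p by simp
 ultimately show ?thesis by blast
qed

lemma E00_idem: "d > 0 ==> E00 d * E00 d = E00 d"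
proof (rule eq_matI)
 fix i j assume "d > 0" "i < dim_row (E00 d)" "j < dim_col (E00 d)"
 then have ij: "i < d" "j < d" by auto
 have "(E00 d * E00 d) $$ (i,j) = (\<Sum>l<d. E00 d $$ (i,l) * E00 d $$ (l,j))"
  by (rule mult_idx[of _ d d _ d]) (use ij in auto)
 also have "\<dots> = (\<Sum>l<d. if l = 0 then (if i = 0 \<and> j = 0 then 1 else 0) else 0)"
  by (intro sum.cong) (use ij in auto)
 finally have "(E00 d * E00 d) $$ (i,j) = (\<Sum>l<d. if l = 0 then (if i = 0 \<and> j = 0 then 1 else 0) else 0)" .
 then show "(E00 d * E00 d) $$ (i,j) = E00 d $$ (i,j)" using ij by simp
qed auto

text \<open>The product of the polynomials that separate \<open>\<phi>\<close> from the single members of \<open>L\<close>; it still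
 evaluates to the idempotent \<open>E00\<close> at \<open>\<phi>\<close>.\<close>
lemma separate_list:
 assumes s: "simple_rep d \<phi>" and L: "\<forall>\<psi>\<in>set L. (\<exists>e. simple_rep e \<psi>) \<and> \<not> rep_iso \<phi> \<psi>"
 shows "\<exists>p. nev d \<phi> p = E00 d \<and> (\<forall>\<psi>\<in>set L. ntr \<psi> p = 0)"
proof -
 have d: "d > 0" using simple_repD[OF s] by simp
 have "\<exists>p. nev d \<phi> p = E00 d \<and> (\<forall>\<psi>\<in>set L. \<forall>e. simple_rep e \<psi> --> nev e \<psi> p = 0\<^sub>m e e)"
  using L
 proof (induction L)
  case Nil
  have "E00 d \<in> mats d" by simp
  then show ?case using burnside[OF s] unfolding full_rep_def by (metis empty_iff empty_set)
 next
  case (Cons \<psi> L)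
  then obtain p where p: "nev d \<phi> p = E00 d" "\<forall>\<psi>\<in>set L. \<forall>e. simple_rep e \<psi> --> nev e \<psi> p = 0\<^sub>m e e" by auto
  obtain e where e: "simple_rep e \<psi>" "\<not> rep_iso \<phi> \<psi>" using Cons.prems by auto
  obtain q where q: "nev d \<phi> q = E00 d" "nev e \<psi> q = 0\<^sub>m e e" using separate[OF s e] by blast
  have uniq: "e' = e" if "simple_rep e' \<psi>" for e'
   using simple_repD(1)[OF that] simple_repD(1)[OF e(1)] by auto
  have "nev d \<phi> (NMul p q) = E00 d" using p(1) q(1) E00_idem[OF d] by simp
  moreover have "nev e' \<psi>' (NMul p q) = 0\<^sub>m e' e'" if "\<psi>' \<in> set (\<psi> # L)" "simple_rep e' \<psi>'" for \<psi>' e'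
  proof (cases "\<psi>' = \<psi>")
   case True
   then have "e' = e" using uniq that(2) by simp
   then show ?thesis using True q(2) by simp
  next
   case False
   then show ?thesis using p(2) that by simp
  qed
  ultimately show ?case by blast
 qed
 then obtain p where p: "nev d \<phi> p = E00 d" "\<forall>\<psi>\<in>set L. \<forall>e. simple_rep e \<psi> --> nev e \<psi> p = 0\<^sub>m e e" by blast
 have "ntr \<psi> p = 0" if psi: "\<psi> \<in> set L" for \<psi>
 proof -
  obtain e where e: "simple_rep e \<psi>" using bspec[OF L psi] by auto
  then have "ntr \<psi> p = mtr (0\<^sub>m e e)" using p(2) psi simple_repD(1)[OF e] by (simp add: ntr_pairs)
  then show ?thesis by (simp add: mtr_def)
 qed
 then show ?thesis using p(1) by blast
qed

definition dsum :: "rep => rep => rep" where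
 "dsum \<phi> \<psi> = (let n = dim_row (fst \<phi>); m = dim_row (fst \<psi>) in
   (four_block_mat (fst \<phi>) (0\<^sub>m n m) (0\<^sub>m m n) (fst \<psi>),
   four_block_mat (snd \<phi>) (0\<^sub>m n m) (0\<^sub>m m n) (snd \<psi>)))"

lemma dsum_pairs [simp]: "\<phi> \<in> pairs n ==> \<psi> \<in> pairs m ==> dsum \<phi> \<psi> \<in> pairs (n + m)"
 by (auto simp: dsum_def Let_def)

lemma direct_sum_pairs: "\<forall>\<phi>\<in>set \<phi>s. \<exists>n. \<phi> \<in> pairs n ==> \<exists>n. direct_sum_rep \<phi>s \<in> pairs n"
 "\<forall>\<phi>\<in>set \<phi>s. \<exists>n. \<phi> \<in> pairs n ==> \<phi> \<in> pairs k ==> direct_sum_rep (\<phi> # \<phi>s) = dsum \<phi> (direct_sum_rep \<phi>s)"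
proof -
 have D: "\<phi> \<in> pairs k ==> direct_sum_rep \<phi>s \<in> pairs n ==> direct_sum_rep (\<phi> # \<phi>s) = dsum \<phi> (direct_sum_rep \<phi>s)" for \<phi> k \<phi>s n
 proof -
  assume a: "\<phi> \<in> pairs k" "direct_sum_rep \<phi>s \<in> pairs n"
  have d: "dim_row (fst \<phi>) = k" "dim_col (fst \<phi>) = k" "dim_row (snd \<phi>) = k" "dim_col (snd \<phi>) = k"
   "dim_row (fst (direct_sum_rep \<phi>s)) = n" "dim_col (fst (direct_sum_rep \<phi>s)) = n"
   "dim_row (snd (direct_sum_rep \<phi>s)) = n" "dim_col (snd (direct_sum_rep \<phi>s)) = n"
   using a by auto
  show ?thesis using d by (simp add: dsum_def Let_def) (simp add: direct_sum_rep_def Let_def)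
 qed
 show 1: "\<exists>n. direct_sum_rep \<phi>s \<in> pairs n" if "\<forall>\<phi>\<in>set \<phi>s. \<exists>n. \<phi> \<in> pairs n" for \<phi>s
  using that
 proof (induction \<phi>s)
  case Nil
  show ?case by (rule exI[of _ 0]) (simp add: direct_sum_rep_def)
 next
  case (Cons \<phi> \<phi>s)
  then obtain n k where nk: "\<phi> \<in> pairs k" "direct_sum_rep \<phi>s \<in> pairs n" by (metis list.set_intros(1,2))
  then show ?case using D[OF nk] dsum_pairs[OF nk] by metis
 qed
 show "\<forall>\<phi>\<in>set \<phi>s. \<exists>n. \<phi> \<in> pairs n ==> \<phi> \<in> pairs k ==> direct_sum_rep (\<phi> # \<phi>s) = dsum \<phi> (direct_sum_rep \<phi>s)"
 proof -
  assume a: "\<forall>\<phi>\<in>set \<phi>s. \<exists>n. \<phi> \<in> pairs n" and k: "\<phi> \<in> pairs k"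
  from 1[OF a] obtain n where "direct_sum_rep \<phi>s \<in> pairs n" ..
  then show ?thesis by (rule D[OF k])
 qed
qed

lemma nev_dsum:
 assumes "\<phi> \<in> pairs n" "\<psi> \<in> pairs m"
 shows "nev (n + m) (dsum \<phi> \<psi>) p = four_block_mat (nev n \<phi> p) (0\<^sub>m n m) (0\<^sub>m m n) (nev m \<psi> p)"
proof (induction p)
 case (NC c)
 have "c \<cdot>\<^sub>m 1\<^sub>m (n + m) = four_block_mat (c \<cdot>\<^sub>m 1\<^sub>m n) (0\<^sub>m n m) (0\<^sub>m m n) (c \<cdot>\<^sub>m 1\<^sub>m m)"
  by (rule eq_matI) auto
 then show ?case by simp
next
 case NX
 have "dim_row (fst \<phi>) = n" "dim_row (fst \<psi>) = m" using assms by auto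
 then show ?case unfolding nev_gen(1)[OF dsum_pairs[OF assms]] nev_gen(1)[OF assms(1)] nev_gen(1)[OF assms(2)]
  by (simp add: dsum_def Let_def)
next
 case NY
 have "dim_row (fst \<phi>) = n" "dim_row (fst \<psi>) = m" using assms by auto
 then show ?case unfolding nev_gen(2)[OF dsum_pairs[OF assms]] nev_gen(2)[OF assms(1)] nev_gen(2)[OF assms(2)]
  by (simp add: dsum_def Let_def)
next
 case (NAdd p q)
 then show ?case by (simp add: add_four_block_mat[of _ n n _ m _ m])
next
 case (NMul p q)
 have "nev n \<phi> p * nev n \<phi> q \<in> mats n" "nev m \<psi> p * nev m \<psi> q \<in> mats m"
  by (auto intro!: mult_carrier_mat)
 with NMul show ?case
  by (simp add: mult_four_block_mat[of _ n n _ m _ m _ _ n _ m] left_add_zero_mat[of _ m m] right_add_zero_mat[of _ n n])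
qed

lemma mtr_four_block:
 "A \<in> mats n ==> D \<in> mats m ==> mtr (four_block_mat A B C D) = mtr A + mtr D"
proof -
 assume A: "A \<in> mats n" and D: "D \<in> mats m"
 have "mtr (four_block_mat A B C D) = (\<Sum>i<n+m. if i < n then A $$ (i,i) else D $$ (i - n, i - n))"
  unfolding mtr_def using A D by (intro sum.cong) auto
 also have "\<dots> = (\<Sum>i<n. A $$ (i,i)) + (\<Sum>i<m. D $$ (i,i))"
 proof -
  have "(\<Sum>i<n+m. f i) = (\<Sum>i<n. f i) + (\<Sum>i<m. f (n + i))" for f :: "nat => complex"
   by (induction m) (auto simp: add.assoc)
  then show ?thesis by simp
 qed
 finally show ?thesis using A D by (simp add: mtr_def)
qed

lemma ntr_dsum:
 assumes "\<phi> \<in> pairs n" "\<psi> \<in> pairs m"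
 shows "ntr (dsum \<phi> \<psi>) p = ntr \<phi> p + ntr \<psi> p"
 using nev_dsum[OF assms] ntr_pairs[OF dsum_pairs[OF assms]] ntr_pairs[OF assms(1)] ntr_pairs[OF assms(2)]
 by (simp add: mtr_four_block[of _ n _ m])

lemma ntr_direct_sum:
 "\<forall>\<phi>\<in>set \<phi>s. \<exists>n. \<phi> \<in> pairs n ==> ntr (direct_sum_rep \<phi>s) p = (\<Sum>\<phi>\<leftarrow>\<phi>s. ntr \<phi> p)"
proof (induction \<phi>s)
 case Nil
 then show ?case by (simp add: direct_sum_rep_def ntr_def mtr_def)
next
 case (Cons \<phi> \<phi>s)
 then obtain n k where nk: "\<phi> \<in> pairs k" "direct_sum_rep \<phi>s \<in> pairs n"
  using direct_sum_pairs(1)[of \<phi>s] by (metis list.set_intros(1,2))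
 then show ?case using Cons direct_sum_pairs(2)[of \<phi>s \<phi> k] ntr_dsum[OF nk] by auto
qed

lemma dsum_cong:
 assumes "rep_iso \<phi> \<phi>'" "rep_iso \<psi> \<psi>'" "\<phi> \<in> pairs n" "\<psi> \<in> pairs m"
 shows "rep_iso (dsum \<phi> \<psi>) (dsum \<phi>' \<psi>')"
proof -
 obtain P Q where P: "P \<in> mats n" "Q \<in> mats n" "P * Q = 1\<^sub>m n" "Q * P = 1\<^sub>m n"
  "\<phi>' \<in> pairs n" "fst \<phi> = P * fst \<phi>' * Q" "snd \<phi> = P * snd \<phi>' * Q" using rep_isoE[OF assms(1,3)] .
 obtain P' Q' where P': "P' \<in> mats m" "Q' \<in> mats m" "P' * Q' = 1\<^sub>m m" "Q' * P' = 1\<^sub>m m"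
  "\<psi>' \<in> pairs m" "fst \<psi> = P' * fst \<psi>' * Q'" "snd \<psi> = P' * snd \<psi>' * Q'" using rep_isoE[OF assms(2,4)] .
 have w: "similar_mat_wit X Y P Q" if "X = P * Y * Q" "X \<in> mats n" "Y \<in> mats n" for X Y
  using that P by (intro similar_mat_witI[of _ _ n]) auto
 have w': "similar_mat_wit X Y P' Q'" if "X = P' * Y * Q'" "X \<in> mats m" "Y \<in> mats m" for X Y
  using that P' by (intro similar_mat_witI[of _ _ m]) auto
 have z: "0\<^sub>m n m = P * 0\<^sub>m n m * Q'" "0\<^sub>m m n = P' * 0\<^sub>m m n * Q" using P P' by auto
 have d: "dim_row (fst \<phi>) = n" "dim_row (fst \<psi>) = m" "dim_row (fst \<phi>') = n" "dim_row (fst \<psi>') = m"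
  using assms P(5) P'(5) by auto
 have c: "fst \<phi> \<in> mats n" "snd \<phi> \<in> mats n" "fst \<psi> \<in> mats m" "snd \<psi> \<in> mats m"
  "fst \<phi>' \<in> mats n" "snd \<phi>' \<in> mats n" "fst \<psi>' \<in> mats m" "snd \<psi>' \<in> mats m"
  using assms P(5) P'(5) by auto
 show ?thesis
  unfolding rep_iso_def dsum_def Let_def d fst_conv snd_conv
  using similar_mat_wit_four_block[OF w[OF P(6)] w'[OF P'(6)] z] similar_mat_wit_four_block[OF w[OF P(7)] w'[OF P'(7)] z] c
  by (meson zero_carrier_mat)
qed

lemma dsum_assoc:
 assumes "\<phi> \<in> pairs n" "\<psi> \<in> pairs m" "\<chi> \<in> pairs k"
 shows "dsum \<phi> (dsum \<psi> \<chi>) = dsum (dsum \<phi> \<psi>) \<chi>"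
proof -
 have "four_block_mat A (0\<^sub>m n (m+k)) (0\<^sub>m (m+k) n) (four_block_mat B (0\<^sub>m m k) (0\<^sub>m k m) C)
  = four_block_mat (four_block_mat A (0\<^sub>m n m) (0\<^sub>m m n) B) (0\<^sub>m (n+m) k) (0\<^sub>m k (n+m)) C"
  if "A \<in> mats n" "B \<in> mats m" "C \<in> mats k" for A B C :: "complex mat"
  using assoc_four_block_mat[of A B C] that by simp
 then show ?thesis using assms by (auto simp: dsum_def Let_def)
qed

lemma dsum_comm:
 assumes "\<phi> \<in> pairs n" "\<psi> \<in> pairs m"
 shows "rep_iso (dsum \<phi> \<psi>) (dsum \<psi> \<phi>)"
proof (rule rep_isoI)
 let ?P = "four_block_mat (0\<^sub>m n m) (1\<^sub>m n) (1\<^sub>m m) (0\<^sub>m m n) :: complex mat"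
 let ?Q = "four_block_mat (0\<^sub>m m n) (1\<^sub>m m) (1\<^sub>m n) (0\<^sub>m n m) :: complex mat"
 have d: "dim_row (fst \<phi>) = n" "dim_row (fst \<psi>) = m" using assms by auto
 show "?P \<in> carrier_mat (n+m) (n+m)" "?Q \<in> carrier_mat (n+m) (n+m)"
  by (intro carrier_matI; simp)+
 show "?P * ?Q = 1\<^sub>m (n+m)"
  by (subst mult_four_block_mat[of _ n m _ n _ m _ _ n _ m]) auto
 have "?Q * ?P = 1\<^sub>m (m+n)"
  by (subst mult_four_block_mat[of _ m n _ m _ n _ _ m _ n]) auto
 then show "?Q * ?P = 1\<^sub>m (n+m)" by (simp add: add.commute)
 show "dsum \<phi> \<psi> \<in> pairs (n+m)" using assms by simp
 show "dsum \<psi> \<phi> \<in> pairs (n+m)" using dsum_pairs[OF assms(2,1)] by (simp add: add.commute)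
 have g: "four_block_mat A (0\<^sub>m n m) (0\<^sub>m m n) B * ?P = ?P * four_block_mat B (0\<^sub>m m n) (0\<^sub>m n m) A"
  if "A \<in> mats n" "B \<in> mats m" for A B :: "complex mat"
  using that
  by (subst mult_four_block_mat[of _ n n _ m _ m _ _ m _ n], auto)
    (subst mult_four_block_mat[of _ n m _ n _ m _ _ m _ n], auto)
 show "fst (dsum \<phi> \<psi>) * ?P = ?P * fst (dsum \<psi> \<phi>)" "snd (dsum \<phi> \<psi>) * ?P = ?P * snd (dsum \<psi> \<phi>)"
  unfolding dsum_def Let_def d fst_conv snd_conv using assms by (auto intro!: g)
qed

text \<open>Summands may be moved to the front one at a time.\<close>
lemma direct_sum_extract:
 assumes "\<forall>\<phi>\<in>set (xs @ s # ys). \<exists>n. \<phi> \<in> pairs n"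
 shows "rep_iso (direct_sum_rep (xs @ s # ys)) (dsum s (direct_sum_rep (xs @ ys)))"
 using assms
proof (induction xs)
 case Nil
 then obtain k n where k: "s \<in> pairs k" and n: "direct_sum_rep ys \<in> pairs n"
  using direct_sum_pairs(1)[of ys] by auto
 have "direct_sum_rep (s # ys) = dsum s (direct_sum_rep ys)" using direct_sum_pairs(2)[of ys s k] Nil k by auto
 then show ?case using dsum_pairs[OF k n] by (simp add: rep_iso_refl)
next
 case (Cons x xs)
 obtain a k n m where a: "x \<in> pairs a" and k: "s \<in> pairs k" and n: "direct_sum_rep (xs @ ys) \<in> pairs n"
  and m: "direct_sum_rep (xs @ s # ys) \<in> pairs m"
 proof -
  have A: "\<exists>n. direct_sum_rep (xs @ ys) \<in> pairs n"
   by (rule direct_sum_pairs(1)) (use Cons.prems in \<open>simp del: mem_Sigma_iff mem_Times_iff\<close>)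
  have B: "\<exists>m. direct_sum_rep (xs @ s # ys) \<in> pairs m"
   by (rule direct_sum_pairs(1)) (use Cons.prems in \<open>simp del: mem_Sigma_iff mem_Times_iff\<close>)
  have C: "\<exists>a. x \<in> pairs a" "\<exists>k. s \<in> pairs k"
   using Cons.prems by (simp_all del: mem_Sigma_iff mem_Times_iff)
  from A obtain a where a: "direct_sum_rep (xs @ ys) \<in> pairs a" ..
  from B obtain b where b: "direct_sum_rep (xs @ s # ys) \<in> pairs b" ..
  from C(1) obtain c where c: "x \<in> pairs c" ..
  from C(2) obtain d where d: "s \<in> pairs d" ..
  show thesis by (rule that[OF c d a b])
 qed
 have IH: "rep_iso (direct_sum_rep (xs @ s # ys)) (dsum s (direct_sum_rep (xs @ ys)))"
 proof (rule Cons.IH)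
  show "\<forall>\<phi>\<in>set (xs @ s # ys). \<exists>n. \<phi> \<in> pairs n" using Cons.prems by (simp del: mem_Sigma_iff mem_Times_iff)
 qed
 let ?D = "direct_sum_rep (xs @ ys)"
 have "rep_iso (dsum x (direct_sum_rep (xs @ s # ys))) (dsum x (dsum s ?D))"
  by (rule dsum_cong[OF rep_iso_refl[OF a] IH a m])
 moreover have "dsum x (dsum s ?D) = dsum (dsum x s) ?D" by (rule dsum_assoc[OF a k n])
 moreover have "rep_iso (dsum (dsum x s) ?D) (dsum (dsum s x) ?D)"
  by (rule dsum_cong[OF dsum_comm[OF a k] rep_iso_refl[OF n] dsum_pairs[OF a k] n])
 moreover have "dsum (dsum s x) ?D = dsum s (dsum x ?D)" by (rule dsum_assoc[OF k a n, symmetric])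
 moreover have "direct_sum_rep (x # xs @ ys) = dsum x ?D" "direct_sum_rep (x # xs @ s # ys) = dsum x (direct_sum_rep (xs @ s # ys))"
  by (rule direct_sum_pairs(2)[OF _ a]; use Cons.prems in \<open>simp del: mem_Sigma_iff mem_Times_iff\<close>)+
 ultimately show ?case using rep_iso_trans by simp
qed

text \<open>A polynomial with trace \<open>1\<close> on the first summand and trace \<open>0\<close> on all simple representations
 not isomorphic to it shows that this summand also occurs on the other side. Both sides then lose
 it.\<close>
theorem characters_determine:
 assumes "\<forall>\<phi>\<in>set \<phi>s. \<exists>n. simple_rep n \<phi>" "\<forall>\<phi>\<in>set \<psi>s. \<exists>n. simple_rep n \<phi>"
  and "\<And>p. (\<Sum>\<phi>\<leftarrow>\<phi>s. ntr \<phi> p) = (\<Sum>\<phi>\<leftarrow>\<psi>s. ntr \<phi> p)"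
 shows "rep_iso (direct_sum_rep \<phi>s) (direct_sum_rep \<psi>s)"
 using assms
proof (induction \<phi>s arbitrary: \<psi>s)
 case Nil
 have "\<psi>s = []"
 proof (cases \<psi>s)
  case (Cons a as)
  have nn: "\<exists>k. (\<Sum>\<phi>\<leftarrow>as. ntr \<phi> (NC 1)) = of_nat k" if "\<forall>\<phi>\<in>set as. \<exists>n. simple_rep n \<phi>" for as
   using that
  proof (induction as)
   case (Cons a as)
   then obtain n k where "simple_rep n a" "(\<Sum>\<phi>\<leftarrow>as. ntr \<phi> (NC 1)) = of_nat k" by auto
   then show ?case using simple_repD(1)[of n a] by (intro exI[of _ "n + k"]) (auto simp: ntr_pairs mtr_smult[of _ n])
  qed auto
  obtain k where k: "(\<Sum>\<phi>\<leftarrow>as. ntr \<phi> (NC 1)) = of_nat k" using nn[of as] Nil(2) Cons by auto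
  obtain n where n: "simple_rep n a" using Nil(2) Cons by auto
  have "0 = (of_nat (n + k) :: complex)" using Nil(3)[of "NC 1"] Cons k simple_repD(1)[OF n]
   by (simp add: ntr_pairs mtr_smult[of _ n])
  then have "n + k = 0" by (metis of_nat_eq_0_iff)
  then show ?thesis using simple_repD(2)[OF n] by simp
 qed auto
 then show ?case by (auto simp: direct_sum_rep_def intro!: rep_iso_refl[of _ 0])
next
 case (Cons s \<phi>s)
 obtain d where s: "simple_rep d s" using Cons.prems(1) by auto
 have d: "d > 0" using simple_repD[OF s] by simp
 have "\<exists>\<psi>\<in>set \<psi>s. rep_iso s \<psi>"
 proof (rule ccontr)
  assume no: "\<not> ?thesis"
  let ?L = "filter (\<lambda>\<psi>. \<not> rep_iso s \<psi>) (\<phi>s @ \<psi>s)"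
  have L: "\<forall>\<psi>\<in>set ?L. (\<exists>e. simple_rep e \<psi>) \<and> \<not> rep_iso s \<psi>"
  proof
   fix \<psi> assume "\<psi> \<in> set ?L"
   then have "\<psi> \<in> set (s # \<phi>s) \<or> \<psi> \<in> set \<psi>s" "\<not> rep_iso s \<psi>" by auto
   then show "(\<exists>e. simple_rep e \<psi>) \<and> \<not> rep_iso s \<psi>" using Cons.prems(1,2) by blast
  qed
  obtain p where p0: "nev d s p = E00 d" "\<forall>\<psi>\<in>set ?L. ntr \<psi> p = 0"
   using separate_list[OF s L] by (elim exE conjE)
  note p = p0(1) p0(2)[rule_format]
  have "mtr (E00 d) = (\<Sum>i<d. if i = 0 then 1 else 0)" by (simp add: mtr_def)
  then have 1: "ntr s p = 1" using p(1) simple_repD(1)[OF s] d by (simp add: ntr_pairs)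
  have "ntr \<phi> p = 0" if "\<phi> \<in> set \<psi>s" for \<phi> by (rule p(2)) (use that no in auto)
  then have "(\<Sum>\<phi>\<leftarrow>\<psi>s. ntr \<phi> p) = (\<Sum>\<phi>\<leftarrow>\<psi>s. 0)" by (intro arg_cong[of _ _ sum_list] map_cong) auto
  then have b: "(\<Sum>\<phi>\<leftarrow>\<psi>s. ntr \<phi> p) = 0" by simp
  have 2: "ntr \<phi> p = 1 \<or> ntr \<phi> p = 0" if "\<phi> \<in> set \<phi>s" for \<phi>
   using that p(2)[of \<phi>] ntr_iso[of s \<phi> d p] simple_repD(1)[OF s] 1 by auto
  have "\<exists>k. (\<Sum>\<phi>\<leftarrow>as. ntr \<phi> p) = of_nat k" if "set as \<subseteq> set \<phi>s" for as
   using that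
  proof (induction as)
   case (Cons a as)
   then obtain k where "(\<Sum>\<phi>\<leftarrow>as. ntr \<phi> p) = of_nat k" by auto
   then show ?case using 2[of a] Cons.prems
    by (cases "ntr a p = 0") (auto intro: exI[of _ k] exI[of _ "Suc k"])
  qed auto
  then obtain k where k: "(\<Sum>\<phi>\<leftarrow>\<phi>s. ntr \<phi> p) = of_nat k" by blast
  have "(of_nat (Suc k) :: complex) = 0" using Cons.prems(3)[of p] 1 b k by simp
  then show False by (metis of_nat_eq_0_iff nat.distinct(1))
 qed
 then obtain \<psi> xs ys where \<psi>: "\<psi>s = xs @ \<psi> # ys" "rep_iso s \<psi>" by (metis split_list)
 have sP: "s \<in> pairs d" using simple_repD[OF s] by simp
 have ps: "\<forall>\<phi>\<in>set (xs @ \<psi> # ys). \<exists>n. \<phi> \<in> pairs n" using Cons.prems(2) simple_repD(1) unfolding \<psi>(1) by blast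
 have pf: "\<forall>\<phi>\<in>set \<phi>s. \<exists>n. \<phi> \<in> pairs n" using Cons.prems(1) simple_repD(1) by (metis list.set_intros(2))
 have "rep_iso (direct_sum_rep \<phi>s) (direct_sum_rep (xs @ ys))"
 proof (rule Cons.IH)
  show "(\<Sum>\<phi>\<leftarrow>\<phi>s. ntr \<phi> p) = (\<Sum>\<phi>\<leftarrow>xs @ ys. ntr \<phi> p)" for p
   using Cons.prems(3)[of p] ntr_iso[OF \<psi>(2) sP, of p] \<psi>(1) by (simp add: algebra_simps)
 qed (use Cons.prems \<psi> in auto)
 moreover obtain n where n: "direct_sum_rep \<phi>s \<in> pairs n" using direct_sum_pairs(1)[OF pf] ..
 ultimately have "rep_iso (dsum s (direct_sum_rep \<phi>s)) (dsum \<psi> (direct_sum_rep (xs @ ys)))"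
  using dsum_cong[OF \<psi>(2) _ sP n] by blast
 moreover have "rep_iso (dsum \<psi> (direct_sum_rep (xs @ ys))) (direct_sum_rep \<psi>s)"
  unfolding \<psi>(1) using direct_sum_extract[OF ps] by (rule rep_iso_sym)
 ultimately show ?case using rep_iso_trans direct_sum_pairs(2)[OF pf sP] by simp
qed

section \<open>Algebras of functions\<close>

text \<open>Regular functions, invariants, polynomials and rational functions of one variable are all
 treated as sets of functions with this closure property, so that determinants and traces of
 matrices of functions need to be considered only once.\<close>
definition subalg :: "('a => complex) set => bool" where
 "subalg R \<longleftrightarrow> (\<forall>c. (\<lambda>_. c) \<in> R) \<and> (\<forall>f\<in>R. \<forall>g\<in>R. (\<lambda>x. f x + g x) \<in> R \<and> (\<lambda>x. f x * g x) \<in> R)"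

lemma subalg_const: "subalg R ==> (\<lambda>_. c) \<in> R"
 and subalg_add: "subalg R ==> f \<in> R ==> g \<in> R ==> (\<lambda>x. f x + g x) \<in> R"
 and subalg_mult: "subalg R ==> f \<in> R ==> g \<in> R ==> (\<lambda>x. f x * g x) \<in> R"
 by (auto simp: subalg_def)

lemma subalg_uminus: "subalg R ==> f \<in> R ==> (\<lambda>x. - f x) \<in> R"
 using subalg_mult[of R "\<lambda>_. -1" f] subalg_const[of R "-1"] by simp

lemma subalg_diff: "subalg R ==> f \<in> R ==> g \<in> R ==> (\<lambda>x. f x - g x) \<in> R"
 using subalg_add[of R f "\<lambda>x. - g x"] subalg_uminus[of R g] by simp

lemma subalg_sum: "subalg R ==> (\<And>i. i \<in> I ==> f i \<in> R) ==> (\<lambda>x. \<Sum>i\<in>I. f i x) \<in> R"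
 by (induction I rule: infinite_finite_induct) (auto intro: subalg_const subalg_add)

lemma subalg_prod: "subalg R ==> (\<And>i. i \<in> I ==> f i \<in> R) ==> (\<lambda>x. \<Prod>i\<in>I. f i x) \<in> R"
 by (induction I rule: infinite_finite_induct) (auto intro: subalg_const subalg_mult)

lemma subalg_power: "subalg R ==> f \<in> R ==> (\<lambda>x. f x ^ k) \<in> R"
 by (induction k) (auto intro: subalg_const subalg_mult)

definition matfun :: "('a => complex) set => nat => nat => ('a => complex mat) set" where
 "matfun R n m = {M. (\<forall>x. M x \<in> carrier_mat n m) \<and> (\<forall>i<n. \<forall>j<m. (\<lambda>x. M x $$ (i,j)) \<in> R)}"

lemma matfunI: "(\<And>x. M x \<in> carrier_mat n m) ==> (\<And>i j. i < n ==> j < m ==> (\<lambda>x. M x $$ (i,j)) \<in> R) ==> M \<in> matfun R n m"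
 by (auto simp: matfun_def)

lemma matfun_mat: "(\<And>i j. i < n ==> j < m ==> (\<lambda>x. f x (i,j)) \<in> R) ==> (\<lambda>x. mat n m (f x)) \<in> matfun R n m"
 by (auto simp: matfun_def)

lemma matfunD: "M \<in> matfun R n m ==> M x \<in> carrier_mat n m"
 "M \<in> matfun R n m ==> i < n ==> j < m ==> (\<lambda>x. M x $$ (i,j)) \<in> R"
 by (auto simp: matfun_def)

lemma matfun_const: "subalg R ==> A \<in> carrier_mat n m ==> (\<lambda>_. A) \<in> matfun R n m"
 by (auto simp: matfun_def intro: subalg_const)

lemma matfun_mult:
 assumes R: "subalg R" and A: "A \<in> matfun R n m" and B: "B \<in> matfun R m k"
 shows "(\<lambda>x. A x * B x) \<in> matfun R n k"
proof (rule matfunI)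
 show "A x * B x \<in> carrier_mat n k" for x using matfunD(1)[OF A] matfunD(1)[OF B] by (rule mult_carrier_mat)
 fix i j assume ij: "i < n" "j < k"
 have "(\<lambda>x. \<Sum>l<m. A x $$ (i,l) * B x $$ (l,j)) \<in> R"
  using ij by (intro subalg_sum[OF R] subalg_mult[OF R] matfunD(2)[OF A] matfunD(2)[OF B]) auto
 then show "(\<lambda>x. (A x * B x) $$ (i,j)) \<in> R"
  using mult_idx[OF matfunD(1)[OF A] matfunD(1)[OF B] ij] by simp
qed

lemma matfun_add:
 assumes R: "subalg R" and A: "A \<in> matfun R n m" and B: "B \<in> matfun R n m"
 shows "(\<lambda>x. A x + B x) \<in> matfun R n m"
proof (rule matfunI)
 show "A x + B x \<in> carrier_mat n m" for x using matfunD(1)[OF B] by (rule add_carrier_mat)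
 fix i j assume ij: "i < n" "j < m"
 have "(A x + B x) $$ (i,j) = A x $$ (i,j) + B x $$ (i,j)" for x
  using ij matfunD(1)[OF A, of x] matfunD(1)[OF B, of x] by simp
 then show "(\<lambda>x. (A x + B x) $$ (i,j)) \<in> R"
  using subalg_add[OF R matfunD(2)[OF A ij] matfunD(2)[OF B ij]] by simp
qed

lemma matfun_smult:
 assumes R: "subalg R" and c: "c \<in> R" and A: "A \<in> matfun R n m"
 shows "(\<lambda>x. c x \<cdot>\<^sub>m A x) \<in> matfun R n m"
proof (rule matfunI)
 show "c x \<cdot>\<^sub>m A x \<in> carrier_mat n m" for x using matfunD(1)[OF A] by (rule smult_carrier_mat)
 fix i j assume ij: "i < n" "j < m"
 have "(c x \<cdot>\<^sub>m A x) $$ (i,j) = c x * A x $$ (i,j)" for x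
  using ij matfunD(1)[OF A, of x] by simp
 then show "(\<lambda>x. (c x \<cdot>\<^sub>m A x) $$ (i,j)) \<in> R"
  using subalg_mult[OF R c matfunD(2)[OF A ij]] by simp
qed

lemma matfun_det:
 assumes R: "subalg R" and A: "A \<in> matfun R n n"
 shows "(\<lambda>x. det (A x)) \<in> R"
proof -
 have "det (A x) = (\<Sum>p\<in>{p. p permutes {0..<n}}. signof p * (\<Prod>i = 0..<n. A x $$ (i, p i)))" for x
  using det_def'[OF matfunD(1)[OF A]] .
 moreover have "(\<lambda>x. \<Sum>p\<in>{p. p permutes {0..<n}}. signof p * (\<Prod>i = 0..<n. A x $$ (i, p i))) \<in> R"
  by (intro subalg_sum[OF R] subalg_mult[OF R] subalg_const[OF R] subalg_prod[OF R] matfunD(2)[OF A]) auto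
 ultimately show ?thesis by simp
qed

lemma matfun_mtr:
 assumes R: "subalg R" and A: "A \<in> matfun R n n"
 shows "(\<lambda>x. mtr (A x)) \<in> R"
proof -
 have "mtr (A x) = (\<Sum>i<n. A x $$ (i,i))" for x using matfunD(1)[OF A, of x] by (simp add: mtr_def)
 then show ?thesis using subalg_sum[OF R, of "{..<n}" "\<lambda>i x. A x $$ (i,i)"] matfunD(2)[OF A] by simp
qed

lemma matfun_adj:
 assumes R: "subalg R" and A: "A \<in> matfun R n n"
 shows "(\<lambda>x. adj_mat (A x)) \<in> matfun R n n"
proof (rule matfunI)
 show "adj_mat (A x) \<in> mats n" for x using adj_mat(1)[OF matfunD(1)[OF A]] .
 fix i j assume ij: "i < n" "j < n"
 have e: "adj_mat (A x) $$ (i,j) = (-1)^(j+i) * det (mat_delete (A x) j i)" for x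
  using ij matfunD(1)[OF A, of x] by (simp add: adj_mat_def cofactor_def)
 have "(\<lambda>x. mat_delete (A x) j i) \<in> matfun R (n-1) (n-1)"
 proof (rule matfunI)
  show "mat_delete (A x) j i \<in> carrier_mat (n-1) (n-1)" for x
   using matfunD(1)[OF A, of x] by (rule mat_delete_carrier)
  fix a b assume ab: "a < n - 1" "b < n - 1"
  have "mat_delete (A x) j i $$ (a,b) = A x $$ (if a < j then a else Suc a, if b < i then b else Suc b)" for x
   using ab matfunD(1)[OF A, of x] by (simp add: mat_delete_def)
  then show "(\<lambda>x. mat_delete (A x) j i $$ (a,b)) \<in> R"
   using matfunD(2)[OF A, of "if a < j then a else Suc a" "if b < i then b else Suc b"] ab by auto
 qed
 then show "(\<lambda>x. adj_mat (A x) $$ (i,j)) \<in> R"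
  unfolding e by (intro subalg_mult[OF R] subalg_const[OF R] matfun_det[OF R])
qed

lemma subalg_regular: "subalg (regular_fun n)"
 by (auto simp: subalg_def intro: regular_fun.intros)

lemma matfun_nev:
 assumes R: "subalg R"
  and e: "\<And>i j. i < n ==> j < n ==> (\<lambda>x. fst (\<gamma> x) $$ (i,j)) \<in> R" "\<And>i j. i < n ==> j < n ==> (\<lambda>x. snd (\<gamma> x) $$ (i,j)) \<in> R"
 shows "(\<lambda>x. nev n (\<gamma> x) p) \<in> matfun R n n"
proof (induction p)
 case (NC c)
 show ?case unfolding nev.simps by (intro matfun_smult[OF R] matfun_const[OF R] subalg_const[OF R]) simp
next
 case NX
 show ?case unfolding nev.simps by (rule matfun_mat) (rule e)
next
 case NY
 show ?case unfolding nev.simps by (rule matfun_mat) (rule e)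
next
 case (NAdd p q)
 then show ?case unfolding nev.simps by (intro matfun_add[OF R])
next
 case (NMul p q)
 then show ?case unfolding nev.simps by (intro matfun_mult[OF R])
qed

lemma nev_regular: "(\<lambda>\<phi>. nev n \<phi> p) \<in> matfun (regular_fun n) n n"
 using matfun_nev[OF subalg_regular, of n "\<lambda>\<phi>. \<phi>" n] by (auto intro: regular_fun.intros)

text \<open>A regular function restricts to an algebra \<open>R\<close> along any map whose coordinates, including the
 inverse determinants, lie in \<open>R\<close>.\<close>
lemma regular_compose:
 assumes R: "subalg R" and f: "f \<in> regular_fun n"
  and e: "\<And>i j. i < n ==> j < n ==> (\<lambda>x. fst (\<gamma> x) $$ (i,j)) \<in> R" "\<And>i j. i < n ==> j < n ==> (\<lambda>x. snd (\<gamma> x) $$ (i,j)) \<in> R"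
  and d: "(\<lambda>x. inverse (det (fst (\<gamma> x)))) \<in> R" "(\<lambda>x. inverse (det (snd (\<gamma> x)))) \<in> R"
 shows "(\<lambda>x. f (\<gamma> x)) \<in> R"
 using f by induction (auto intro: subalg_const[OF R] subalg_add[OF R] subalg_mult[OF R] e d)

definition ntrn :: "nat => ncp => rep => complex" where
 "ntrn n p \<phi> = mtr (nev n \<phi> p)"

lemma ntrn_regular: "ntrn n p \<in> regular_fun n"
 unfolding ntrn_def[abs_def] by (rule matfun_mtr[OF subalg_regular nev_regular])

lemma invariantI:
 assumes "f \<in> regular_fun n" "\<And>\<phi> \<psi>. \<phi> \<in> rep_B3 n ==> \<psi> \<in> rep_B3 n ==> rep_iso \<phi> \<psi> ==> f \<phi> = f \<psi>"
 shows "f \<in> invariant_fun n"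
 using assms by (auto simp: invariant_fun_def)

lemma ntrn_invariant: "ntrn n p \<in> invariant_fun n"
proof (rule invariantI[OF ntrn_regular])
 fix \<phi> \<psi> assume "\<phi> \<in> rep_B3 n" "\<psi> \<in> rep_B3 n" "rep_iso \<phi> \<psi>"
 then show "ntrn n p \<phi> = ntrn n p \<psi>"
  using ntr_iso[of \<phi> \<psi> n p] ntr_pairs[OF rep_pairs, of \<phi> n p] ntr_pairs[OF rep_pairs, of \<psi> n p] rep_pairs[of \<phi> n] by (simp add: ntrn_def)
qed

lemma subalg_invariant: "subalg (invariant_fun n)"
 unfolding subalg_def
proof (intro conjI allI ballI)
 show "(\<lambda>_. c) \<in> invariant_fun n" for c by (rule invariantI) (auto intro: regular_fun.const)
 fix f g assume f: "f \<in> invariant_fun n" and g: "g \<in> invariant_fun n"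
 then show "(\<lambda>x. f x + g x) \<in> invariant_fun n"
  unfolding invariant_fun_def using regular_fun.add[of f n g] by simp
 show "(\<lambda>x. f x * g x) \<in> invariant_fun n"
  using f g unfolding invariant_fun_def using regular_fun.mult[of f n g] by simp
qed

section \<open>Isomorphism classes and the Zariski topology\<close>

lemma iso_class_self: "\<phi> \<in> rep_B3 n ==> \<phi> \<in> iso_class n \<phi>"
 by (auto simp: iso_class_def intro: rep_iso_refl[OF rep_pairs])

lemma iso_class_eq: "rep_iso \<phi> \<psi> ==> iso_class n \<phi> = iso_class n \<psi>"
 unfolding iso_class_def using rep_iso_sym rep_iso_trans by blast

lemma simple_semisimple: assumes "simple_rep n \<phi>" shows "semisimple_rep n \<phi>"
proof -
 note p = simple_repD(1)[OF assms]
 have "dsum \<phi> (direct_sum_rep []) = \<phi>"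
  using p by (auto simp: dsum_def direct_sum_rep_def Let_def intro!: prod_eqI eq_matI)
 then have "direct_sum_rep [\<phi>] = \<phi>" using direct_sum_pairs(2)[of "[]" \<phi> n] p by simp
 then show ?thesis unfolding semisimple_rep_def using assms simple_repD(3)[OF assms] rep_iso_refl[OF p]
  by (intro conjI exI[of _ "[\<phi>]"]) auto
qed

definition vanishes :: "(rep => complex) => rep set => bool" where
 "vanishes f C \<longleftrightarrow> (\<forall>\<phi>\<in>C. f \<phi> = 0)"

lemma issE:
 assumes "C \<in> iss_B3 n"
 obtains \<phi> where "semisimple_rep n \<phi>" "C = iso_class n \<phi>" "\<phi> \<in> C" "\<phi> \<in> rep_B3 n"
 using assms that iso_class_self unfolding iss_B3_def semisimple_rep_def by blast

lemma vanishes_class: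
 assumes "f \<in> invariant_fun n" "\<phi> \<in> rep_B3 n"
 shows "vanishes f (iso_class n \<phi>) \<longleftrightarrow> f \<phi> = 0" "(\<forall>\<psi>\<in>iso_class n \<phi>. f \<psi> \<noteq> 0) \<longleftrightarrow> f \<phi> \<noteq> 0"
proof -
 have "f \<psi> = f \<phi>" if "\<psi> \<in> iso_class n \<phi>" for \<psi>
  using that assms unfolding iso_class_def invariant_fun_def by fastforce
 then show "vanishes f (iso_class n \<phi>) \<longleftrightarrow> f \<phi> = 0" "(\<forall>\<psi>\<in>iso_class n \<phi>. f \<psi> \<noteq> 0) \<longleftrightarrow> f \<phi> \<noteq> 0"
  using iso_class_self[OF assms(2)] unfolding vanishes_def by metis+
qed

lemma nonvanishing_iff:
 assumes "f \<in> invariant_fun n" "C \<in> iss_B3 n"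
 shows "(\<forall>\<psi>\<in>C. f \<psi> \<noteq> 0) \<longleftrightarrow> \<not> vanishes f C"
proof -
 obtain \<phi> where "C = iso_class n \<phi>" "\<phi> \<in> rep_B3 n" using issE[OF assms(2)] by metis
 then show ?thesis using vanishes_class[OF assms(1)] by simp
qed

lemma topspace_zariski [simp]: "topspace (zariski_iss n) = iss_B3 n"
proof -
 have "(\<lambda>_. 1) \<in> invariant_fun n" using subalg_const[OF subalg_invariant] .
 let ?B = "(\<lambda>f. {C \<in> iss_B3 n. \<forall>\<phi>\<in>C. f \<phi> \<noteq> 0}) ` invariant_fun n"
 have "iss_B3 n \<in> ?B" using \<open>(\<lambda>_. 1) \<in> invariant_fun n\<close> by (rule rev_image_eqI) simp
 then have "iss_B3 n \<subseteq> \<Union>?B" by (rule Union_upper)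
 moreover have "\<Union>?B \<subseteq> iss_B3 n"
 proof (rule Union_least)
  fix X assume "X \<in> ?B"
  then obtain f :: "rep => complex" where "X = {C \<in> iss_B3 n. \<forall>\<phi>\<in>C. f \<phi> \<noteq> 0}"
   unfolding image_iff by (elim bexE)
  then show "X \<subseteq> iss_B3 n" by (simp only: Collect_restrict)
 qed
 ultimately show ?thesis unfolding zariski_iss_def topology_generated_by_topspace by (rule subset_antisym[rotated])
qed

lemma openin_nonvanishing:
 assumes "f \<in> invariant_fun n"
 shows "openin (zariski_iss n) {C \<in> iss_B3 n. \<not> vanishes f C}"
proof -
 have "{C \<in> iss_B3 n. \<not> vanishes f C} = {C \<in> iss_B3 n. \<forall>\<phi>\<in>C. f \<phi> \<noteq> 0}"
  using nonvanishing_iff[OF assms] by blast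
 then show ?thesis unfolding zariski_iss_def
  by (simp only:) (rule topology_generated_by_Basis, rule imageI, rule assms)
qed

lemma zariski_open_basis:
 assumes "openin (zariski_iss n) U" "C \<in> U"
 shows "\<exists>f\<in>invariant_fun n. \<not> vanishes f C \<and> {C \<in> iss_B3 n. \<not> vanishes f C} \<subseteq> U"
proof -
 have "generate_topology_on ((\<lambda>f. {C \<in> iss_B3 n. \<forall>\<phi>\<in>C. f \<phi> \<noteq> 0}) ` invariant_fun n) U"
  using assms(1) unfolding zariski_iss_def openin_topology_generated_by_iff .
 then show ?thesis using assms(2)
 proof (induction arbitrary: C)
  case Empty
  then show ?case by simp
 next
  case (Int a b)
  from Int.IH(1)[OF IntD1[OF Int.prems]] obtain f
   where f: "f\<in>invariant_fun n" "\<not> vanishes f C" "{C \<in> iss_B3 n. \<not> vanishes f C} \<subseteq> a" by (elim bexE conjE)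
  from Int.IH(2)[OF IntD2[OF Int.prems]] obtain g
   where g: "g\<in>invariant_fun n" "\<not> vanishes g C" "{C \<in> iss_B3 n. \<not> vanishes g C} \<subseteq> b" by (elim bexE conjE)
  have fg: "(\<lambda>x. f x * g x) \<in> invariant_fun n" using subalg_mult[OF subalg_invariant f(1) g(1)] .
  have "openin (zariski_iss n) a" using Int(1) unfolding zariski_iss_def openin_topology_generated_by_iff .
  then have Ci: "C \<in> iss_B3 n" using Int.prems openin_subset[of "zariski_iss n" a] by auto
  have "vanishes (\<lambda>x. f x * g x) D \<longleftrightarrow> vanishes f D \<or> vanishes g D" if D: "D \<in> iss_B3 n" for D
  proof -
   obtain \<phi> where "D = iso_class n \<phi>" "\<phi> \<in> rep_B3 n" using issE[OF D] by metis
   then show ?thesis using vanishes_class(1)[OF f(1)] vanishes_class(1)[OF g(1)] vanishes_class(1)[OF fg] by simp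
  qed
  then show ?case using f g Ci fg by (intro bexI[of _ "\<lambda>x. f x * g x"]) auto
 next
  case (UN K)
  then obtain k where "k \<in> K" "C \<in> k" by auto
  then show ?case using UN.IH[of k C] by blast
 next
  case (Basis s)
  then obtain f where f: "f \<in> invariant_fun n" "s = {C \<in> iss_B3 n. \<forall>\<phi>\<in>C. f \<phi> \<noteq> 0}" by auto
  then show ?case using Basis.prems nonvanishing_iff[OF f(1)] by (intro bexI[of _ f]) auto
 qed
qed

lemma closed_separate:
 assumes "closedin (zariski_iss n) A" "C \<in> iss_B3 n" "C \<notin> A"
 shows "\<exists>f\<in>invariant_fun n. \<not> vanishes f C \<and> (\<forall>D\<in>A. vanishes f D)"
proof -
 have "openin (zariski_iss n) (iss_B3 n - A)" using assms(1) by (simp add: closedin_def)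
 then obtain f where f: "f\<in>invariant_fun n" "\<not> vanishes f C" "{C \<in> iss_B3 n. \<not> vanishes f C} \<subseteq> iss_B3 n - A"
  using zariski_open_basis[of n "iss_B3 n - A" C] assms(2,3) by blast
 moreover have "A \<subseteq> iss_B3 n" using assms(1) by (simp add: closedin_def)
 ultimately show ?thesis by blast
qed

text \<open>The Zariski closure is the common zero set of all invariants that vanish on the given classes.\<close>
lemma closure_iff:
 assumes "S \<subseteq> iss_B3 n"
 shows "C \<in> zariski_iss n closure_of S \<longleftrightarrow>
  C \<in> iss_B3 n \<and> (\<forall>f\<in>invariant_fun n. (\<forall>D\<in>S. vanishes f D) --> vanishes f C)"
proof
 assume C: "C \<in> zariski_iss n closure_of S"
 then have Ci: "C \<in> iss_B3 n" using closure_of_subset_topspace[of "zariski_iss n" S] by auto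
 moreover have "vanishes f C" if f: "f \<in> invariant_fun n" "\<forall>D\<in>S. vanishes f D" for f
 proof (rule ccontr)
  assume "\<not> vanishes f C"
  then have "C \<in> {C \<in> iss_B3 n. \<not> vanishes f C}" using Ci by simp
  then have "\<exists>y\<in>S. y \<in> {C \<in> iss_B3 n. \<not> vanishes f C}"
   using C[unfolded in_closure_of, THEN conjunct2, THEN spec, of "{C \<in> iss_B3 n. \<not> vanishes f C}"]
    openin_nonvanishing[OF f(1)] by (simp only: simp_thms Bex_def)
  then obtain y where "y \<in> S" "\<not> vanishes f y" by (simp only: mem_Collect_eq) (elim bexE conjE)
  with f(2) show False by simp
 qed
 ultimately show "C \<in> iss_B3 n \<and> (\<forall>f\<in>invariant_fun n. (\<forall>D\<in>S. vanishes f D) --> vanishes f C)" by blast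
next
 assume a: "C \<in> iss_B3 n \<and> (\<forall>f\<in>invariant_fun n. (\<forall>D\<in>S. vanishes f D) --> vanishes f C)"
 show "C \<in> zariski_iss n closure_of S"
 proof (rule ccontr)
  assume "C \<notin> zariski_iss n closure_of S"
  from closed_separate[OF closedin_closure_of a[THEN conjunct1] this]
  obtain f where f: "f\<in>invariant_fun n" "\<not> vanishes f C" "\<forall>D\<in>zariski_iss n closure_of S. vanishes f D"
   by (elim bexE conjE)
  have "S \<subseteq> zariski_iss n closure_of S" using assms by (intro closure_of_subset) simp
  then show False using a f by blast
 qed
qed

text \<open>It suffices that two invariants, each non-zero somewhere on the family, are simultaneously
 non-zero somewhere on it.\<close>
lemma irreducible_family:
 assumes G: "G \<noteq> {}" "\<And>\<phi>. \<phi> \<in> G ==> simple_rep n \<phi>"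
  and gen: "\<And>f g \<phi> \<psi>. f \<in> invariant_fun n ==> g \<in> invariant_fun n ==> \<phi> \<in> G ==> \<psi> \<in> G ==> f \<phi> \<noteq> 0 ==> g \<psi> \<noteq> 0 ==>
   \<exists>\<chi>\<in>G. f \<chi> \<noteq> 0 \<and> g \<chi> \<noteq> 0"
 shows "irreducible_in (zariski_iss n) (zariski_iss n closure_of (iso_class n ` G))"
proof -
 let ?T = "zariski_iss n" let ?S = "iso_class n ` G"
 have Gr: "\<phi> \<in> rep_B3 n" if "\<phi> \<in> G" for \<phi> using G(2)[OF that] simple_repD(3) by blast
 have S: "?S \<subseteq> iss_B3 n" using G(2) simple_semisimple unfolding iss_B3_def by blast
 have sub: "?S \<subseteq> ?T closure_of ?S" using S by (intro closure_of_subset) simp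
 show ?thesis unfolding irreducible_in_def
 proof (intro conjI allI impI)
  show "?T closure_of ?S \<subseteq> topspace ?T" by (rule closure_of_subset_topspace)
  show "?T closure_of ?S \<noteq> {}" using sub G(1) by blast
  fix A B assume AB: "closedin ?T A \<and> closedin ?T B \<and> ?T closure_of ?S \<subseteq> A \<union> B"
  have "?S \<subseteq> A \<or> ?S \<subseteq> B"
  proof (rule ccontr)
   assume "\<not> ?thesis"
   then obtain \<phi> \<psi> where p: "\<phi> \<in> G" "iso_class n \<phi> \<notin> A" "\<psi> \<in> G" "iso_class n \<psi> \<notin> B" by blast
   have i: "iso_class n \<phi> \<in> iss_B3 n" "iso_class n \<psi> \<in> iss_B3 n" using p S by blast+
   obtain f where f: "f \<in> invariant_fun n" "\<not> vanishes f (iso_class n \<phi>)" "\<forall>D\<in>A. vanishes f D"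
    using closed_separate[OF _ i(1) p(2)] AB by blast
   obtain g where g: "g \<in> invariant_fun n" "\<not> vanishes g (iso_class n \<psi>)" "\<forall>D\<in>B. vanishes g D"
    using closed_separate[OF _ i(2) p(4)] AB by blast
   have "f \<phi> \<noteq> 0" "g \<psi> \<noteq> 0" using f(2) g(2) vanishes_class(1)[OF f(1) Gr[OF p(1)]] vanishes_class(1)[OF g(1) Gr[OF p(3)]] by auto
   from gen[OF f(1) g(1) p(1,3) this] obtain \<chi> where c: "\<chi> \<in> G" "f \<chi> \<noteq> 0" "g \<chi> \<noteq> 0" by blast
   have "iso_class n \<chi> \<in> A \<union> B" using c(1) sub AB by blast
   then show False using f(3) g(3) c vanishes_class(1)[OF f(1) Gr[OF c(1)]] vanishes_class(1)[OF g(1) Gr[OF c(1)]] by blast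
  qed
  then show "?T closure_of ?S \<subseteq> A \<or> ?T closure_of ?S \<subseteq> B"
   using AB closure_of_minimal by blast
 qed
qed

section \<open>Rational curves\<close>

text \<open>Rational functions whose only possible poles are the zeros of \<open>D\<close>. No condition is imposed on
 the values at these poles.\<close>
definition ratfun :: "complex poly => (complex => complex) set" where
 "ratfun D = {F. \<exists>p N. \<forall>\<epsilon>. poly D \<epsilon> \<noteq> 0 --> F \<epsilon> = poly p \<epsilon> / poly D \<epsilon> ^ N}"

lemma ratfunI: "(\<And>\<epsilon>. poly D \<epsilon> \<noteq> 0 ==> F \<epsilon> = poly p \<epsilon> / poly D \<epsilon> ^ N) ==> F \<in> ratfun D"
 unfolding ratfun_def by blast

lemma subalg_ratfun: "subalg (ratfun D)"
 unfolding subalg_def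
proof (intro conjI allI ballI)
 show "(\<lambda>_. c) \<in> ratfun D" for c by (rule ratfunI[of _ _ "[:c:]" 0]) simp
 fix f g assume "f \<in> ratfun D" "g \<in> ratfun D"
 then obtain p N q M where p: "\<And>\<epsilon>. poly D \<epsilon> \<noteq> 0 ==> f \<epsilon> = poly p \<epsilon> / poly D \<epsilon> ^ N"
  "\<And>\<epsilon>. poly D \<epsilon> \<noteq> 0 ==> g \<epsilon> = poly q \<epsilon> / poly D \<epsilon> ^ M" unfolding ratfun_def by blast
 show "(\<lambda>x. f x + g x) \<in> ratfun D"
  by (rule ratfunI[of _ _ "p * D^M + q * D^N" "N + M"]) (auto simp: p field_simps power_add)
 show "(\<lambda>x. f x * g x) \<in> ratfun D"
  by (rule ratfunI[of _ _ "p * q" "N + M"]) (auto simp: p power_add)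
qed

lemma ratfun_poly: "poly p \<in> ratfun D"
 by (rule ratfunI[of _ _ p 0]) simp

text \<open>A rational curve through members of \<open>F\<close> along which all regular functions are rational; it is
 defined at the parameters \<open>0\<close> and \<open>1\<close>.\<close>
definition curve :: "nat => complex poly => (complex => rep) => rep set => bool" where
 "curve n D \<gamma> F \<longleftrightarrow> poly D 0 \<noteq> 0 \<and> poly D 1 \<noteq> 0 \<and> (\<forall>f\<in>regular_fun n. (\<lambda>\<epsilon>. f (\<gamma> \<epsilon>)) \<in> ratfun D) \<and>
   (\<forall>\<epsilon>. poly D \<epsilon> \<noteq> 0 --> \<gamma> \<epsilon> \<in> F)"

definition rconn :: "nat => rep set => bool" where
 "rconn n F \<longleftrightarrow> (\<forall>\<phi>\<in>F. \<forall>\<psi>\<in>F. \<exists>D \<gamma>. curve n D \<gamma> F \<and> \<gamma> 0 = \<phi> \<and> \<gamma> 1 = \<psi>)"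

text \<open>Along a curve from a point with \<open>f \<noteq> 0\<close> to one with \<open>g \<noteq> 0\<close>, both are non-zero rational
 functions, hence both are non-zero at all but finitely many parameters.\<close>
lemma rconn_generic:
 assumes F: "rconn n F" and f: "f \<in> regular_fun n" "\<phi> \<in> F" "f \<phi> \<noteq> 0" and g: "g \<in> regular_fun n" "\<psi> \<in> F" "g \<psi> \<noteq> 0"
 shows "\<exists>\<chi>\<in>F. f \<chi> \<noteq> 0 \<and> g \<chi> \<noteq> 0"
proof -
 obtain D \<gamma> where D: "curve n D \<gamma> F" "\<gamma> 0 = \<phi>" "\<gamma> 1 = \<psi>" using F f(2) g(2) unfolding rconn_def by blast
 note d = D(1)[unfolded curve_def]
 obtain p N where p: "\<And>\<epsilon>. poly D \<epsilon> \<noteq> 0 ==> f (\<gamma> \<epsilon>) = poly p \<epsilon> / poly D \<epsilon> ^ N" using d f(1) unfolding ratfun_def by blast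
 obtain q M where q: "\<And>\<epsilon>. poly D \<epsilon> \<noteq> 0 ==> g (\<gamma> \<epsilon>) = poly q \<epsilon> / poly D \<epsilon> ^ M" using d g(1) unfolding ratfun_def by blast
 have "poly p 0 \<noteq> 0" using p[of 0] d f(3) D(2) by auto
 moreover have "poly q 1 \<noteq> 0" using q[of 1] d g(3) D(3) by auto
 moreover have "poly D 0 \<noteq> 0" using d by simp
 ultimately have "p * q * D \<noteq> 0" by auto
 then have "finite {x. poly (p * q * D) x = 0}" by (rule poly_roots_finite)
 then obtain x where "x \<notin> {x. poly (p * q * D) x = 0}" using ex_new_if_finite[OF infinite_UNIV_char_0] by blast
 then have x: "poly p x \<noteq> 0" "poly q x \<noteq> 0" "poly D x \<noteq> 0" by auto
 then show ?thesis using d p[OF x(3)] q[OF x(3)] by (intro bexI[of _ "\<gamma> x"]) auto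
qed

lemma rconn_vanish:
 assumes "rconn n F" "f \<in> regular_fun n" "g \<in> regular_fun n" "\<psi> \<in> F" "g \<psi> \<noteq> 0"
  "\<And>\<phi>. \<phi> \<in> F ==> g \<phi> \<noteq> 0 ==> f \<phi> = 0" "\<phi> \<in> F"
 shows "f \<phi> = 0"
 using rconn_generic[OF assms(1,2,7) _ assms(3,4,5)] assms(6) by blast

text \<open>By Burnside's theorem the matrix units are values of \<open>n\<^sup>2\<close> polynomials at \<open>\<phi>\<close>. Wherever the
 values of the same polynomials remain linearly independent, a condition on one determinant, the
 representation is simple.\<close>
lemma simple_open:
 assumes s: "simple_rep n \<phi>"
 shows "\<exists>f\<in>regular_fun n. f \<phi> \<noteq> 0 \<and> (\<forall>\<psi>\<in>rep_B3 n. f \<psi> \<noteq> 0 --> simple_rep n \<psi>)"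
proof -
 have n: "n > 0" using simple_repD[OF s] by simp
 have "\<forall>r. \<exists>p. nev n \<phi> p = mat n n (\<lambda>(i,j). if i * n + j = r then 1 else 0)"
  using burnside[OF s] unfolding full_rep_def by simp
 then obtain p where p: "\<And>r. nev n \<phi> (p r) = mat n n (\<lambda>(i,j). if i * n + j = r then 1 else 0)" by metis
 define G where "G \<psi> = mat (n*n) (n*n) (\<lambda>(c,r). nev n \<psi> (p r) $$ (c div n, c mod n))" for \<psi>
 have dm: "c div n < n" "c mod n < n" if "c < n * n" for c using that n by (auto simp: less_mult_imp_div_less)
 have GR: "G \<in> matfun (regular_fun n) (n*n) (n*n)"
  unfolding G_def[abs_def] by (rule matfun_mat) (use dm matfunD(2)[OF nev_regular] in auto)
 have "G \<phi> = 1\<^sub>m (n*n)"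
  by (rule eq_matI) (use dm in \<open>auto simp: G_def p\<close>)
 then have "det (G \<phi>) \<noteq> 0" by simp
 moreover have "simple_rep n \<psi>" if \<psi>: "\<psi> \<in> rep_B3 n" "det (G \<psi>) \<noteq> 0" for \<psi>
 proof (rule full_imp_simple[OF \<psi>(1) n])
  have GC: "G \<psi> \<in> carrier_mat (n*n) (n*n)" by (simp add: G_def)
  obtain B where B: "B \<in> carrier_mat (n*n) (n*n)" "G \<psi> * B = 1\<^sub>m (n*n)"
   using det_non_zero_imp_unit[OF GC \<psi>(2), of "()"] unfolding Units_def ring_mat_def by auto
  show "full_rep n \<psi>" unfolding full_rep_def
  proof
   fix M :: "complex mat" assume M: "M \<in> mats n"
   define m where "m = vec (n*n) (\<lambda>c. M $$ (c div n, c mod n))"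
   define c where "c = B *\<^sub>v m"
   have cC: "c \<in> carrier_vec (n*n)" unfolding c_def using B by (auto simp: m_def)
   have "G \<psi> *\<^sub>v c = m" unfolding c_def using B GC
    by (subst assoc_mult_mat_vec[of _ "n*n" "n*n" _ "n*n", symmetric]) (auto simp: m_def)
   then have sol: "(\<Sum>r<n*n. nev n \<psi> (p r) $$ (k div n, k mod n) * c $ r) = M $$ (k div n, k mod n)" if "k < n * n" for k
    using that mult_vec_idx[OF GC cC that] by (simp add: G_def m_def)
   obtain q where q: "\<forall>i<n. \<forall>j<n. nev n \<psi> q $$ (i,j) = (\<Sum>r<n*n. c $ r * nev n \<psi> (p r) $$ (i,j))"
    using nev_lincomb[where m = "n*n" and c = "\<lambda>r. c $ r" and f = p] by blast
   have "nev n \<psi> q = M"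
   proof (rule eq_matI)
    fix i j assume "i < dim_row M" "j < dim_col M"
    then have ij: "i < n" "j < n" using M by auto
    have "i * n + j < Suc i * n" using ij by simp
    also have "\<dots> \<le> n * n" using ij by (intro mult_right_mono) auto
    finally have k: "i * n + j < n * n" .
    have "(i * n + j) div n = i" "(i * n + j) mod n = j" using ij by auto
    then show "nev n \<psi> q $$ (i,j) = M $$ (i,j)" using sol[OF k] q ij by (simp add: mult.commute)
   qed (use M in auto)
   then show "\<exists>p. nev n \<psi> p = M" ..
  qed
 qed
 moreover have "(\<lambda>\<psi>. det (G \<psi>)) \<in> regular_fun n" by (rule matfun_det[OF subalg_regular GR])
 ultimately show ?thesis by (intro bexI[of _ "\<lambda>\<psi>. det (G \<psi>)"]) auto
qed

section \<open>Matrices of finite order\<close>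

definition diagm :: "complex list => complex mat" where
 "diagm as = mat (length as) (length as) (\<lambda>(i,j). if i = j then as ! i else 0)"

lemma diag_block_one:
 fixes As :: "complex mat list"
 assumes "\<forall>A\<in>set As. square_mat A" "diag_block_mat As = 1\<^sub>m N" "A \<in> set As"
 shows "A = 1\<^sub>m (dim_row A)"
 using assms
proof (induction As arbitrary: N)
 case (Cons B As)
 let ?D = "diag_block_mat As"
 have sq: "square_mat B" "square_mat ?D" using Cons.prems(1) diag_block_mat_square[of As] by auto
 then have c: "B \<in> carrier_mat (dim_row B) (dim_row B)" "?D \<in> carrier_mat (dim_row ?D) (dim_row ?D)" by auto
 have f: "four_block_mat B (0\<^sub>m (dim_row B) (dim_row ?D)) (0\<^sub>m (dim_row ?D) (dim_row B)) ?D = 1\<^sub>m N"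
  using Cons.prems(2) sq by (simp add: Let_def)
 have N: "N = dim_row B + dim_row ?D" using arg_cong[OF f, of dim_row] by simp
 have 1: "B = 1\<^sub>m (dim_row B)"
 proof (rule eq_matI)
  fix i j assume ij: "i < dim_row (1\<^sub>m (dim_row B))" "j < dim_col (1\<^sub>m (dim_row B))"
  have "B $$ (i,j) = (1\<^sub>m N :: complex mat) $$ (i,j)" unfolding f[symmetric] using ij sq by simp
  then show "B $$ (i,j) = 1\<^sub>m (dim_row B) $$ (i,j)" using ij N by simp
 qed (use sq in auto)
 have 2: "?D = 1\<^sub>m (dim_row ?D)"
 proof (rule eq_matI)
  fix i j assume ij: "i < dim_row (1\<^sub>m (dim_row ?D))" "j < dim_col (1\<^sub>m (dim_row ?D))"
  have "?D $$ (i,j) = (1\<^sub>m N :: complex mat) $$ (dim_row B + i, dim_row B + j)" unfolding f[symmetric] using ij sq by simp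
  then show "?D $$ (i,j) = 1\<^sub>m (dim_row ?D) $$ (i,j)" using ij N by simp
 qed (use sq in auto)
 show ?case using 1 2 Cons.IH[of "dim_row ?D"] Cons.prems(1,3) by auto
qed simp

lemma jordan_matrix_ones: "jordan_matrix (map (Pair 1) as) = diagm as"
proof (induction as)
 case Nil
 then show ?case by (auto simp: jordan_matrix_def diagm_def)
next
 case (Cons a as)
 have l: "sum_list (map fst (map (Pair (1::nat)) as)) = length as" by (induction as) auto
 show ?case unfolding list.map jordan_matrix_Cons Cons l
  by (rule eq_matI) (auto simp: diagm_def nth_Cons' jordan_block_def)
qed

text \<open>In a Jordan normal form of \<open>A\<close> all blocks have finite order and therefore size \<open>1\<close>.\<close>
lemma finite_order_diagonalizable:
 assumes A: "A \<in> mats n" and p: "A ^\<^sub>m m = 1\<^sub>m n" and m: "m > 0"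
 shows "\<exists>as. length as = n \<and> (\<forall>a\<in>set as. a ^ m = 1) \<and> (\<forall>e. eigenspace_dim A e = count (mset as) e)
  \<and> similar_mat A (diagm as)"
proof -
 obtain n_as where nf: "jordan_nf A n_as"
  using jordan_nf_exists[OF A] char_poly_factorized[OF A] by blast
 then have nz: "0 \<notin> fst ` set n_as" and sim: "similar_mat A (jordan_matrix n_as)" by (auto simp: jordan_nf_def)
 then obtain P Q where w: "similar_mat_wit A (jordan_matrix n_as) P Q" unfolding similar_mat_def by blast
 from similar_mat_witD2[OF A w] have PQ: "P \<in> mats n" "Q \<in> mats n" "P * Q = 1\<^sub>m n" "Q * P = 1\<^sub>m n"
  "jordan_matrix n_as \<in> mats n" by auto
 have "similar_mat_wit (jordan_matrix n_as) A Q P" using similar_mat_wit_sym[OF w] .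
 from similar_mat_wit_pow_id[OF this, of m] have "jordan_matrix n_as ^\<^sub>m m = 1\<^sub>m n" using PQ p by simp
 then have d1: "diag_block_mat (map (\<lambda>(k,a). jordan_block k a ^\<^sub>m m) n_as) = 1\<^sub>m n" unfolding jordan_matrix_pow .
 have blk: "k = 1 \<and> a ^ m = 1" if ka: "(k,a) \<in> set n_as" for k a
 proof -
  have "jordan_block k a ^\<^sub>m m = 1\<^sub>m (dim_row (jordan_block k a ^\<^sub>m m))"
   by (rule diag_block_one[OF _ d1]) (use ka in force)+
  then have e: "jordan_block k a ^\<^sub>m m = 1\<^sub>m k" by simp
  have k: "k > 0" using nz ka by force
  from arg_cong[OF e, of "\<lambda>M. M $$ (0,0)"] have am: "a ^ m = 1" using k by (simp add: jordan_block_pow)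
  have "\<not> k \<ge> 2"
  proof
   assume "k \<ge> 2"
   with arg_cong[OF e, of "\<lambda>M. M $$ (0,1)"] have "of_nat m * a ^ (m - 1) = 0" by (simp add: jordan_block_pow)
   then have "a = 0" using m by auto
   then show False using am zero_power[OF m, where 'a = complex] by simp
  qed
  then show ?thesis using am k by simp
 qed
 define as where "as = map snd n_as"
 have nas: "n_as = map (Pair 1) as"
  unfolding as_def using blk by (intro nth_equalityI) (auto simp: prod_eq_iff, metis nth_mem prod.collapse)
 have "length as = n" using PQ(5) unfolding nas jordan_matrix_ones by (auto simp: diagm_def)
 moreover have "\<forall>a\<in>set as. a ^ m = 1" using blk unfolding as_def by auto
 moreover have "eigenspace_dim A e = count (mset as) e" for e
 proof -
  have "eigenspace_dim A e = dim_gen_eigenspace A e 1"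
   using A by (simp add: eigenspace_dim_def dim_gen_eigenspace_def)
  also have "\<dots> = (\<Sum>n\<leftarrow>map fst [(n, e')\<leftarrow>n_as . e' = e]. min 1 n)" by (rule dim_gen_eigenspace[OF nf])
  also have "\<dots> = count (mset as) e" unfolding nas by (induction as) auto
  finally show ?thesis .
 qed
 moreover have "similar_mat A (diagm as)" using sim unfolding nas jordan_matrix_ones .
 ultimately show ?thesis by blast
qed

lemma diagm_perm:
 assumes "mset as = mset bs"
 shows "similar_mat (diagm as) (diagm bs)"
proof -
 obtain p where p: "p permutes {..<length bs}" "permute_list p bs = as" using mset_eq_permutation[OF assms] .
 let ?n = "length bs"
 have l: "length as = ?n" using mset_eq_length[OF assms] .
 have pn: "p i < ?n \<longleftrightarrow> i < ?n" for i using permutes_in_image[OF p(1), of i] by simp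
 have as: "as ! i = bs ! p i" if "i < ?n" for i using permute_list_nth[OF p(1) that] p(2) by simp
 define P where "P = (mat ?n ?n (\<lambda>(i,j). if j = p i then 1 else 0) :: complex mat)"
 have PC: "P \<in> carrier_mat ?n ?n" by (simp add: P_def)
 have QC: "transpose_mat P \<in> carrier_mat ?n ?n" using PC by simp
 have inj: "p i = p j \<longleftrightarrow> i = j" for i j using permutes_inj[OF p(1)] by (auto dest: injD)
 have PQ: "P * transpose_mat P = 1\<^sub>m ?n"
 proof (rule eq_matI)
  fix i j assume "i < dim_row (1\<^sub>m ?n)" "j < dim_col (1\<^sub>m ?n)"
  then have ij: "i < ?n" "j < ?n" by auto
  have "(P * transpose_mat P) $$ (i,j) = (\<Sum>l<?n. if l = p i then (if i = j then 1 else 0) else 0)"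
   unfolding mult_idx[OF PC QC ij] using ij by (intro sum.cong) (auto simp: P_def inj)
  then show "(P * transpose_mat P) $$ (i,j) = 1\<^sub>m ?n $$ (i,j)" using ij pn by simp
 qed (auto simp: P_def)
 have QP: "transpose_mat P * P = 1\<^sub>m ?n" by (rule mat_mult_left_right_inverse[OF PC QC PQ])
 have bC: "diagm bs \<in> carrier_mat ?n ?n" "diagm as \<in> carrier_mat ?n ?n" by (auto simp: diagm_def l)
 have c: "diagm as * P = P * diagm bs"
 proof (rule eq_matI)
  fix i j assume "i < dim_row (P * diagm bs)" "j < dim_col (P * diagm bs)"
  then have ij: "i < ?n" "j < ?n" by (auto simp: P_def diagm_def)
  have "(diagm as * P) $$ (i,j) = (\<Sum>k<?n. if k = i then (if j = p i then as ! i else 0) else 0)"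
   unfolding mult_idx[OF bC(2) PC ij] using ij l by (intro sum.cong) (auto simp: P_def diagm_def)
  moreover have "(P * diagm bs) $$ (i,j) = (\<Sum>k<?n. if k = p i then (if j = p i then bs ! j else 0) else 0)"
   unfolding mult_idx[OF PC bC(1) ij] using ij l by (intro sum.cong) (auto simp: P_def diagm_def)
  ultimately show "(diagm as * P) $$ (i,j) = (P * diagm bs) $$ (i,j)" using ij as pn by auto
 qed (use PC bC in auto)
 have "diagm as = diagm as * (P * transpose_mat P)" using PQ bC by simp
 also have "\<dots> = P * diagm bs * transpose_mat P" unfolding c[symmetric] by (rule assoc_mult_mat[symmetric, OF bC(2) PC QC])
 finally have eq: "diagm as = P * diagm bs * transpose_mat P" .
 show ?thesis by (rule similar_matI[OF _ PQ QP eq]) (use PC QC bC in simp)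
qed

lemma same_dims_similar:
 assumes A: "A \<in> mats n" "A ^\<^sub>m m = 1\<^sub>m n" and B: "B \<in> mats n" "B ^\<^sub>m m = 1\<^sub>m n" and m: "m > 0"
  and e: "\<And>e. e ^ m = 1 ==> eigenspace_dim A e = eigenspace_dim B e"
 shows "similar_mat A B"
proof -
 obtain as where a: "\<forall>a\<in>set as. a ^ m = 1" "\<forall>e. eigenspace_dim A e = count (mset as) e" "similar_mat A (diagm as)"
  using finite_order_diagonalizable[OF A m] by blast
 obtain bs where b: "\<forall>a\<in>set bs. a ^ m = 1" "\<forall>e. eigenspace_dim B e = count (mset bs) e" "similar_mat B (diagm bs)"
  using finite_order_diagonalizable[OF B m] by blast
 have "mset as = mset bs"
 proof (rule multiset_eqI)
  fix x show "count (mset as) x = count (mset bs) x"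
  proof (cases "x ^ m = 1")
   case True
   then show ?thesis using e[OF True] a(2) b(2) by simp
  next
   case False
   then have "x \<notin># mset as" "x \<notin># mset bs" using a(1) b(1) by auto
   then show ?thesis by (metis not_in_iff)
  qed
 qed
 then have "similar_mat (diagm as) (diagm bs)" by (rule diagm_perm)
 then have "similar_mat A (diagm bs)" by (rule similar_mat_trans[OF a(3)])
 then show ?thesis by (rule similar_mat_trans[OF _ similar_mat_sym[OF b(3)]])
qed

lemma mtr_similar: "similar_mat A B ==> mtr A = mtr B"
proof -
 assume "similar_mat A B"
 then obtain P Q where w: "similar_mat_wit A B P Q" unfolding similar_mat_def by blast
 note d = similar_mat_witD[OF refl w]
 have "mtr (P * B * Q) = mtr B" by (rule mtr_conj[OF d(6,7,2,5)])
 then show ?thesis by (simp only: d(3)[symmetric])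
qed

lemma eigenspace_dim_similar:
 assumes "similar_mat A B"
 shows "eigenspace_dim A e = eigenspace_dim B e"
proof -
 obtain P Q where w: "similar_mat_wit A B P Q" using assms unfolding similar_mat_def by blast
 note AB = similar_mat_witD(4,5)[OF refl w]
 have "C ^\<^sub>m 1 = C" if "C \<in> mats k" for C :: "complex mat" and k using that by simp
 from this[OF char_matrix_closed[OF AB(1), of e]] this[OF char_matrix_closed[OF AB(2), of e]]
 show ?thesis using fun_cong[OF fun_cong[OF dim_gen_eigenspace_similar[OF assms], of e], of 1]
  unfolding eigenspace_dim_def dim_gen_eigenspace_def by (simp only:)
qed

lemma mtr_finite_order:
 assumes A: "A \<in> mats n" and p: "A ^\<^sub>m m = 1\<^sub>m n" and m: "m > 0" and fin: "finite E" "\<And>a. a ^ m = 1 ==> a \<in> E"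
 shows "(\<Sum>e\<in>E. eigenspace_dim A e) = n" "mtr A = (\<Sum>e\<in>E. of_nat (eigenspace_dim A e) * e)"
  "mtr (A * A) = (\<Sum>e\<in>E. of_nat (eigenspace_dim A e) * (e * e))"
proof -
 obtain as where a: "length as = n" "\<forall>a\<in>set as. a ^ m = 1" "\<forall>e. eigenspace_dim A e = count (mset as) e" "similar_mat A (diagm as)"
  using finite_order_diagonalizable[OF A p m] by blast
 have sub: "set as \<subseteq> E" using a(2) fin by auto
 have s: "(\<Sum>a\<leftarrow>as. f a) = (\<Sum>e\<in>E. of_nat (count (mset as) e) * f e)" for f :: "complex => 'z::comm_semiring_1"
 proof -
  have "set as' \<subseteq> E ==> (\<Sum>a\<leftarrow>as'. f a) = (\<Sum>e\<in>E. of_nat (count (mset as') e) * f e)" for as'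
  proof (induction as')
   case (Cons x xs)
   have "(\<Sum>e\<in>E. of_nat (count (mset (x # xs)) e) * f e) = (\<Sum>e\<in>E. of_nat (count (mset xs) e) * f e + (if e = x then f x else 0))"
    by (intro sum.cong) (auto simp: algebra_simps)
   then show ?case using Cons fin by (simp add: sum.distrib add.commute)
  qed simp
  then show ?thesis using sub by blast
 qed
 have l: "(\<Sum>a\<leftarrow>as. f a) = (\<Sum>i<n. f (as ! i))" for f :: "complex => complex"
  using a(1) by (simp add: sum_list_sum_nth atLeast0LessThan)
 have "(\<Sum>a\<leftarrow>as. 1::nat) = n" using a(1) by (simp add: sum_list_triv)
 then show "(\<Sum>e\<in>E. eigenspace_dim A e) = n" using s[of "\<lambda>_. 1::nat"] a(3) by simp
 have dC: "diagm as \<in> mats n" using a(1) by (simp add: diagm_def)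
 have "mtr (diagm as) = (\<Sum>a\<leftarrow>as. a)" unfolding l[of "\<lambda>a. a"] using a(1) by (simp add: mtr_def diagm_def)
 then show "mtr A = (\<Sum>e\<in>E. of_nat (eigenspace_dim A e) * e)" using s[of "\<lambda>a. a"] a(3) mtr_similar[OF a(4)] by simp
 have "mtr (diagm as * diagm as) = (\<Sum>i<n. as ! i * as ! i)"
  unfolding mtr_def
 proof (intro sum.cong)
  show "{..<dim_row (diagm as * diagm as)} = {..<n}" using dC by simp
  fix i assume "i \<in> {..<n}"
  then have i: "i < n" by simp
  have "(diagm as * diagm as) $$ (i,i) = (\<Sum>l<n. if l = i then as ! i * as ! i else 0)"
   unfolding mult_idx[OF dC dC i i] using i a(1) by (intro sum.cong) (auto simp: diagm_def)
  then show "(diagm as * diagm as) $$ (i,i) = as ! i * as ! i" using i by simp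
 qed
 also have "\<dots> = (\<Sum>a\<leftarrow>as. a * a)" by (rule l[of "\<lambda>a. a * a", symmetric])
 finally have 1: "mtr (diagm as * diagm as) = (\<Sum>a\<leftarrow>as. a * a)" .
 obtain P Q where w: "similar_mat_wit A (diagm as) P Q" using a(4) unfolding similar_mat_def by blast
 from similar_mat_wit_pow[OF w, of 2] have "similar_mat (A * A) (diagm as * diagm as)"
  unfolding similar_mat_def using A dC by (auto simp: numeral_2_eq_2)
 then show "mtr (A * A) = (\<Sum>e\<in>E. of_nat (eigenspace_dim A e) * (e * e))"
  using 1 s[of "\<lambda>a. a * a"] a(3) mtr_similar by simp
qed

section \<open>Representations of the modular group\<close>

definition gamma_pair :: "nat => complex mat => complex mat => bool" where
 "gamma_pair n S T \<longleftrightarrow> S \<in> mats n \<and> T \<in> mats n \<and> S * S = 1\<^sub>m n \<and> T * (T * T) = 1\<^sub>m n"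

text \<open>The two braid generators expressed in \<open>S\<close> and \<open>T\<close>; then \<open>repT\<close> and \<open>repS\<close> recover \<open>T\<close> and \<open>S\<close>.\<close>
definition stp :: "complex mat => complex mat => rep" where
 "stp S T = (T * (T * S), S * (T * T))"

definition repT :: "rep => complex mat" where "repT \<phi> = fst \<phi> * snd \<phi>"
definition repS :: "rep => complex mat" where "repS \<phi> = fst \<phi> * snd \<phi> * fst \<phi>"

lemma invertible_matI:
 assumes "A \<in> mats n" "B \<in> mats n" "A * B = 1\<^sub>m n" "B * A = 1\<^sub>m n"
 shows "invertible_mat A"
 using assms unfolding invertible_mat_def inverts_mat_def by auto

lemma cancel_left:
 fixes A :: "complex mat"
 assumes "A \<in> mats n" "B \<in> mats n" "A * B = 1\<^sub>m n" "X \<in> carrier_mat n m"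
 shows "A * (B * X) = X"
proof -
 have "A * (B * X) = A * B * X" by (rule assoc_mult_mat[symmetric, OF assms(1,2,4)])
 then show ?thesis unfolding assms(3) left_mult_one_mat[OF assms(4)] .
qed

lemma gamma_pairD:
 assumes "gamma_pair n S T"
 shows "S \<in> mats n" "T \<in> mats n" "S * S = 1\<^sub>m n" "T * (T * T) = 1\<^sub>m n"
  "X \<in> carrier_mat n m ==> S * (S * X) = X" "X \<in> carrier_mat n m ==> T * (T * (T * X)) = X"
proof -
 show *: "S \<in> mats n" "T \<in> mats n" "S * S = 1\<^sub>m n" "T * (T * T) = 1\<^sub>m n"
  using assms by (auto simp: gamma_pair_def)
 show "X \<in> carrier_mat n m ==> S * (S * X) = X" by (rule cancel_left[OF *(1,1,3)])
 show "T * (T * (T * X)) = X" if X: "X \<in> carrier_mat n m"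
 proof -
  have "T * (T * (T * X)) = T * ((T * T) * X)" using * X by (simp add: assoc_mult_mat[of _ n n _ n _ m])
  also have "\<dots> = X" by (rule cancel_left[OF *(2) _ *(4) X]) (use * in auto)
  finally show ?thesis .
 qed
qed

lemma stp_rep:
 assumes g: "gamma_pair n S T"
 shows "stp S T \<in> rep_B3 n" "repT (stp S T) = T" "repS (stp S T) = S" "stp S T \<in> pairs n"
  "det (fst (stp S T)) * (det S * det T) = 1" "det (snd (stp S T)) * (det S * det T) = 1"
proof -
 note G = gamma_pairD[OF g]
 note A = assoc_mult_mat[of _ n n _ n _ n]
 note sm = G(3,4) gamma_pairD(5,6)[OF g, where m = n] A stp_def repT_def repS_def
 have C: "T * T \<in> mats n" "T * S \<in> mats n" "S * T \<in> mats n" using G(1,2) by auto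
 show T: "repT (stp S T) = T" using G(1,2) by (simp add: sm)
 show S: "repS (stp S T) = S" using G(1,2) by (simp add: sm)
 have "invertible_mat (T * (T * S))" by (rule invertible_matI[of _ n "S * T"]) (use G(1,2) in \<open>simp_all add: sm\<close>)
 moreover have "invertible_mat (S * (T * T))" by (rule invertible_matI[of _ n "T * S"]) (use G(1,2) in \<open>simp_all add: sm\<close>)
 ultimately show "stp S T \<in> rep_B3 n" using G(1,2) by (simp add: rep_B3_def sm)
 then show "stp S T \<in> pairs n" by (rule rep_pairs)
 have dS: "det S * det S = 1" using det_mult[OF G(1) G(1)] G(3) by simp
 have dT: "det T * (det T * det T) = 1" using det_mult[OF G(2) C(1)] det_mult[OF G(2) G(2)] G(4) by simp
 have 1: "det T * (det T * det S) * (det S * det T) = (det T * (det T * det T)) * (det S * det S)"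
  by (simp add: mult_ac)
 have "det (T * (T * S)) = det T * (det T * det S)" using det_mult[OF G(2) C(2)] det_mult[OF G(2) G(1)] by simp
 then show "det (fst (stp S T)) * (det S * det T) = 1" using 1 dS dT by (simp add: stp_def)
 have "det (S * (T * T)) = det S * (det T * det T)" using det_mult[OF G(1) C(1)] det_mult[OF G(2) G(2)] by simp
 then show "det (snd (stp S T)) * (det S * det T) = 1" using 1 dS dT by (simp add: stp_def mult_ac)
qed

lemma gamma_of_rep:
 assumes r: "\<phi> \<in> rep_B3 n" and c: "(fst \<phi> * snd \<phi>) ^\<^sub>m 3 = 1\<^sub>m n"
 shows "gamma_pair n (repS \<phi>) (repT \<phi>)" "\<phi> = stp (repS \<phi>) (repT \<phi>)"
proof -
 obtain X Y where \<phi>: "\<phi> = (X,Y)" by (cases \<phi>)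
 have X: "X \<in> mats n" and Y: "Y \<in> mats n" and br: "X * (Y * X) = Y * (X * Y)"
  using r by (auto simp: \<phi> rep_B3_def assoc_mult_mat[of _ n n _ n _ n])
 note A = assoc_mult_mat[of _ n n _ n _ n]
 have XY: "X * Y \<in> mats n" using X Y by simp
 have pw: "X * (Y * (X * (Y * (X * Y)))) = 1\<^sub>m n"
  using c X Y XY by (simp add: \<phi> numeral_3_eq_3 A)
 have S: "repS \<phi> = X * (Y * X)" using X Y by (simp add: repS_def \<phi> A)
 have T: "repT \<phi> = X * Y" by (simp add: repT_def \<phi>)
 have "X * (Y * X) * (X * (Y * X)) = X * (Y * X) * (Y * (X * Y))" unfolding br ..
 also have "\<dots> = 1\<^sub>m n" using X Y pw by (simp add: A)
 finally have SS: "X * (Y * X) * (X * (Y * X)) = 1\<^sub>m n" .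
 show g: "gamma_pair n (repS \<phi>) (repT \<phi>)"
  unfolding gamma_pair_def S T using X Y SS pw by (simp add: A)
 note G = gamma_pairD[OF g, unfolded S T]
 have 1: "X * Y * (X * Y * (X * (Y * X))) = X"
 proof -
  have "X * Y * (X * Y * (X * (Y * X))) = (X * (Y * (X * (Y * (X * Y))))) * X" using X Y by (simp add: A)
  then show ?thesis using pw X by simp
 qed
 have 2: "X * (Y * X) * (X * Y * (X * Y)) = Y"
 proof -
  have "X * (Y * X) * (X * Y * (X * Y)) = (Y * (X * Y)) * (X * Y * (X * Y))" unfolding br ..
  also have "\<dots> = Y * (X * (Y * (X * (Y * (X * Y)))))" using X Y by (simp add: A)
  finally show ?thesis using pw Y by simp
 qed
 show "\<phi> = stp (repS \<phi>) (repT \<phi>)" unfolding stp_def S T 1 2 by (simp add: \<phi>)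
qed

lemma gamma_pow:
 assumes "gamma_pair n S T"
 shows "S ^\<^sub>m 2 = 1\<^sub>m n" "T ^\<^sub>m 3 = 1\<^sub>m n"
 using gamma_pairD[OF assms] by (simp_all add: numeral_2_eq_2 numeral_3_eq_3 assoc_mult_mat[of _ n n _ n _ n])

lemma simple_Gamma_iff:
 "simple_Gamma_rep n \<phi> \<longleftrightarrow> simple_rep n \<phi> \<and> (\<exists>S T. gamma_pair n S T \<and> \<phi> = stp S T)"
proof
 assume "simple_Gamma_rep n \<phi>"
 then show "simple_rep n \<phi> \<and> (\<exists>S T. gamma_pair n S T \<and> \<phi> = stp S T)"
  unfolding simple_Gamma_rep_def using gamma_of_rep[of \<phi> n] simple_repD(3) by blast
next
 assume a: "simple_rep n \<phi> \<and> (\<exists>S T. gamma_pair n S T \<and> \<phi> = stp S T)"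
 then obtain S T where "gamma_pair n S T" "\<phi> = stp S T" by blast
 then show "simple_Gamma_rep n \<phi>"
  using a gamma_pow(2)[of n S T] stp_rep(2)[of n S T] unfolding simple_Gamma_rep_def repT_def by simp
qed

lemma dim_vector_stp:
 assumes "gamma_pair n S T"
 shows "dim_vector \<rho> (stp S T) = (eigenspace_dim S 1, eigenspace_dim S (-1), eigenspace_dim T 1, eigenspace_dim T \<rho>, eigenspace_dim T (\<rho>\<^sup>2))"
 using stp_rep(2,3)[OF assms] unfolding dim_vector_def repT_def repS_def Let_def by simp

locale cube_root =
 fixes \<rho> :: complex
 assumes rho3: "\<rho> ^ 3 = 1" and rho1: "\<rho> \<noteq> 1"
begin

lemma rho_sum: "1 + \<rho> + \<rho>\<^sup>2 = 0"
proof -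
 have "(\<rho> - 1) * (1 + \<rho> + \<rho>\<^sup>2) = \<rho>^3 - 1" by (simp add: algebra_simps power2_eq_square power3_eq_cube)
 then show ?thesis using rho3 rho1 by simp
qed

lemma rho2: "\<rho>\<^sup>2 = - 1 - \<rho>" using rho_sum by (simp add: eq_neg_iff_add_eq_0 algebra_simps)

lemma rho_distinct: "\<rho> \<noteq> 1" "\<rho>\<^sup>2 \<noteq> 1" "\<rho>\<^sup>2 \<noteq> \<rho>" "\<rho> \<noteq> 0"
proof -
 show 0: "\<rho> \<noteq> 0" using rho3 by auto
 show "\<rho> \<noteq> 1" by (rule rho1)
 show "\<rho>\<^sup>2 \<noteq> 1"
 proof
  assume "\<rho>\<^sup>2 = 1"
  then have "\<rho>^3 = \<rho>" by (simp add: power3_eq_cube power2_eq_square)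
  then show False using rho3 rho1 by simp
 qed
 show "\<rho>\<^sup>2 \<noteq> \<rho>"
 proof
  assume "\<rho>\<^sup>2 = \<rho>"
  then have "\<rho> * (\<rho> - 1) = 0" by (simp add: algebra_simps power2_eq_square)
  then show False using 0 rho1 by simp
 qed
qed

lemma cube_roots: "e ^ 3 = 1 \<longleftrightarrow> e \<in> {1, \<rho>, \<rho>\<^sup>2}"
proof -
 have "(e - 1) * ((e - \<rho>) * (e - \<rho>\<^sup>2)) = e^3 - e^2 * (1 + \<rho> + \<rho>\<^sup>2) + e * (\<rho> * (1 + \<rho> + \<rho>\<^sup>2)) - \<rho>^3"
  by (simp add: algebra_simps power2_eq_square power3_eq_cube)
 also have "\<dots> = e^3 - 1" unfolding rho_sum rho3 by simp
 finally have "(e - 1) * ((e - \<rho>) * (e - \<rho>\<^sup>2)) = e^3 - 1" .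
 then show ?thesis by auto
qed

lemma square_roots: "e ^ 2 = (1::complex) \<longleftrightarrow> e \<in> {1, -1}"
 by (simp add: power2_eq_1_iff)

lemma gamma_traces:
 assumes g: "gamma_pair n S T" and d: "dim_vector \<rho> (stp S T) = (a,b,x,y,z)"
 shows "a + b = n" "x + y + z = n" "mtr S = of_nat a - of_nat b" "mtr T = of_nat x + of_nat y * \<rho> + of_nat z * \<rho>\<^sup>2"
  "mtr (T * T) = of_nat x + of_nat y * \<rho>\<^sup>2 + of_nat z * \<rho>"
proof -
 note G = gamma_pairD[OF g]
 have e: "eigenspace_dim S 1 = a" "eigenspace_dim S (-1) = b" "eigenspace_dim T 1 = x" "eigenspace_dim T \<rho> = y" "eigenspace_dim T (\<rho>\<^sup>2) = z"
  using d dim_vector_stp[OF g] by auto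
 note s = mtr_finite_order[OF G(1) gamma_pow(1)[OF g], of "{1,-1}"]
 note t = mtr_finite_order[OF G(2) gamma_pow(2)[OF g], of "{1,\<rho>,\<rho>\<^sup>2}"]
 have n1: "(1::complex) \<noteq> -1" by simp
 show "a + b = n" using s(1) square_roots e n1 by simp
 show "mtr S = of_nat a - of_nat b" using s(2) square_roots e n1 by simp
 note rd = rho_distinct rho_distinct[symmetric]
 have "\<rho>\<^sup>2 * \<rho>\<^sup>2 = \<rho>^3 * \<rho>" by (simp add: power2_eq_square power3_eq_cube mult.assoc)
 then have r4: "\<rho>\<^sup>2 * \<rho>\<^sup>2 = \<rho>" using rho3 by simp
 show "x + y + z = n" using t(1) cube_roots e rd by simp
 show "mtr T = of_nat x + of_nat y * \<rho> + of_nat z * \<rho>\<^sup>2" using t(2) cube_roots e rd by simp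
 show "mtr (T * T) = of_nat x + of_nat y * \<rho>\<^sup>2 + of_nat z * \<rho>" using t(3) cube_roots e rd r4 by (simp add: power2_eq_square)
qed

text \<open>The multiplicities of the cube roots of unity are recovered from the traces of \<open>1\<close>, \<open>T\<close> and
 \<open>T\<^sup>2\<close> by the inverse discrete Fourier transform of order three.\<close>
lemma dims_from_traces:
 assumes g: "gamma_pair n S T" and n: "n = a + b" "n = x + y + z"
  and t: "mtr S = of_nat a - of_nat b" "mtr T = of_nat x + of_nat y * \<rho> + of_nat z * \<rho>\<^sup>2"
  "mtr (T * T) = of_nat x + of_nat y * \<rho>\<^sup>2 + of_nat z * \<rho>"
 shows "dim_vector \<rho> (stp S T) = (a,b,x,y,z)"
proof -
 obtain a' b' x' y' z' where d: "dim_vector \<rho> (stp S T) = (a',b',x',y',z')" by (metis prod_cases5)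
 note G = gamma_traces[OF g d]
 have "of_nat a' - of_nat b' = (of_nat a - of_nat b :: complex)" using G t by simp
 then have "of_nat (a' + b) = (of_nat (a + b') :: complex)" by (simp add: algebra_simps)
 then have "a' + b = a + b'" by (metis of_nat_eq_iff)
 then have ab: "a' = a" "b' = b" using G(1) n by auto
 define X Y Z where "X = (of_nat x' - of_nat x :: complex)" "Y = (of_nat y' - of_nat y :: complex)" "Z = (of_nat z' - of_nat z :: complex)"
 have s: "X + Y + Z = 0"
 proof -
  have "(of_nat x' + of_nat y' + of_nat z' :: complex) = of_nat x + of_nat y + of_nat z"
   using G(2) n(2) by (metis of_nat_add)
  then show ?thesis by (simp add: X_Y_Z_def algebra_simps)
 qed
 have 1: "X + Y * \<rho> + Z * \<rho>\<^sup>2 = 0" "X + Y * \<rho>\<^sup>2 + Z * \<rho> = 0" using G t by (simp_all add: X_Y_Z_def algebra_simps)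
 have "3 * X = (X + Y + Z) + (X + Y * \<rho> + Z * \<rho>\<^sup>2) + (X + Y * \<rho>\<^sup>2 + Z * \<rho>)"
  unfolding rho2 by (simp add: algebra_simps)
 then have X: "X = 0" using s 1 by simp
 have "Z = - Y" using s X by (simp add: add_eq_0_iff)
 then have "Y * (\<rho> - \<rho>\<^sup>2) = 0" using 1(1) X by (simp add: algebra_simps)
 then have Y: "Y = 0" using rho_distinct(3) by auto
 have "Z = 0" using s X Y by simp
 then have "x' = x" "y' = y" "z' = z" using X Y by (auto simp: X_Y_Z_def)
 then show ?thesis using ab d by simp
qed

text \<open>All representations with the given dimension vector, simple or not. Simplicity is left out on
 purpose: the degenerations used below lie in this set, and the curves of \<open>FGM_rconn\<close> stay in it.\<close>
definition FG :: "nat => dim_vec5 => rep set" where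
 "FG n \<alpha> = {stp S T | S T. gamma_pair n S T \<and> dim_vector \<rho> (stp S T) = \<alpha>}"

definition FGM :: "nat => dim_vec5 => complex set => rep set" where
 "FGM n \<alpha> M = {scale_rep \<mu> \<phi> | \<mu> \<phi>. \<mu> \<in> M \<and> \<phi> \<in> FG n \<alpha>}"

lemma FG_simple: "simple_Gamma_rep n \<phi> \<and> dim_vector \<rho> \<phi> = \<alpha> \<longleftrightarrow> simple_rep n \<phi> \<and> \<phi> \<in> FG n \<alpha>"
 unfolding simple_Gamma_iff FG_def by auto

end

section \<open>Scaling\<close>

lemma scale_one: "scale_rep 1 \<phi> = \<phi>"
 by (auto simp: scale_rep_def intro!: prod_eqI eq_matI)

lemma scale_scale: "scale_rep \<mu> (scale_rep \<nu> \<phi>) = scale_rep (\<mu> * \<nu>) \<phi>"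
 by (auto simp: scale_rep_def intro!: eq_matI)

lemma scale_pairs: "\<phi> \<in> pairs n ==> scale_rep \<mu> \<phi> \<in> pairs n"
 by (auto simp: scale_rep_def)

lemma smult_mult_smult:
 fixes A :: "complex mat"
 assumes "A \<in> carrier_mat n m" "B \<in> carrier_mat m k"
 shows "(c \<cdot>\<^sub>m A) * (d \<cdot>\<^sub>m B) = (c * d) \<cdot>\<^sub>m (A * B)"
 by (rule eq_matI) (use assms in auto)

lemma invertible_smult:
 fixes A :: "complex mat"
 assumes "invertible_mat A" "c \<noteq> 0"
 shows "invertible_mat (c \<cdot>\<^sub>m A)"
proof -
 obtain B where sq: "square_mat A" and B: "A * B = 1\<^sub>m (dim_row A)" "B * A = 1\<^sub>m (dim_row B)"
  using assms(1) unfolding invertible_mat_def inverts_mat_def by blast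
 let ?n = "dim_row A"
 have dims: "dim_col A = ?n" "dim_col B = ?n" "dim_row B = ?n"
  using sq arg_cong[OF B(1), of dim_col] arg_cong[OF B(2), of dim_col] by simp_all
 then have C: "A \<in> carrier_mat ?n ?n" "B \<in> carrier_mat ?n ?n" by auto
 have "(c * (1/c)) \<cdot>\<^sub>m 1\<^sub>m ?n = (1\<^sub>m ?n :: complex mat)" "((1/c) * c) \<cdot>\<^sub>m 1\<^sub>m ?n = (1\<^sub>m ?n :: complex mat)"
  using assms(2) by auto
 then have "(c \<cdot>\<^sub>m A) * ((1/c) \<cdot>\<^sub>m B) = 1\<^sub>m ?n" "((1/c) \<cdot>\<^sub>m B) * (c \<cdot>\<^sub>m A) = 1\<^sub>m ?n"
  unfolding smult_mult_smult[OF C] smult_mult_smult[OF C(2,1)] B dims .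
 then show ?thesis
  by (rule invertible_matI[of _ ?n "(1/c) \<cdot>\<^sub>m B", rotated 2]) (rule smult_carrier_mat[OF C(1)], rule smult_carrier_mat[OF C(2)])
qed

lemma scale_rep_B3:
 assumes "\<phi> \<in> rep_B3 n" "\<mu> \<noteq> 0"
 shows "scale_rep \<mu> \<phi> \<in> rep_B3 n"
proof -
 obtain X Y where \<phi>: "\<phi> = (X,Y)" by (cases \<phi>)
 have X: "X \<in> mats n" and Y: "Y \<in> mats n" and br: "X * Y * X = Y * X * Y"
  and i: "invertible_mat X" "invertible_mat Y"
  using assms by (auto simp: \<phi> rep_B3_def)
 have "A \<in> mats n ==> B \<in> mats n ==> (\<mu> \<cdot>\<^sub>m A) * (\<mu> \<cdot>\<^sub>m B) * (\<mu> \<cdot>\<^sub>m A) = (\<mu>*\<mu>*\<mu>) \<cdot>\<^sub>m (A * B * A)" for A B :: "complex mat"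
 proof -
  assume A: "A \<in> mats n" and B: "B \<in> mats n"
  have AB: "A * B \<in> mats n" "A * B * A \<in> mats n" using A B by auto
  show ?thesis unfolding smult_mult_smult[OF A B] smult_mult_smult[OF AB(1) A] ..
 qed
 then show ?thesis using X Y br i assms(2) by (simp add: \<phi> rep_B3_def scale_rep_def invertible_smult)
qed

lemma scale_iso: "rep_iso \<phi> \<psi> ==> rep_iso (scale_rep \<mu> \<phi>) (scale_rep \<mu> \<psi>)"
 unfolding rep_iso_def scale_rep_def using similar_mat_wit_smult by fastforce

text \<open>Substitution of \<open>c X\<close> and \<open>c Y\<close> for the variables; see \<open>nev_scale\<close>.\<close>
primrec nscale :: "complex => ncp => ncp" where
 "nscale c (NC d) = NC d"
| "nscale c NX = NMul (NC c) NX"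
| "nscale c NY = NMul (NC c) NY"
| "nscale c (NAdd p q) = NAdd (nscale c p) (nscale c q)"
| "nscale c (NMul p q) = NMul (nscale c p) (nscale c q)"

lemma nev_scale:
 assumes "\<phi> \<in> pairs n"
 shows "nev n (scale_rep c \<phi>) p = nev n \<phi> (nscale c p)"
proof (induction p)
 case NX
 show ?case unfolding nscale.simps nev.simps(5)
  unfolding nev_gen(1)[OF assms] nev_gen(1)[OF scale_pairs[OF assms]]
  using assms by (auto simp: scale_rep_def mult_smult_assoc_mat[of _ n n _ n])
next
 case NY
 show ?case unfolding nscale.simps nev.simps(5)
  unfolding nev_gen(2)[OF assms] nev_gen(2)[OF scale_pairs[OF assms]]
  using assms by (auto simp: scale_rep_def mult_smult_assoc_mat[of _ n n _ n])
qed simp_all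

lemma scale_simple:
 assumes s: "simple_rep n \<phi>" and m: "\<mu> \<noteq> 0"
 shows "simple_rep n (scale_rep \<mu> \<phi>)"
proof (rule full_imp_simple)
 note ph = simple_repD(1)[OF s]
 show "scale_rep \<mu> \<phi> \<in> rep_B3 n" by (rule scale_rep_B3[OF simple_repD(3)[OF s] m])
 show "n > 0" by (rule simple_repD(2)[OF s])
 show "full_rep n (scale_rep \<mu> \<phi>)" unfolding full_rep_def
 proof
  fix M :: "complex mat" assume "M \<in> mats n"
  then obtain p where "nev n \<phi> p = M" using burnside[OF s] unfolding full_rep_def by blast
  moreover have "nev n (scale_rep \<mu> \<phi>) (nscale (1/\<mu>) p) = nev n (scale_rep (1/\<mu>) (scale_rep \<mu> \<phi>)) p"
   by (rule nev_scale[OF scale_pairs[OF ph], symmetric])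
  ultimately have "nev n (scale_rep \<mu> \<phi>) (nscale (1/\<mu>) p) = M" using m by (simp add: scale_scale scale_one)
  then show "\<exists>p. nev n (scale_rep \<mu> \<phi>) p = M" ..
 qed
qed

text \<open>Scaling is an automorphism of the affine variety of representations.\<close>
lemma scale_regular:
 assumes f: "f \<in> regular_fun n" and m: "\<mu> \<noteq> 0"
 shows "\<exists>g\<in>regular_fun n. \<forall>\<phi>\<in>rep_B3 n. f (scale_rep \<mu> \<phi>) = g \<phi>"
proof -
 let ?R = "{F. \<exists>g\<in>regular_fun n. \<forall>\<phi>\<in>rep_B3 n. F \<phi> = g \<phi>}"
 have R: "subalg ?R" unfolding subalg_def
 proof (intro conjI allI ballI)
  show "(\<lambda>_. c) \<in> ?R" for c by (auto intro!: bexI[of _ "\<lambda>_. c"] regular_fun.const)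
  fix f g assume "f \<in> ?R" "g \<in> ?R"
  then obtain f' g' where "f' \<in> regular_fun n" "g' \<in> regular_fun n" "\<forall>\<phi>\<in>rep_B3 n. f \<phi> = f' \<phi>" "\<forall>\<phi>\<in>rep_B3 n. g \<phi> = g' \<phi>" by blast
  then show "(\<lambda>x. f x + g x) \<in> ?R" "(\<lambda>x. f x * g x) \<in> ?R"
   using regular_fun.add[of f' n g'] regular_fun.mult[of f' n g'] by auto
 qed
 have "(\<lambda>\<phi>. f (scale_rep \<mu> \<phi>)) \<in> ?R"
 proof (rule regular_compose[OF R f])
  fix i j assume ij: "i < n" "j < n"
  have 1: "(\<lambda>\<phi>. \<mu> * fst \<phi> $$ (i,j)) \<in> regular_fun n" "(\<lambda>\<phi>. \<mu> * snd \<phi> $$ (i,j)) \<in> regular_fun n"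
   using ij by (auto intro: regular_fun.intros)
  have 2: "fst (scale_rep \<mu> \<phi>) $$ (i,j) = \<mu> * fst \<phi> $$ (i,j)" "snd (scale_rep \<mu> \<phi>) $$ (i,j) = \<mu> * snd \<phi> $$ (i,j)"
   if "\<phi> \<in> rep_B3 n" for \<phi> using ij that by (auto simp: scale_rep_def rep_B3_def)
  show "(\<lambda>x. fst (scale_rep \<mu> x) $$ (i, j)) \<in> ?R" using 2(1) by (intro CollectI bexI[OF _ 1(1)]) simp
  show "(\<lambda>x. snd (scale_rep \<mu> x) $$ (i, j)) \<in> ?R" using 2(2) by (intro CollectI bexI[OF _ 1(2)]) simp
 next
  have 1: "(\<lambda>\<phi>. inverse (\<mu>^n) * inverse (det (fst \<phi>))) \<in> regular_fun n" "(\<lambda>\<phi>. inverse (\<mu>^n) * inverse (det (snd \<phi>))) \<in> regular_fun n"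
   by (auto intro: regular_fun.intros)
  have 2: "inverse (det (fst (scale_rep \<mu> \<phi>))) = inverse (\<mu>^n) * inverse (det (fst \<phi>))"
   "inverse (det (snd (scale_rep \<mu> \<phi>))) = inverse (\<mu>^n) * inverse (det (snd \<phi>))"
   if "\<phi> \<in> rep_B3 n" for \<phi> using that by (auto simp: scale_rep_def rep_B3_def)
  show "(\<lambda>x. inverse (det (fst (scale_rep \<mu> x)))) \<in> ?R" using 2(1) by (intro CollectI bexI[OF _ 1(1)]) simp
  show "(\<lambda>x. inverse (det (snd (scale_rep \<mu> x)))) \<in> ?R" using 2(2) by (intro CollectI bexI[OF _ 1(2)]) simp
 qed
 then show ?thesis by blast
qed

section \<open>Rational connectedness of the variety of modular representations\<close>

lemma ratfun_cong: "G \<in> ratfun D ==> (\<And>\<epsilon>. poly D \<epsilon> \<noteq> 0 ==> F \<epsilon> = G \<epsilon>) ==> F \<in> ratfun D"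
 unfolding ratfun_def by force

lemma conj_adj:
 fixes P :: "complex mat"
 assumes P: "P \<in> mats n" and Q: "Q \<in> mats n" and S: "S \<in> mats n"
  and PQ: "P * Q = 1\<^sub>m n" "Q * P = 1\<^sub>m n"
 shows "inverse (det P) \<cdot>\<^sub>m (P * S * adj_mat P) = P * S * Q"
proof -
 note aC = adj_mat(1)[OF P]
 have "adj_mat P = Q * (P * adj_mat P)" using cancel_left[OF Q P PQ(2) aC] by simp
 also have "\<dots> = det P \<cdot>\<^sub>m Q" unfolding adj_mat(2)[OF P] using Q by (simp add: mult_smult_distrib[of _ n n _ n])
 finally have a: "adj_mat P = det P \<cdot>\<^sub>m Q" .
 have "P * S * adj_mat P = det P \<cdot>\<^sub>m (P * S * Q)" unfolding a using P S Q by (simp add: mult_smult_distrib[of _ n n _ n])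
 moreover have "det P \<noteq> 0" using det_mult[OF P Q] PQ by auto
 ultimately show ?thesis using P S Q by (auto intro!: eq_matI)
qed

lemma conj_mult:
 fixes P :: "complex mat"
 assumes P: "P \<in> mats n" and Q: "Q \<in> mats n" and QP: "Q * P = 1\<^sub>m n"
  and A: "A \<in> mats n" and B: "B \<in> mats n"
 shows "(P * A * Q) * (P * B * Q) = P * (A * B) * Q"
proof -
 have "(P * A * Q) * (P * B * Q) = P * (A * (Q * (P * (B * Q))))"
  using P Q A B by (simp add: assoc_mult_mat[of _ n n _ n _ n])
 also have "Q * (P * (B * Q)) = B * Q" by (rule cancel_left[OF Q P QP, where m = n]) (use B Q in simp)
 finally show ?thesis using P Q A B by (simp add: assoc_mult_mat[of _ n n _ n _ n])
qed

lemma gamma_pair_conj: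
 assumes g: "gamma_pair n S T"
  and P: "P \<in> mats n" "Q \<in> mats n" "P * Q = 1\<^sub>m n" "Q * P = 1\<^sub>m n"
  and P': "P' \<in> mats n" "Q' \<in> mats n" "P' * Q' = 1\<^sub>m n" "Q' * P' = 1\<^sub>m n"
 shows "gamma_pair n (P * S * Q) (P' * T * Q')"
proof -
 note G = gamma_pairD[OF g]
 have "T * T \<in> mats n" using G by simp
 then show ?thesis unfolding gamma_pair_def
  using conj_mult[OF P(1,2,4) G(1,1)] conj_mult[OF P'(1,2,4) G(2,2)] conj_mult[OF P'(1,2,4) G(2), of "T * T"] G P P' by auto
qed

text \<open>The straight line from the unit matrix to \<open>h\<close>. It meets the matrices of determinant zero at
 finitely many parameters only.\<close>
definition hline :: "complex mat => nat => complex => complex mat" where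
 "hline h n \<epsilon> = mat n n (\<lambda>(i,j). (if i = j then 1 else 0) + \<epsilon> * (h $$ (i,j) - (if i = j then 1 else 0)))"

lemma hline_ends: "hline h n 0 = 1\<^sub>m n" "h \<in> mats n ==> hline h n 1 = h"
 by (auto simp: hline_def intro!: eq_matI)

lemma hline_matfun:
 assumes R: "subalg R" "(\<lambda>\<epsilon>. \<epsilon>) \<in> R"
 shows "hline h n \<in> matfun R n n"
 unfolding hline_def[abs_def]
 by (rule matfun_mat) (auto intro!: subalg_add[OF R(1)] subalg_mult[OF R(1)] subalg_const[OF R(1)] R(2))

lemma hline_det: "\<exists>D. \<forall>\<epsilon>. poly D \<epsilon> = det (hline h n \<epsilon>)"
proof -
 have R: "subalg (range poly :: (complex => complex) set)" unfolding subalg_def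
 proof (intro conjI allI ballI)
  show "(\<lambda>_. c) \<in> range poly" for c :: complex by (rule range_eqI[of _ _ "[:c:]"]) auto
  fix f g :: "complex => complex" assume "f \<in> range poly" "g \<in> range poly"
  then obtain p q where "f = poly p" "g = poly q" by auto
  then have "(\<lambda>x. f x + g x) = poly (p + q)" "(\<lambda>x. f x * g x) = poly (p * q)" by auto
  then show "(\<lambda>x. f x + g x) \<in> range poly" "(\<lambda>x. f x * g x) \<in> range poly" by simp_all
 qed
 have "(\<lambda>\<epsilon>. \<epsilon>) \<in> (range poly :: (complex => complex) set)" by (rule range_eqI[of _ _ "[:0,1:]"]) auto
 from matfun_det[OF R hline_matfun[OF R this, of h n]] obtain D where "(\<lambda>\<epsilon>. det (hline h n \<epsilon>)) = poly D" by auto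
 then show ?thesis by (metis)
qed

lemma det_inverse_exists:
 assumes A: "(A :: complex mat) \<in> mats n" "det A \<noteq> 0"
 shows "\<exists>B\<in>mats n. A * B = 1\<^sub>m n \<and> B * A = 1\<^sub>m n"
 using det_non_zero_imp_unit[OF A, of "()"] unfolding Units_def ring_mat_def by auto

lemma similarE:
 assumes "similar_mat A B" "A \<in> mats n"
 obtains P Q where "P \<in> mats n" "Q \<in> mats n" "P * Q = 1\<^sub>m n" "Q * P = 1\<^sub>m n" "A = P * B * Q"
proof -
 obtain P Q where "similar_mat_wit A B P Q" using assms(1) unfolding similar_mat_def by (elim exE)
 from similar_mat_witD2[OF assms(2) this] that show thesis by metis
qed

context cube_root
begin

lemma FG_similar:
 assumes "gamma_pair n S T" "gamma_pair n S' T'" "dim_vector \<rho> (stp S T) = dim_vector \<rho> (stp S' T')"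
 shows "similar_mat S S'" "similar_mat T T'"
proof -
 note d = assms(3)[unfolded dim_vector_stp[OF assms(1)] dim_vector_stp[OF assms(2)]]
 note G = gamma_pairD[OF assms(1)] gamma_pairD[OF assms(2)]
 show "similar_mat S S'"
  by (rule same_dims_similar[OF gamma_pairD(1)[OF assms(1)] gamma_pow(1)[OF assms(1)] gamma_pairD(1)[OF assms(2)] gamma_pow(1)[OF assms(2)]])
    (use d square_roots in auto)
 show "similar_mat T T'"
  by (rule same_dims_similar[OF gamma_pairD(2)[OF assms(1)] gamma_pow(2)[OF assms(1)] gamma_pairD(2)[OF assms(2)] gamma_pow(2)[OF assms(2)]])
    (use d cube_roots in auto)
qed

text \<open>Two members have similar \<open>S\<close> and similar \<open>T\<close>, with conjugating matrices \<open>h\<close> and \<open>k\<close>. Moving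
 \<open>h\<close> and \<open>k\<close> independently along \<open>hline\<close> keeps both relations and the dimension vector. The
 inverses are rational in the parameter by the adjugate formula. The scalar moves along a line as
 well.\<close>
theorem FGM_rconn:
 assumes M: "M = {1} \<or> M = - {0}"
 shows "rconn n (FGM n \<alpha> M)"
 unfolding rconn_def
proof (intro ballI)
 fix \<phi> \<psi> assume "\<phi> \<in> FGM n \<alpha> M" "\<psi> \<in> FGM n \<alpha> M"
 then obtain \<mu>0 S0 T0 \<mu>1 S1 T1 where p0: "\<phi> = scale_rep \<mu>0 (stp S0 T0)" "\<mu>0 \<in> M" "gamma_pair n S0 T0" "dim_vector \<rho> (stp S0 T0) = \<alpha>"
  and p1: "\<psi> = scale_rep \<mu>1 (stp S1 T1)" "\<mu>1 \<in> M" "gamma_pair n S1 T1" "dim_vector \<rho> (stp S1 T1) = \<alpha>"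
  unfolding FGM_def FG_def by blast
 note G0 = gamma_pairD[OF p0(3)] note G1 = gamma_pairD[OF p1(3)]
 have sim: "similar_mat S1 S0" "similar_mat T1 T0" using FG_similar[OF p1(3) p0(3)] p0(4) p1(4) by auto
 obtain h h' where h: "h \<in> mats n" "h' \<in> mats n" "h * h' = 1\<^sub>m n" "h' * h = 1\<^sub>m n" "S1 = h * S0 * h'"
  using similarE[OF sim(1) G1(1)] .
 obtain g g' where g: "g \<in> mats n" "g' \<in> mats n" "g * g' = 1\<^sub>m n" "g' * g = 1\<^sub>m n" "T1 = g * T0 * g'"
  using similarE[OF sim(2) G1(2)] .
 obtain Dh where Dh: "\<And>\<epsilon>. poly Dh \<epsilon> = det (hline h n \<epsilon>)" using hline_det by blast
 obtain Dg where Dg: "\<And>\<epsilon>. poly Dg \<epsilon> = det (hline g n \<epsilon>)" using hline_det by blast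
 define mp where "mp = [:\<mu>0, \<mu>1 - \<mu>0:]"
 define D where "D = Dh * Dg * mp"
 define H where "H = hline h n" define G where "G = hline g n"
 define SS where "SS \<epsilon> = inverse (poly Dh \<epsilon>) \<cdot>\<^sub>m (H \<epsilon> * S0 * adj_mat (H \<epsilon>))" for \<epsilon>
 define TT where "TT \<epsilon> = inverse (poly Dg \<epsilon>) \<cdot>\<^sub>m (G \<epsilon> * T0 * adj_mat (G \<epsilon>))" for \<epsilon>
 define \<gamma> where "\<gamma> \<epsilon> = scale_rep (poly mp \<epsilon>) (stp (SS \<epsilon>) (TT \<epsilon>))" for \<epsilon>
 have HC: "H \<epsilon> \<in> mats n" "G \<epsilon> \<in> mats n" for \<epsilon> by (auto simp: H_def G_def hline_def)
 have SSe: "SS \<epsilon> = H \<epsilon> * S0 * Q" if "Q \<in> mats n" "H \<epsilon> * Q = 1\<^sub>m n" "Q * H \<epsilon> = 1\<^sub>m n" for \<epsilon> Q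
  unfolding SS_def Dh H_def[symmetric] by (rule conj_adj[OF HC(1) that(1) G0(1) that(2,3)])
 have TTe: "TT \<epsilon> = G \<epsilon> * T0 * Q" if "Q \<in> mats n" "G \<epsilon> * Q = 1\<^sub>m n" "Q * G \<epsilon> = 1\<^sub>m n" for \<epsilon> Q
  unfolding TT_def Dg G_def[symmetric] by (rule conj_adj[OF HC(2) that(1) G0(2) that(2,3)])
 have pair: "gamma_pair n (SS \<epsilon>) (TT \<epsilon>)" "dim_vector \<rho> (stp (SS \<epsilon>) (TT \<epsilon>)) = \<alpha>" if D0: "poly D \<epsilon> \<noteq> 0" for \<epsilon>
 proof -
  have "det (H \<epsilon>) \<noteq> 0" "det (G \<epsilon>) \<noteq> 0" using D0 by (auto simp: D_def Dh Dg H_def G_def)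
  then obtain Q Q' where Q: "Q \<in> mats n" "H \<epsilon> * Q = 1\<^sub>m n" "Q * H \<epsilon> = 1\<^sub>m n"
   and Q': "Q' \<in> mats n" "G \<epsilon> * Q' = 1\<^sub>m n" "Q' * G \<epsilon> = 1\<^sub>m n"
   using det_inverse_exists[OF HC(1)] det_inverse_exists[OF HC(2)] by metis
  show gp: "gamma_pair n (SS \<epsilon>) (TT \<epsilon>)" unfolding SSe[OF Q] TTe[OF Q']
   by (rule gamma_pair_conj[OF p0(3) HC(1) Q HC(2) Q'])
  have "similar_mat (SS \<epsilon>) S0" by (rule similar_matI[OF _ Q(2,3) SSe[OF Q]]) (use gamma_pairD(1)[OF gp] G0 HC Q in simp)
  moreover have "similar_mat (TT \<epsilon>) T0" by (rule similar_matI[OF _ Q'(2,3) TTe[OF Q']]) (use gamma_pairD(2)[OF gp] G0 HC Q' in simp)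
  ultimately show "dim_vector \<rho> (stp (SS \<epsilon>) (TT \<epsilon>)) = \<alpha>"
   using p0(4) unfolding dim_vector_stp[OF gp] dim_vector_stp[OF p0(3)] by (simp add: eigenspace_dim_similar)
 qed
 have mpM: "poly mp \<epsilon> \<in> M" if "poly D \<epsilon> \<noteq> 0" for \<epsilon>
 proof -
  have "poly mp \<epsilon> \<noteq> 0" using that unfolding D_def poly_mult by simp
  then show ?thesis using M p0(2) p1(2) by (auto simp: mp_def)
 qed
 have D01: "poly D 0 \<noteq> 0" "poly D 1 \<noteq> 0"
 proof -
  have "det h \<noteq> 0" "det g \<noteq> 0" using det_mult[OF h(1,2)] h(3) det_mult[OF g(1,2)] g(3) by auto
  moreover have "poly mp 0 \<noteq> 0" "poly mp 1 \<noteq> 0" using M p0(2) p1(2) by (auto simp: mp_def)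
  ultimately show "poly D 0 \<noteq> 0" "poly D 1 \<noteq> 0"
   unfolding D_def poly_mult Dh Dg by (simp_all add: hline_ends h g)
 qed
 note R = subalg_ratfun[of D]
 have id: "(\<lambda>\<epsilon>. \<epsilon>) \<in> ratfun D" by (rule ratfun_cong[OF ratfun_poly[of "[:0,1:]" D]]) simp
 have inv: "(\<lambda>\<epsilon>. inverse (poly Dh \<epsilon>)) \<in> ratfun D" "(\<lambda>\<epsilon>. inverse (poly Dg \<epsilon>)) \<in> ratfun D" "(\<lambda>\<epsilon>. inverse (poly mp \<epsilon>)) \<in> ratfun D"
  by (rule ratfunI[of _ _ "Dg * mp" 1], simp add: D_def field_simps, rule ratfunI[of _ _ "Dh * mp" 1], simp add: D_def field_simps,
    rule ratfunI[of _ _ "Dh * Dg" 1], simp add: D_def field_simps)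
 have HR: "H \<in> matfun (ratfun D) n n" "G \<in> matfun (ratfun D) n n" unfolding H_def G_def by (rule hline_matfun[OF R id])+
 have SR: "SS \<in> matfun (ratfun D) n n" unfolding SS_def[abs_def]
  by (intro matfun_smult[OF R] inv matfun_mult[OF R, of _ _ n] matfun_adj[OF R] HR matfun_const[OF R] G0)
 have TR: "TT \<in> matfun (ratfun D) n n" unfolding TT_def[abs_def]
  by (intro matfun_smult[OF R] inv matfun_mult[OF R, of _ _ n] matfun_adj[OF R] HR matfun_const[OF R] G0)
 have mR: "poly mp \<in> ratfun D" by (rule ratfun_poly)
 have f1: "(\<lambda>\<epsilon>. fst (\<gamma> \<epsilon>)) \<in> matfun (ratfun D) n n" unfolding \<gamma>_def scale_rep_def stp_def fst_conv
  by (intro matfun_smult[OF R] mR matfun_mult[OF R, of _ _ n] SR TR)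
 have f2: "(\<lambda>\<epsilon>. snd (\<gamma> \<epsilon>)) \<in> matfun (ratfun D) n n" unfolding \<gamma>_def scale_rep_def stp_def snd_conv
  by (intro matfun_smult[OF R] mR matfun_mult[OF R, of _ _ n] SR TR)
 have idet: "(\<lambda>\<epsilon>. inverse (poly mp \<epsilon>) ^ n * (det (SS \<epsilon>) * det (TT \<epsilon>))) \<in> ratfun D"
  by (intro subalg_mult[OF R] subalg_power[OF R] inv matfun_det[OF R SR] matfun_det[OF R TR])
 have id1: "inverse (det (fst (\<gamma> \<epsilon>))) = inverse (poly mp \<epsilon>) ^ n * (det (SS \<epsilon>) * det (TT \<epsilon>))"
  "inverse (det (snd (\<gamma> \<epsilon>))) = inverse (poly mp \<epsilon>) ^ n * (det (SS \<epsilon>) * det (TT \<epsilon>))" if "poly D \<epsilon> \<noteq> 0" for \<epsilon>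
 proof -
  note s = stp_rep[OF pair(1)[OF that]]
  have "dim_col (fst (stp (SS \<epsilon>) (TT \<epsilon>))) = n" "dim_col (snd (stp (SS \<epsilon>) (TT \<epsilon>))) = n" using s(4) by auto
  then show "inverse (det (fst (\<gamma> \<epsilon>))) = inverse (poly mp \<epsilon>) ^ n * (det (SS \<epsilon>) * det (TT \<epsilon>))"
   "inverse (det (snd (\<gamma> \<epsilon>))) = inverse (poly mp \<epsilon>) ^ n * (det (SS \<epsilon>) * det (TT \<epsilon>))"
   using inverse_unique[OF s(5)] inverse_unique[OF s(6)] by (simp_all add: \<gamma>_def scale_rep_def power_inverse)
 qed
 have "curve n D \<gamma> (FGM n \<alpha> M)" unfolding curve_def
 proof (intro conjI ballI allI impI D01)
  fix f assume "f \<in> regular_fun n"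
  then show "(\<lambda>\<epsilon>. f (\<gamma> \<epsilon>)) \<in> ratfun D"
  proof (rule regular_compose[OF R])
   show "(\<lambda>x. inverse (det (fst (\<gamma> x)))) \<in> ratfun D" "(\<lambda>x. inverse (det (snd (\<gamma> x)))) \<in> ratfun D"
    using ratfun_cong[OF idet id1(1)] ratfun_cong[OF idet id1(2)] by auto
  qed (use matfunD(2)[OF f1] matfunD(2)[OF f2] in auto)
 next
  fix \<epsilon> assume "poly D \<epsilon> \<noteq> 0"
  then show "\<gamma> \<epsilon> \<in> FGM n \<alpha> M" unfolding FGM_def FG_def \<gamma>_def using pair mpM by blast
 qed
 moreover have "SS 0 = S0" using SSe[of "1\<^sub>m n" 0] G0 by (simp add: H_def hline_ends)
 moreover have "TT 0 = T0" using TTe[of "1\<^sub>m n" 0] G0 by (simp add: G_def hline_ends)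
 moreover have "SS 1 = S1" using SSe[of h' 1] h by (simp add: H_def hline_ends)
 moreover have "TT 1 = T1" using TTe[of g' 1] g by (simp add: G_def hline_ends)
 ultimately show "\<exists>D \<gamma>. curve n D \<gamma> (FGM n \<alpha> M) \<and> \<gamma> 0 = \<phi> \<and> \<gamma> 1 = \<psi>"
  using p0(1) p1(1) by (intro exI[of _ D] exI[of _ \<gamma>]) (simp add: \<gamma>_def mp_def)
qed

lemma FGM_one: "FGM n \<alpha> {1} = FG n \<alpha>"
 by (auto simp: FGM_def scale_one)

lemma FG_rep: "\<phi> \<in> FG n \<alpha> ==> \<phi> \<in> rep_B3 n"
 unfolding FG_def using stp_rep(1) by blast

lemma FGM_rep: "\<phi> \<in> FGM n \<alpha> (-{0}) ==> \<phi> \<in> rep_B3 n"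
 unfolding FGM_def using scale_rep_B3[OF FG_rep] by blast

lemma FG_rconn: "rconn n (FG n \<alpha>)"
 using FGM_rconn[of "{1}" n \<alpha>] by (simp add: FGM_one)

lemma FG_density:
 assumes "\<psi> \<in> FG n \<alpha>" "g \<in> regular_fun n" "g \<psi> \<noteq> 0" "f \<in> regular_fun n"
  "\<And>\<phi>. \<phi> \<in> FG n \<alpha> ==> g \<phi> \<noteq> 0 ==> f \<phi> = 0" "\<phi> \<in> FG n \<alpha>"
 shows "f \<phi> = 0"
 using rconn_vanish[OF FG_rconn assms(4,2,1,3,5,6)] .

lemma FG_generic_simple:
 assumes s: "simple_rep n \<psi>" "\<psi> \<in> FG n \<alpha>" and f: "f \<in> regular_fun n" "\<phi> \<in> FG n \<alpha>" "f \<phi> \<noteq> 0"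
 shows "\<exists>\<chi>\<in>FG n \<alpha>. simple_rep n \<chi> \<and> f \<chi> \<noteq> 0"
proof -
 obtain g where g: "g\<in>regular_fun n" "g \<psi> \<noteq> 0" "\<forall>\<chi>\<in>rep_B3 n. g \<chi> \<noteq> 0 --> simple_rep n \<chi>" using simple_open[OF s(1)] by blast
 show ?thesis using rconn_generic[OF FG_rconn f(1,2,3) g(1) s(2) g(2)] g(3) FG_rep by blast
qed

definition FS :: "nat => dim_vec5 => rep set" where
 "FS n \<alpha> = {scale_rep \<mu> \<phi> | \<mu> \<phi>. \<mu> \<noteq> 0 \<and> \<phi> \<in> FG n \<alpha> \<and> simple_rep n \<phi>}"

lemma iss_comp_FS: "iss_comp \<rho> n \<alpha> = zariski_iss n closure_of (iso_class n ` FS n \<alpha>)"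
proof -
 have "{iso_class n (scale_rep \<mu> \<phi>) | \<mu> \<phi>. \<mu> \<noteq> 0 \<and> simple_Gamma_rep n \<phi> \<and> dim_vector \<rho> \<phi> = \<alpha>} = iso_class n ` FS n \<alpha>"
  unfolding FS_def using FG_simple[of n _ \<alpha>] by blast
 then show ?thesis unfolding iss_comp_def by simp
qed

lemma FS_simple: "\<phi> \<in> FS n \<alpha> ==> simple_rep n \<phi>"
 unfolding FS_def using scale_simple by blast

lemma FS_FGM: "\<phi> \<in> FS n \<alpha> \<longleftrightarrow> \<phi> \<in> FGM n \<alpha> (-{0}) \<and> simple_rep n \<phi>"
proof
 show "\<phi> \<in> FS n \<alpha> ==> \<phi> \<in> FGM n \<alpha> (-{0}) \<and> simple_rep n \<phi>"
  using FS_simple unfolding FS_def FGM_def by blast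
next
 assume a: "\<phi> \<in> FGM n \<alpha> (-{0}) \<and> simple_rep n \<phi>"
 then obtain \<mu> \<psi> where m: "\<mu> \<noteq> 0" "\<psi> \<in> FG n \<alpha>" "\<phi> = scale_rep \<mu> \<psi>" unfolding FGM_def by blast
 have "simple_rep n (scale_rep (1/\<mu>) \<phi>)" using a m by (intro scale_simple) auto
 then have "simple_rep n \<psi>" using m by (simp add: scale_scale scale_one)
 then show "\<phi> \<in> FS n \<alpha>" unfolding FS_def using m by blast
qed

lemma FS_iss: "iso_class n ` FS n \<alpha> \<subseteq> iss_B3 n"
 using FS_simple simple_semisimple unfolding iss_B3_def by blast

lemma FS_comp: "\<phi> \<in> FS n \<alpha> ==> iso_class n \<phi> \<in> iss_comp \<rho> n \<alpha>"
 unfolding iss_comp_FS using closure_of_subset[of "iso_class n ` FS n \<alpha>" "zariski_iss n"] FS_iss by auto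

lemma FG_FS: "\<phi> \<in> FG n \<alpha> ==> simple_rep n \<phi> ==> \<phi> \<in> FS n \<alpha>"
 unfolding FS_def using scale_one[of \<phi>] by (metis (mono_tags, lifting) mem_Collect_eq zero_neq_one)

lemma iss_comp_vanish:
 assumes f: "f \<in> invariant_fun n" "\<And>\<phi>. \<phi> \<in> FS n \<alpha> ==> f \<phi> = 0" and C: "C \<in> iss_comp \<rho> n \<alpha>"
 shows "vanishes f C"
proof -
 have "\<forall>D\<in>iso_class n ` FS n \<alpha>. vanishes f D"
  using vanishes_class(1)[OF f(1)] f(2) simple_repD(3)[OF FS_simple] by blast
 then show ?thesis using C f(1) unfolding iss_comp_FS closure_iff[OF FS_iss] by blast
qed

lemma iss_comp_irreducible:
 assumes "FS n \<alpha> \<noteq> {}"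
 shows "irreducible_in (zariski_iss n) (iss_comp \<rho> n \<alpha>)"
 unfolding iss_comp_FS
proof (rule irreducible_family[OF assms FS_simple])
 fix f g \<phi> \<psi> assume f: "f \<in> invariant_fun n" and g: "g \<in> invariant_fun n" and p: "\<phi> \<in> FS n \<alpha>" "\<psi> \<in> FS n \<alpha>" "f \<phi> \<noteq> 0" "g \<psi> \<noteq> 0"
 let ?F = "FGM n \<alpha> (-{0})"
 have rc: "rconn n ?F" by (rule FGM_rconn) simp
 have pF: "\<phi> \<in> ?F" "\<psi> \<in> ?F" using p FS_FGM by auto
 have fr: "f \<in> regular_fun n" "g \<in> regular_fun n" using f g by (auto simp: invariant_fun_def)
 obtain h where h: "h\<in>regular_fun n" "h \<psi> \<noteq> 0" "\<forall>\<chi>\<in>rep_B3 n. h \<chi> \<noteq> 0 --> simple_rep n \<chi>"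
  using simple_open[OF FS_simple[OF p(2)]] by blast
 have "(\<lambda>x. g x * h x) \<in> regular_fun n" using fr(2) h(1) by (rule regular_fun.mult)
 from rconn_generic[OF rc fr(1) pF(1) p(3) this pF(2)] obtain \<chi> where "\<chi>\<in>?F" "f \<chi> \<noteq> 0" "g \<chi> \<noteq> 0" "h \<chi> \<noteq> 0"
  using p(4) h(2) by auto
 then show "\<exists>\<chi>\<in>FS n \<alpha>. f \<chi> \<noteq> 0 \<and> g \<chi> \<noteq> 0" using FS_FGM h(3) FGM_rep by blast
qed

end

section \<open>The involution on classes\<close>

lemma invertible_matE:
 fixes A :: "complex mat"
 assumes "invertible_mat A" "A \<in> mats n"
 obtains B where "B \<in> mats n" "A * B = 1\<^sub>m n" "B * A = 1\<^sub>m n"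
proof -
 obtain B where B: "A * B = 1\<^sub>m (dim_row A)" "B * A = 1\<^sub>m (dim_row B)"
  using assms(1) unfolding invertible_mat_def inverts_mat_def by blast
 have d: "dim_row A = n" "dim_col A = n" using assms(2) by auto
 have "dim_col B = n" "dim_row B = n"
  using arg_cong[OF B(1), of dim_col] arg_cong[OF B(2), of dim_col] d by simp_all
 then show ?thesis using that[of B] B d by auto
qed

lemma transpose_rep_B3: "\<phi> \<in> rep_B3 n ==> transpose_rep \<phi> \<in> rep_B3 n"
proof -
 assume a: "\<phi> \<in> rep_B3 n"
 obtain X Y where \<phi>: "\<phi> = (X,Y)" by (cases \<phi>)
 have X: "X \<in> mats n" and Y: "Y \<in> mats n" and br: "X * Y * X = Y * X * Y"
  and i: "invertible_mat X" "invertible_mat Y"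
  using a by (auto simp: \<phi> rep_B3_def)
 have it: "invertible_mat (transpose_mat A)" if Ai: "invertible_mat A" "A \<in> mats n" for A :: "complex mat"
 proof -
  obtain B where B: "B \<in> mats n" "A * B = 1\<^sub>m n" "B * A = 1\<^sub>m n" by (rule invertible_matE[OF Ai])
  have "transpose_mat A * transpose_mat B = 1\<^sub>m n" "transpose_mat B * transpose_mat A = 1\<^sub>m n"
   unfolding transpose_mult[OF B(1) Ai(2), symmetric] transpose_mult[OF Ai(2) B(1), symmetric] B by simp_all
  then show ?thesis by (rule invertible_matI[of _ n "transpose_mat B", rotated 2]) (use Ai(2) B(1) in simp_all)
 qed
 have "transpose_mat (A * B * A) = transpose_mat A * transpose_mat B * transpose_mat A" if "A \<in> mats n" "B \<in> mats n" for A B :: "complex mat"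
  using that by (simp add: transpose_mult[of _ n n _ n] assoc_mult_mat[of _ n n _ n _ n])
 from this[OF X Y] this[OF Y X] br show ?thesis using it[OF i(1) X] it[OF i(2) Y] X Y
  by (simp add: \<phi> transpose_rep_def rep_B3_def)
qed

lemma transpose_rep_invol [simp]: "transpose_rep (transpose_rep \<phi>) = \<phi>"
 by (simp add: transpose_rep_def)

lemma transpose_iso:
 assumes "rep_iso \<phi> \<psi>" "\<phi> \<in> pairs n"
 shows "rep_iso (transpose_rep \<phi>) (transpose_rep \<psi>)"
proof -
 obtain P Q where P: "P \<in> mats n" "Q \<in> mats n" "P * Q = 1\<^sub>m n" "Q * P = 1\<^sub>m n"
  "\<psi> \<in> pairs n" "fst \<phi> = P * fst \<psi> * Q" "snd \<phi> = P * snd \<psi> * Q" using rep_isoE[OF assms] .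
 have PT: "transpose_mat Q * transpose_mat P = 1\<^sub>m n" "transpose_mat P * transpose_mat Q = 1\<^sub>m n"
  unfolding transpose_mult[OF P(1,2), symmetric] transpose_mult[OF P(2,1), symmetric] P(3,4) by simp_all
 have c: "transpose_mat (P * Y * Q) * transpose_mat Q = transpose_mat Q * transpose_mat Y" if "Y \<in> mats n" for Y
 proof -
  have "transpose_mat (P * Y * Q) = transpose_mat Q * (transpose_mat Y * transpose_mat P)"
   using that P by (simp add: transpose_mult[of _ n n _ n])
  then show ?thesis using that P PT by (simp add: assoc_mult_mat[of _ n n _ n _ n])
 qed
 have e: "fst (transpose_rep \<phi>) * transpose_mat Q = transpose_mat Q * fst (transpose_rep \<psi>)"
  "snd (transpose_rep \<phi>) * transpose_mat Q = transpose_mat Q * snd (transpose_rep \<psi>)"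
  unfolding transpose_rep_def fst_conv snd_conv P(6,7) by (rule c; use P(5) in auto)+
 have pr: "transpose_rep \<phi> \<in> pairs n" "transpose_rep \<psi> \<in> pairs n" using assms(2) P(5) by (auto simp: transpose_rep_def)
 show ?thesis
  by (rule rep_isoI[OF _ _ PT pr e]) (use P(1,2) in simp_all)
qed

lemma tau_iso_class:
 assumes "\<phi> \<in> rep_B3 n"
 shows "tau (iso_class n \<phi>) = iso_class n (transpose_rep \<phi>)"
proof
 show "tau (iso_class n \<phi>) \<subseteq> iso_class n (transpose_rep \<phi>)"
  using transpose_iso[OF _ rep_pairs[OF assms]] transpose_rep_B3 unfolding tau_def iso_class_def by blast
 show "iso_class n (transpose_rep \<phi>) \<subseteq> tau (iso_class n \<phi>)"
 proof
  fix \<psi> assume "\<psi> \<in> iso_class n (transpose_rep \<phi>)"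
  then have p: "\<psi> \<in> rep_B3 n" "rep_iso (transpose_rep \<phi>) \<psi>" by (auto simp: iso_class_def)
  then have "rep_iso \<phi> (transpose_rep \<psi>)"
   using transpose_iso[OF p(2) rep_pairs[OF transpose_rep_B3[OF assms]]] by simp
  then have "transpose_rep \<psi> \<in> iso_class n \<phi>" using transpose_rep_B3[OF p(1)] by (simp add: iso_class_def)
  then show "\<psi> \<in> tau (iso_class n \<phi>)" unfolding tau_def by (intro image_eqI[of _ _ "transpose_rep \<psi>"]) auto
 qed
qed

lemma transpose_simple:
 assumes s: "simple_rep n \<phi>"
 shows "simple_rep n (transpose_rep \<phi>)"
proof (rule full_imp_simple)
 show "transpose_rep \<phi> \<in> rep_B3 n" by (rule transpose_rep_B3[OF simple_repD(3)[OF s]])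
 show "n > 0" by (rule simple_repD(2)[OF s])
 have nn: "nrev (nrev p) = p" for p by (induction p) auto
 show "full_rep n (transpose_rep \<phi>)" unfolding full_rep_def
 proof
  fix M :: "complex mat" assume "M \<in> mats n"
  then have "transpose_mat M \<in> mats n" by simp
  then obtain p where "nev n \<phi> p = transpose_mat M" using burnside[OF s] unfolding full_rep_def by blast
  then have "nev n (transpose_rep \<phi>) (nrev p) = M" using nev_transpose[OF simple_repD(1)[OF s], of "nrev p"] nn by simp
  then show "\<exists>p. nev n (transpose_rep \<phi>) p = M" ..
 qed
qed

lemma transpose_direct_sum:
 assumes "\<forall>\<phi>\<in>set \<phi>s. \<exists>n. simple_rep n \<phi>"
 shows "transpose_rep (direct_sum_rep \<phi>s) = direct_sum_rep (map transpose_rep \<phi>s)"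
 using assms
proof (induction \<phi>s)
 case Nil
 then show ?case by (auto simp: direct_sum_rep_def transpose_rep_def)
next
 case (Cons \<phi> \<phi>s)
 obtain k where k: "simple_rep k \<phi>" using Cons.prems by auto
 have P: "\<forall>\<psi>\<in>set \<phi>s. \<exists>n. \<psi> \<in> pairs n"
 proof
  fix \<psi> assume "\<psi> \<in> set \<phi>s"
  then obtain m where "simple_rep m \<psi>" using Cons.prems by auto
  from simple_repD(1)[OF this] show "\<exists>n. \<psi> \<in> pairs n" ..
 qed
 have P': "\<forall>\<psi>\<in>set (map transpose_rep \<phi>s). \<exists>n. \<psi> \<in> pairs n"
 proof
  fix \<psi> assume "\<psi> \<in> set (map transpose_rep \<phi>s)"
  then obtain m \<psi>' where "simple_rep m \<psi>'" "\<psi> = transpose_rep \<psi>'" using Cons.prems by auto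
  from simple_repD(1)[OF transpose_simple[OF this(1)]] this(2) show "\<exists>n. \<psi> \<in> pairs n" by metis
 qed
 from direct_sum_pairs(1)[OF P] obtain m where m: "direct_sum_rep \<phi>s \<in> pairs m" ..
 note kp = simple_repD(1)[OF k] note kt = simple_repD(1)[OF transpose_simple[OF k]]
 have IH: "transpose_rep (direct_sum_rep \<phi>s) = direct_sum_rep (map transpose_rep \<phi>s)" using Cons by simp
 have d: "dim_row (fst \<phi>) = k" "dim_row (fst (direct_sum_rep \<phi>s)) = m" "dim_row (fst (transpose_rep \<phi>)) = k"
  "dim_row (fst (transpose_rep (direct_sum_rep \<phi>s))) = m" using kp m by (auto simp: transpose_rep_def)
 have "transpose_rep (dsum \<phi> (direct_sum_rep \<phi>s)) = dsum (transpose_rep \<phi>) (transpose_rep (direct_sum_rep \<phi>s))"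
  unfolding dsum_def Let_def d using kp m
  by (auto simp: transpose_rep_def transpose_four_block_mat[of _ k k _ m _ m] mem_Times_iff)
 then show ?case using direct_sum_pairs(2)[OF P kp] direct_sum_pairs(2)[OF P' kt] IH by simp
qed

lemma transpose_semisimple:
 assumes "semisimple_rep n \<phi>"
 shows "semisimple_rep n (transpose_rep \<phi>)"
proof -
 obtain \<phi>s where p: "\<phi> \<in> rep_B3 n" "\<forall>\<psi>\<in>set \<phi>s. \<exists>m. simple_rep m \<psi>" "rep_iso \<phi> (direct_sum_rep \<phi>s)"
  using assms unfolding semisimple_rep_def by blast
 have "rep_iso (transpose_rep \<phi>) (direct_sum_rep (map transpose_rep \<phi>s))"
  using transpose_iso[OF p(3) rep_pairs[OF p(1)]] transpose_direct_sum[OF p(2)] by simp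
 moreover have "\<forall>\<psi>\<in>set (map transpose_rep \<phi>s). \<exists>m. simple_rep m \<psi>" using p(2) transpose_simple by fastforce
 ultimately show ?thesis unfolding semisimple_rep_def using transpose_rep_B3[OF p(1)] by blast
qed

lemma semisimple_traces_iso:
 assumes s: "semisimple_rep n \<phi>" "semisimple_rep n \<psi>" and t: "\<And>p. ntrn n p \<phi> = ntrn n p \<psi>"
 shows "rep_iso \<phi> \<psi>"
proof -
 obtain \<phi>s where p: "\<phi> \<in> rep_B3 n" "\<forall>\<psi>\<in>set \<phi>s. \<exists>m. simple_rep m \<psi>" "rep_iso \<phi> (direct_sum_rep \<phi>s)"
  using s(1) unfolding semisimple_rep_def by blast
 obtain \<psi>s where q: "\<psi> \<in> rep_B3 n" "\<forall>\<psi>\<in>set \<psi>s. \<exists>m. simple_rep m \<psi>" "rep_iso \<psi> (direct_sum_rep \<psi>s)"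
  using s(2) unfolding semisimple_rep_def by blast
 have pp: "\<forall>\<psi>\<in>set \<phi>s. \<exists>n. \<psi> \<in> pairs n" "\<forall>\<psi>\<in>set \<psi>s. \<exists>n. \<psi> \<in> pairs n" using p(2) q(2) simple_repD(1) by blast+
 have "(\<Sum>\<phi>\<leftarrow>\<phi>s. ntr \<phi> r) = (\<Sum>\<phi>\<leftarrow>\<psi>s. ntr \<phi> r)" for r
  using ntr_direct_sum[OF pp(1), of r] ntr_direct_sum[OF pp(2), of r] ntr_iso[OF p(3) rep_pairs[OF p(1)], of r]
   ntr_iso[OF q(3) rep_pairs[OF q(1)], of r] t[of r] ntr_pairs[OF rep_pairs[OF p(1)], of r] ntr_pairs[OF rep_pairs[OF q(1)], of r]
  by (simp add: ntrn_def)
 then have "rep_iso (direct_sum_rep \<phi>s) (direct_sum_rep \<psi>s)" by (rule characters_determine[OF p(2) q(2)])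
 then show ?thesis using p(3) q(3) rep_iso_sym rep_iso_trans by blast
qed

lemma ntrn_transpose: "\<phi> \<in> pairs n ==> ntrn n p (transpose_rep \<phi>) = ntrn n (nrev p) \<phi>"
 unfolding ntrn_def by (simp add: nev_transpose mtr_transpose[of _ n])

text \<open>The hypothesis extends to the closure because traces are invariants; at a semisimple
 representation it says that the transpose has the same traces.\<close>
lemma (in cube_root) tau_trivial_if_traces:
 assumes t: "\<And>\<phi> p. \<phi> \<in> FS n \<alpha> ==> ntrn n (nrev p) \<phi> = ntrn n p \<phi>" and C: "C \<in> iss_comp \<rho> n \<alpha>"
 shows "tau C = C"
proof -
 have "C \<in> iss_B3 n" using C unfolding iss_comp_FS closure_iff[OF FS_iss] by blast
 then obtain \<phi> where p: "semisimple_rep n \<phi>" "C = iso_class n \<phi>" "\<phi> \<in> C" "\<phi> \<in> rep_B3 n" using issE by blast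
 have "ntrn n (nrev r) \<phi> = ntrn n r \<phi>" for r
 proof -
  have inv: "(\<lambda>x. ntrn n (nrev r) x - ntrn n r x) \<in> invariant_fun n"
   by (rule subalg_diff[OF subalg_invariant ntrn_invariant ntrn_invariant])
  have "vanishes (\<lambda>x. ntrn n (nrev r) x - ntrn n r x) C"
   by (rule iss_comp_vanish[OF inv _ C]) (use t in simp)
  then show ?thesis unfolding p(2) vanishes_class(1)[OF inv p(4)] by simp
 qed
 then have "ntrn n r (transpose_rep \<phi>) = ntrn n r \<phi>" for r using ntrn_transpose[OF rep_pairs[OF p(4)]] by simp
 then have "rep_iso (transpose_rep \<phi>) \<phi>" by (rule semisimple_traces_iso[OF transpose_semisimple[OF p(1)] p(1)])
 then have "iso_class n (transpose_rep \<phi>) = iso_class n \<phi>" by (rule iso_class_eq)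
 then show ?thesis using tau_iso_class[OF p(4)] p(2) by simp
qed

section \<open>Idempotents\<close>

text \<open>An idempotent of trace \<open>r\<close> factors through dimension \<open>r\<close>. The factorisation replaces the
 choice of a basis of an eigenspace.\<close>
lemma idempotent_factor:
 assumes E: "E \<in> mats n" "E * E = E"
 shows "\<exists>r U V. U \<in> carrier_mat n r \<and> V \<in> carrier_mat r n \<and> E = U * V \<and> V * U = 1\<^sub>m r \<and> mtr E = of_nat r"
proof -
 define A where "A = 1\<^sub>m n + (-2) \<cdot>\<^sub>m E"
 have AC: "A \<in> mats n" using E by (simp add: A_def)
 have e2C: "(-2) \<cdot>\<^sub>m E \<in> mats n" using E by simp
 have "A * A = A + (-2) \<cdot>\<^sub>m E * A"
  unfolding A_def using E by (subst add_mult_distrib_mat[of _ n n _ _ n]) auto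
 also have "(-2) \<cdot>\<^sub>m E * A = (-2) \<cdot>\<^sub>m E + (4::complex) \<cdot>\<^sub>m E"
  unfolding A_def using E smult_mult_smult[OF E(1) E(1), of "-2" "-2"] by (subst mult_add_distrib_mat[of _ n n _ n]) auto
 also have "A + ((-2) \<cdot>\<^sub>m E + 4 \<cdot>\<^sub>m E) = 1\<^sub>m n" unfolding A_def using E by (auto intro!: eq_matI)
 finally have "A ^\<^sub>m 2 = 1\<^sub>m n" using AC by (simp add: numeral_2_eq_2)
 from finite_order_diagonalizable[OF AC this] obtain as where as: "length as = n" "\<forall>a\<in>set as. a ^ 2 = 1" "similar_mat A (diagm as)" by auto
 obtain P Q where P: "P \<in> mats n" "Q \<in> mats n" "P * Q = 1\<^sub>m n" "Q * P = 1\<^sub>m n" "A = P * diagm as * Q"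
  using similarE[OF as(3) AC] .
 define K where "K = {k. k < n \<and> as ! k = -1}"
 define r where "r = card K"
 have finK: "finite K" by (simp add: K_def)
 obtain f where f: "bij_betw f {0..<r} K" using ex_bij_betw_nat_finite[OF finK] unfolding r_def by blast
 then have f': "bij_betw f {..<r} K" by (simp add: lessThan_atLeast0)
 have fK: "f l < n" if "l < r" for l using bij_betwE[OF f'] that by (auto simp: K_def)
 define U where "U = mat n r (\<lambda>(i,l). P $$ (i, f l))"
 define V where "V = mat r n (\<lambda>(l,j). Q $$ (f l, j))"
 have C: "U \<in> carrier_mat n r" "V \<in> carrier_mat r n" by (auto simp: U_def V_def)
 have asv: "as ! k = (if k \<in> K then -1 else 1)" if "k < n" for k
 proof -
  have "(as ! k)^2 = 1" using as(1,2) that nth_mem[of k as] by simp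
  then show ?thesis using that by (auto simp: K_def power2_eq_1_iff)
 qed
 have dC: "diagm as \<in> mats n" using as(1) by (simp add: diagm_def)
 have EUV: "E = U * V"
 proof (rule eq_matI)
  fix i j assume "i < dim_row (U * V)" "j < dim_col (U * V)"
  then have ij: "i < n" "j < n" using C by auto
  have PD: "(P * diagm as) $$ (i,k) = P $$ (i,k) * as ! k" if "k < n" for k
  proof -
   have "(P * diagm as) $$ (i,k) = (\<Sum>l<n. if l = k then P $$ (i,k) * as ! k else 0)"
    unfolding mult_idx[OF P(1) dC ij(1) that] using that as(1) by (intro sum.cong) (auto simp: diagm_def)
   then show ?thesis using that by simp
  qed
  have "A $$ (i,j) = (\<Sum>k<n. P $$ (i,k) * as ! k * Q $$ (k,j))"
   unfolding P(5) mult_idx[OF mult_carrier_mat[OF P(1) dC] P(2) ij] using PD by simp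
  moreover have "(1\<^sub>m n :: complex mat) $$ (i,j) = (\<Sum>k<n. P $$ (i,k) * Q $$ (k,j))"
   unfolding P(3)[symmetric] mult_idx[OF P(1,2) ij] ..
  moreover have "A $$ (i,j) = 1\<^sub>m n $$ (i,j) - 2 * E $$ (i,j)" using ij E by (simp add: A_def)
  ultimately have "2 * E $$ (i,j) = (\<Sum>k<n. P $$ (i,k) * Q $$ (k,j) - P $$ (i,k) * as ! k * Q $$ (k,j))"
   by (simp add: sum_subtractf algebra_simps)
  also have "\<dots> = (\<Sum>k<n. if k \<in> K then 2 * (P $$ (i,k) * Q $$ (k,j)) else 0)"
   by (intro sum.cong) (auto simp: asv)
  also have "\<dots> = (\<Sum>k\<in>{..<n} \<inter> K. 2 * (P $$ (i,k) * Q $$ (k,j)))" by (subst sum.inter_restrict) auto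
  also have "{..<n} \<inter> K = K" by (auto simp: K_def)
  also have "(\<Sum>k\<in>K. 2 * (P $$ (i,k) * Q $$ (k,j))) = (\<Sum>l<r. 2 * (P $$ (i,f l) * Q $$ (f l,j)))"
   by (rule sum.reindex_bij_betw[OF f', symmetric])
  also have "\<dots> = 2 * (U * V) $$ (i,j)" unfolding mult_idx[OF C ij] sum_distrib_left using ij by (simp add: U_def V_def)
  finally show "E $$ (i,j) = (U * V) $$ (i,j)" by simp
 qed (use C E in auto)
 have VU: "V * U = 1\<^sub>m r"
 proof (rule eq_matI)
  fix l m assume "l < dim_row (1\<^sub>m r)" "m < dim_col (1\<^sub>m r)"
  then have lm: "l < r" "m < r" by auto
  have "(V * U) $$ (l,m) = (\<Sum>i<n. Q $$ (f l,i) * P $$ (i, f m))"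
   unfolding mult_idx[OF C(2,1) lm] using lm by (simp add: U_def V_def)
  also have "\<dots> = (Q * P) $$ (f l, f m)" using mult_idx[OF P(2,1) fK[OF lm(1)] fK[OF lm(2)]] by simp
  also have "\<dots> = 1\<^sub>m r $$ (l,m)" using lm fK bij_betw_imp_inj_on[OF f'] unfolding P(4)
   by (auto dest: inj_onD)
  finally show "(V * U) $$ (l,m) = 1\<^sub>m r $$ (l,m)" .
 qed (use C in auto)
 have "mtr E = of_nat r" unfolding EUV using mtr_comm[OF C] VU by simp
 then show ?thesis using C EUV VU by blast
qed

text \<open>For \<open>T\<^sup>3 = 1\<close> and a cube root of unity \<open>e\<close> this is the projector onto the \<open>e\<close>-eigenspace of
 \<open>T\<close>: the factors \<open>e\<^sup>2\<close> and \<open>e\<close> are the inverses of \<open>e\<close> and \<open>e\<^sup>2\<close>.\<close>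
definition proj :: "nat => complex mat => complex => complex mat" where
 "proj n T e = (1/3) \<cdot>\<^sub>m (1\<^sub>m n + (e^2 \<cdot>\<^sub>m T + e \<cdot>\<^sub>m (T * T)))"

lemma proj_carrier: "T \<in> mats n ==> proj n T e \<in> mats n"
 by (simp add: proj_def)

lemma proj_idx: "T \<in> mats n ==> i < n ==> j < n ==>
  proj n T e $$ (i,j) = 1/3 * ((if i = j then 1 else 0) + (e^2 * T $$ (i,j) + e * (T * T) $$ (i,j)))"
 by (simp add: proj_def del: index_mult_mat(1))

lemma T_proj:
 assumes T: "T \<in> mats n" "T * (T * T) = 1\<^sub>m n" and e: "e^3 = 1"
 shows "T * proj n T e = e \<cdot>\<^sub>m proj n T e" "proj n T e * T = e \<cdot>\<^sub>m proj n T e"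
proof -
 have TT: "T * T \<in> mats n" "e^2 \<cdot>\<^sub>m T \<in> mats n" "e \<cdot>\<^sub>m (T * T) \<in> mats n"
  "e^2 \<cdot>\<^sub>m T + e \<cdot>\<^sub>m (T * T) \<in> mats n" "1\<^sub>m n + (e^2 \<cdot>\<^sub>m T + e \<cdot>\<^sub>m (T * T)) \<in> mats n" using T by auto
 have T3: "T * T * T = 1\<^sub>m n" using T by (simp add: assoc_mult_mat[of _ n n _ n _ n])
 have 1: "T * proj n T e = (1/3) \<cdot>\<^sub>m (T + (e^2 \<cdot>\<^sub>m (T * T) + e \<cdot>\<^sub>m 1\<^sub>m n))"
  unfolding proj_def using T TT
  by (simp only: mult_smult_distrib[OF T(1) TT(5)] mult_add_distrib_mat[OF T(1) one_carrier_mat TT(4)]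
   mult_add_distrib_mat[OF T(1) TT(2,3)] mult_smult_distrib[OF T(1) T(1)] mult_smult_distrib[OF T(1) TT(1)] T(2) right_mult_one_mat[OF T(1)])
 have 2: "proj n T e * T = (1/3) \<cdot>\<^sub>m (T + (e^2 \<cdot>\<^sub>m (T * T) + e \<cdot>\<^sub>m 1\<^sub>m n))"
  unfolding proj_def using T TT
  by (simp only: mult_smult_assoc_mat[OF TT(5) T(1)] add_mult_distrib_mat[OF one_carrier_mat TT(4) T(1)]
   add_mult_distrib_mat[OF TT(2,3) T(1)] mult_smult_assoc_mat[OF T(1) T(1)] mult_smult_assoc_mat[OF TT(1) T(1)] T3 left_mult_one_mat[OF T(1)])
 have ee: "e * e^2 = 1" "e * e = e^2" using e by (simp_all add: power2_eq_square power3_eq_cube mult.assoc)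
 have 3: "(1/3) \<cdot>\<^sub>m (T + (e^2 \<cdot>\<^sub>m (T * T) + e \<cdot>\<^sub>m 1\<^sub>m n)) = e \<cdot>\<^sub>m proj n T e"
 proof (rule eq_matI)
  fix i j assume "i < dim_row (e \<cdot>\<^sub>m proj n T e)" "j < dim_col (e \<cdot>\<^sub>m proj n T e)"
  then have ij: "i < n" "j < n" using proj_carrier[OF T(1), of e] by auto
  have "(e \<cdot>\<^sub>m proj n T e) $$ (i,j) = 1/3 * (e * (if i = j then 1 else 0) + ((e * e^2) * T $$ (i,j) + (e * e) * (T * T) $$ (i,j)))"
   using ij T proj_carrier[OF T(1), of e] by (simp add: proj_idx algebra_simps del: index_mult_mat(1))
  then show "((1/3) \<cdot>\<^sub>m (T + (e^2 \<cdot>\<^sub>m (T * T) + e \<cdot>\<^sub>m 1\<^sub>m n))) $$ (i,j) = (e \<cdot>\<^sub>m proj n T e) $$ (i,j)"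
   unfolding ee using ij T TT by (simp add: algebra_simps del: index_mult_mat(1))
 qed (use T TT proj_carrier[OF T(1), of e] in auto)
 show "T * proj n T e = e \<cdot>\<^sub>m proj n T e" "proj n T e * T = e \<cdot>\<^sub>m proj n T e" using 1 2 3 by auto
qed

lemma proj_mult:
 assumes T: "T \<in> mats n" "T * (T * T) = 1\<^sub>m n" and e: "e^3 = 1" "f^3 = 1"
 shows "proj n T e * proj n T f = (if e = f then proj n T f else 0\<^sub>m n n)"
proof -
 let ?F = "proj n T f"
 have FC: "?F \<in> mats n" by (rule proj_carrier[OF T(1)])
 have TT: "T * T \<in> mats n" "e^2 \<cdot>\<^sub>m T \<in> mats n" "e \<cdot>\<^sub>m (T * T) \<in> mats n"
  "e^2 \<cdot>\<^sub>m T + e \<cdot>\<^sub>m (T * T) \<in> mats n" "1\<^sub>m n + (e^2 \<cdot>\<^sub>m T + e \<cdot>\<^sub>m (T * T)) \<in> mats n" using T by auto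
 have TF: "T * ?F = f \<cdot>\<^sub>m ?F" by (rule T_proj(1)[OF T e(2)])
 have TTF: "T * T * ?F = f \<cdot>\<^sub>m (f \<cdot>\<^sub>m ?F)"
  unfolding assoc_mult_mat[OF T(1) T(1) FC] TF mult_smult_distrib[OF T(1) FC] ..
 have "proj n T e * ?F = (1/3) \<cdot>\<^sub>m (?F + (e^2 \<cdot>\<^sub>m (f \<cdot>\<^sub>m ?F) + e \<cdot>\<^sub>m (f \<cdot>\<^sub>m (f \<cdot>\<^sub>m ?F))))"
  unfolding proj_def[of n T e]
  by (simp only: mult_smult_assoc_mat[OF TT(5) FC] add_mult_distrib_mat[OF one_carrier_mat TT(4) FC]
   add_mult_distrib_mat[OF TT(2,3) FC] mult_smult_assoc_mat[OF T(1) FC] mult_smult_assoc_mat[OF TT(1) FC] TF TTF left_mult_one_mat[OF FC])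
 also have "\<dots> = (1/3 * (1 + e^2 * f + e * f^2)) \<cdot>\<^sub>m ?F"
  using FC by (auto intro!: eq_matI simp: algebra_simps power2_eq_square)
 finally have 1: "proj n T e * ?F = (1/3 * (1 + e^2 * f + e * f^2)) \<cdot>\<^sub>m ?F" .
 show ?thesis
 proof (cases "e = f")
  case True
  have a: "f^2 * f = f^3" "f * f^2 = f^3" by (simp_all add: power2_eq_square power3_eq_cube mult.assoc)
  have c: "1/3 * (1 + f^2 * f + f * f^2) = 1" unfolding a e(2) by simp
  have "proj n T f * ?F = 1 \<cdot>\<^sub>m ?F" using 1 unfolding True c .
  also have "1 \<cdot>\<^sub>m ?F = ?F" using FC by (auto intro!: eq_matI)
  finally show ?thesis using True by simp
 next
  case False
  have "(e - f) * (1 + e^2 * f + e * f^2) = (e - f) + (e^3 * f - f^3 * e)"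
   by (simp add: algebra_simps power2_eq_square power3_eq_cube)
  also have "\<dots> = 0" using e by simp
  finally have "1 + e^2 * f + e * f^2 = 0" using False by simp
  then have c: "1/3 * (1 + e^2 * f + e * f^2) = 0" by simp
  have "proj n T e * ?F = 0 \<cdot>\<^sub>m ?F" using 1 unfolding c .
  also have "0 \<cdot>\<^sub>m ?F = 0\<^sub>m n n" using FC by (auto intro!: eq_matI)
  finally show ?thesis using False by simp
 qed
qed

context cube_root
begin

text \<open>The three cube roots of unity in an arbitrary order, so that the cases that differ by a
 permutation of the eigenspaces of \<open>T\<close> are treated together.\<close>
definition tri :: "complex => complex => complex => bool" where
 "tri e1 e2 e3 \<longleftrightarrow> e1^3 = 1 \<and> e2^3 = 1 \<and> e3^3 = 1 \<and> e1 \<noteq> e2 \<and> e1 \<noteq> e3 \<and> e2 \<noteq> e3"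

lemma triD:
 assumes "tri e1 e2 e3"
 shows "e1^3 = 1" "e2^3 = 1" "e3^3 = 1" "e1 + e2 + e3 = 0" "e1^2 + e2^2 + e3^2 = 0" "e1 \<noteq> e2" "e1 \<noteq> e3" "e2 \<noteq> e3"
proof -
 show *: "e1^3 = 1" "e2^3 = 1" "e3^3 = 1" "e1 \<noteq> e2" "e1 \<noteq> e3" "e2 \<noteq> e3" using assms by (auto simp: tri_def)
 have "(e1 - e2) * (e1^2 + e1 * e2 + e2^2) = e1^3 - e2^3" "(e1 - e3) * (e1^2 + e1 * e3 + e3^2) = e1^3 - e3^3"
  by (simp_all add: algebra_simps power2_eq_square power3_eq_cube)
 then have 1: "e1^2 + e1 * e2 + e2^2 = 0" "e1^2 + e1 * e3 + e3^2 = 0" using * by auto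
 have "(e2 - e3) * (e1 + e2 + e3) = (e1^2 + e1 * e2 + e2^2) - (e1^2 + e1 * e3 + e3^2)"
  by (simp add: algebra_simps power2_eq_square)
 then have s: "(e2 - e3) * (e1 + e2 + e3) = 0" unfolding 1 by simp
 then show s: "e1 + e2 + e3 = 0" using *(6) by simp
 then have e3: "e3 = - e1 - e2" by (simp add: eq_neg_iff_add_eq_0 algebra_simps)
 have "e1^2 + e2^2 + e3^2 = 2 * (e1^2 + e1 * e2 + e2^2)" unfolding e3 by (simp add: algebra_simps power2_eq_square)
 then show "e1^2 + e2^2 + e3^2 = 0" using 1 by simp
qed

lemma proj_sum:
 assumes t: "tri e1 e2 e3" and T: "T \<in> mats n"
 shows "proj n T e1 + (proj n T e2 + proj n T e3) = 1\<^sub>m n"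
  "T = e2 \<cdot>\<^sub>m 1\<^sub>m n + ((e1 - e2) \<cdot>\<^sub>m proj n T e1 + (e3 - e2) \<cdot>\<^sub>m proj n T e3)"
proof -
 note d = triD[OF t] note pc = proj_carrier[OF T]
 show "proj n T e1 + (proj n T e2 + proj n T e3) = 1\<^sub>m n"
 proof (rule eq_matI)
  fix i j assume "i < dim_row (1\<^sub>m n)" "j < dim_col (1\<^sub>m n)"
  then have ij: "i < n" "j < n" by auto
  have "(proj n T e1 + (proj n T e2 + proj n T e3)) $$ (i,j) = proj n T e1 $$ (i,j) + (proj n T e2 $$ (i,j) + proj n T e3 $$ (i,j))"
   using ij pc[of e1] pc[of e2] pc[of e3] by auto
  also have "\<dots> = (if i = j then 1 else 0) + 1/3 * ((e1^2 + e2^2 + e3^2) * T $$ (i,j) + (e1 + e2 + e3) * (T * T) $$ (i,j))"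
   using ij T by (simp add: proj_idx algebra_simps del: index_mult_mat(1))
  finally show "(proj n T e1 + (proj n T e2 + proj n T e3)) $$ (i,j) = 1\<^sub>m n $$ (i,j)"
   unfolding d using ij by simp
 qed (use pc[of e3] in auto)
 show "T = e2 \<cdot>\<^sub>m 1\<^sub>m n + ((e1 - e2) \<cdot>\<^sub>m proj n T e1 + (e3 - e2) \<cdot>\<^sub>m proj n T e3)"
 proof (rule eq_matI)
  fix i j assume "i < dim_row (e2 \<cdot>\<^sub>m 1\<^sub>m n + ((e1 - e2) \<cdot>\<^sub>m proj n T e1 + (e3 - e2) \<cdot>\<^sub>m proj n T e3))"
   "j < dim_col (e2 \<cdot>\<^sub>m 1\<^sub>m n + ((e1 - e2) \<cdot>\<^sub>m proj n T e1 + (e3 - e2) \<cdot>\<^sub>m proj n T e3))"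
  then have ij: "i < n" "j < n" using pc[of e3] by auto
  have e3: "e3 = - e1 - e2" using d(4) by (simp add: eq_neg_iff_add_eq_0 algebra_simps)
  have q: "(e1 - e2) * e1^2 + (e3 - e2) * e3^2 = 3"
  proof -
   have "(e1 - e2) * e1^2 + (e3 - e2) * e3^2 = e1^3 + e2^3 + e3^3 - e2 * (e1^2 + e2^2 + e3^2)"
    by (simp add: algebra_simps power2_eq_square power3_eq_cube)
   then show ?thesis unfolding d by simp
  qed
  have q2: "(e1 - e2) * e1 + (e3 - e2) * e3 = 0"
  proof -
   have "(e1 - e2) * e1 + (e3 - e2) * e3 = (e1^2 + e2^2 + e3^2) - e2 * (e1 + e2 + e3)"
    by (simp add: algebra_simps power2_eq_square)
   then show ?thesis unfolding d by simp
  qed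
  have q3: "e2 + 1/3 * ((e1 - e2) + (e3 - e2)) = 0" unfolding e3 by (simp add: algebra_simps)
  have "(e2 \<cdot>\<^sub>m 1\<^sub>m n + ((e1 - e2) \<cdot>\<^sub>m proj n T e1 + (e3 - e2) \<cdot>\<^sub>m proj n T e3)) $$ (i,j)
   = e2 * (if i = j then 1 else 0) + ((e1 - e2) * proj n T e1 $$ (i,j) + (e3 - e2) * proj n T e3 $$ (i,j))"
   using ij pc[of e1] pc[of e3] by auto
  also have "\<dots> = (e2 + 1/3 * ((e1 - e2) + (e3 - e2))) * (if i = j then 1 else 0)
    + 1/3 * (((e1 - e2) * e1^2 + (e3 - e2) * e3^2) * T $$ (i,j) + ((e1 - e2) * e1 + (e3 - e2) * e3) * (T * T) $$ (i,j))"
  proof -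
   have gen: "e2 * u + ((e1 - e2) * (1/3 * (u + (a * s + e1 * t))) + (e3 - e2) * (1/3 * (u + (b * s + e3 * t))))
    = (e2 + 1/3 * ((e1 - e2) + (e3 - e2))) * u + 1/3 * (((e1 - e2) * a + (e3 - e2) * b) * s + ((e1 - e2) * e1 + (e3 - e2) * e3) * t)"
    for u a b s t :: complex by (simp add: field_simps)
   show ?thesis unfolding proj_idx[OF T ij] by (rule gen)
  qed
  finally show "T $$ (i,j) = (e2 \<cdot>\<^sub>m 1\<^sub>m n + ((e1 - e2) \<cdot>\<^sub>m proj n T e1 + (e3 - e2) \<cdot>\<^sub>m proj n T e3)) $$ (i,j)"
   unfolding q q2 q3 by simp
 qed (use T pc[of e3] in auto)
qed

lemma mtr_proj:
 assumes T: "T \<in> mats n" "T * (T * T) = 1\<^sub>m n" and e: "e^3 = 1"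
 shows "mtr (proj n T e) = of_nat (eigenspace_dim T e)"
proof -
 have p: "T ^\<^sub>m 3 = 1\<^sub>m n" using T by (simp add: numeral_3_eq_3 assoc_mult_mat[of _ n n _ n _ n])
 note t = mtr_finite_order[OF T(1) p, of "{1,\<rho>,\<rho>\<^sup>2}"]
 let ?d = "\<lambda>e. of_nat (eigenspace_dim T e) :: complex"
 note rd = rho_distinct rho_distinct[symmetric]
 have r: "\<rho>\<^sup>2 * \<rho>\<^sup>2 = \<rho>" "\<rho> * \<rho>\<^sup>2 = 1" "\<rho>\<^sup>2 * \<rho> = 1" "\<rho> * \<rho> = \<rho>\<^sup>2"
 proof -
  have "\<rho>\<^sup>2 * \<rho>\<^sup>2 = \<rho>^3 * \<rho>" by (simp add: power2_eq_square power3_eq_cube mult.assoc)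
  then show "\<rho>\<^sup>2 * \<rho>\<^sup>2 = \<rho>" using rho3 by simp
  show "\<rho> * \<rho>\<^sup>2 = 1" "\<rho>\<^sup>2 * \<rho> = 1" "\<rho> * \<rho> = \<rho>\<^sup>2" using rho3 by (simp_all add: power2_eq_square power3_eq_cube mult.assoc)
 qed
 have n: "of_nat n = ?d 1 + ?d \<rho> + ?d (\<rho>\<^sup>2)"
 proof -
  have "n = eigenspace_dim T 1 + eigenspace_dim T \<rho> + eigenspace_dim T (\<rho>\<^sup>2)" using t(1) cube_roots rd by simp
  then show ?thesis by (metis of_nat_add)
 qed
 have t1: "mtr T = ?d 1 + ?d \<rho> * \<rho> + ?d (\<rho>\<^sup>2) * \<rho>\<^sup>2" using t(2) cube_roots rd by simp
 have t2: "mtr (T * T) = ?d 1 + ?d \<rho> * \<rho>\<^sup>2 + ?d (\<rho>\<^sup>2) * \<rho>" using t(3) cube_roots rd r by simp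
 have m: "mtr (proj n T e) = 1/3 * (of_nat n + (e^2 * mtr T + e * mtr (T * T)))"
  unfolding proj_def using T by (simp add: mtr_smult[of _ n] mtr_add[of _ n])
 have "e \<in> {1,\<rho>,\<rho>\<^sup>2}" using e cube_roots by simp
 have z: "\<rho> + \<rho>\<^sup>2 = -1" using rho_sum by (simp add: eq_neg_iff_add_eq_0 algebra_simps)
 have k: "1/3 * (x + y + w + (c * (x + y * \<rho> + w * \<rho>\<^sup>2) + d * (x + y * \<rho>\<^sup>2 + w * \<rho>)))
   = 1/3 * ((1 + c + d) * x + (1 + c * \<rho> + d * \<rho>\<^sup>2) * y + (1 + c * \<rho>\<^sup>2 + d * \<rho>) * w)" for x y w c d :: complex
  by (simp add: algebra_simps)
 have s3: "1 + (\<rho> + \<rho>\<^sup>2) = 0" "1 + \<rho> + \<rho>\<^sup>2 = 0" "1 + \<rho>\<^sup>2 + \<rho> = 0" using rho_sum by (simp_all add: algebra_simps)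
 consider "e = 1" | "e = \<rho>" | "e = \<rho>\<^sup>2" using e cube_roots by blast
 then show ?thesis
 proof cases
  case 1
  then show ?thesis unfolding m n t1 t2 k using s3 by simp
 next
  case 2
  have c: "1 + \<rho>\<^sup>2 * \<rho> + \<rho> * \<rho>\<^sup>2 = 3" "1 + \<rho>\<^sup>2 * \<rho>\<^sup>2 + \<rho> * \<rho> = 0" unfolding r using s3 by simp_all
  show ?thesis unfolding m n t1 t2 unfolding 2 k c s3 by simp
 next
  case 3
  have e2: "(\<rho>\<^sup>2)\<^sup>2 = \<rho>" using r(1) by (simp add: power2_eq_square[of "\<rho>\<^sup>2"])
  have c: "1 + \<rho> * \<rho>\<^sup>2 + \<rho>\<^sup>2 * \<rho> = 3" "1 + \<rho> * \<rho> + \<rho>\<^sup>2 * \<rho>\<^sup>2 = 0" unfolding r using s3 by simp_all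
  show ?thesis unfolding m n t1 t2 unfolding 3 e2 k c s3 by simp
 qed
qed

end

lemma mult22:
 assumes "A \<in> mats 2" "B \<in> mats 2" "i < 2" "j < 2"
 shows "(A * B) $$ (i,j) = A $$ (i,0) * B $$ (0,j) + A $$ (i,1) * B $$ (1,j)"
 unfolding mult_idx[OF assms] by (simp add: numeral_2_eq_2)

section \<open>Small invariant subspaces\<close>

text \<open>The span of the \<open>f l\<close> is invariant and non-zero.\<close>
lemma simple_dim_le:
 assumes g: "gamma_pair n S T" and s: "simple_rep n (stp S T)"
  and f: "\<And>l. l < k ==> f l \<in> carrier_vec n" "l0 < k" "f l0 \<noteq> 0\<^sub>v n"
  and cl: "\<And>l. l < k ==> \<exists>c. \<forall>i<n. (S *\<^sub>v f l) $ i = (\<Sum>m<k. c m * f m $ i)"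
   "\<And>l. l < k ==> \<exists>c. \<forall>i<n. (T *\<^sub>v f l) $ i = (\<Sum>m<k. c m * f m $ i)"
 shows "n \<le> k"
proof -
 note G = gamma_pairD[OF g]
 define W where "W = {v \<in> carrier_vec n. \<exists>c. \<forall>i<n. v $ i = (\<Sum>m<k. c m * f m $ i)}"
 have X: "X *\<^sub>v v \<in> W" if X: "X \<in> mats n" "\<And>l. l < k ==> \<exists>c. \<forall>i<n. (X *\<^sub>v f l) $ i = (\<Sum>m<k. c m * f m $ i)"
  and v: "v \<in> W" for X v
 proof -
  obtain c where c: "\<And>i. i < n ==> v $ i = (\<Sum>m<k. c m * f m $ i)" and vC: "v \<in> carrier_vec n" using v unfolding W_def by blast
  obtain d where d: "\<And>l i. l < k ==> i < n ==> (X *\<^sub>v f l) $ i = (\<Sum>m<k. d l m * f m $ i)" using X(2) by metis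
  have "(X *\<^sub>v v) $ i = (\<Sum>m<k. (\<Sum>l<k. c l * d l m) * f m $ i)" if i: "i < n" for i
  proof -
   have "(X *\<^sub>v v) $ i = (\<Sum>j<n. X $$ (i,j) * (\<Sum>l<k. c l * f l $ j))"
    unfolding mult_vec_idx[OF X(1) vC i] using c by simp
   also have "\<dots> = (\<Sum>l<k. c l * (\<Sum>j<n. X $$ (i,j) * f l $ j))"
    unfolding sum_distrib_left by (subst sum.swap) (simp add: algebra_simps)
   also have "\<dots> = (\<Sum>l<k. c l * (\<Sum>m<k. d l m * f m $ i))"
    using mult_vec_idx[OF X(1) f(1) i] d[OF _ i] by simp
   also have "\<dots> = (\<Sum>m<k. (\<Sum>l<k. c l * d l m) * f m $ i)"
    unfolding sum_distrib_left sum_distrib_right by (subst sum.swap) (simp add: algebra_simps)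
   finally show ?thesis .
  qed
  then show ?thesis unfolding W_def using X(1) vC by (auto intro!: exI[of _ "\<lambda>m. \<Sum>l<k. c l * d l m"])
 qed
 have SW: "v \<in> W ==> S *\<^sub>v v \<in> W" and TW: "v \<in> W ==> T *\<^sub>v v \<in> W" for v using X[OF G(1) cl(1)] X[OF G(2) cl(2)] by auto
 have WC: "v \<in> W ==> v \<in> carrier_vec n" for v by (simp add: W_def)
 have C: "T * T \<in> mats n" "T * S \<in> mats n" using G by auto
 have "W = {0\<^sub>v n} \<or> W = carrier_vec n"
 proof (rule simple_invariant[OF s])
  show "W \<subseteq> carrier_vec n" using WC by blast
  show "0\<^sub>v n \<in> W" unfolding W_def by (auto intro!: exI[of _ "\<lambda>_. 0"])
  show "v + u \<in> W" if vu: "v \<in> W" "u \<in> W" for v u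
  proof -
   obtain c d where "v \<in> carrier_vec n" "u \<in> carrier_vec n" "\<forall>i<n. v $ i = (\<Sum>m<k. c m * f m $ i)" "\<forall>i<n. u $ i = (\<Sum>m<k. d m * f m $ i)"
    using vu unfolding W_def by blast
   then show ?thesis unfolding W_def by (auto intro!: exI[of _ "\<lambda>m. c m + d m"] simp: sum.distrib algebra_simps)
  qed
  show "a \<cdot>\<^sub>v v \<in> W" if vW: "v \<in> W" for a v
  proof -
   obtain c where "v \<in> carrier_vec n" "\<forall>i<n. v $ i = (\<Sum>m<k. c m * f m $ i)" using vW unfolding W_def by blast
   then show ?thesis unfolding W_def by (auto intro!: exI[of _ "\<lambda>m. a * c m"] simp: sum_distrib_left algebra_simps)
  qed
  show "fst (stp S T) *\<^sub>v v \<in> W" if "v \<in> W" for v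
  proof -
   have "fst (stp S T) *\<^sub>v v = T *\<^sub>v (T *\<^sub>v (S *\<^sub>v v))"
    unfolding stp_def fst_conv assoc_mult_mat_vec[OF G(2) C(2) WC[OF that]] assoc_mult_mat_vec[OF G(2,1) WC[OF that]] ..
   then show ?thesis using SW TW that by simp
  qed
  show "snd (stp S T) *\<^sub>v v \<in> W" if "v \<in> W" for v
  proof -
   have "snd (stp S T) *\<^sub>v v = S *\<^sub>v (T *\<^sub>v (T *\<^sub>v v))"
    unfolding stp_def snd_conv assoc_mult_mat_vec[OF G(1) C(1) WC[OF that]] assoc_mult_mat_vec[OF G(2,2) WC[OF that]] ..
   then show ?thesis using SW TW that by simp
  qed
 qed
 moreover have "f l0 \<in> W" unfolding W_def using f
  by (auto intro!: exI[of _ "\<lambda>m. if m = l0 then 1 else 0"] simp: if_distrib[of "\<lambda>x. x * _"] cong: if_cong)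
 ultimately have W: "W = carrier_vec n" using f(3) by blast
 show ?thesis
 proof (rule ccontr)
  assume "\<not> n \<le> k"
  then obtain c where c: "\<exists>e\<in>{..<n}. c e \<noteq> 0" "\<forall>r\<in>{..<k}. (\<Sum>e\<in>{..<n}. c e * f r $ e) = 0"
   using homogeneous_system[of "{..<k}" "{..<n}" "\<lambda>e r. f r $ e"] by auto
  then obtain e where e: "e < n" "c e \<noteq> 0" by auto
  have "unit_vec n e \<in> W" unfolding W by simp
  then obtain d where d: "\<forall>i<n. unit_vec n e $ i = (\<Sum>m<k. d m * f m $ i)" unfolding W_def by blast
  have "c e = (\<Sum>i<n. c i * unit_vec n e $ i)" using e by (simp add: if_distrib[of "\<lambda>x. _ * x"] cong: if_cong)
  also have "\<dots> = (\<Sum>i<n. c i * (\<Sum>m<k. d m * f m $ i))" using d by simp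
  also have "\<dots> = (\<Sum>m<k. d m * (\<Sum>i<n. c i * f m $ i))"
   unfolding sum_distrib_left by (subst sum.swap) (simp add: algebra_simps)
  also have "\<dots> = 0" using c(2) by simp
  finally show False using e by simp
 qed
qed

lemma involution_projector:
 assumes S: "S \<in> mats n" "S * S = 1\<^sub>m n" and Q: "Q = (1/2) \<cdot>\<^sub>m (1\<^sub>m n + c \<cdot>\<^sub>m S)" and c: "c * c = 1"
 shows "Q \<in> mats n" "Q * Q = Q" "S * Q = c \<cdot>\<^sub>m Q" "Q * S = c \<cdot>\<^sub>m Q" "mtr Q = 1/2 * (of_nat n + c * mtr S)"
proof -
 have SC: "c \<cdot>\<^sub>m S \<in> mats n" "1\<^sub>m n + c \<cdot>\<^sub>m S \<in> mats n" using S by auto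
 show QC: "Q \<in> mats n" unfolding Q using SC by simp
 have h: "(1/2) \<cdot>\<^sub>m (S + c \<cdot>\<^sub>m 1\<^sub>m n) = c \<cdot>\<^sub>m Q" unfolding Q
  by (rule eq_matI) (use S c in \<open>auto simp: field_simps simp flip: mult.assoc\<close>)
 show SQ: "S * Q = c \<cdot>\<^sub>m Q" unfolding h[symmetric] unfolding Q
  by (simp only: mult_smult_distrib[OF S(1) SC(2)] mult_add_distrib_mat[OF S(1) one_carrier_mat SC(1)]
   mult_smult_distrib[OF S(1) S(1)] S(2) right_mult_one_mat[OF S(1)])
 show "Q * S = c \<cdot>\<^sub>m Q" unfolding h[symmetric] unfolding Q
  by (simp only: mult_smult_assoc_mat[OF SC(2) S(1)] add_mult_distrib_mat[OF one_carrier_mat SC(1) S(1)]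
   mult_smult_assoc_mat[OF S(1) S(1)] S(2) left_mult_one_mat[OF S(1)])
 have "Q * Q = (1/2) \<cdot>\<^sub>m (Q + c \<cdot>\<^sub>m (c \<cdot>\<^sub>m Q))"
  unfolding Q[THEN arg_cong[of _ _ "\<lambda>X. X * Q"]]
  by (simp only: mult_smult_assoc_mat[OF SC(2) QC] add_mult_distrib_mat[OF one_carrier_mat SC(1) QC]
   mult_smult_assoc_mat[OF S(1) QC] SQ left_mult_one_mat[OF QC])
 also have "\<dots> = Q" by (rule eq_matI) (use QC c in \<open>auto simp: field_simps simp flip: mult.assoc\<close>)
 finally show "Q * Q = Q" .
 show "mtr Q = 1/2 * (of_nat n + c * mtr S)" unfolding Q using SC S by (simp add: mtr_smult[of _ n] mtr_add[of _ n])
qed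

section \<open>Which dimension vectors admit simple representations\<close>

context cube_root
begin

text \<open>If \<open>a + x > n\<close>, then the \<open>1\<close>-eigenspaces of \<open>S\<close> and \<open>T\<close> have a common vector, which spans an
 invariant line.\<close>
lemma simple_bound:
 assumes g: "gamma_pair n S T" and s: "simple_rep n (stp S T)" and d: "dim_vector \<rho> (stp S T) = (a,b,x,y,z)" and n: "n \<ge> 2"
 shows "a + x \<le> n"
proof (rule ccontr)
 assume "\<not> a + x \<le> n"
 then have ax: "n < a + x" by simp
 note G = gamma_pairD[OF g]
 note t = gamma_traces[OF g d]
 define Q where "Q = (1/2) \<cdot>\<^sub>m (1\<^sub>m n + 1 \<cdot>\<^sub>m S)"
 note Q = involution_projector[OF G(1,3) Q_def, simplified]
 have "mtr Q = of_nat a" using Q(5) t(1,3) by (auto simp: field_simps)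
 then obtain U V where U: "U \<in> carrier_mat n a" "V \<in> carrier_mat a n" "Q = U * V" "V * U = 1\<^sub>m a"
  using idempotent_factor[OF Q(1,2)] by (metis of_nat_eq_iff)
 define P where "P = proj n T 1"
 have P: "P \<in> mats n" "P * P = P" unfolding P_def using proj_carrier[OF G(2)] proj_mult[OF G(2,4)] by auto
 have TP: "T * P = P" using T_proj(1)[OF G(2,4), of 1] P(1) unfolding P_def by (auto intro!: eq_matI)
 have ed: "eigenspace_dim T 1 = x" using d dim_vector_stp[OF g] by simp
 have "mtr P = of_nat x" unfolding P_def using mtr_proj[OF G(2,4), of 1] ed by simp
 then obtain U' V' where U': "U' \<in> carrier_mat n x" "V' \<in> carrier_mat x n" "P = U' * V'" "V' * U' = 1\<^sub>m x"
  using idempotent_factor[OF P(1,2)] by (metis of_nat_eq_iff)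
 have SU: "S * U = U"
 proof -
  have "U = U * (V * U)" using U by (simp add: right_mult_one_mat[OF U(1)])
  also have "\<dots> = Q * U" unfolding U(3) by (rule assoc_mult_mat[symmetric, OF U(1,2,1)])
  finally have QU: "U = Q * U" .
  have "S * (Q * U) = S * Q * U" by (rule assoc_mult_mat[symmetric, OF G(1) Q(1) U(1)])
  moreover have "S * Q = Q" using Q(1,3) by (auto intro!: eq_matI)
  ultimately show ?thesis using QU by simp
 qed
 have TU: "T * U' = U'"
 proof -
  have "U' = U' * (V' * U')" using U' by (simp add: right_mult_one_mat[OF U'(1)])
  also have "\<dots> = P * U'" unfolding U'(3) by (rule assoc_mult_mat[symmetric, OF U'(1,2,1)])
  finally have QU: "U' = P * U'" .
  have "T * (P * U') = T * P * U'" by (rule assoc_mult_mat[symmetric, OF G(2) P(1) U'(1)])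
  then show ?thesis using QU TP by simp
 qed
 obtain c where c: "\<exists>e\<in>{..<a+x}. c e \<noteq> 0" "\<forall>r\<in>{..<n}. (\<Sum>e\<in>{..<a+x}. c e * (if e < a then U $$ (r,e) else U' $$ (r, e - a))) = 0"
  using homogeneous_system[of "{..<n}" "{..<a+x}" "\<lambda>e r. if e < a then U $$ (r,e) else U' $$ (r, e - a)"] ax by auto
 define u u' where "u = vec a c" and "u' = vec x (\<lambda>i. c (a + i))"
 have uC: "u \<in> carrier_vec a" "u' \<in> carrier_vec x" by (auto simp: u_def u'_def)
 define v where "v = U *\<^sub>v u"
 have vC: "v \<in> carrier_vec n" unfolding v_def using U uC by simp
 have split: "(\<Sum>e<a+x. F e) = (\<Sum>e<a. F e) + (\<Sum>e<x. F (a + e))" for F :: "nat => complex"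
  by (induction x) (auto simp: add.assoc)
 have vv: "v = - (U' *\<^sub>v u')"
 proof (rule eq_vecI)
  fix i assume "i < dim_vec (- (U' *\<^sub>v u'))"
  then have i: "i < n" using U' by simp
  have "v $ i + (U' *\<^sub>v u') $ i = 0"
   using c(2) i unfolding v_def mult_vec_idx[OF U(1) uC(1) i] mult_vec_idx[OF U'(1) uC(2) i] split
   by (simp add: u_def u'_def mult.commute)
  then show "v $ i = (- (U' *\<^sub>v u')) $ i" using i U' by (simp add: eq_neg_iff_add_eq_0 del: index_mult_mat_vec)
 qed (use U' vC in simp)
 have v0: "v \<noteq> 0\<^sub>v n"
 proof
  assume z: "v = 0\<^sub>v n"
  have "u = (V * U) *\<^sub>v u" using uC U by simp
  also have "\<dots> = V *\<^sub>v v" unfolding v_def by (rule assoc_mult_mat_vec[OF U(2,1) uC(1)])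
  finally have u0: "u = 0\<^sub>v a" using z U by auto
  have "u' = (V' * U') *\<^sub>v u'" using uC U' by simp
  also have "\<dots> = V' *\<^sub>v (U' *\<^sub>v u')" by (rule assoc_mult_mat_vec[OF U'(2,1) uC(2)])
  also have "U' *\<^sub>v u' = 0\<^sub>v n"
  proof (rule eq_vecI)
   fix i assume "i < dim_vec (0\<^sub>v n)"
   then have i: "i < n" by simp
   have "(- (U' *\<^sub>v u')) $ i = 0" using z vv i by simp
   then show "(U' *\<^sub>v u') $ i = 0\<^sub>v n $ i" using i U' by (simp del: index_mult_mat_vec)
  qed (use U' in simp)
  finally have u'0: "u' = 0\<^sub>v x" using U' by auto
  from c(1) obtain e where e: "e < a + x" "c e \<noteq> 0" by auto
  show False
  proof (cases "e < a")
   case True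
   then have "u $ e = c e" by (simp add: u_def)
   then show False using u0 True e by simp
  next
   case False
   then have "a + (e - a) = e" "e - a < x" using e by auto
   then have "u' $ (e - a) = c e" by (simp add: u'_def)
   then show False using u'0 False e by simp
  qed
 qed
 have Sv: "S *\<^sub>v v = v" unfolding v_def using SU assoc_mult_mat_vec[OF G(1) U(1) uC(1)] by simp
 have U'v: "U' *\<^sub>v u' \<in> carrier_vec n" using U' uC by simp
 have Tv: "T *\<^sub>v v = v"
 proof -
  have "T *\<^sub>v (U' *\<^sub>v u') = U' *\<^sub>v u'" using TU assoc_mult_mat_vec[OF G(2) U'(1) uC(2)] by simp
  moreover have "T *\<^sub>v (- (U' *\<^sub>v u')) = - (T *\<^sub>v (U' *\<^sub>v u'))"
   using mult_mat_vec[OF G(2) U'v, of "-1"] U'v G(2) by (simp add: uminus_vec_def smult_vec_def del: index_mult_mat_vec)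
  ultimately show ?thesis unfolding vv by simp
 qed
 have "n \<le> 1"
  by (rule simple_dim_le[OF g s, of 1 "\<lambda>_. v" 0]) (use vC v0 Sv Tv in \<open>auto intro!: exI[of _ "\<lambda>_. 1"]\<close>)
 then show False using n by simp
qed

text \<open>With two eigenvalues \<open>T\<close> is a linear combination of \<open>1\<close> and an involution \<open>R\<close>. An eigenvector
 \<open>v\<close> of \<open>S R\<close> and \<open>S v\<close> then span an invariant subspace.\<close>
lemma simple_two_eigenvalues:
 assumes g: "gamma_pair n S T" and s: "simple_rep n (stp S T)" and t: "tri e1 e2 e3" and d: "eigenspace_dim T e3 = 0"
 shows "n \<le> 2"
proof -
 note G = gamma_pairD[OF g] note tD = triD[OF t]
 have n: "n > 0" using simple_repD[OF s] by simp
 define A P where "A = proj n T e1" and "P = proj n T e3"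
 have C: "A \<in> mats n" "P \<in> mats n" unfolding A_def P_def using proj_carrier[OF G(2)] by auto
 have AA: "A * A = A" "P * P = P" unfolding A_def P_def using proj_mult[OF G(2,4)] tD by auto
 have "mtr P = of_nat 0" unfolding P_def using mtr_proj[OF G(2,4) tD(3)] d by simp
 then obtain U V where U: "U \<in> carrier_mat n 0" "V \<in> carrier_mat 0 n" "P = U * V"
  using idempotent_factor[OF C(2) AA(2)] by (metis of_nat_eq_iff)
 have "P = 0\<^sub>m n n" unfolding U(3) by (rule eq_matI) (use U in \<open>auto simp: scalar_prod_def\<close>)
 then have T: "T = e2 \<cdot>\<^sub>m 1\<^sub>m n + (e1 - e2) \<cdot>\<^sub>m A"
  using proj_sum(2)[OF t G(2)] C unfolding A_def[symmetric] P_def[symmetric] by (auto intro!: eq_matI)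
 define R where "R = (-1) \<cdot>\<^sub>m 1\<^sub>m n + 2 \<cdot>\<^sub>m A"
 have RC: "R \<in> mats n" using C by (simp add: R_def)
 have A2: "2 \<cdot>\<^sub>m A \<in> mats n" "(-1) \<cdot>\<^sub>m 1\<^sub>m n \<in> mats n" using C by auto
 have RR: "R * R = 1\<^sub>m n"
 proof -
  have AR: "A * R = A"
  proof -
   have "A * R = (-1) \<cdot>\<^sub>m A + 2 \<cdot>\<^sub>m A" unfolding R_def
    by (simp only: mult_add_distrib_mat[OF C(1) A2(2,1)] mult_smult_distrib[OF C(1) one_carrier_mat] mult_smult_distrib[OF C(1) C(1)] AA right_mult_one_mat[OF C(1)])
   then show ?thesis using C by (auto intro!: eq_matI)
  qed
  have "R * R = (-1) \<cdot>\<^sub>m R + 2 \<cdot>\<^sub>m A" unfolding R_def[THEN arg_cong[of _ _ "\<lambda>X. X * R"]]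
   by (simp only: add_mult_distrib_mat[OF A2(2,1) RC] mult_smult_assoc_mat[OF one_carrier_mat RC] mult_smult_assoc_mat[OF C(1) RC] AR left_mult_one_mat[OF RC])
  then show ?thesis unfolding R_def using C by (auto intro!: eq_matI)
 qed
 have SRC: "S * R \<in> mats n" using G RC by simp
 obtain k where "k \<in> spectrum (S * R)" using spectrum_non_empty[OF SRC n] by auto
 then obtain v where v: "v \<in> carrier_vec n" "v \<noteq> 0\<^sub>v n" "(S * R) *\<^sub>v v = k \<cdot>\<^sub>v v"
  using SRC unfolding spectrum_def eigenvalue_def eigenvector_def by auto
 have Rv: "R *\<^sub>v v \<in> carrier_vec n" and Sv: "S *\<^sub>v v \<in> carrier_vec n" using RC G v by auto
 have SS: "S *\<^sub>v (S *\<^sub>v u) = u" if "u \<in> carrier_vec n" for u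
  using assoc_mult_mat_vec[OF G(1,1) that] that unfolding G(3) by simp
 have RRv: "R *\<^sub>v (R *\<^sub>v u) = u" if "u \<in> carrier_vec n" for u
  using assoc_mult_mat_vec[OF RC RC that] that unfolding RR by simp
 have e: "S *\<^sub>v (R *\<^sub>v v) = k \<cdot>\<^sub>v v" using v(3) assoc_mult_mat_vec[OF G(1) RC v(1)] by simp
 have Rv': "R *\<^sub>v v = k \<cdot>\<^sub>v (S *\<^sub>v v)" using SS[OF Rv] unfolding e mult_mat_vec[OF G(1) v(1)] by simp
 have k0: "k \<noteq> 0"
 proof
  assume "k = 0"
  have z: "0 \<cdot>\<^sub>v u = 0\<^sub>v n" if "u \<in> carrier_vec n" for u :: "complex vec" using that by (auto intro!: eq_vecI)
  have "R *\<^sub>v v = 0\<^sub>v n" unfolding Rv' \<open>k = 0\<close> by (rule z[OF Sv])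
  then have "v = R *\<^sub>v 0\<^sub>v n" using RRv[OF v(1)] by simp
  then show False using v(2) RC by auto
 qed
 have "k \<cdot>\<^sub>v (R *\<^sub>v (S *\<^sub>v v)) = v" using RRv[OF v(1)] unfolding Rv' mult_mat_vec[OF RC Sv] .
 then have "(1/k) \<cdot>\<^sub>v v = (1/k) \<cdot>\<^sub>v (k \<cdot>\<^sub>v (R *\<^sub>v (S *\<^sub>v v)))" by simp
 also have "\<dots> = R *\<^sub>v (S *\<^sub>v v)" using k0 by (auto intro!: eq_vecI simp: smult_smult_assoc)
 finally have RSv: "R *\<^sub>v (S *\<^sub>v v) = (1/k) \<cdot>\<^sub>v v" by simp
 define \<alpha> \<beta> where "\<alpha> = e2 + (e1 - e2) / 2" and "\<beta> = (e1 - e2) / 2"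
 have TR: "T = \<alpha> \<cdot>\<^sub>m 1\<^sub>m n + \<beta> \<cdot>\<^sub>m R" unfolding T R_def \<alpha>_def \<beta>_def using C by (auto intro!: eq_matI simp: field_simps)
 have Tu: "T *\<^sub>v u = \<alpha> \<cdot>\<^sub>v u + \<beta> \<cdot>\<^sub>v (R *\<^sub>v u)" if "u \<in> carrier_vec n" for u
 proof -
  have "T *\<^sub>v u = (\<alpha> \<cdot>\<^sub>m 1\<^sub>m n) *\<^sub>v u + (\<beta> \<cdot>\<^sub>m R) *\<^sub>v u" unfolding TR using RC that by (subst add_mult_distrib_mat_vec[of _ n n]) auto
  moreover have "(\<alpha> \<cdot>\<^sub>m 1\<^sub>m n) *\<^sub>v u = \<alpha> \<cdot>\<^sub>v u" "(\<beta> \<cdot>\<^sub>m R) *\<^sub>v u = \<beta> \<cdot>\<^sub>v (R *\<^sub>v u)" using RC that by (auto intro!: eq_vecI)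
  ultimately show ?thesis by simp
 qed
 define f where "f l = (if l = 0 then v else S *\<^sub>v v)" for l :: nat
 have sum2: "(\<Sum>m<2. c m * f m $ i) = c 0 * v $ i + c (Suc 0) * (S *\<^sub>v v) $ i" for c i by (simp add: f_def numeral_2_eq_2)
 show ?thesis
 proof (rule simple_dim_le[OF g s, of 2 f 0])
  show "f l \<in> carrier_vec n" for l using v Sv by (simp add: f_def)
  show "f 0 \<noteq> 0\<^sub>v n" using v by (simp add: f_def)
  fix l :: nat assume "l < 2"
  then consider "l = 0" | "l = Suc 0" by linarith
  then show "\<exists>c. \<forall>i<n. (S *\<^sub>v f l) $ i = (\<Sum>m<2. c m * f m $ i)"
  proof cases
   case 1
   show ?thesis unfolding sum2 by (rule exI[of _ "\<lambda>m. if m = 0 then 0 else 1"]) (simp add: 1 f_def)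
  next
   case 2
   show ?thesis unfolding sum2 by (rule exI[of _ "\<lambda>m. if m = 0 then 1 else 0"]) (simp add: 2 f_def SS[OF v(1)])
  qed
  consider "l = 0" | "l = Suc 0" using \<open>l < 2\<close> by linarith
  then show "\<exists>c. \<forall>i<n. (T *\<^sub>v f l) $ i = (\<Sum>m<2. c m * f m $ i)"
  proof cases
   case 1
   show ?thesis unfolding sum2
    by (rule exI[of _ "\<lambda>m. if m = 0 then \<alpha> else \<beta> * k"]) (use v Sv in \<open>simp add: 1 f_def carrier_vecD[OF v(1)] carrier_matD[OF G(1)] Tu[OF v(1)] Rv' del: index_mult_mat_vec\<close>)
  next
   case 2
   show ?thesis unfolding sum2
    by (rule exI[of _ "\<lambda>m. if m = 0 then \<beta> / k else \<alpha>"]) (use v Sv in \<open>simp add: 2 f_def carrier_vecD[OF v(1)] carrier_matD[OF G(1)] Tu[OF Sv] RSv del: index_mult_mat_vec\<close>)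
  qed
 qed simp
qed

lemma simple_non_list:
 assumes g: "gamma_pair n S T" and s: "simple_rep n (stp S T)" and d: "dim_vector \<rho> (stp S T) = (a,b,x,y,z)"
  and ab: "a \<ge> b" and x: "x \<ge> y" "x \<ge> z" and nl: "(a,b,x,y,z) \<notin> tau_trivial_list"
 shows "a \<ge> 3" "b \<ge> 3" "x \<ge> 2" "y \<ge> 2" "z \<ge> 2"
proof -
 note t = gamma_traces(1,2)[OF g d]
 have n: "n > 0" using simple_repD[OF s] by simp
 have c3: "(\<rho>\<^sup>2) ^ 3 = 1" by (rule cube_roots[THEN iffD2]) simp
 have t1: "tri 1 \<rho> (\<rho>\<^sup>2)" "tri 1 (\<rho>\<^sup>2) \<rho>" unfolding tri_def using c3 rho3 rho_distinct by (metis power_one)+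
 have ed: "eigenspace_dim T \<rho> = y" "eigenspace_dim T (\<rho>\<^sup>2) = z" using d dim_vector_stp[OF g] by auto
 have l1: "(1,0,1,0,0) \<in> tau_trivial_list" "(4,2,2,2,2) \<in> tau_trivial_list" by (auto simp: tau_trivial_list_def)
 have l2: "(k,k,k,k-1,1) \<in> tau_trivial_list" "(k,k,k,1,k-1) \<in> tau_trivial_list"
  "(k+1,k,k,k,1) \<in> tau_trivial_list" "(k+1,k,k,1,k) \<in> tau_trivial_list" if "k \<ge> 1" for k
  using that unfolding tau_trivial_list_def by blast+
 have n2: "n \<ge> 2"
 proof (rule ccontr)
  assume "\<not> n \<ge> 2"
  then have "n = 1" using n by simp
  then have "a = 1" "b = 0" "x = 1" "y = 0" "z = 0" using t ab x by auto
  then show False using nl l1 by simp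
 qed
 have xb: "x \<le> b" using simple_bound[OF g s d n2] t by simp
 have z0: "z \<noteq> 0"
 proof
  assume z: "z = 0"
  then have "n \<le> 2" using simple_two_eigenvalues[OF g s t1(1)] ed by simp
  then have "a = 1" "b = 1" "x = 1" "y = 1" using n2 t xb x ab z by auto
  then show False using nl l2(2)[of 1] z by simp
 qed
 have y0: "y \<noteq> 0"
 proof
  assume z: "y = 0"
  then have "n \<le> 2" using simple_two_eigenvalues[OF g s t1(2)] ed by simp
  then have "a = 1" "b = 1" "x = 1" "z = 1" using n2 t xb x ab z by auto
  then show False using nl l2(1)[of 1] z by simp
 qed
 have z1: "z \<noteq> 1"
 proof
  assume z: "z = 1"
  have "a = b \<and> x = b \<and> y = b - 1 \<or> a = b + 1 \<and> x = b \<and> y = b" using t xb x ab z by linarith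
  then show False using nl l2(1)[of b] l2(3)[of b] z y0 by auto
 qed
 have y1: "y \<noteq> 1"
 proof
  assume z: "y = 1"
  have "a = b \<and> x = b \<and> z = b - 1 \<or> a = b + 1 \<and> x = b \<and> z = b" using t xb x ab z by linarith
  then show False using nl l2(2)[of b] l2(4)[of b] z z0 by auto
 qed
 show "y \<ge> 2" "z \<ge> 2" using y0 y1 z0 z1 by auto
 then show x2: "x \<ge> 2" using x by simp
 show b3: "b \<ge> 3"
 proof (rule ccontr)
  assume "\<not> b \<ge> 3"
  then have "b = 2" "x = 2" "y = 2" "z = 2" using xb x2 x y0 y1 z0 z1 by auto
  moreover have "a = 4" using t calculation by simp
  ultimately show False using nl l1 by simp
 qed
 then show "a \<ge> 3" using ab by simp
qed

end

section \<open>Detecting braid reversal\<close>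

text \<open>The inverse of the first generator for pairs \<open>stp S T\<close>, where it equals \<open>S T\<close>.\<close>
definition nI :: ncp where "nI = NMul (NMul NX (NMul NY NX)) (NMul NX NY)"
definition nw :: ncp where
 "nw = NMul nI (NMul nI (NMul NY (NMul nI (NMul NY (NMul nI (NMul NY NY))))))"
definition nw' :: ncp where
 "nw' = NMul NY (NMul NY (NMul nI (NMul NY (NMul nI (NMul NY (NMul nI nI))))))"

text \<open>The partial inverse computed by Gaussian elimination agrees with any two-sided inverse.\<close>
lemma mat_inverse_eq:
 assumes A: "A \<in> mats n" and B: "B \<in> mats n" "A * B = 1\<^sub>m n" "B * A = 1\<^sub>m n"
 shows "mat_inverse A = Some (B :: complex mat)"
proof (cases "mat_inverse A")
 case None
 from mat_inverse(1)[OF A None, of "()"] have "A \<notin> Units (ring_mat TYPE(complex) n ())" .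
 moreover have "A \<in> Units (ring_mat TYPE(complex) n ())" unfolding Units_def ring_mat_def using A B by auto
 ultimately show ?thesis by simp
next
 case (Some C)
 from mat_inverse(2)[OF A Some] have C: "A * C = 1\<^sub>m n" "C * A = 1\<^sub>m n" "C \<in> mats n" by auto
 have "C = C * (A * B)" using C B by (simp add: right_mult_one_mat[of _ n n])
 also have "\<dots> = C * A * B" by (rule assoc_mult_mat[symmetric, OF C(3) A B(1)])
 also have "\<dots> = B" using C B by (simp add: left_mult_one_mat[of _ n n])
 finally show ?thesis using Some by simp
qed

lemma nev_nI:
 assumes g: "gamma_pair n S T"
 shows "nev n (stp S T) nI = S * T" "nev n (stp S T) (nrev nI) = S * T"
proof -
 note G = gamma_pairD[OF g]
 note ph = stp_rep(4)[OF g]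
 note A = assoc_mult_mat[of _ n n _ n _ n]
 note gg = G(3,4) gamma_pairD(5,6)[OF g, where m = n]
 have N: "nev n (stp S T) NX = T * (T * S)" "nev n (stp S T) NY = S * (T * T)"
  unfolding nev_gen(1)[OF ph] nev_gen(2)[OF ph] by (simp_all add: stp_def)
 show "nev n (stp S T) nI = S * T" "nev n (stp S T) (nrev nI) = S * T"
  unfolding nI_def nrev.simps nev.simps(5) N using G(1,2) by (simp_all add: A gg)
qed

lemma word_trace_gamma:
 assumes g: "gamma_pair n S T"
 shows "word_trace n (stp S T) braid_w = ntrn n nw (stp S T)"
  "word_trace n (stp S T) braid_w' = ntrn n nw' (stp S T)"
  "ntrn n (nrev nw) (stp S T) = ntrn n nw' (stp S T)"
proof -
 note G = gamma_pairD[OF g]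
 note ph = stp_rep(4)[OF g]
 let ?\<phi> = "stp S T"
 let ?X = "T * (T * S)" let ?Y = "S * (T * T)" let ?I = "S * T"
 note A = assoc_mult_mat[of _ n n _ n _ n]
 note gg = G(3,4) gamma_pairD(5,6)[OF g, where m = n]
 have C: "?X \<in> mats n" "?Y \<in> mats n" "?I \<in> mats n" using G by auto
 have "mat_inverse ?X = Some ?I" by (rule mat_inverse_eq[OF C(1,3)]) (use G(1,2) in \<open>simp_all add: A gg\<close>)
 then have p: "mat_int_pow ?X (-2) = ?I * ?I" "mat_int_pow ?X (-1) = ?I" "mat_int_pow ?Y 1 = ?Y" "mat_int_pow ?Y 2 = ?Y * ?Y"
  using C by (simp_all add: mat_int_pow_def numeral_2_eq_2)
 have N: "nev n ?\<phi> NY = ?Y" unfolding nev_gen(2)[OF ph] by (simp add: stp_def)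
 note I = nev_nI[OF g]
 have tr: "word_trace n ?\<phi> u = mtr (word_image n ?\<phi> u)" if "word_image n ?\<phi> u \<in> mats n" for u
  using that by (simp add: word_trace_def mtr_def)
 have w: "word_image n ?\<phi> braid_w = nev n ?\<phi> nw"
  unfolding word_image_def braid_w_def nw_def nev.simps(5) N I using G(1,2) by (simp add: stp_def p A)
 have w': "word_image n ?\<phi> braid_w' = nev n ?\<phi> nw'"
  unfolding word_image_def braid_w'_def nw'_def nev.simps(5) N I using G(1,2) by (simp add: stp_def p A)
 show "word_trace n ?\<phi> braid_w = ntrn n nw ?\<phi>" "word_trace n ?\<phi> braid_w' = ntrn n nw' ?\<phi>"
  using tr w w' by (simp_all add: ntrn_def)
 have "nev n ?\<phi> (nrev nw) = nev n ?\<phi> nw'"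
  unfolding nw_def nw'_def nrev.simps nev.simps(5) N I using G(1,2) by (simp add: A)
 then show "ntrn n (nrev nw) ?\<phi> = ntrn n nw' ?\<phi>" by (simp add: ntrn_def)
qed

text \<open>Integer matrices as lists, so that the traces of the explicit representation are computed by
 rewriting with integers.\<close>
definition toM :: "int list list => complex mat" where
 "toM A = mat 6 6 (\<lambda>(i,j). of_int (A ! i ! j))"

definition lmul :: "int list list => int list list => int list list" where
 "lmul A B = map (\<lambda>i. map (\<lambda>j. \<Sum>k\<leftarrow>[0..<6]. A ! i ! k * B ! k ! j) [0..<6]) [0..<6]"

definition ltr :: "int list list => int" where
 "ltr A = (\<Sum>k\<leftarrow>[0..<6]. A ! k ! k)"

lemma toM_carrier [simp]: "toM A \<in> mats 6" by (simp add: toM_def)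

lemma toM_mult: "toM A * toM B = toM (lmul A B)"
proof (rule eq_matI)
 fix i j assume "i < dim_row (toM (lmul A B))" "j < dim_col (toM (lmul A B))"
 then have ij: "i < 6" "j < 6" by (auto simp: toM_def)
 have "lmul A B ! i ! j = (\<Sum>k\<leftarrow>[0..<6]. A ! i ! k * B ! k ! j)"
  unfolding lmul_def using ij by (simp del: upt.simps upt_rec_numeral)
 also have "\<dots> = (\<Sum>k<6. A ! i ! k * B ! k ! j)"
  by (simp add: sum_list_distinct_conv_sum_set atLeast0LessThan del: upt.simps upt_rec_numeral)
 finally show "(toM A * toM B) $$ (i,j) = toM (lmul A B) $$ (i,j)"
  unfolding mult_idx[OF toM_carrier toM_carrier ij] using ij by (simp add: toM_def)
qed (auto simp: toM_def)

lemma mtr_toM: "mtr (toM A) = of_int (ltr A)"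
proof -
 have "ltr A = (\<Sum>k<6. A ! k ! k)" unfolding ltr_def
  by (simp add: sum_list_distinct_conv_sum_set atLeast0LessThan del: upt.simps upt_rec_numeral)
 then show ?thesis unfolding mtr_def by (simp add: toM_def)
qed

definition S6 :: "int list list" where
 "S6 = [[-1,0,0,-2,0,0],[0,1,0,0,0,0],[0,0,1,0,0,0],[0,0,0,1,0,0],[0,2,0,0,-1,0],[0,0,0,0,0,-1]]"
definition T6 :: "int list list" where
 "T6 = [[0,0,1,0,0,0],[1,0,0,0,0,0],[0,1,0,0,0,0],[0,0,0,0,0,1],[0,0,0,1,0,0],[0,0,0,0,1,0]]"
definition I6 :: "int list list" where
 "I6 = [[1,0,0,0,0,0],[0,1,0,0,0,0],[0,0,1,0,0,0],[0,0,0,1,0,0],[0,0,0,0,1,0],[0,0,0,0,0,1]]"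

lemma toM_I6: "toM I6 = 1\<^sub>m 6"
proof (rule eq_matI)
 fix i j :: nat assume "i < dim_row (1\<^sub>m 6)" "j < dim_col (1\<^sub>m 6)"
 then have ij: "i < 6" "j < 6" by auto
 have "i \<in> {0,1,2,3,4,5}" "j \<in> {0,1,2,3,4,5}" using ij by auto
 then show "toM I6 $$ (i,j) = 1\<^sub>m 6 $$ (i,j)" using ij by (auto simp: toM_def I6_def)
qed (auto simp: toM_def)

lemma six_computations:
 "lmul S6 S6 = I6" "lmul T6 (lmul T6 T6) = I6" "ltr S6 = 0" "ltr T6 = 0" "ltr (lmul T6 T6) = 0"
 by code_simp+

definition Y6 :: "int list list" where "Y6 = lmul S6 (lmul T6 T6)"
definition J6 :: "int list list" where "J6 = lmul S6 T6"

lemma six_traces: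
 "ltr (lmul J6 (lmul J6 (lmul Y6 (lmul J6 (lmul Y6 (lmul J6 (lmul Y6 Y6))))))) = - 310"
 "ltr (lmul Y6 (lmul Y6 (lmul J6 (lmul Y6 (lmul J6 (lmul Y6 (lmul J6 J6))))))) = 330"
 by code_simp+

context cube_root
begin

text \<open>Only the family is mentioned, not simplicity: direct sums are allowed as witnesses, and
 \<open>detects_simple\<close> passes to a simple one.\<close>
definition detects :: "nat => dim_vec5 => bool" where
 "detects n \<alpha> \<longleftrightarrow> (\<exists>\<phi>\<in>FG n \<alpha>. ntrn n nw \<phi> \<noteq> ntrn n nw' \<phi>)"

text \<open>The traces of the braid and its reverse at this representation are \<open>-310\<close> and \<open>330\<close>.\<close>
lemma detects_six: "detects 6 (3,3,2,2,2)"
proof -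
 let ?S = "toM S6" let ?T = "toM T6"
 have g: "gamma_pair 6 ?S ?T"
  unfolding gamma_pair_def toM_mult six_computations toM_I6 by simp
 have d: "dim_vector \<rho> (stp ?S ?T) = (3,3,2,2,2)"
 proof (rule dims_from_traces[OF g])
  have "of_nat 2 + of_nat 2 * \<rho> + of_nat 2 * \<rho>\<^sup>2 = 2 * (1 + \<rho> + \<rho>\<^sup>2)" by (simp add: algebra_simps)
  moreover have "of_nat 2 + of_nat 2 * \<rho>\<^sup>2 + of_nat 2 * \<rho> = 2 * (1 + \<rho> + \<rho>\<^sup>2)" by (simp add: algebra_simps)
  ultimately show "mtr ?T = of_nat 2 + of_nat 2 * \<rho> + of_nat 2 * \<rho>\<^sup>2" "mtr (?T * ?T) = of_nat 2 + of_nat 2 * \<rho>\<^sup>2 + of_nat 2 * \<rho>"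
   unfolding toM_mult mtr_toM six_computations rho_sum by simp_all
 qed (simp_all add: mtr_toM six_computations)
 note ph = stp_rep(4)[OF g]
 have N: "nev 6 (stp ?S ?T) NY = toM Y6" unfolding nev_gen(2)[OF ph] by (simp add: stp_def toM_mult Y6_def)
 have I: "nev 6 (stp ?S ?T) nI = toM J6" unfolding nev_nI[OF g] by (simp add: toM_mult J6_def)
 have "ntrn 6 nw (stp ?S ?T) = - 310" unfolding ntrn_def nw_def nev.simps(5) N I toM_mult mtr_toM six_traces by simp
 moreover have "ntrn 6 nw' (stp ?S ?T) = 330" unfolding ntrn_def nw'_def nev.simps(5) N I toM_mult mtr_toM six_traces by simp
 ultimately show ?thesis unfolding detects_def FG_def using g d by (intro bexI[of _ "stp ?S ?T"]) auto
qed

text \<open>On a one-dimensional summand a braid and its reverse have the same trace.\<close>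
lemma detects_add:
 fixes s t :: complex
 assumes d: "detects n (a,b,x,y,z)" and n: "n = a + b" "n = x + y + z" and s: "s = 1 \<or> s = -1" and t: "t^3 = 1"
 shows "detects (n + 1) (a + (if s = 1 then 1 else 0), b + (if s = -1 then 1 else 0),
  x + (if t = 1 then 1 else 0), y + (if t = \<rho> then 1 else 0), z + (if t = \<rho>\<^sup>2 then 1 else 0))"
proof -
 obtain S T where p: "gamma_pair n S T" "dim_vector \<rho> (stp S T) = (a,b,x,y,z)" "ntrn n nw (stp S T) \<noteq> ntrn n nw' (stp S T)"
  using d unfolding detects_def FG_def by blast
 note G = gamma_pairD[OF p(1)]
 define s1 t1 where "s1 = mat 1 1 (\<lambda>_. s)" and "t1 = mat 1 1 (\<lambda>_. t)"
 have C1: "s1 \<in> mats 1" "t1 \<in> mats 1" by (auto simp: s1_def t1_def)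
 have m11: "(A * B) = mat 1 1 (\<lambda>_. A $$ (0,0) * B $$ (0,0))" if "A \<in> mats 1" "B \<in> mats 1" for A B :: "complex mat"
  using that by (intro eq_matI) (auto simp: mult_idx[of _ 1 1 _ 1] simp del: index_mult_mat(1))
 have o11: "mat 1 1 (\<lambda>_. 1) = (1\<^sub>m 1 :: complex mat)" by (auto intro!: eq_matI)
 have g1: "gamma_pair 1 s1 t1" unfolding gamma_pair_def
 proof (intro conjI C1)
  show "s1 * s1 = 1\<^sub>m 1" unfolding m11[OF C1(1,1)] using s by (auto simp: s1_def o11)
  have "t * (t * t) = 1" using t by (simp add: power3_eq_cube mult.assoc)
  moreover have "t1 * t1 \<in> mats 1" using C1 by simp
  ultimately show "t1 * (t1 * t1) = 1\<^sub>m 1" using m11[OF C1(2,2)] m11[OF C1(2), of "t1 * t1"] by (simp add: t1_def o11[unfolded One_nat_def])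
 qed
 define S' T' where "S' = four_block_mat S (0\<^sub>m n 1) (0\<^sub>m 1 n) s1" and "T' = four_block_mat T (0\<^sub>m n 1) (0\<^sub>m 1 n) t1"
 have mb: "four_block_mat A (0\<^sub>m n 1) (0\<^sub>m 1 n) A1 * four_block_mat B (0\<^sub>m n 1) (0\<^sub>m 1 n) B1 = four_block_mat (A * B) (0\<^sub>m n 1) (0\<^sub>m 1 n) (A1 * B1)"
  if "A \<in> mats n" "B \<in> mats n" "A1 \<in> mats 1" "B1 \<in> mats 1" for A B A1 B1 :: "complex mat"
 proof -
  have "A * B \<in> mats n" "A1 * B1 \<in> mats 1" using that by auto
  then show ?thesis using that
   by (subst mult_four_block_mat[of _ n n _ 1 _ 1 _ _ n _ 1]) (simp_all add: left_add_zero_mat[of _ 1 1] right_add_zero_mat[of _ n n])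
 qed
 note G1 = gamma_pairD[OF g1]
 have TT: "T * T \<in> mats n" "t1 * t1 \<in> mats 1" using G G1 by auto
 have gS: "S' * S' = 1\<^sub>m (n+1)" unfolding S'_def mb[OF G(1,1) C1(1,1)] G G1 by simp
 have T2: "T' * T' = four_block_mat (T * T) (0\<^sub>m n 1) (0\<^sub>m 1 n) (t1 * t1)" unfolding T'_def mb[OF G(2,2) C1(2,2)] ..
 have gT: "T' * (T' * T') = 1\<^sub>m (n+1)" unfolding T2 unfolding T'_def mb[OF G(2) TT(1) C1(2) TT(2)] G G1 by simp
 have g': "gamma_pair (n+1) S' T'" unfolding gamma_pair_def using gS gT G(1,2) C1 by (auto simp: S'_def T'_def)
 have st: "stp S' T' = dsum (stp S T) (stp s1 t1)"
 proof -
  have TS: "T * S \<in> mats n" "t1 * s1 \<in> mats 1" using G G1 by auto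
  have "T' * (T' * S') = four_block_mat (T * (T * S)) (0\<^sub>m n 1) (0\<^sub>m 1 n) (t1 * (t1 * s1))"
   unfolding T'_def S'_def mb[OF G(2,1) C1(2,1)] mb[OF G(2) TS(1) C1(2) TS(2)] ..
  moreover have "S' * (T' * T') = four_block_mat (S * (T * T)) (0\<^sub>m n 1) (0\<^sub>m 1 n) (s1 * (t1 * t1))"
   unfolding T2 unfolding S'_def mb[OF G(1) TT(1) C1(1) TT(2)] ..
  moreover have "dim_row (T * (T * S)) = n" "dim_row (t1 * (t1 * s1)) = 1" using G G1 by auto
  ultimately show ?thesis unfolding dsum_def stp_def Let_def fst_conv snd_conv by simp
 qed
 have tr: "ntrn (n+1) q (stp S' T') = ntrn n q (stp S T) + ntrn 1 q (stp s1 t1)" for q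
  using ntr_dsum[OF stp_rep(4)[OF p(1)] stp_rep(4)[OF g1], of q] ntr_pairs[OF stp_rep(4)[OF p(1)], of q] ntr_pairs[OF stp_rep(4)[OF g1], of q]
   ntr_pairs[OF stp_rep(4)[OF g'], of q] st by (simp add: ntrn_def)
 have "nev 1 \<phi> nw = nev 1 \<phi> nw'" for \<phi>
  unfolding nw_def nw'_def nev.simps(5) using m11 by (simp add: mult_ac del: nev.simps(5))
 then have "ntrn (n+1) nw (stp S' T') \<noteq> ntrn (n+1) nw' (stp S' T')" using p(3) unfolding tr by (simp add: ntrn_def)
 moreover have "dim_vector \<rho> (stp S' T') = (a + (if s = 1 then 1 else 0), b + (if s = -1 then 1 else 0),
  x + (if t = 1 then 1 else 0), y + (if t = \<rho> then 1 else 0), z + (if t = \<rho>\<^sup>2 then 1 else 0))"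
 proof (rule dims_from_traces[OF g'])
  note tt = gamma_traces[OF p(1,2)]
  have n1: "(1::complex) \<noteq> -1" by simp
  have tc: "t = 1 \<or> t = \<rho> \<or> t = \<rho>\<^sup>2" using t cube_roots by simp
  note rd = rho_distinct rho_distinct[symmetric]
  have r4: "\<rho>\<^sup>2 * \<rho>\<^sup>2 = \<rho>"
  proof -
   have "\<rho>\<^sup>2 * \<rho>\<^sup>2 = \<rho>^3 * \<rho>" by (simp add: power2_eq_square power3_eq_cube mult.assoc)
   then show ?thesis using rho3 by simp
  qed
  have mt: "mtr s1 = s" "mtr t1 = t" "mtr (t1 * t1) = t * t" unfolding m11[OF C1(2,2)] by (auto simp: mtr_def s1_def t1_def)
  show "n + 1 = a + (if s = 1 then 1 else 0) + (b + (if s = -1 then 1 else 0))" using n s n1 by auto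
  show "n + 1 = x + (if t = 1 then 1 else 0) + (y + (if t = \<rho> then 1 else 0)) + (z + (if t = \<rho>\<^sup>2 then 1 else 0))"
   using n tc rd by auto
  show "mtr S' = of_nat (a + (if s = 1 then 1 else 0)) - of_nat (b + (if s = -1 then 1 else 0))"
   unfolding S'_def mtr_four_block[OF G(1) C1(1)] mt tt using s n1 by auto
  show "mtr T' = of_nat (x + (if t = 1 then 1 else 0)) + of_nat (y + (if t = \<rho> then 1 else 0)) * \<rho> + of_nat (z + (if t = \<rho>\<^sup>2 then 1 else 0)) * \<rho>\<^sup>2"
   unfolding T'_def mtr_four_block[OF G(2) C1(2)] mt tt using tc rd by (auto simp: algebra_simps)
  show "mtr (T' * T') = of_nat (x + (if t = 1 then 1 else 0)) + of_nat (y + (if t = \<rho> then 1 else 0)) * \<rho>\<^sup>2 + of_nat (z + (if t = \<rho>\<^sup>2 then 1 else 0)) * \<rho>"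
   unfolding T2 mtr_four_block[OF TT] mt tt using tc rd r4 by (auto simp: algebra_simps power2_eq_square[of \<rho>, symmetric])
 qed
 ultimately show ?thesis unfolding detects_def FG_def using g' by blast
qed

text \<open>One-dimensional summands are added to the six-dimensional example. Any vector above the
 minimal one allows removing one unit from \<open>{a, b}\<close> and one from \<open>{x, y, z}\<close>.\<close>
lemma detects_large:
 assumes "a \<ge> 3" "b \<ge> 3" "x \<ge> 2" "y \<ge> 2" "z \<ge> 2" "n = a + b" "n = x + y + z"
 shows "detects n (a,b,x,y,z)"
 using assms
proof (induction n arbitrary: a b x y z rule: less_induct)
 case (less n)
 show ?case
 proof (cases "n = 6")
  case True
  then have "a = 3" "b = 3" "x = 2" "y = 2" "z = 2" using less.prems by auto
  then show ?thesis using detects_six True by simp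
 next
  case False
  have c3: "(\<rho>\<^sup>2) ^ 3 = 1" by (rule cube_roots[THEN iffD2]) simp
  note rd = rho_distinct rho_distinct[symmetric]
  have n1: "(1::complex) \<noteq> -1" "(-1::complex) \<noteq> 1" by simp_all
  have step: "detects n (a,b,x,y,z)"
   if s: "s = 1 \<or> s = -1" "t^3 = 1" and e: "a = a' + (if s = 1 then 1 else 0)" "b = b' + (if s = -1 then 1 else 0)"
    "x = x' + (if t = 1 then 1 else 0)" "y = y' + (if t = \<rho> then 1 else 0)" "z = z' + (if t = \<rho>\<^sup>2 then 1 else 0)"
    and ge: "a' \<ge> 3" "b' \<ge> 3" "x' \<ge> 2" "y' \<ge> 2" "z' \<ge> 2" for s t :: complex and a' b' x' y' z'
  proof -
   have tc: "t = 1 \<or> t = \<rho> \<or> t = \<rho>\<^sup>2" using s(2) cube_roots by simp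
   have n': "n = (a' + b') + 1" "a' + b' = x' + y' + z'" using less.prems(6,7) e s(1) tc n1 rd by auto
   have "detects (a' + b') (a',b',x',y',z')" by (rule less.IH) (use ge n' in auto)
   from detects_add[OF this refl n'(2) s] show ?thesis unfolding e n'(1) .
  qed
  have "(a > 3 \<or> b > 3) \<and> (x > 2 \<or> y > 2 \<or> z > 2)" using False less.prems by auto
  then consider "a > 3" "x > 2" | "a > 3" "y > 2" | "a > 3" "z > 2" | "b > 3" "x > 2" | "b > 3" "y > 2" | "b > 3" "z > 2" by blast
  then show ?thesis
  proof cases
   case 1 then show ?thesis using less.prems rd n1 by (intro step[of 1 1 "a-1" b "x-1" y z]) auto
  next
   case 2 then show ?thesis using less.prems rd n1 rho3 by (intro step[of 1 \<rho> "a-1" b x "y-1" z]) auto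
  next
   case 3 then show ?thesis using less.prems rd n1 c3 by (intro step[of 1 "\<rho>\<^sup>2" "a-1" b x y "z-1"]) auto
  next
   case 4 then show ?thesis using less.prems rd n1 by (intro step[of "-1" 1 a "b-1" "x-1" y z]) auto
  next
   case 5 then show ?thesis using less.prems rd n1 rho3 by (intro step[of "-1" \<rho> a "b-1" x "y-1" z]) auto
  next
   case 6 then show ?thesis using less.prems rd n1 c3 by (intro step[of "-1" "\<rho>\<^sup>2" a "b-1" x y "z-1"]) auto
  qed
 qed
qed

text \<open>The two traces differ at one member of the family, hence at a generic simple one.\<close>
lemma detects_simple:
 assumes d: "detects n \<alpha>" and s: "simple_rep n \<psi>" "\<psi> \<in> FG n \<alpha>"
 shows "\<exists>\<phi>. simple_rep n \<phi> \<and> iso_class n \<phi> \<in> iss_comp \<rho> n \<alpha> \<and> word_trace n \<phi> braid_w \<noteq> word_trace n \<phi> braid_w' \<and>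
  tau (iso_class n \<phi>) \<noteq> iso_class n \<phi>"
proof -
 obtain \<phi>0 where p0: "\<phi>0 \<in> FG n \<alpha>" "ntrn n nw \<phi>0 \<noteq> ntrn n nw' \<phi>0" using d unfolding detects_def by blast
 have "(\<lambda>\<phi>. ntrn n nw \<phi> - ntrn n nw' \<phi>) \<in> regular_fun n"
  by (rule subalg_diff[OF subalg_regular ntrn_regular ntrn_regular])
 from FG_generic_simple[OF s this p0(1)] p0(2) obtain \<phi> where p: "\<phi> \<in> FG n \<alpha>" "simple_rep n \<phi>" "ntrn n nw \<phi> \<noteq> ntrn n nw' \<phi>" by auto
 obtain S T where st: "gamma_pair n S T" "\<phi> = stp S T" using p(1) unfolding FG_def by blast
 note wt = word_trace_gamma[OF st(1), folded st(2)]
 have r: "\<phi> \<in> rep_B3 n" by (rule FG_rep[OF p(1)])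
 have "tau (iso_class n \<phi>) \<noteq> iso_class n \<phi>"
 proof
  assume "tau (iso_class n \<phi>) = iso_class n \<phi>"
  then have "transpose_rep \<phi> \<in> iso_class n \<phi>" using tau_iso_class[OF r] iso_class_self[OF transpose_rep_B3[OF r]] by simp
  then have "rep_iso \<phi> (transpose_rep \<phi>)" by (simp add: iso_class_def)
  then have "ntrn n nw \<phi> = ntrn n nw (transpose_rep \<phi>)"
   using ntr_iso[of \<phi> "transpose_rep \<phi>" n nw] ntr_pairs[OF rep_pairs[OF r]] ntr_pairs[OF rep_pairs[OF transpose_rep_B3[OF r]]] rep_pairs[OF r]
   by (simp add: ntrn_def)
  also have "\<dots> = ntrn n nw' \<phi>" using ntrn_transpose[OF rep_pairs[OF r]] wt(3) by simp
  finally show False using p(3) by simp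
 qed
 moreover have "word_trace n \<phi> braid_w \<noteq> word_trace n \<phi> braid_w'" using p(3) wt by simp
 ultimately show ?thesis using p(2) FS_comp[OF FG_FS[OF p(1,2)]] by blast
qed

end

section \<open>Polynomial functions and algebraic independence\<close>

text \<open>Polynomial of degree at most \<open>k\<close> along every line. This weak form of being a polynomial in
 several variables is all that is used: coordinate lines serve in \<open>grid_vanish\<close>, general lines in
 \<open>polys_generic\<close>.\<close>
definition pdeg :: "nat => ((nat => complex) => complex) => bool" where
 "pdeg k F \<longleftrightarrow> (\<forall>c v. \<exists>p. degree p \<le> k \<and> (\<forall>t. F (\<lambda>i. c i + t * v i) = poly p t))"

lemma pdeg_const: "pdeg k (\<lambda>_. a)"
 unfolding pdeg_def by (intro allI exI[of _ "[:a:]"]) simp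

lemma pdeg_coord: "pdeg 1 (\<lambda>c. c i)"
 unfolding pdeg_def
proof (intro allI)
 fix c v :: "nat => complex"
 show "\<exists>p. degree p \<le> 1 \<and> (\<forall>t. c i + t * v i = poly p t)" by (rule exI[of _ "[:c i, v i:]"]) simp
qed

lemma pdeg_le: "pdeg k F ==> k \<le> l ==> pdeg l F"
 unfolding pdeg_def by (meson le_trans)

lemma pdeg_add:
 assumes "pdeg k F" "pdeg k G"
 shows "pdeg k (\<lambda>c. F c + G c)"
 unfolding pdeg_def
proof (intro allI)
 fix c v
 obtain p q where "degree p \<le> k" "\<forall>t. F (\<lambda>i. c i + t * v i) = poly p t" "degree q \<le> k" "\<forall>t. G (\<lambda>i. c i + t * v i) = poly q t"
  using assms unfolding pdeg_def by meson
 then show "\<exists>p. degree p \<le> k \<and> (\<forall>t. F (\<lambda>i. c i + t * v i) + G (\<lambda>i. c i + t * v i) = poly p t)"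
  by (intro exI[of _ "p + q"]) (simp add: degree_add_le)
qed

lemma pdeg_mult:
 assumes "pdeg k F" "pdeg l G"
 shows "pdeg (k + l) (\<lambda>c. F c * G c)"
 unfolding pdeg_def
proof (intro allI)
 fix c v
 obtain p q where p: "degree p \<le> k" "\<forall>t. F (\<lambda>i. c i + t * v i) = poly p t" "degree q \<le> l" "\<forall>t. G (\<lambda>i. c i + t * v i) = poly q t"
  using assms unfolding pdeg_def by meson
 have "degree (p * q) \<le> k + l" using degree_mult_le[of p q] p by linarith
 then show "\<exists>p. degree p \<le> k + l \<and> (\<forall>t. F (\<lambda>i. c i + t * v i) * G (\<lambda>i. c i + t * v i) = poly p t)"
  using p by (intro exI[of _ "p * q"]) simp
qed

lemma pdeg_sum: "(\<And>e. e \<in> E ==> pdeg k (F e)) ==> pdeg k (\<lambda>c. \<Sum>e\<in>E. F e c)"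
 by (induction E rule: infinite_finite_induct) (auto intro: pdeg_const pdeg_add)

lemma pdeg_power: "pdeg k F ==> pdeg (m * k) (\<lambda>c. F c ^ m)"
 by (induction m) (auto intro: pdeg_const pdeg_mult)

definition polys :: "((nat => complex) => complex) set" where
 "polys = {F. \<exists>k. pdeg k F}"

lemma subalg_polys: "subalg polys"
 unfolding subalg_def
proof (intro conjI allI ballI)
 show "(\<lambda>_. c) \<in> polys" for c unfolding polys_def using pdeg_const by blast
 fix F G assume "F \<in> polys" "G \<in> polys"
 then obtain k l where kl: "pdeg k F" "pdeg l G" unfolding polys_def by blast
 have "pdeg (max k l) F" "pdeg (max k l) G" using kl pdeg_le by (meson max.cobounded1 max.cobounded2)+
 then show "(\<lambda>x. F x + G x) \<in> polys" unfolding polys_def using pdeg_add by blast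
 show "(\<lambda>x. F x * G x) \<in> polys" unfolding polys_def using pdeg_mult[OF kl] by blast
qed

lemma polys_coord: "(\<lambda>c. c i) \<in> polys"
 unfolding polys_def using pdeg_coord by blast

lemma polys_generic:
 assumes F: "F \<in> polys" "F c \<noteq> 0" and G: "G \<in> polys" "G c' \<noteq> 0" and X: "finite X"
 shows "\<exists>t. t \<notin> X \<and> F (\<lambda>i. c i + t * (c' i - c i)) \<noteq> 0 \<and> G (\<lambda>i. c i + t * (c' i - c i)) \<noteq> 0"
proof -
 have line: "\<exists>p. \<forall>t. H (\<lambda>i. c i + t * (c' i - c i)) = poly p t" if H: "H \<in> polys" for H
 proof -
  obtain k where "pdeg k H" using H unfolding polys_def by blast
  from this[unfolded pdeg_def, rule_format, of c "\<lambda>i. c' i - c i"] show ?thesis by blast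
 qed
 obtain p where p: "\<And>t. F (\<lambda>i. c i + t * (c' i - c i)) = poly p t" using line[OF F(1)] by blast
 obtain q where q: "\<And>t. G (\<lambda>i. c i + t * (c' i - c i)) = poly q t" using line[OF G(1)] by blast
 have "poly p 0 \<noteq> 0" "poly q 1 \<noteq> 0" using p[of 0] q[of 1] F G by simp_all
 then have "p \<noteq> 0" "q \<noteq> 0" by auto
 then have "finite ({t. poly p t = 0} \<union> {t. poly q t = 0} \<union> X)" using poly_roots_finite X by auto
 from ex_new_if_finite[OF infinite_UNIV_char_0 this] obtain t where "t \<notin> {t. poly p t = 0} \<union> {t. poly q t = 0} \<union> X" by (elim exE)
 then show ?thesis using p q by auto
qed

text \<open>One coordinate after the other is freed; a polynomial of degree at most \<open>k\<close> with \<open>k + 1\<close> zeros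
 vanishes.\<close>
lemma grid_vanish:
 assumes F: "pdeg k F"
  and g: "\<And>c. (\<forall>i<n. c i \<in> of_nat ` {..k}) ==> (\<forall>i\<ge>n. c i = 0) ==> F c = 0"
  and c: "\<forall>i\<ge>n. c i = 0"
 shows "F c = 0"
proof -
 have "m \<le> n ==> (\<forall>i<n. i \<ge> m --> c i \<in> of_nat ` {..k}) ==> (\<forall>i\<ge>n. c i = 0) ==> F c = 0" for m c
 proof (induction m arbitrary: c)
  case 0
  then show ?case using g by blast
 next
  case (Suc m)
  obtain p where p: "degree p \<le> k" "\<And>t. F (\<lambda>i. (c(m := 0)) i + t * (if i = m then 1 else 0)) = poly p t"
   using F unfolding pdeg_def by meson
  have l: "(\<lambda>i. (c(m := 0)) i + t * (if i = m then 1 else 0)) = c(m := t)" for t by auto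
  have z: "poly p t = 0" if "t \<in> of_nat ` {..k}" for t
  proof -
   have "F (c(m := t)) = 0" using Suc.prems that by (intro Suc.IH) auto
   then show ?thesis using p(2)[of t] unfolding l by simp
  qed
  have "p = 0"
  proof (rule ccontr)
   assume "p \<noteq> 0"
   have "card (of_nat ` {..k} :: complex set) = Suc k" by (subst card_image) (auto simp: inj_on_def)
   moreover have "card (of_nat ` {..k} :: complex set) \<le> card {t. poly p t = 0}"
    by (rule card_mono) (use poly_roots_finite[OF \<open>p \<noteq> 0\<close>] z in auto)
   ultimately show False using card_poly_roots_bound[OF \<open>p \<noteq> 0\<close>] p(1) by linarith
  qed
  then show ?case using p(2)[of "c m"] unfolding l by simp
 qed
 from this[of n c] c show ?thesis by simp
qed

text \<open>With \<open>p i m = f i ^ m\<close> this is a monomial in the functions \<open>f 0, ..., f (j - 1)\<close>; the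
 exponents are the digits of \<open>e\<close> in base \<open>L\<close>. The encoding makes the number of monomials \<open>L ^ j\<close>
 and reduces the step from \<open>j\<close> to \<open>j + 1\<close> to a division with remainder.\<close>
primrec monomial :: "nat => (nat => nat => complex) => nat => nat => complex" where
 "monomial L p 0 e = 1"
| "monomial L p (Suc j) e = monomial L p j (e mod L^j) * p j (e div L^j)"

lemma digit_less: "e < L ^ Suc j ==> e div L^j < (L::nat)" "e < L ^ Suc j ==> e mod L^j < L^j"
 by (auto simp: less_mult_imp_div_less intro!: mod_less_divisor gr0I)

lemma monomial_subalg:
 assumes R: "subalg R"
 shows "(\<And>i m. i < j ==> (\<lambda>x. p x i m) \<in> R) ==> (\<lambda>x. monomial L (p x) j e) \<in> R"
 by (induction j arbitrary: e) (auto intro!: subalg_const[OF R] subalg_mult[OF R])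

lemma monomial_scale:
 "(\<And>i m. i < j ==> m < L ==> p i m * w = q i m) ==> e < L^j ==> monomial L p j e * w^j = monomial L q j e"
proof (induction j arbitrary: e)
 case (Suc j)
 have "monomial L p j (e mod L^j) * w^j = monomial L q j (e mod L^j)"
  by (rule Suc.IH) (use Suc.prems digit_less in auto)
 moreover have "p j (e div L^j) * w = q j (e div L^j)" using Suc.prems digit_less by auto
 ultimately show ?case by (simp only: monomial.simps power_Suc) (metis mult.assoc mult.commute)
qed simp

lemma monomial_pdeg:
 "(\<And>i m. i < j ==> m < L ==> pdeg k (\<lambda>c. p c i m)) ==> e < L^j ==> pdeg (j * k) (\<lambda>c. monomial L (p c) j e)"
proof (induction j arbitrary: e)
 case (Suc j)
 have "pdeg (j * k) (\<lambda>c. monomial L (p c) j (e mod L^j))" by (rule Suc.IH) (use Suc.prems digit_less in auto)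
 moreover have "pdeg k (\<lambda>c. p c j (e div L^j))" using Suc.prems digit_less by auto
 ultimately show ?case using pdeg_mult[of "j*k" _ k] by (simp add: add.commute)
qed (simp add: pdeg_const)

lemma monomial_split:
 assumes "L > 0"
 shows "(\<Sum>e<L ^ Suc j. a e * monomial L p (Suc j) e) = (\<Sum>m<L. (\<Sum>e<L^j. a (m * L^j + e) * monomial L p j e) * p j m)"
proof -
 let ?h = "\<lambda>e. a e * monomial L p (Suc j) e" let ?K = "L^j"
 have K: "?K > 0" using assms by simp
 have "(\<Sum>e<L ^ Suc j. ?h e) = (\<Sum>m<L. sum ?h {m * ?K..<m * ?K + ?K})" unfolding sum.nat_group by simp
 also have "\<dots> = (\<Sum>m<L. \<Sum>e<?K. ?h (m * ?K + e))"
 proof (rule sum.cong[OF refl])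
  fix m
  show "sum ?h {m * ?K..<m * ?K + ?K} = (\<Sum>e<?K. ?h (m * ?K + e))"
   by (rule sum.reindex_bij_witness[of _ "\<lambda>e. m * ?K + e" "\<lambda>e. e - m * ?K"]) auto
 qed
 also have "\<dots> = (\<Sum>m<L. (\<Sum>e<?K. a (m * ?K + e) * monomial L p j e) * p j m)"
  unfolding sum_distrib_right
 proof (intro sum.cong refl)
  fix m e assume "e \<in> {..<?K}"
  then have "(m * ?K + e) div ?K = m" "(m * ?K + e) mod ?K = e" using K by simp_all
  then show "?h (m * ?K + e) = a (m * ?K + e) * monomial L p j e * p j m" by simp
 qed
 finally show ?thesis .
qed

text \<open>Suppose a relation between \<open>f 0, ..., f j\<close> holds on \<open>Y (Suc j)\<close>. Since \<open>f j\<close> does not vanish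
 there and \<open>Y (Suc j)\<close> is irreducible, the lowest power of \<open>f j\<close> that occurs can be cancelled.
 Restricting to \<open>Y j\<close>, where \<open>f j\<close> vanishes, leaves a relation between \<open>f 0, ..., f (j - 1)\<close>.\<close>
lemma chain_independent:
 fixes f :: "nat => 'a => complex"
 assumes R: "subalg R" and f: "\<And>i. i < d ==> f i \<in> R" and Y: "\<And>i. i < d ==> Y i \<subseteq> Y (Suc i)" "Y 0 \<noteq> {}"
  and pr: "\<And>i g h. i \<le> d ==> g \<in> R ==> h \<in> R ==> \<forall>x\<in>Y i. g x * h x = 0 ==> (\<forall>x\<in>Y i. g x = 0) \<or> (\<forall>x\<in>Y i. h x = 0)"
  and van: "\<And>i x. i < d ==> x \<in> Y i ==> f i x = 0" and nvan: "\<And>i. i < d ==> \<exists>x\<in>Y (Suc i). f i x \<noteq> 0" and L: "L > 0"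
 shows "j \<le> d ==> \<forall>x\<in>Y j. (\<Sum>e<L^j. a e * monomial L (\<lambda>i m. f i x ^ m) j e) = 0 ==> e < L^j ==> a e = 0"
proof (induction j arbitrary: a e)
 case 0
 then show ?case using Y(2) by auto
next
 case (Suc j)
 define G where "G m x = (\<Sum>e<L^j. a (m * L^j + e) * monomial L (\<lambda>i m. f i x ^ m) j e)" for m x
 have GR: "G m \<in> R" for m
  unfolding G_def[abs_def] using Suc.prems(1)
  by (intro subalg_sum[OF R] subalg_mult[OF R] subalg_const[OF R] monomial_subalg[OF R] subalg_power[OF R] f) auto
 have S: "(\<Sum>m<L. G m x * f j x ^ m) = 0" if "x \<in> Y (Suc j)" for x
  using Suc.prems(2) that unfolding monomial_split[OF L] G_def by blast
 have "m < L ==> \<forall>e<L^j. a (m * L^j + e) = 0" for m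
 proof (induction m rule: less_induct)
  case (less m)
  have G0: "G m' x = 0" if "m' < m" for m' x using less.IH[of m'] that less.prems by (auto simp: G_def)
  define H where "H x = (\<Sum>m'\<in>{m..<L}. G m' x * f j x ^ (m' - m))" for x
  have fj: "f j \<in> R" using f Suc.prems(1) by simp
  have HR: "H \<in> R" unfolding H_def[abs_def]
   by (intro subalg_sum[OF R] subalg_mult[OF R] GR subalg_power[OF R] fj)
  have "f j x ^ m * H x = 0" if "x \<in> Y (Suc j)" for x
  proof -
   have "0 = (\<Sum>m'<L. G m' x * f j x ^ m')" using S[OF that] by simp
   also have "\<dots> = (\<Sum>m'\<in>{m..<L}. G m' x * f j x ^ m')"
    by (rule sum.mono_neutral_right) (auto simp: G0)
   also have "\<dots> = f j x ^ m * H x" unfolding H_def sum_distrib_left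
    by (intro sum.cong refl) (auto simp: mult.assoc mult.left_commute simp flip: power_add)
   finally show ?thesis by simp
  qed
  then have "(\<forall>x\<in>Y (Suc j). f j x ^ m = 0) \<or> (\<forall>x\<in>Y (Suc j). H x = 0)"
   by (intro pr[OF Suc.prems(1) subalg_power[OF R fj] HR]) blast
  moreover have "\<not> (\<forall>x\<in>Y (Suc j). f j x ^ m = 0)" using nvan[of j] Suc.prems(1) by auto
  ultimately have H0: "\<forall>x\<in>Y (Suc j). H x = 0" by blast
  have "G m x = 0" if x: "x \<in> Y j" for x
  proof -
   have fx: "f j x = 0" using van x Suc.prems(1) by simp
   have "H x = (\<Sum>m'\<in>{m..<L}. if m' = m then G m x else 0)"
    unfolding H_def by (intro sum.cong refl) (auto simp: fx)
   also have "\<dots> = G m x" using less.prems by simp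
   finally show ?thesis using H0 Y(1)[of j] x Suc.prems(1) by auto
  qed
  then have z: "\<forall>x\<in>Y j. (\<Sum>e<L^j. a (m * L^j + e) * monomial L (\<lambda>i m. f i x ^ m) j e) = 0" unfolding G_def by blast
  show ?case using Suc.IH[of "\<lambda>e. a (m * L^j + e)"] z Suc.prems(1) by simp
 qed
 from this[of "e div L^j"] digit_less[OF Suc.prems(3)] have "a (e div L^j * L^j + e mod L^j) = 0" by blast
 then show ?case by (simp only: div_mult_mod_eq)
qed

text \<open>Monomials in \<open>n + 1\<close> functions with exponents below \<open>L\<close> number \<open>L ^ (n + 1)\<close>, while a
 polynomial of degree \<open>O(L)\<close> in \<open>n\<close> variables is determined by its values on a grid of \<open>O(L ^ n)\<close>
 points. For large \<open>L\<close> some combination vanishes on the grid. The denominators, powers of the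
 variable \<open>c (n - 1)\<close>, are cleared beforehand.\<close>
lemma polys_dependent:
 assumes G: "\<And>i. i \<le> n ==> pdeg k (G i)" and FG: "\<And>i c. i \<le> n ==> c (n - 1) \<noteq> 0 ==> F i c * c (n - 1) ^ K = G i c"
 shows "\<exists>L>0. \<exists>a. (\<exists>e<L ^ Suc n. a e \<noteq> 0) \<and> (\<forall>c. c (n - 1) \<noteq> 0 --> (\<forall>i\<ge>n. c i = 0) -->
   (\<Sum>e<L ^ Suc n. a e * monomial L (\<lambda>i m. F i c ^ m) (Suc n) e) = 0)"
proof -
 define M where "M = Suc n * (k + K)"
 \<comment> \<open>Then \<open>L ^ (n + 1)\<close> exceeds \<open>(L * (M + 1)) ^ n\<close>, an upper bound for the size of the grid.\<close>
 define L where "L = (M + 1) ^ n + 1"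
 have L0: "L > 0" by (simp add: L_def)
 define q where "q c i m = G i c ^ m * c (n - 1) ^ (K * (L - m))" for c :: "nat => complex" and i m
 have qd: "pdeg (L * M) (\<lambda>c. monomial L (q c) (Suc n) e)" if "e < L ^ Suc n" for e
 proof -
  have 1: "pdeg (L * (k + K)) (\<lambda>c. q c i m)" if im: "i < Suc n" "m < L" for i m
  proof -
   have "pdeg (m * k + K * (L - m) * 1) (\<lambda>c. q c i m)" unfolding q_def
    by (intro pdeg_mult pdeg_power G pdeg_coord) (use im in simp)
   moreover have "m * k \<le> L * k" "K * (L - m) * 1 \<le> K * L" using im by (simp_all del: mult_le_cancel1)
   ultimately show ?thesis by (elim pdeg_le) (simp only: add_mult_distrib2 mult.commute[of K L] add_mono)
  qed
  have "pdeg (Suc n * (L * (k + K))) (\<lambda>c. monomial L (q c) (Suc n) e)" by (rule monomial_pdeg[OF 1 that])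
  moreover have "Suc n * (L * (k + K)) = L * M" unfolding M_def by (simp only: mult.assoc mult.left_commute)
  ultimately show ?thesis by simp
 qed
 define grid :: "(nat => complex) set" where
  "grid = (\<lambda>g i. if i < n then of_nat (g i) else 0) ` (PiE {..<n} (\<lambda>_. {..L * M}))"
 have fin: "finite (PiE {..<n} (\<lambda>_. {..L * M}))" by (intro finite_PiE) auto
 have "card grid \<le> (L * M + 1) ^ n" unfolding grid_def using card_image_le[OF fin] by (simp add: card_PiE)
 also have "\<dots> \<le> (L * (M + 1)) ^ n" using L0 by (intro power_mono) auto
 also have "\<dots> = L ^ n * (M + 1) ^ n" by (rule power_mult_distrib)
 also have "\<dots> < L ^ n * L" using L0 by (simp add: L_def)
 finally have cg: "card grid < card {..<L ^ Suc n}" by (simp add: mult.commute)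
 have fg: "finite grid" unfolding grid_def using fin by simp
 obtain a where a: "\<exists>e\<in>{..<L ^ Suc n}. a e \<noteq> 0" "\<forall>c\<in>grid. (\<Sum>e<L ^ Suc n. a e * monomial L (q c) (Suc n) e) = 0"
  using homogeneous_system[OF fg _ cg, of "\<lambda>e c. monomial L (q c) (Suc n) e"] by auto
 have z: "(\<Sum>e<L ^ Suc n. a e * monomial L (q c) (Suc n) e) = 0" if c: "\<forall>i\<ge>n. c i = 0" for c
 proof (rule grid_vanish[where F = "\<lambda>c. (\<Sum>e<L ^ Suc n. a e * monomial L (q c) (Suc n) e)", OF _ _ c])
  show "pdeg (L * M) (\<lambda>c. \<Sum>e<L ^ Suc n. a e * monomial L (q c) (Suc n) e)"
  proof (rule pdeg_sum)
   fix e assume "e \<in> {..<L ^ Suc n}"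
   then show "pdeg (L * M) (\<lambda>c. a e * monomial L (q c) (Suc n) e)"
    using pdeg_mult[OF pdeg_const[of 0 "a e"] qd[of e]] by simp
  qed
  fix c :: "nat => complex" assume c: "\<forall>i<n. c i \<in> of_nat ` {..L * M}" "\<forall>i\<ge>n. c i = 0"
  then obtain g where g: "\<forall>i<n. g i \<le> L * M \<and> c i = of_nat (g i)" unfolding image_iff by (metis atMost_iff)
  have "c = (\<lambda>i. if i < n then of_nat (restrict g {..<n} i) else 0)" using g c(2) by (auto simp: fun_eq_iff)
  moreover have "restrict g {..<n} \<in> PiE {..<n} (\<lambda>_. {..L * M})" using g by auto
  ultimately have "c \<in> grid" unfolding grid_def by blast
  then show "(\<Sum>e<L ^ Suc n. a e * monomial L (q c) (Suc n) e) = 0" using a(2) by blast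
 qed
 have "(\<Sum>e<L ^ Suc n. a e * monomial L (\<lambda>i m. F i c ^ m) (Suc n) e) = 0" if c: "c (n - 1) \<noteq> 0" "\<forall>i\<ge>n. c i = 0" for c
 proof -
  let ?w = "c (n - 1) ^ (K * L)"
  have "F i c ^ m * ?w = q c i m" if "i < Suc n" "m < L" for i m
  proof -
   have "K * L = K * m + K * (L - m)" using that by (simp flip: add_mult_distrib2)
   then have "F i c ^ m * ?w = (F i c * c (n-1) ^ K) ^ m * c (n-1) ^ (K * (L - m))"
    by (simp only: power_add power_mult_distrib power_mult) (simp add: mult.assoc)
   also have "\<dots> = q c i m" using FG[of i c] that c by (simp add: q_def)
   finally show ?thesis .
  qed
  then have "monomial L (\<lambda>i m. F i c ^ m) (Suc n) e * ?w ^ Suc n = monomial L (q c) (Suc n) e" if "e < L ^ Suc n" for e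
   by (rule monomial_scale) (use that in auto)
  then have "(\<Sum>e<L ^ Suc n. a e * monomial L (\<lambda>i m. F i c ^ m) (Suc n) e) * ?w ^ Suc n = (\<Sum>e<L ^ Suc n. a e * monomial L (q c) (Suc n) e)"
   unfolding sum_distrib_right by (intro sum.cong refl) (simp only: lessThan_iff mult.assoc)
  then show ?thesis using z[OF c(2)] c(1) by simp
 qed
 note vanish = this
 show ?thesis by (rule exI[of _ L], rule conjI[OF L0], rule exI[of _ a], rule conjI) (use a(1) vanish in blast)+
qed

section \<open>Krull dimension of a component with a normal form\<close>

text \<open>The invariant \<open>f\<close> notices when the parameter \<open>c j\<close>, frozen at \<open>c0 j\<close> together with all later
 ones, is set free.\<close>
definition releases :: "nat => ((nat => complex) => rep) => (nat => complex) => nat => (rep => complex) => bool" where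
 "releases n N c0 j f \<longleftrightarrow> f \<in> invariant_fun n \<and> (\<forall>c. (\<forall>i. j \<le> i --> i < n - 1 --> c i = c0 i) --> f (N c) = 0) \<and>
   (\<exists>c. (\<forall>i. j < i --> i < n - 1 --> c i = c0 i) \<and> f (N c) \<noteq> 0)"

text \<open>The parameters of the family are \<open>c 0, ..., c (n - 2)\<close>. The coordinate \<open>c (n - 1)\<close>, on which
 the matrices do not depend, is reserved for the scalar.\<close>
locale normal_form = cube_root +
 fixes n :: nat and \<alpha> :: dim_vec5 and NS NT :: "(nat => complex) => complex mat"
 assumes npos: "n > 0"
  and NS_polys: "NS \<in> matfun polys n n" and NT_polys: "NT \<in> matfun polys n n"
  and N_gamma: "gamma_pair n (NS c) (NT c)" and N_dim: "dim_vector \<rho> (stp (NS c) (NT c)) = \<alpha>"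
  and N_local: "(\<And>i. i < n - 1 ==> c i = c' i) ==> NS c = NS c' \<and> NT c = NT c'"
  and N_generic: "\<exists>g\<in>regular_fun n. (\<exists>\<phi>\<in>FG n \<alpha>. g \<phi> \<noteq> 0) \<and>
   (\<forall>\<phi>\<in>FG n \<alpha>. g \<phi> \<noteq> 0 --> (\<exists>c. rep_iso \<phi> (stp (NS c) (NT c))))"
  and N_flag: "\<exists>c0. simple_rep n (stp (NS c0) (NT c0)) \<and> (\<forall>j<n - 1. \<exists>f. releases n (\<lambda>c. stp (NS c) (NT c)) c0 j f)"
begin

abbreviation N :: "(nat => complex) => rep" where "N c \<equiv> stp (NS c) (NT c)"

lemma N_FG: "N c \<in> FG n \<alpha>"
 unfolding FG_def using N_gamma N_dim by blast

lemma N_rep: "N c \<in> rep_B3 n" by (rule FG_rep[OF N_FG])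

lemma N_entries:
 "(\<lambda>c. fst (N c)) \<in> matfun polys n n" "(\<lambda>c. snd (N c)) \<in> matfun polys n n"
proof -
 note M = matfun_mult[OF subalg_polys, of _ n n _ n]
 show "(\<lambda>c. fst (N c)) \<in> matfun polys n n" unfolding stp_def fst_conv
  by (rule M[OF NT_polys M[OF NT_polys NS_polys]])
 show "(\<lambda>c. snd (N c)) \<in> matfun polys n n" unfolding stp_def snd_conv
  by (rule M[OF NS_polys M[OF NT_polys NT_polys]])
qed

lemma N_inverse_det:
 "inverse (det (fst (N c))) = det (NS c) * det (NT c)" "inverse (det (snd (N c))) = det (NS c) * det (NT c)"
 using stp_rep(5,6)[OF N_gamma, of c] by (simp_all add: inverse_unique)

lemma N_det_polys: "(\<lambda>c. det (NS c) * det (NT c)) \<in> polys"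
 by (rule subalg_mult[OF subalg_polys matfun_det[OF subalg_polys NS_polys] matfun_det[OF subalg_polys NT_polys]])

lemma N_regular: "f \<in> regular_fun n ==> (\<lambda>c. f (N c)) \<in> polys"
 by (rule regular_compose[OF subalg_polys]) (use N_entries N_det_polys in \<open>auto simp: N_inverse_det dest: matfunD(2)\<close>)

text \<open>The inverse determinants contribute negative powers of the scalar.\<close>
lemma scaled_N_regular:
 assumes f: "f \<in> regular_fun n"
 shows "\<exists>K. \<exists>G\<in>polys. \<forall>c. c (n - 1) \<noteq> 0 --> f (scale_rep (c (n - 1)) (N c)) * c (n - 1) ^ K = G c"
proof -
 let ?R = "{F. \<exists>K. \<exists>G\<in>polys. \<forall>c. c (n - 1) \<noteq> 0 --> F c * c (n - 1) ^ K = G c}"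
 have R: "subalg ?R" unfolding subalg_def
 proof (intro conjI allI ballI)
  show "(\<lambda>_. c) \<in> ?R" for c
   by (intro CollectI exI[of _ 0] bexI[of _ "\<lambda>_. c"]) (auto intro: subalg_const[OF subalg_polys])
  fix F F' assume "F \<in> ?R" "F' \<in> ?R"
  then obtain K G K' G' where h: "G \<in> polys" "G' \<in> polys" "\<And>c. c (n - 1) \<noteq> 0 ==> F c * c (n - 1) ^ K = G c"
   "\<And>c. c (n - 1) \<noteq> 0 ==> F' c * c (n - 1) ^ K' = G' c" by blast
  have p: "(\<lambda>c. G c * c (n-1) ^ K' + G' c * c (n-1) ^ K) \<in> polys"
   by (intro subalg_add[OF subalg_polys] subalg_mult[OF subalg_polys] h subalg_power[OF subalg_polys] polys_coord)
  have "(F c + F' c) * c (n-1) ^ (K + K') = G c * c (n-1) ^ K' + G' c * c (n-1) ^ K" if "c (n - 1) \<noteq> 0" for c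
   unfolding h(3)[of c, OF that, symmetric] h(4)[of c, OF that, symmetric] by (simp only: power_add distrib_right mult_ac)
  then show "(\<lambda>x. F x + F' x) \<in> ?R"
   by (intro CollectI exI[of _ "K + K'"] bexI[OF _ p]) blast
  have p2: "(\<lambda>c. G c * G' c) \<in> polys" by (intro subalg_mult[OF subalg_polys] h)
  have "(F c * F' c) * c (n-1) ^ (K + K') = G c * G' c" if "c (n - 1) \<noteq> 0" for c
   unfolding h(3)[of c, OF that, symmetric] h(4)[of c, OF that, symmetric] by (simp only: power_add mult_ac)
  then show "(\<lambda>x. F x * F' x) \<in> ?R"
   by (intro CollectI exI[of _ "K + K'"] bexI[OF _ p2]) blast
 qed
 have P: "F \<in> ?R" if "F \<in> polys" for F
  by (intro CollectI exI[of _ 0] bexI[OF _ that]) simp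
 have E: "(\<lambda>c. (c (n-1) \<cdot>\<^sub>m M c) $$ (i,j)) \<in> ?R" if "M \<in> matfun polys n n" "i < n" "j < n" for M :: "(nat => complex) => complex mat" and i j
  by (rule P) (rule matfunD(2)[OF matfun_smult[OF subalg_polys polys_coord that(1)] that(2,3)])
 have D: "(\<lambda>c. inverse (det (c (n-1) \<cdot>\<^sub>m M c))) \<in> ?R"
  if M: "M \<in> matfun polys n n" "\<And>c. inverse (det (M c)) = det (NS c) * det (NT c)" for M
 proof -
  have "inverse (det (c (n-1) \<cdot>\<^sub>m M c)) * c (n-1) ^ n = det (NS c) * det (NT c)" if c: "c (n - 1) \<noteq> 0" for c
   using c M(2)[of c] matfunD(1)[OF M(1), of c] by (simp add: det_smult)
  then show ?thesis by (intro CollectI exI[of _ n] bexI[OF _ N_det_polys]) blast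
 qed
 have "(\<lambda>c. f (scale_rep (c (n - 1)) (N c))) \<in> ?R"
  by (rule regular_compose[OF R f]) (simp_all only: scale_rep_def fst_conv snd_conv E[OF N_entries(1)] E[OF N_entries(2)]
    D[OF N_entries(1) N_inverse_det(1)] D[OF N_entries(2) N_inverse_det(2)])
 then show ?thesis by simp
qed

text \<open>The relation found on the normal forms holds on a dense part of the family, hence everywhere;
 the scalar is treated as fixed in this step.\<close>
lemma invariants_dependent:
 assumes f: "\<And>i. i \<le> n ==> f i \<in> invariant_fun n"
 shows "\<exists>L>0. \<exists>a. (\<exists>e<L ^ Suc n. a e \<noteq> 0) \<and>
  (\<forall>\<phi>\<in>FS n \<alpha>. (\<Sum>e<L ^ Suc n. a e * monomial L (\<lambda>i m. f i \<phi> ^ m) (Suc n) e) = 0)"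
proof -
 have fr: "f i \<in> regular_fun n" if "i \<le> n" for i using f[OF that] unfolding invariant_fun_def by blast
 obtain K G where KG: "\<And>i. i \<le> n ==> G i \<in> polys"
  "\<And>i c. i \<le> n ==> c (n - 1) \<noteq> 0 ==> f i (scale_rep (c (n - 1)) (N c)) * c (n - 1) ^ K i = G i c"
  using scaled_N_regular[OF fr] by metis
 define K' where "K' = (\<Sum>i\<le>n. K i)"
 have Kle: "K i \<le> K'" if "i \<le> n" for i unfolding K'_def using that by (intro member_le_sum) auto
 define G' where "G' i c = G i c * c (n-1) ^ (K' - K i)" for i c
 have G': "G' i \<in> polys" if "i \<le> n" for i unfolding G'_def[abs_def]
  by (intro subalg_mult[OF subalg_polys] subalg_power[OF subalg_polys] polys_coord KG that)
 then obtain k where k: "\<And>i. i \<le> n ==> pdeg (k i) (G' i)" unfolding polys_def by (simp only: mem_Collect_eq) metis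
 have kle: "k i \<le> (\<Sum>i\<le>n. k i)" if "i \<le> n" for i using that by (intro member_le_sum) auto
 have FK: "f i (scale_rep (c (n - 1)) (N c)) * c (n - 1) ^ K' = G' i c" if "i \<le> n" "c (n - 1) \<noteq> 0" for i c
 proof -
  have "K' = K i + (K' - K i)" using Kle[OF that(1)] by simp
  then have "c (n-1) ^ K' = c (n-1) ^ K i * c (n-1) ^ (K' - K i)" by (metis power_add)
  then show ?thesis using KG(2)[of i c, OF that] by (simp add: G'_def flip: mult.assoc)
 qed
 obtain L a where L: "L > 0" "\<exists>e<L ^ Suc n. a e \<noteq> 0" and z: "\<And>c. c (n - 1) \<noteq> 0 ==> \<forall>i\<ge>n. c i = 0 ==>
   (\<Sum>e<L ^ Suc n. a e * monomial L (\<lambda>i m. f i (scale_rep (c (n - 1)) (N c)) ^ m) (Suc n) e) = 0"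
  using polys_dependent[of n "\<Sum>i\<le>n. k i" G' "\<lambda>i c. f i (scale_rep (c (n - 1)) (N c))" K', OF pdeg_le[OF k kle] FK] by blast
 define h where "h \<phi> = (\<Sum>e<L ^ Suc n. a e * monomial L (\<lambda>i m. f i \<phi> ^ m) (Suc n) e)" for \<phi>
 have hi: "h \<in> invariant_fun n" unfolding h_def[abs_def]
  by (intro subalg_sum[OF subalg_invariant] subalg_mult[OF subalg_invariant] subalg_const[OF subalg_invariant]
    monomial_subalg[OF subalg_invariant] subalg_power[OF subalg_invariant] f) auto
 then have hr: "h \<in> regular_fun n" unfolding invariant_fun_def by blast
 obtain g \<psi> where g: "g \<in> regular_fun n" "\<psi> \<in> FG n \<alpha>" "g \<psi> \<noteq> 0" "\<And>\<phi>. \<phi> \<in> FG n \<alpha> ==> g \<phi> \<noteq> 0 ==> \<exists>c. rep_iso \<phi> (N c)"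
  using N_generic by blast
 have hz: "h (scale_rep \<mu> \<phi>) = 0" if m: "\<mu> \<noteq> 0" and ph: "\<phi> \<in> FG n \<alpha>" for \<mu> \<phi>
 proof -
  obtain g' where g': "g' \<in> regular_fun n" "\<And>\<phi>. \<phi> \<in> rep_B3 n ==> h (scale_rep \<mu> \<phi>) = g' \<phi>"
   using scale_regular[OF hr m] by blast
  have "g' \<phi> = 0"
  proof (rule FG_density[OF g(2,1,3) g'(1) _ ph])
   fix \<chi> assume x: "\<chi> \<in> FG n \<alpha>" "g \<chi> \<noteq> 0"
   obtain c where c: "rep_iso \<chi> (N c)" using g(4)[OF x] by blast
   define c' where "c' i = (if i < n - 1 then c i else if i = n - 1 then \<mu> else 0)" for i
   have N: "N c' = N c" using N_local[of c' c] by (auto simp: c'_def)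
   have "\<forall>i\<ge>n. c' i = 0" "c' (n - 1) = \<mu>" using npos by (auto simp: c'_def)
   then have "h (scale_rep \<mu> (N c')) = 0" using z[of c'] m unfolding h_def by simp
   moreover have "h (scale_rep \<mu> \<chi>) = h (scale_rep \<mu> (N c'))"
    using hi scale_iso[OF c, of \<mu>] scale_rep_B3[OF FG_rep[OF x(1)] m] scale_rep_B3[OF N_rep m] unfolding N invariant_fun_def by blast
   ultimately show "g' \<chi> = 0" using g'(2)[OF FG_rep[OF x(1)]] by simp
  qed
  then show ?thesis using g'(2)[OF FG_rep[OF ph]] by simp
 qed
 have "h \<phi> = 0" if "\<phi> \<in> FS n \<alpha>" for \<phi> using that hz unfolding FS_def by blast
 then show ?thesis using L unfolding h_def by blast
qed

lemma iss_comp_closed: "closedin (zariski_iss n) (iss_comp \<rho> n \<alpha>)"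
 unfolding iss_comp_def by (rule closedin_closure_of)

lemma chain_length_le:
 assumes Z: "\<And>i. i \<le> d ==> closedin (subtopology (zariski_iss n) (iss_comp \<rho> n \<alpha>)) (Z i)"
   "\<And>i. i \<le> d ==> irreducible_in (subtopology (zariski_iss n) (iss_comp \<rho> n \<alpha>)) (Z i)"
  and lt: "\<And>i. i < d ==> Z i \<subset> Z (Suc i)"
 shows "d \<le> n"
proof (rule ccontr)
 assume "\<not> d \<le> n"
 then have d: "Suc n \<le> d" by simp
 let ?X = "iss_comp \<rho> n \<alpha>" let ?T = "zariski_iss n"
 have ZC: "closedin ?T (Z i)" "Z i \<subseteq> ?X" if "i \<le> d" for i
  using Z(1)[OF that] closedin_closed_subtopology[OF iss_comp_closed] by blast+
 have Zi: "C \<in> iss_B3 n" if "C \<in> Z i" "i \<le> d" for C i using ZC(1)[OF that(2)] that(1) closedin_subset by fastforce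
 have "\<exists>f\<in>invariant_fun n. (\<exists>C\<in>Z (Suc i). \<not> vanishes f C) \<and> (\<forall>D\<in>Z i. vanishes f D)" if i: "i < d" for i
 proof -
  obtain C where C: "C \<in> Z (Suc i)" "C \<notin> Z i" using lt[OF i] by blast
  show ?thesis using closed_separate[OF ZC(1) Zi[OF C(1)] C(2)] i C(1) by auto
 qed
 then obtain f where f: "\<And>i. i < d ==> f i \<in> invariant_fun n" "\<And>i. i < d ==> \<exists>C\<in>Z (Suc i). \<not> vanishes (f i) C"
  "\<And>i. i < d ==> \<forall>D\<in>Z i. vanishes (f i) D" by metis
 have prime: "(\<forall>x\<in>\<Union>(Z i). g x = 0) \<or> (\<forall>x\<in>\<Union>(Z i). h x = 0)"
  if i: "i \<le> d" and gh: "g \<in> invariant_fun n" "h \<in> invariant_fun n" "\<forall>x\<in>\<Union>(Z i). g x * h x = 0" for i g h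
 proof -
  have cl: "closedin (subtopology ?T ?X) ({C \<in> iss_B3 n. vanishes g C} \<inter> ?X)" if g: "g \<in> invariant_fun n" for g
  proof -
   have "{C \<in> iss_B3 n. vanishes g C} = topspace ?T - {C \<in> iss_B3 n. \<not> vanishes g C}" by auto
   then have "closedin ?T {C \<in> iss_B3 n. vanishes g C}" using openin_nonvanishing[OF g] by (simp only:) blast
   then show ?thesis unfolding closedin_closed_subtopology[OF iss_comp_closed] using iss_comp_closed by blast
  qed
  have "Z i \<subseteq> ({C \<in> iss_B3 n. vanishes g C} \<inter> ?X) \<union> ({C \<in> iss_B3 n. vanishes h C} \<inter> ?X)"
  proof
   fix C assume C: "C \<in> Z i"
   note Ci = Zi[OF C i]
   obtain \<phi> where ph: "\<phi> \<in> C" using issE[OF Ci] by metis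
   have "vanishes g C \<or> vanishes h C"
    using nonvanishing_iff[OF gh(1) Ci] nonvanishing_iff[OF gh(2) Ci] gh(3) C ph by (metis UnionI mult_eq_0_iff)
   then show "C \<in> ({C \<in> iss_B3 n. vanishes g C} \<inter> ?X) \<union> ({C \<in> iss_B3 n. vanishes h C} \<inter> ?X)" using Ci C ZC(2)[OF i] by blast
  qed
  then have "Z i \<subseteq> {C \<in> iss_B3 n. vanishes g C} \<inter> ?X \<or> Z i \<subseteq> {C \<in> iss_B3 n. vanishes h C} \<inter> ?X"
   using Z(2)[OF i] cl[OF gh(1)] cl[OF gh(2)] unfolding irreducible_in_def by blast
  then show ?thesis unfolding vanishes_def by blast
 qed
 have ne: "\<Union>(Z 0) \<noteq> {}"
 proof -
  obtain C where C: "C \<in> Z 0" using Z(2)[of 0] unfolding irreducible_in_def by blast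
  obtain \<phi> where "\<phi> \<in> C" by (rule issE[OF Zi[OF C le0]])
  then show ?thesis using C by blast
 qed
 obtain L a where L: "L > 0" "\<exists>e<L ^ Suc n. a e \<noteq> 0"
  "\<And>\<phi>. \<phi> \<in> FS n \<alpha> ==> (\<Sum>e<L ^ Suc n. a e * monomial L (\<lambda>i m. f i \<phi> ^ m) (Suc n) e) = 0"
 proof -
  have "f i \<in> invariant_fun n" if "i \<le> n" for i using f(1) that d by simp
  from invariants_dependent[of f, OF this] that show thesis by blast
 qed
 have hi: "(\<lambda>\<phi>. \<Sum>e<L ^ Suc n. a e * monomial L (\<lambda>i m. f i \<phi> ^ m) (Suc n) e) \<in> invariant_fun n"
  using d by (intro subalg_sum[OF subalg_invariant] subalg_mult[OF subalg_invariant] subalg_const[OF subalg_invariant]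
    monomial_subalg[OF subalg_invariant] subalg_power[OF subalg_invariant] f) auto
 have "\<forall>x\<in>\<Union>(Z (Suc n)). (\<Sum>e<L ^ Suc n. a e * monomial L (\<lambda>i m. f i x ^ m) (Suc n) e) = 0"
  using iss_comp_vanish[OF hi L(3)] ZC(2)[OF d] unfolding vanishes_def by blast
 note top = this
 have 1: "\<Union>(Z i) \<subseteq> \<Union>(Z (Suc i))" if "i < d" for i using lt[OF that] by blast
 have 2: "f i x = 0" if "i < d" "x \<in> \<Union>(Z i)" for i x using f(3)[OF that(1)] that(2) unfolding vanishes_def by blast
 have 3: "\<exists>x\<in>\<Union>(Z (Suc i)). f i x \<noteq> 0" if "i < d" for i using f(2)[OF that] unfolding vanishes_def by blast
 have "a e = 0" if "e < L ^ Suc n" for e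
  by (rule chain_independent[where R = "invariant_fun n" and f = f and Y = "\<lambda>i. \<Union>(Z i)" and d = d and a = a and L = L and j = "Suc n" and e = e,
     OF subalg_invariant f(1) 1 ne prime 2 3 L(1) d top that])
 then show False using L(2) by blast
qed

text \<open>The chain consists of the closures of the simple \<open>N c\<close> whose parameters from index \<open>j\<close> on are
 frozen, for \<open>j < n\<close>, followed by the whole component. In the last step the central element \<open>(X
 Y)\<^sup>3\<close>, which has trace \<open>n\<close> on all \<open>N c\<close>, detects the scalar.\<close>
lemma chain_exists:
 "\<exists>Z. (\<forall>i\<le>n. closedin (subtopology (zariski_iss n) (iss_comp \<rho> n \<alpha>)) (Z i) \<and>
   irreducible_in (subtopology (zariski_iss n) (iss_comp \<rho> n \<alpha>)) (Z i)) \<and> (\<forall>i<n. Z i \<subset> Z (Suc i))"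
proof -
 let ?X = "iss_comp \<rho> n \<alpha>" let ?T = "zariski_iss n"
 obtain c0 f where c0: "simple_rep n (N c0)" and f: "\<And>j. j < n - 1 ==> f j \<in> invariant_fun n"
  "\<And>j c. j < n - 1 ==> \<forall>i. j \<le> i --> i < n - 1 --> c i = c0 i ==> f j (N c) = 0"
  "\<And>j. j < n - 1 ==> \<exists>c. (\<forall>i. j < i --> i < n - 1 --> c i = c0 i) \<and> f j (N c) \<noteq> 0"
 proof -
  obtain c0 where c: "simple_rep n (N c0)" and c2: "\<forall>j<n - 1. \<exists>f. releases n N c0 j f"
   using N_flag by (elim exE conjE) (rule that)
  then have "\<forall>j. \<exists>f. j < n - 1 --> releases n N c0 j f" by blast
  from choice[OF this] obtain f where f: "\<forall>j. j < n - 1 --> releases n N c0 j (f j)" ..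
  show thesis by (rule that[of c0 f, OF c]) (use f in \<open>simp_all add: releases_def\<close>)
 qed
 define L where "L j = {c. \<forall>i. j \<le> i --> i < n - 1 --> c i = c0 i}" for j
 define G where "G j = {N c | c. c \<in> L j \<and> simple_rep n (N c)}" for j
 have GFS: "G j \<subseteq> FS n \<alpha>" for j unfolding G_def using FG_FS[OF N_FG] by blast
 have Gs: "\<phi> \<in> G j ==> simple_rep n \<phi>" for \<phi> j unfolding G_def by blast
 have Gi: "iso_class n ` G j \<subseteq> iss_B3 n" for j using GFS FS_iss by blast
 have G0: "N c0 \<in> G j" for j unfolding G_def L_def using c0 by blast
 have gen: "\<exists>\<chi>\<in>G j. g \<chi> \<noteq> 0 \<and> h \<chi> \<noteq> 0"
  if gh: "g \<in> invariant_fun n" "h \<in> invariant_fun n" and c: "c \<in> L j" "c' \<in> L j" "simple_rep n (N c')" "g (N c) \<noteq> 0" "h (N c') \<noteq> 0" for j g h c c'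
 proof -
  obtain s where s: "s \<in> regular_fun n" "s (N c') \<noteq> 0" "\<forall>\<psi>\<in>rep_B3 n. s \<psi> \<noteq> 0 --> simple_rep n \<psi>"
   using simple_open[OF c(3)] by blast
  have r: "g \<in> regular_fun n" "(\<lambda>x. h x * s x) \<in> regular_fun n"
   using gh s(1) unfolding invariant_fun_def by (auto intro: regular_fun.mult)
  obtain t where t: "g (N (\<lambda>i. c i + t * (c' i - c i))) \<noteq> 0" "h (N (\<lambda>i. c i + t * (c' i - c i))) * s (N (\<lambda>i. c i + t * (c' i - c i))) \<noteq> 0"
   using polys_generic[OF N_regular[OF r(1)] c(4) N_regular[OF r(2)], of c' "{}"] c(5) s(2) by auto
  moreover have "(\<lambda>i. c i + t * (c' i - c i)) \<in> L j" using c(1,2) unfolding L_def by auto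
  ultimately show ?thesis using s(3) N_rep unfolding G_def by (intro bexI[of _ "N (\<lambda>i. c i + t * (c' i - c i))"]) auto
 qed
 have irr: "irreducible_in ?T (?T closure_of (iso_class n ` G j))" for j
 proof (rule irreducible_family[OF _ Gs])
  show "G j \<noteq> {}" using G0 by blast
  fix g h \<phi> \<psi> assume "g \<in> invariant_fun n" "h \<in> invariant_fun n" "\<phi> \<in> G j" "\<psi> \<in> G j" "g \<phi> \<noteq> 0" "h \<psi> \<noteq> 0"
  then show "\<exists>\<chi>\<in>G j. g \<chi> \<noteq> 0 \<and> h \<chi> \<noteq> 0" using gen unfolding G_def by blast
 qed
 define Z where "Z j = (if j < n then ?T closure_of (iso_class n ` G j) else ?X)" for j
 have ZX: "Z j \<subseteq> ?X" for j unfolding Z_def iss_comp_FS by (cases "j < n") (simp_all add: closure_of_mono[OF image_mono[OF GFS]])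
 have FSne: "FS n \<alpha> \<noteq> {}" using G0 GFS by blast
 have Zc: "closedin ?T (Z j)" for j unfolding Z_def using iss_comp_closed by auto
 have Zirr: "irreducible_in ?T (Z j)" for j unfolding Z_def using irr iss_comp_irreducible[OF FSne] by auto
 have "irreducible_in (subtopology ?T ?X) (Z j)" for j
 proof -
  have "A \<inter> ?X = A" "closedin ?T A" if "closedin (subtopology ?T ?X) A" for A
   using that unfolding closedin_closed_subtopology[OF iss_comp_closed] by blast+
  note cl = this
  show ?thesis unfolding irreducible_in_def topspace_subtopology
  proof (intro conjI allI impI)
   show "Z j \<subseteq> topspace ?T \<inter> ?X" "Z j \<noteq> {}" using Zirr[of j] ZX[of j] unfolding irreducible_in_def by simp_all
   fix A B assume "closedin (subtopology ?T ?X) A \<and> closedin (subtopology ?T ?X) B \<and> Z j \<subseteq> A \<union> B"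
   then show "Z j \<subseteq> A \<or> Z j \<subseteq> B" using Zirr[of j] cl(2) unfolding irreducible_in_def by simp
  qed
 qed
 moreover have "closedin (subtopology ?T ?X) (Z j)" for j
  unfolding closedin_closed_subtopology[OF iss_comp_closed] using Zc ZX by blast
 moreover have "Z j \<subset> Z (Suc j)" if j: "j < n" for j
 proof (cases "Suc j < n")
  case True
  then have j1: "j < n - 1" by simp
  have "L j \<subseteq> L (Suc j)" unfolding L_def by auto
  then have "Z j \<subseteq> Z (Suc j)" unfolding Z_def using True j by (auto simp: G_def intro!: closure_of_mono image_mono)
  moreover have "Z j \<noteq> Z (Suc j)"
  proof -
   obtain c where c: "c \<in> L (Suc j)" "f j (N c) \<noteq> 0" using f(3)[OF j1] unfolding L_def by (auto simp: Suc_le_eq)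
   have "c0 \<in> L (Suc j)" unfolding L_def by simp
   then obtain \<chi> where x: "\<chi> \<in> G (Suc j)" "f j \<chi> \<noteq> 0"
    using gen[OF f(1)[OF j1] subalg_const[OF subalg_invariant, of 1] c(1) _ c0 c(2)] by auto
   note xr = simple_repD(3)[OF Gs[OF x(1)]]
   have "iso_class n \<chi> \<in> Z (Suc j)" unfolding Z_def using True closure_of_subset[OF Gi[of "Suc j", folded topspace_zariski]] x(1) by auto
   moreover have "iso_class n \<chi> \<notin> Z j"
   proof
    assume "iso_class n \<chi> \<in> Z j"
    moreover have "\<forall>D\<in>iso_class n ` G j. vanishes (f j) D"
     using f(2)[OF j1] vanishes_class(1)[OF f(1)[OF j1] N_rep] unfolding G_def L_def by auto
    ultimately have "vanishes (f j) (iso_class n \<chi>)" unfolding Z_def using j closure_iff[OF Gi] f(1)[OF j1] by auto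
    then show False using vanishes_class(1)[OF f(1)[OF j1] xr] x(2) by simp
   qed
   ultimately show ?thesis by blast
  qed
  ultimately show ?thesis by blast
 next
  case False
  define F where "F \<phi> = ntrn n (NMul (NMul NX NY) (NMul (NMul NX NY) (NMul NX NY))) \<phi> - of_nat n" for \<phi>
  have Fi: "F \<in> invariant_fun n" unfolding F_def[abs_def]
   by (intro subalg_diff[OF subalg_invariant] ntrn_invariant subalg_const[OF subalg_invariant])
  have nT: "nev n (N c) (NMul NX NY) = NT c" for c
   using stp_rep(2)[OF N_gamma, of c] nev_gen[OF stp_rep(4)[OF N_gamma]] by (simp add: repT_def)
  have FN: "F (N c) = 0" for c
   unfolding F_def ntrn_def nev.simps(5)[of n "N c" "NMul NX NY"] nT unfolding nev.simps(5)[of n "N c" "NMul NX NY"] nT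
   using gamma_pairD(4)[OF N_gamma, of c] by simp
  \<comment> \<open>Scaling by \<open>2\<close> multiplies \<open>(X Y)\<^sup>3\<close> by \<open>64\<close>.\<close>
  let ?\<psi> = "scale_rep 2 (N c0)"
  have p: "?\<psi> \<in> FS n \<alpha>" unfolding FS_def
   by (rule CollectI, rule exI[of _ 2], rule exI[of _ "N c0"]) (simp add: N_FG c0)
  have "F ?\<psi> \<noteq> 0"
  proof -
   have TC: "NT c0 \<in> mats n" by (rule gamma_pairD(2)[OF N_gamma])
   have XC: "fst (N c0) \<in> mats n" "snd (N c0) \<in> mats n" using stp_rep(4)[OF N_gamma, of c0] by auto
   have "nev n ?\<psi> (NMul NX NY) = (2 \<cdot>\<^sub>m fst (N c0)) * (2 \<cdot>\<^sub>m snd (N c0))"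
    unfolding nev.simps(5) nev_gen[OF scale_pairs[OF stp_rep(4)[OF N_gamma]]] by (simp add: scale_rep_def)
   also have "\<dots> = 4 \<cdot>\<^sub>m NT c0" unfolding smult_mult_smult[OF XC] using stp_rep(2)[OF N_gamma, of c0] by (simp add: repT_def)
   finally have e: "nev n ?\<psi> (NMul NX NY) = 4 \<cdot>\<^sub>m NT c0" .
   have "NT c0 * NT c0 \<in> mats n" using TC by simp
   then have "4 \<cdot>\<^sub>m NT c0 * (4 \<cdot>\<^sub>m NT c0 * (4 \<cdot>\<^sub>m NT c0)) = 64 \<cdot>\<^sub>m 1\<^sub>m n"
    unfolding smult_mult_smult[OF TC TC] by (simp add: smult_mult_smult[OF TC] gamma_pairD(4)[OF N_gamma])
   then have "F ?\<psi> = 64 * of_nat n - of_nat n"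
    unfolding F_def ntrn_def nev.simps(5)[of n ?\<psi> "NMul NX NY"] e unfolding nev.simps(5)[of n ?\<psi> "NMul NX NY"] e
    by (simp add: mtr_smult[of _ n])
   then show ?thesis using npos by simp
  qed
  note pr = simple_repD(3)[OF FS_simple[OF p]]
  have "iso_class n ?\<psi> \<notin> Z j"
  proof
   assume "iso_class n ?\<psi> \<in> Z j"
   moreover have "\<forall>D\<in>iso_class n ` G j. vanishes F D"
    using FN vanishes_class(1)[OF Fi N_rep] unfolding G_def by auto
   ultimately have "vanishes F (iso_class n ?\<psi>)" unfolding Z_def using j closure_iff[OF Gi] Fi by auto
   then show False using vanishes_class(1)[OF Fi pr] \<open>F ?\<psi> \<noteq> 0\<close> by simp
  qed
  moreover have "Z (Suc j) = ?X" using False by (simp add: Z_def)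
  ultimately show ?thesis using ZX[of j] FS_comp[OF p] by blast
 qed
 ultimately show ?thesis by (intro exI[of _ Z]) blast
qed

lemma krull_dim_eq: "krull_dim (subtopology (zariski_iss n) (iss_comp \<rho> n \<alpha>)) = enat n"
proof -
 let ?P = "\<lambda>d Z. (\<forall>i\<le>d. closedin (subtopology (zariski_iss n) (iss_comp \<rho> n \<alpha>)) (Z i) \<and>
   irreducible_in (subtopology (zariski_iss n) (iss_comp \<rho> n \<alpha>)) (Z i)) \<and> (\<forall>i<d. Z i \<subset> Z (Suc i))"
 obtain Z where Z: "?P n Z" using chain_exists by (elim exE)
 have le: "d \<le> n" if "?P d Y" for d Y by (rule chain_length_le[of d Y]) (simp_all only: that)
 have "Sup {enat d |d Z. ?P d Z} = enat n"
 proof (rule antisym)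
  show "Sup {enat d |d Z. ?P d Z} \<le> enat n"
  proof (rule Sup_least)
   fix e assume "e \<in> {enat d |d Z. ?P d Z}"
   then obtain d Y where "e = enat d" "?P d Y" unfolding mem_Collect_eq by (elim exE) (erule conjE, rule that)
   then show "e \<le> enat n" using le[of d Y] by (simp only: enat_ord_simps)
  qed
  show "enat n \<le> Sup {enat d |d Z. ?P d Z}"
   by (rule Sup_upper) (intro CollectI exI[of _ n] exI[of _ Z] conjI[OF refl Z])
 qed
 then show ?thesis unfolding krull_dim_def .
qed

end

section \<open>Changing bases of Gamma-representations\<close>

lemma mult_delta_col:
 fixes A :: "complex mat"
 assumes "A \<in> mats n" "B \<in> mats n" "i < n" "j < n" "m < n" "\<And>l. l < n ==> B $$ (l,j) = (if l = m then 1 else 0)"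
 shows "(A * B) $$ (i,j) = A $$ (i,m)"
proof -
 have "(A * B) $$ (i,j) = (\<Sum>l<n. A $$ (i,l) * B $$ (l,j))" by (rule mult_idx[OF assms(1-4)])
 also have "\<dots> = (\<Sum>l<n. if l = m then A $$ (i,l) else 0)" by (intro sum.cong refl) (simp add: assms(6))
 also have "\<dots> = A $$ (i,m)" using assms(5) by simp
 finally show ?thesis .
qed

text \<open>It suffices to conjugate \<open>S\<close> and \<open>T\<close>, of which the generators are words.\<close>
lemma stp_intertwine_iso:
 assumes g: "gamma_pair n S T" and g': "gamma_pair n S' T'"
  and P: "P \<in> mats n" "Q \<in> mats n" "P * Q = 1\<^sub>m n" "Q * P = 1\<^sub>m n"
  and e: "S * P = P * S'" "T * P = P * T'"
 shows "rep_iso (stp S T) (stp S' T')"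
proof (rule rep_isoI[OF P stp_rep(4)[OF g] stp_rep(4)[OF g']])
 note G = gamma_pairD(1,2)[OF g] gamma_pairD(1,2)[OF g'] and a = assoc_mult_mat[of _ n n _ n _ n]
 have c: "(X * Y) * P = P * (X' * Y')" if "X * P = P * X'" "Y * P = P * Y'" "X \<in> mats n" "Y \<in> mats n" "X' \<in> mats n" "Y' \<in> mats n"
  for X Y X' Y'
 proof -
  have "(X * Y) * P = X * (Y * P)" by (rule a[OF that(3,4) P(1)])
  also have "\<dots> = (X * P) * Y'" unfolding that(2) by (rule a[OF that(3) P(1) that(6), symmetric])
  also have "\<dots> = P * (X' * Y')" unfolding that(1) by (rule a[OF P(1) that(5,6)])
  finally show ?thesis .
 qed
 have "T * S \<in> mats n" "T' * S' \<in> mats n" "T * T \<in> mats n" "T' * T' \<in> mats n" using G by auto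
 then show "fst (stp S T) * P = P * fst (stp S' T')" "snd (stp S T) * P = P * snd (stp S' T')"
  unfolding stp_def fst_conv snd_conv using G e c by simp_all
qed

lemma (in cube_root) tri_products:
 assumes "tri e1 e2 e3"
 shows "e1^2 * e2 + e1 * e2^2 = -1" "e2^2 * e3 + e2 * e3^2 = -1" "e1^2 * e3 + e1 * e3^2 = -1"
proof -
 have *: "a^2 * b + a * b^2 = -1" if "a^3 = 1" "b^3 = 1" "a \<noteq> b" for a b :: complex
 proof -
  have "(a - b) * (a^2 + a * b + b^2) = 0" using that by (simp add: algebra_simps power2_eq_square power3_eq_cube)
  then have "a * (a^2 + a * b + b^2) = 0" using that by simp
  then have "a^3 + (a^2 * b + a * b^2) = 0" by (simp add: algebra_simps power2_eq_square power3_eq_cube)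
  then show ?thesis using that by (simp add: eq_neg_iff_add_eq_0 add.commute)
 qed
 show "e1^2 * e2 + e1 * e2^2 = -1" "e2^2 * e3 + e2 * e3^2 = -1" "e1^2 * e3 + e1 * e3^2 = -1"
  using assms * unfolding tri_def by auto
qed

text \<open>Conversely to \<open>proj_sum\<close>, two orthogonal idempotents are the spectral projectors of the matrix
 of order three built from them.\<close>
lemma (in cube_root) tri_combination:
 assumes t: "tri e1 e2 e3" and A: "A \<in> mats n" and P: "P \<in> mats n"
  and m: "A * A = A" "P * P = P" "A * P = 0\<^sub>m n n" "P * A = 0\<^sub>m n n"
  and T: "T = e2 \<cdot>\<^sub>m 1\<^sub>m n + ((e1 - e2) \<cdot>\<^sub>m A + (e3 - e2) \<cdot>\<^sub>m P)"
 shows "T * (T * T) = 1\<^sub>m n" "proj n T e1 = A" "proj n T e3 = P"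
proof -
 define C where "C x y w = x \<cdot>\<^sub>m 1\<^sub>m n + (y \<cdot>\<^sub>m A + w \<cdot>\<^sub>m P)" for x y w
 have CC: "C x y w \<in> mats n" for x y w using A P by (simp add: C_def)
 have Ci: "C x y w $$ (i,j) = x * (if i = j then 1 else 0) + (y * A $$ (i,j) + w * P $$ (i,j))" if "i < n" "j < n" for x y w i j
  using that A P by (simp add: C_def)
 have lin: "(\<Sum>l<n. (C x y w) $$ (i,l) * M $$ (l,j)) = x * M $$ (i,j) + (y * (A * M) $$ (i,j) + w * (P * M) $$ (i,j))"
  if ij: "i < n" "j < n" and M: "M \<in> mats n" for x y w i j M
 proof -
  have "(\<Sum>l<n. C x y w $$ (i,l) * M $$ (l,j)) = (\<Sum>l<n. (if l = i then x * M $$ (l,j) else 0) + (y * (A $$ (i,l) * M $$ (l,j)) + w * (P $$ (i,l) * M $$ (l,j))))"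
   by (intro sum.cong refl) (auto simp: Ci ij algebra_simps)
  also have "\<dots> = x * M $$ (i,j) + (y * (A * M) $$ (i,j) + w * (P * M) $$ (i,j))"
   unfolding sum.distrib sum_distrib_left[symmetric] mult_idx[OF A M ij] mult_idx[OF P M ij] using ij by simp
  finally show ?thesis .
 qed
 have AC: "(A * C x y w) $$ (i,j) = (x + y) * A $$ (i,j)" "(P * C x y w) $$ (i,j) = (x + w) * P $$ (i,j)" if ij: "i < n" "j < n" for x y w i j
 proof -
  have 1: "(D * C x y w) $$ (i,j) = x * D $$ (i,j) + (y * (D * A) $$ (i,j) + w * (D * P) $$ (i,j))" if D: "D \<in> mats n" for D
  proof -
   have "(D * C x y w) $$ (i,j) = (\<Sum>l<n. (if l = j then x * D $$ (i,l) else 0) + (y * (D $$ (i,l) * A $$ (l,j)) + w * (D $$ (i,l) * P $$ (l,j))))"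
    unfolding mult_idx[OF D CC ij] by (intro sum.cong refl) (auto simp: Ci ij algebra_simps)
   also have "\<dots> = x * D $$ (i,j) + (y * (D * A) $$ (i,j) + w * (D * P) $$ (i,j))"
    unfolding sum.distrib sum_distrib_left[symmetric] mult_idx[OF D A ij] mult_idx[OF D P ij] using ij by simp
   finally show ?thesis .
  qed
  show "(A * C x y w) $$ (i,j) = (x + y) * A $$ (i,j)" "(P * C x y w) $$ (i,j) = (x + w) * P $$ (i,j)"
   unfolding 1[OF A] 1[OF P] m using ij by (simp_all add: algebra_simps)
 qed
 have Cm: "C x y w * C x' y' w' = C (x * x') (x * y' + y * (x' + y')) (x * w' + w * (x' + w'))" for x y w x' y' w'
 proof (rule eq_matI)
  fix i j assume "i < dim_row (C (x * x') (x * y' + y * (x' + y')) (x * w' + w * (x' + w')))" "j < dim_col (C (x * x') (x * y' + y * (x' + y')) (x * w' + w * (x' + w')))"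
  then have ij: "i < n" "j < n" using CC carrier_matD by metis+
  show "(C x y w * C x' y' w') $$ (i,j) = C (x * x') (x * y' + y * (x' + y')) (x * w' + w * (x' + w')) $$ (i,j)"
   unfolding mult_idx[OF CC CC ij] lin[OF ij CC] AC[OF ij] Ci[OF ij] by (simp add: algebra_simps)
 qed (use carrier_matD[OF CC] carrier_matD[OF mult_carrier_mat[OF CC CC]] in simp_all)
 note d = triD[OF t]
 have T1: "T = C e2 (e1 - e2) (e3 - e2)" unfolding T C_def ..
 have T2: "T * T = C (e2^2) (e1^2 - e2^2) (e3^2 - e2^2)" unfolding T1 Cm by (simp add: algebra_simps power2_eq_square)
 have "T * (T * T) = C (e2^3) (e1^3 - e2^3) (e3^3 - e2^3)" unfolding T2 unfolding T1 Cm by (simp add: algebra_simps power2_eq_square power3_eq_cube)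
 also have "\<dots> = 1\<^sub>m n" unfolding d by (rule eq_matI) (use A P in \<open>auto simp: C_def\<close>)
 finally show "T * (T * T) = 1\<^sub>m n" .
 have TC: "T \<in> mats n" unfolding T1 by (rule CC)
 have pr: "proj n T e $$ (i,j) = 1/3 * ((1 + e^2 * e2 + e * e2^2) * (if i = j then 1 else 0)
   + (e^2 * (e1 - e2) + e * (e1^2 - e2^2)) * A $$ (i,j) + (e^2 * (e3 - e2) + e * (e3^2 - e2^2)) * P $$ (i,j))" if "i < n" "j < n" for e i j
  unfolding proj_idx[OF TC that] T2 unfolding T1 Ci[OF that] by (simp add: algebra_simps)
 note q = tri_products[OF t]
 have c1: "1 + e1^2 * e2 + e1 * e2^2 = 0" using q(1) by (simp add: add.assoc)
 have c2: "e1^2 * (e1 - e2) + e1 * (e1^2 - e2^2) = 3"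
 proof -
  have "e1^2 * (e1 - e2) + e1 * (e1^2 - e2^2) = 2 * e1^3 - (e1^2 * e2 + e1 * e2^2)" by (simp add: algebra_simps power2_eq_square power3_eq_cube)
  then show ?thesis unfolding q d by simp
 qed
 have c3: "e1^2 * (e3 - e2) + e1 * (e3^2 - e2^2) = 0"
 proof -
  have "e1^2 * (e3 - e2) + e1 * (e3^2 - e2^2) = (e1^2 * e3 + e1 * e3^2) - (e1^2 * e2 + e1 * e2^2)" by (simp add: algebra_simps)
  then show ?thesis unfolding q by simp
 qed
 have c4: "1 + e3^2 * e2 + e3 * e2^2 = 0" using q(2) by (simp add: algebra_simps)
 have c5: "e3^2 * (e1 - e2) + e3 * (e1^2 - e2^2) = 0"
 proof -
  have "e3^2 * (e1 - e2) + e3 * (e1^2 - e2^2) = (e1^2 * e3 + e1 * e3^2) - (e2^2 * e3 + e2 * e3^2)" by (simp add: algebra_simps)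
  then show ?thesis unfolding q by simp
 qed
 have c6: "e3^2 * (e3 - e2) + e3 * (e3^2 - e2^2) = 3"
 proof -
  have "e3^2 * (e3 - e2) + e3 * (e3^2 - e2^2) = 2 * e3^3 - (e2^2 * e3 + e2 * e3^2)" by (simp add: algebra_simps power2_eq_square power3_eq_cube)
  then show ?thesis unfolding q d by simp
 qed
 show "proj n T e1 = A"
  by (rule eq_matI) (use A P proj_carrier[OF TC] in \<open>auto simp: pr c1 c2 c3\<close>)
 show "proj n T e3 = P"
  by (rule eq_matI) (use A P proj_carrier[OF TC] in \<open>auto simp: pr c4 c5 c6\<close>)
qed

definition pT :: ncp where "pT = NMul NX NY"
definition pS :: ncp where "pS = NMul pT NX"
definition pE :: "complex => ncp" where
 "pE e = NMul (NC (1/3)) (NAdd (NC 1) (NAdd (NMul (NC (e^2)) pT) (NMul (NC e) (NMul pT pT))))"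

lemma nev_generators:
 assumes g: "gamma_pair n S T"
 shows "nev n (stp S T) pT = T" "nev n (stp S T) pS = S" "nev n (stp S T) (pE e) = proj n T e"
proof -
 note p = stp_rep(4)[OF g] and C = gamma_pairD(1,2)[OF g]
 show 1: "nev n (stp S T) pT = T"
  unfolding pT_def nev.simps(5) nev_gen[OF p] using stp_rep(2)[OF g] by (simp add: repT_def)
 show "nev n (stp S T) pS = S"
  unfolding pS_def nev.simps(5) 1 unfolding nev_gen[OF p] using stp_rep(2,3)[OF g] by (simp add: repT_def repS_def)
 have "(c \<cdot>\<^sub>m 1\<^sub>m n) * M = c \<cdot>\<^sub>m M" if "M \<in> mats n" for c and M :: "complex mat"
  using that by (simp add: mult_smult_assoc_mat[of _ n n])
 note sm = this
 have TT: "T * T \<in> mats n" "e\<^sup>2 \<cdot>\<^sub>m T + e \<cdot>\<^sub>m (T * T) \<in> mats n" "1\<^sub>m n + (e\<^sup>2 \<cdot>\<^sub>m T + e \<cdot>\<^sub>m (T * T)) \<in> mats n" using C by auto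
 have "1 \<cdot>\<^sub>m 1\<^sub>m n = (1\<^sub>m n :: complex mat)" by auto
 then show "nev n (stp S T) (pE e) = proj n T e"
  unfolding pE_def nev.simps 1 proj_def using sm[OF C(2)] sm[OF TT(1)] sm[OF TT(3)] by simp
qed

section \<open>Invariant symmetric forms\<close>

text \<open>For symmetric \<open>D\<close> the matrix \<open>D X - X\<^sup>T D\<close> is antisymmetric. Therefore one index \<open>b\<close> may be
 left unchecked.\<close>
lemma self_adjointI:
 fixes D X :: "complex mat"
 assumes D: "D \<in> mats n" and X: "X \<in> mats n"
  and s: "\<And>i j. i < n ==> j < n ==> D $$ (i,j) = D $$ (j,i)"
  and m: "\<And>i j. i < n ==> j < n ==> i \<noteq> b ==> (D * X) $$ (i,j) = (D * X) $$ (j,i)"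
 shows "D * X = transpose_mat X * D"
proof (rule eq_matI)
 fix i j assume "i < dim_row (transpose_mat X * D)" "j < dim_col (transpose_mat X * D)"
 then have ij: "i < n" "j < n" using D X by auto
 have XT: "transpose_mat X \<in> mats n" using X by simp
 have "(transpose_mat X * D) $$ (i,j) = (\<Sum>l<n. D $$ (j,l) * X $$ (l,i))"
  unfolding mult_idx[OF XT D ij] using ij X s by (intro sum.cong refl) auto
 also have "\<dots> = (D * X) $$ (j,i)" by (rule mult_idx[OF D X ij(2,1), symmetric])
 also have "\<dots> = (D * X) $$ (i,j)" using m[OF ij] m[OF ij(2,1)] by metis
 finally show "(D * X) $$ (i,j) = (transpose_mat X * D) $$ (i,j)" ..
qed (use D X in auto)

text \<open>The form \<open>D\<close> is an intertwiner to the transpose, after multiplication by the transpose of \<open>S\<close>,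
 and is therefore an isomorphism.\<close>
lemma self_adjoint_reversal:
 assumes g: "gamma_pair n S T" and s: "simple_rep n (stp S T)" and D: "D \<in> mats n" "D \<noteq> 0\<^sub>m n n"
  and e: "D * S = transpose_mat S * D" "D * T = transpose_mat T * D"
 shows "ntrn n (nrev q) (stp S T) = ntrn n q (stp S T)"
proof -
 note G = gamma_pairD[OF g] and p = stp_rep(4)[OF g]
 let ?S = "transpose_mat S" let ?T = "transpose_mat T"
 have C: "?S \<in> mats n" "?T \<in> mats n" "T * T \<in> mats n" "?T * ?T \<in> mats n" "T * S \<in> mats n" using G by auto
 have SS: "?S * ?S = 1\<^sub>m n" using transpose_mult[OF G(1,1)] unfolding G(3) by simp
 have m: "D * (X * Y) = (X' * Y') * D" if "D * X = X' * D" "D * Y = Y' * D" "X \<in> mats n" "Y \<in> mats n" "X' \<in> mats n" "Y' \<in> mats n" for X Y X' Y'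
 proof -
  have "D * (X * Y) = (D * X) * Y" by (rule assoc_mult_mat[OF D(1) that(3,4), symmetric])
  also have "\<dots> = X' * (D * Y)" unfolding that(1) by (rule assoc_mult_mat[OF that(5) D(1) that(4)])
  also have "\<dots> = (X' * Y') * D" unfolding that(2) by (rule assoc_mult_mat[OF that(5,6) D(1), symmetric])
  finally show ?thesis .
 qed
 have TT: "D * (T * T) = (?T * ?T) * D" by (rule m[OF e(2,2) G(2,2) C(2,2)])
 have TTS: "D * (T * (T * S)) = (?T * (?T * ?S)) * D"
  by (rule m[OF e(2) m[OF e(2,1) G(2,1) C(2,1)] G(2) C(5) C(2) mult_carrier_mat[OF C(2,1)]])
 have tr: "transpose_rep (stp S T) = (?S * (?T * ?T), (?T * ?T) * ?S)"
  unfolding transpose_rep_def stp_def fst_conv snd_conv transpose_mult[OF G(2) C(5)] transpose_mult[OF G(2,1)] transpose_mult[OF G(1) C(3)] transpose_mult[OF G(2,2)]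
  using assoc_mult_mat[OF C(1,2,2)] by simp
 \<comment> \<open>Transposing \<open>stp S T\<close> also exchanges the two generators, up to conjugation by \<open>S\<close>; the factor \<open>S\<close> makes up for that.\<close>
 let ?L = "?S * D"
 have LC: "?L \<in> mats n" using C D by simp
 have L0: "?L \<noteq> 0\<^sub>m n n"
 proof
  assume "?L = 0\<^sub>m n n"
  then have "?S * (?S * D) = 0\<^sub>m n n" using C(1) by simp
  then show False using D cancel_left[OF C(1,1) SS D(1)] by simp
 qed
 have STT: "?S * (?T * ?T) \<in> mats n" "(?T * ?T) * ?S \<in> mats n" by (rule mult_carrier_mat[OF C(1,4)], rule mult_carrier_mat[OF C(4,1)])
 have "rep_iso (transpose_rep (stp S T)) (stp S T)"
 proof (rule schur_iso[OF transpose_simple[OF s] s LC L0])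
  have A: "?T * (?T * ?S) = (?T * ?T) * ?S" by (rule assoc_mult_mat[OF C(2,2,1), symmetric])
  have "(?S * (?T * ?T)) * (?S * D) = ((?S * (?T * ?T)) * ?S) * D" by (rule assoc_mult_mat[OF STT(1) C(1) D(1), symmetric])
  also have "(?S * (?T * ?T)) * ?S = ?S * ((?T * ?T) * ?S)" by (rule assoc_mult_mat[OF C(1,4,1)])
  also have "\<dots> * D = ?S * (((?T * ?T) * ?S) * D)" by (rule assoc_mult_mat[OF C(1) STT(2) D(1)])
  also have "((?T * ?T) * ?S) * D = D * (T * (T * S))" unfolding TTS A ..
  also have "?S * (D * (T * (T * S))) = (?S * D) * (T * (T * S))" using assoc_mult_mat[OF C(1) D(1) mult_carrier_mat[OF G(2) C(5)]] by simp
  finally show "fst (transpose_rep (stp S T)) * ?L = ?L * fst (stp S T)" unfolding tr by (simp add: stp_def)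
  have "((?T * ?T) * ?S) * (?S * D) = (?T * ?T) * (?S * (?S * D))" by (rule assoc_mult_mat[OF C(4,1) LC])
  also have "?S * (?S * D) = D" by (rule cancel_left[OF C(1,1) SS D(1)])
  also have "(?T * ?T) * D = D * (T * T)" using TT ..
  also have "T * T = S * (S * (T * T))" using G(5)[OF C(3)] ..
  also have "D * (S * (S * (T * T))) = (D * S) * (S * (T * T))" by (rule assoc_mult_mat[OF D(1) G(1) mult_carrier_mat[OF G(1) C(3)], symmetric])
  finally show "snd (transpose_rep (stp S T)) * ?L = ?L * snd (stp S T)" unfolding tr by (simp add: stp_def e)
 qed
 then have "ntr (transpose_rep (stp S T)) q = ntr (stp S T) q"
  by (rule ntr_iso[OF _ rep_pairs[OF transpose_rep_B3[OF stp_rep(1)[OF g]]]])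
 then have "ntrn n q (transpose_rep (stp S T)) = ntrn n q (stp S T)"
  unfolding ntrn_def using ntr_pairs[OF p] ntr_pairs[OF rep_pairs[OF transpose_rep_B3[OF stp_rep(1)[OF g]]]] by simp
 then show ?thesis unfolding ntrn_transpose[OF p] .
qed

lemma (in cube_root) reversal_by_density:
 assumes s: "simple_rep n \<psi>" "\<psi> \<in> FG n \<alpha>" and h: "h \<in> regular_fun n" "\<phi>0 \<in> FG n \<alpha>" "h \<phi>0 \<noteq> 0"
  and r: "\<And>\<phi>. \<phi> \<in> FG n \<alpha> ==> simple_rep n \<phi> ==> h \<phi> \<noteq> 0 ==> ntrn n (nrev q) \<phi> = ntrn n q \<phi>"
  and \<phi>: "\<phi> \<in> FG n \<alpha>"
 shows "ntrn n (nrev q) \<phi> = ntrn n q \<phi>"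
proof (rule ccontr)
 assume n: "ntrn n (nrev q) \<phi> \<noteq> ntrn n q \<phi>"
 let ?f = "\<lambda>\<phi>. ntrn n (nrev q) \<phi> - ntrn n q \<phi>"
 have f: "?f \<in> regular_fun n" by (rule subalg_diff[OF subalg_regular ntrn_regular ntrn_regular])
 obtain \<chi> where x: "\<chi> \<in> FG n \<alpha>" "?f \<chi> \<noteq> 0" "h \<chi> \<noteq> 0"
  using rconn_generic[OF FG_rconn f \<phi> _ h] n by auto
 have "(\<lambda>\<phi>. ?f \<phi> * h \<phi>) \<in> regular_fun n" by (rule regular_fun.mult[OF f h(1)])
 from FG_generic_simple[OF s this x(1)] x(2,3) r show False by auto
qed

section \<open>The normal form for a one-dimensional eigenspace\<close>

text \<open>The eigenvalue \<open>e3\<close> of \<open>T\<close> is simple and \<open>e1\<close> has multiplicity \<open>n div 2\<close>; \<open>e2\<close> takes the rest.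
 The eigenspaces of \<open>S\<close> are as equal in dimension as possible. The assumption on \<open>\<alpha>\<close> says this by
 traces, which is the form in which it is used.\<close>
locale rank_one_form = cube_root +
 fixes n :: nat and \<alpha> :: dim_vec5 and e1 e2 e3 :: complex
 assumes npos: "n > 0" and tri: "tri e1 e2 e3"
  and dims: "\<And>S T. gamma_pair n S T ==> dim_vector \<rho> (stp S T) = \<alpha> \<longleftrightarrow>
   mtr S = (if even n then 0 else 1) \<and> mtr (proj n T e1) = of_nat (n div 2) \<and> mtr (proj n T e3) = 1"
begin

text \<open>In the basis \<open>b\<^sub>0, S b\<^sub>0, A S b\<^sub>0, S A S b\<^sub>0, \<dots>\<close> the next vector after the last basis vector
 has the coordinates \<open>za c\<close>. The even ones are parameters; the odd ones are forced by \<open>S\<^sup>2 = 1\<close> for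
 odd \<open>n\<close> and by \<open>A\<^sup>2 = A\<close> for even \<open>n\<close>. The last one is \<open>1\<close> because of the trace.\<close>
definition za :: "(nat => complex) => nat => complex" where
 "za c i = (if i = n - 1 then 1 else if even i then c i else - c (if even n then i + 1 else i - 1))"

text \<open>The row of the rank one projector \<open>P\<close>. The odd coordinates are parameters; \<open>P A = 0\<close> forces
 the even ones, and for even \<open>n\<close> also the last one.\<close>
definition xa :: "(nat => complex) => nat => complex" where
 "xa c i = (if i = 0 then 1 else if even i then 0
   else if i = n - 1 then - (\<Sum>j<n - 1. (if j = 0 then 1 else if even j then 0 else c j) * za c j) else c i)"

text \<open>How \<open>S\<close> and \<open>A\<close> permute the indices of the basis: \<open>S\<close> exchanges \<open>2 i\<close> and \<open>2 i + 1\<close>, and \<open>A\<close>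
 raises \<open>2 i + 1\<close> to \<open>2 i + 2\<close>.\<close>
definition sw :: "nat => nat" where "sw j = (if even j then j + 1 else j - 1)"
definition up :: "nat => nat" where "up j = (if odd j then j + 1 else j)"

definition NS where "NS c = mat n n (\<lambda>(i,j). if odd n \<and> j = n - 1 then za c i else if i = sw j then 1 else 0)"
definition NA where "NA c = mat n n (\<lambda>(i,j). if even n \<and> j = n - 1 then za c i else if j \<noteq> 0 \<and> i = up j then 1 else 0)"
definition NP where "NP c = mat n n (\<lambda>(i,j). if i = 0 then xa c j else 0)"
definition NT where "NT c = e2 \<cdot>\<^sub>m 1\<^sub>m n + ((e1 - e2) \<cdot>\<^sub>m NA c + (e3 - e2) \<cdot>\<^sub>m NP c)"

lemma NC [simp]: "NS c \<in> mats n" "NA c \<in> mats n" "NP c \<in> mats n" "NT c \<in> mats n"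
 by (auto simp: NS_def NA_def NP_def NT_def)

lemma sw_less: "j < n ==> \<not> (odd n \<and> j = n - 1) ==> sw j < n \<and> sw (sw j) = j \<and> \<not> (odd n \<and> sw j = n - 1)"
proof -
 assume j: "j < n" "\<not> (odd n \<and> j = n - 1)"
 show ?thesis
 proof (cases "even j")
  case True
  have "Suc j < n" "odd n ==> Suc j \<noteq> n - 1" using j True by presburger+
  then show ?thesis using True by (cases "even n") (simp_all add: sw_def)
 next
  case False
  have "Suc (j - 1) = j" "even (j - 1)" "odd n ==> j - 1 \<noteq> n - 1" using j False by presburger+
  then show ?thesis using False j by (cases "even n") (simp_all add: sw_def)
 qed
qed

lemma sw_neq: "i \<noteq> sw i"
 by (cases "even i") (auto simp: sw_def dest: odd_pos)

lemma up_less: "j < n ==> \<not> (even n \<and> j = n - 1) ==> up j < n \<and> even (up j) \<and> \<not> (even n \<and> up j = n - 1)"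
proof -
 assume j: "j < n" "\<not> (even n \<and> j = n - 1)"
 show ?thesis
 proof (cases "even j")
  case True
  have "even n ==> j \<noteq> n - 1" using j True by presburger
  then show ?thesis using True j by (cases "even n") (simp_all add: up_def)
 next
  case False
  have "Suc j < n" "even n ==> Suc j \<noteq> n - 1" using j False by presburger+
  then show ?thesis using False by (cases "even n") (simp_all add: up_def)
 qed
qed

lemma swap_square:
 fixes X :: "complex mat"
 assumes X: "X \<in> mats n" and n: "odd n" and i: "i < n"
  and e: "\<And>i j. i < n ==> j < n - 1 ==> X $$ (i,j) = (if i = sw j then 1 else 0)"
 shows "(X * X) $$ (i,n-1) = X $$ (i,n-1) * X $$ (n-1,n-1) + (if i \<noteq> n - 1 then X $$ (sw i,n-1) else 0)"
proof -
 have "(X * X) $$ (i,n-1) = (\<Sum>l<n. X $$ (i,l) * X $$ (l,n-1))" by (rule mult_idx[OF X X i]) (use npos in simp)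
 also have "\<dots> = (\<Sum>l<n. (if l = n - 1 then X $$ (i,n-1) * X $$ (l,n-1) else 0) + (if l = sw i \<and> i \<noteq> n - 1 then X $$ (l,n-1) else 0))"
 proof (intro sum.cong refl)
  fix l assume "l \<in> {..<n}"
  then have l: "l < n" by simp
  show "X $$ (i,l) * X $$ (l,n-1) = (if l = n - 1 then X $$ (i,n-1) * X $$ (l,n-1) else 0) + (if l = sw i \<and> i \<noteq> n - 1 then X $$ (l,n-1) else 0)"
  proof (cases "l = n - 1")
   case l1: True
   then have e: "(l = sw i \<and> i \<noteq> n - 1) = False" using sw_less[OF i] n by metis
   show ?thesis unfolding e using l1 by simp
  next
   case l1: False
   then have "i = sw l \<longleftrightarrow> l = sw i \<and> i \<noteq> n - 1" using sw_less[OF i] sw_less[OF l] n by metis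
   then show ?thesis using l1 l e[OF i, of l] by simp
  qed
 qed
 also have "\<dots> = X $$ (i,n-1) * X $$ (n-1,n-1) + (if i \<noteq> n - 1 then X $$ (sw i,n-1) else 0)"
  unfolding sum.distrib using sw_less[OF i] n npos by (cases "i = n - 1") auto
 finally show ?thesis .
qed

lemma NS_entries: "i < n ==> j < n - 1 ==> NS c $$ (i,j) = (if i = sw j then 1 else 0)"
 "odd n ==> i < n ==> NS c $$ (i,n-1) = za c i"
 "even n ==> i < n ==> NS c $$ (i,n-1) = (if i = sw (n-1) then 1 else 0)"
 using npos by (auto simp: NS_def)

lemma NS_square: "NS c * NS c = 1\<^sub>m n"
proof (rule eq_matI)
 fix i j assume "i < dim_row (1\<^sub>m n)" "j < dim_col (1\<^sub>m n)"
 then have ij: "i < n" "j < n" by auto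
 show "(NS c * NS c) $$ (i,j) = 1\<^sub>m n $$ (i,j)"
 proof (cases "odd n \<and> j = n - 1")
  case False
  have s: "sw j < n" "sw (sw j) = j" "\<not> (odd n \<and> sw j = n - 1)" using sw_less[OF ij(2) False] by auto
  have "(NS c * NS c) $$ (i,j) = NS c $$ (i, sw j)"
   by (rule mult_delta_col[OF NC(1) NC(1) ij s(1)]) (use False ij in \<open>auto simp: NS_def\<close>)
  then show ?thesis using s ij by (auto simp: NS_def)
 next
  case True
  then have j: "j = n - 1" and n: "odd n" by auto
  have "(NS c * NS c) $$ (i,j) = za c i * za c (n - 1) + (if i \<noteq> n - 1 then NS c $$ (sw i,n-1) else 0)"
  proof -
   have "(NS c * NS c) $$ (i,n-1) = NS c $$ (i,n-1) * NS c $$ (n-1,n-1) + (if i \<noteq> n - 1 then NS c $$ (sw i,n-1) else 0)"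
    by (rule swap_square[OF NC(1) n ij(1)]) (rule NS_entries(1))
   then show ?thesis unfolding j using NS_entries(2)[OF n, of _ c] ij npos by simp
  qed
  also have "\<dots> = (if i = j then 1 else 0)"
  proof (cases "i = n - 1")
   case True
   then show ?thesis using j by (simp add: za_def)
  next
   case i1: False
   then have s: "sw i < n" "sw i \<noteq> n - 1" "even i \<noteq> even (sw i)" using sw_less[OF ij(1)] n by (auto simp: sw_def)
   moreover have "odd i ==> sw i = i - 1" "even i ==> sw i = i + 1" by (auto simp: sw_def)
   ultimately show ?thesis using i1 j n NS_entries(2)[OF n s(1)] by (cases "even i") (simp_all add: za_def)
  qed
  finally show ?thesis using ij by simp
 qed
qed (use carrier_matD[OF NC(1)] in simp_all)

lemma up_square:
 fixes X :: "complex mat"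
 assumes X: "X \<in> mats n" and n: "even n" and i: "i < n"
  and e: "\<And>i j. i < n ==> j < n - 1 ==> X $$ (i,j) = (if j \<noteq> 0 \<and> i = up j then 1 else 0)"
 shows "(X * X) $$ (i,n-1) = X $$ (i,n-1) * X $$ (n-1,n-1) + (if even i \<and> i \<noteq> 0 then X $$ (i,n-1) + X $$ (i - 1,n-1) else 0)"
proof -
 have o: "odd (n - 1)" using n npos by simp
 have "(X * X) $$ (i,n-1) = (\<Sum>l<n. X $$ (i,l) * X $$ (l,n-1))" by (rule mult_idx[OF X X i]) (use npos in simp)
 also have "\<dots> = (\<Sum>l<n. (if l = n - 1 then X $$ (i,n-1) * X $$ (l,n-1) else 0) + ((if l = i \<and> even i \<and> i \<noteq> 0 then X $$ (l,n-1) else 0) + (if l = i - 1 \<and> even i \<and> i \<noteq> 0 then X $$ (l,n-1) else 0)))"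
 proof (intro sum.cong refl)
  fix l assume "l \<in> {..<n}"
  then have l: "l < n" by simp
  show "X $$ (i,l) * X $$ (l,n-1) = (if l = n - 1 then X $$ (i,n-1) * X $$ (l,n-1) else 0) + ((if l = i \<and> even i \<and> i \<noteq> 0 then X $$ (l,n-1) else 0) + (if l = i - 1 \<and> even i \<and> i \<noteq> 0 then X $$ (l,n-1) else 0))"
  proof (cases "l = n - 1")
   case True
   moreover have "\<not> (i - 1 = n - 1 \<and> i \<noteq> 0)" using i by auto
   ultimately show ?thesis using i o by auto
  next
   case l1: False
   then show ?thesis using i l e[OF i, of l] by (auto simp: up_def)
  qed
 qed
 also have "\<dots> = X $$ (i,n-1) * X $$ (n-1,n-1) + (if even i \<and> i \<noteq> 0 then X $$ (i,n-1) + X $$ (i - 1,n-1) else 0)"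
  unfolding sum.distrib using i npos by (cases "even i \<and> i \<noteq> 0") auto
 finally show ?thesis .
qed

lemma NA_entries: "i < n ==> j < n - 1 ==> NA c $$ (i,j) = (if j \<noteq> 0 \<and> i = up j then 1 else 0)"
 "even n ==> i < n ==> NA c $$ (i,n-1) = za c i"
 "odd n ==> i < n ==> NA c $$ (i,n-1) = (if n - 1 \<noteq> 0 \<and> i = up (n-1) then 1 else 0)"
 using npos by (auto simp: NA_def)

lemma NA_square: "NA c * NA c = NA c"
proof (rule eq_matI)
 fix i j assume "i < dim_row (NA c)" "j < dim_col (NA c)"
 then have ij: "i < n" "j < n" using NC(2)[of c] by auto
 show "(NA c * NA c) $$ (i,j) = NA c $$ (i,j)"
 proof (cases "even n \<and> j = n - 1")
  case False
  note u = up_less[OF ij(2) False]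
  show ?thesis
  proof (cases "j = 0")
   case True
   have "NA c $$ (l,j) = 0" if "l < n" for l using True that False ij by (auto simp: NA_def)
   then show ?thesis unfolding mult_idx[OF NC(2) NC(2) ij] using ij by simp
  next
   case j0: False
   have "(NA c * NA c) $$ (i,j) = NA c $$ (i, up j)"
    by (rule mult_delta_col[OF NC(2) NC(2) ij]) (use False ij j0 u in \<open>auto simp: NA_def\<close>)
   then show ?thesis using u ij j0 False by (auto simp: NA_def up_def split: if_splits)
  qed
 next
  case True
  then have j: "j = n - 1" and n: "even n" by auto
  have "even i ==> i \<noteq> 0 ==> za c i + za c (i - 1) = 0" using n ij by (auto simp: za_def)
  moreover have "NA c $$ (i - 1,n-1) = za c (i - 1)" "NA c $$ (n-1,n-1) = 1" using NA_entries(2)[OF n] ij npos by (simp_all add: za_def)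
  moreover have "(NA c * NA c) $$ (i,n-1) = NA c $$ (i,n-1) * NA c $$ (n-1,n-1) + (if even i \<and> i \<noteq> 0 then NA c $$ (i,n-1) + NA c $$ (i - 1,n-1) else 0)"
   by (rule up_square[OF NC(2) n ij(1)]) (rule NA_entries(1))
  ultimately show ?thesis unfolding j using NA_entries(2)[OF n ij(1), of c] by simp
 qed
qed (use NC in auto)

lemma NP_mult:
 assumes M: "M \<in> mats n" and ij: "i < n" "j < n"
 shows "(NP c * M) $$ (i,j) = (if i = 0 then \<Sum>l<n. xa c l * M $$ (l,j) else 0)"
 unfolding mult_idx[OF NC(3) M ij] using ij by (auto simp: NP_def)

lemma mult_NP:
 assumes M: "M \<in> mats n" and ij: "i < n" "j < n"
 shows "(M * NP c) $$ (i,j) = M $$ (i,0) * xa c j"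
proof -
 have "(M * NP c) $$ (i,j) = (\<Sum>l<n. if l = 0 then M $$ (i,l) * xa c j else 0)"
  unfolding mult_idx[OF M NC(3) ij] using ij by (intro sum.cong refl) (auto simp: NP_def)
 then show ?thesis using npos by simp
qed

lemma NP_square: "NP c * NP c = NP c"
proof (rule eq_matI)
 fix i j assume "i < dim_row (NP c)" "j < dim_col (NP c)"
 then have ij: "i < n" "j < n" using NC(3)[of c] by auto
 show "(NP c * NP c) $$ (i,j) = NP c $$ (i,j)" unfolding mult_NP[OF NC(3) ij] using ij by (simp add: NP_def xa_def)
qed (use carrier_matD[OF NC(3)] in simp_all)

lemma NA_NP: "NA c * NP c = 0\<^sub>m n n"
proof (rule eq_matI)
 fix i j assume "i < dim_row (0\<^sub>m n n :: complex mat)" "j < dim_col (0\<^sub>m n n :: complex mat)"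
 then have ij: "i < n" "j < n" by auto
 have "\<not> (even n \<and> 0 = n - 1)" using npos by presburger
 then have "NA c $$ (i,0) = 0" using ij by (auto simp: NA_def)
 then show "(NA c * NP c) $$ (i,j) = 0\<^sub>m n n $$ (i,j)" unfolding mult_NP[OF NC(2) ij] using ij by simp
qed (use carrier_matD[OF NC(3)] carrier_matD[OF NC(2)] in simp_all)

lemma xa_za: "even n ==> (\<Sum>l<n. xa c l * za c l) = 0"
proof -
 assume n: "even n"
 then have o: "odd (n - 1)" "n - 1 \<noteq> 0" "n = Suc (n - 1)" using npos by (auto elim!: evenE)
 have "(\<Sum>l<n. xa c l * za c l) = (\<Sum>l<n - 1. xa c l * za c l) + xa c (n - 1) * za c (n - 1)"
  by (subst o(3)) (rule sum.lessThan_Suc)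
 also have "(\<Sum>l<n - 1. xa c l * za c l) = (\<Sum>j<n - 1. (if j = 0 then 1 else if even j then 0 else c j) * za c j)"
  by (intro sum.cong refl) (auto simp: xa_def)
 also have "\<dots> + xa c (n - 1) * za c (n - 1) = 0" using o by (simp add: xa_def za_def)
 finally show ?thesis .
qed

lemma NP_NA: "NP c * NA c = 0\<^sub>m n n"
proof (rule eq_matI)
 fix i j assume "i < dim_row (0\<^sub>m n n :: complex mat)" "j < dim_col (0\<^sub>m n n :: complex mat)"
 then have ij: "i < n" "j < n" by auto
 have "(\<Sum>l<n. xa c l * NA c $$ (l,j)) = 0"
 proof (cases "even n \<and> j = n - 1")
  case True
  then have "(\<Sum>l<n. xa c l * NA c $$ (l,j)) = (\<Sum>l<n. xa c l * za c l)" using ij by (intro sum.cong refl) (auto simp: NA_def)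
  then show ?thesis using xa_za True by simp
 next
  case False
  then have "(\<Sum>l<n. xa c l * NA c $$ (l,j)) = (\<Sum>l<n. if l = up j then (if j = 0 then 0 else xa c l) else 0)"
   using ij by (intro sum.cong refl) (auto simp: NA_def)
  also have "\<dots> = (if j = 0 then 0 else xa c (up j))" using up_less[OF ij(2) False] by simp
  also have "\<dots> = 0" using up_less[OF ij(2) False] by (auto simp: xa_def up_def)
  finally show ?thesis .
 qed
 then show "(NP c * NA c) $$ (i,j) = 0\<^sub>m n n $$ (i,j)" using ij by (simp add: NP_mult[OF NC(2) ij] del: index_mult_mat(1))
qed (use carrier_matD[OF NC(3)] carrier_matD[OF NC(2)] in simp_all)

lemma N_proj:
 "NT c * (NT c * NT c) = 1\<^sub>m n" "proj n (NT c) e1 = NA c" "proj n (NT c) e3 = NP c"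
 using tri_combination[OF tri NC(2,3) NA_square NP_square NA_NP NP_NA NT_def] .

lemma N_gamma: "gamma_pair n (NS c) (NT c)"
 unfolding gamma_pair_def using NS_square N_proj(1) by simp

lemma N_traces: "mtr (NS c) = (if even n then 0 else 1)" "mtr (NA c) = of_nat (n div 2)" "mtr (NP c) = 1"
proof -
 have "mtr (NS c) = (\<Sum>i<n. if odd n \<and> i = n - 1 then 1 else 0)"
  unfolding mtr_def using NC(1)[of c] by (intro sum.cong) (auto simp: NS_def za_def sw_neq)
 then show "mtr (NS c) = (if even n then 0 else 1)" using npos by (cases "even n") auto
 have "mtr (NP c) = (\<Sum>i<n. if i = 0 then 1 else 0)"
  unfolding mtr_def using NC(3)[of c] by (intro sum.cong) (auto simp: NP_def xa_def)
 then show "mtr (NP c) = 1" using npos by simp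
 have "(\<Sum>i<n. if (even n \<and> i = n - 1) \<or> (i \<noteq> 0 \<and> even i) then 1 else 0 :: complex) = of_nat (n div 2)"
 proof (cases "even n")
  case False
  then have "(\<Sum>i<n. if (even n \<and> i = n - 1) \<or> (i \<noteq> 0 \<and> even i) then 1 else 0 :: complex) = (\<Sum>i<n. if i \<noteq> 0 \<and> even i then 1 else 0)" by simp
  moreover have "(\<Sum>i<2 * k + 1. if i \<noteq> 0 \<and> even i then 1 else 0 :: complex) = of_nat k" for k by (induction k) auto
  moreover obtain k where "n = 2 * k + 1" using False by (elim oddE)
  ultimately show ?thesis by simp
 next
  case True
  moreover have "(\<Sum>i<2 * k. if i \<noteq> 0 \<and> even i then 1 else 0 :: complex) = of_nat (k - 1)" for k by (induction k) (auto split: nat_diff_split)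
  moreover obtain k where k: "n = 2 * k" using True by (elim evenE)
  have "(\<Sum>i<n. if (even n \<and> i = n - 1) \<or> (i \<noteq> 0 \<and> even i) then 1 else 0 :: complex) = (\<Sum>i<n. (if i = n - 1 then 1 else 0) + (if i \<noteq> 0 \<and> even i then 1 else 0))"
   using True npos by (intro sum.cong refl) auto
  ultimately show ?thesis using k npos unfolding sum.distrib by simp
 qed
 moreover have "mtr (NA c) = (\<Sum>i<n. if (even n \<and> i = n - 1) \<or> (i \<noteq> 0 \<and> even i) then 1 else 0)"
  unfolding mtr_def using NC(2)[of c] by (intro sum.cong) (auto simp: NA_def za_def up_def)
 ultimately show "mtr (NA c) = of_nat (n div 2)" by simp
qed

lemma N_dim: "dim_vector \<rho> (stp (NS c) (NT c)) = \<alpha>"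
 unfolding dims[OF N_gamma] N_proj using N_traces by simp

lemma polys_if: "F \<in> polys ==> G \<in> polys ==> (\<lambda>c. if b then F c else G c) \<in> polys"
 by (cases b) auto

lemma za_polys: "(\<lambda>c. za c i) \<in> polys"
 unfolding za_def by (cases "i = n - 1"; cases "even i") (auto intro!: subalg_const[OF subalg_polys] subalg_uminus[OF subalg_polys] polys_coord)

lemma xa_polys: "(\<lambda>c. xa c i) \<in> polys"
proof -
 have "(\<lambda>c. - (\<Sum>j<n - 1. (if j = 0 then 1 else if even j then 0 else c j) * za c j)) \<in> polys"
 proof (intro subalg_uminus[OF subalg_polys] subalg_sum[OF subalg_polys] subalg_mult[OF subalg_polys] za_polys)
  show "(\<lambda>c. if j = 0 then 1 else if even j then 0 else c j) \<in> polys" for j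
   by (cases "j = 0"; cases "even j") (auto intro!: subalg_const[OF subalg_polys] polys_coord)
 qed
 then show ?thesis unfolding xa_def
  by (cases "i = 0"; cases "even i"; cases "i = n - 1") (auto intro!: subalg_const[OF subalg_polys] polys_coord)
qed

lemma N_polys: "NS \<in> matfun polys n n" "NT \<in> matfun polys n n"
proof -
 note k = subalg_const[OF subalg_polys]
 show "NS \<in> matfun polys n n" unfolding NS_def[abs_def]
  by (rule matfun_mat) (simp only: prod.case, intro polys_if k za_polys)
 have A: "NA \<in> matfun polys n n" unfolding NA_def[abs_def]
  by (rule matfun_mat) (simp only: prod.case, intro polys_if k za_polys)
 have P: "NP \<in> matfun polys n n" unfolding NP_def[abs_def]
  by (rule matfun_mat) (simp only: prod.case, intro polys_if k xa_polys)
 show "NT \<in> matfun polys n n" unfolding NT_def[abs_def]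
  by (intro matfun_add[OF subalg_polys] matfun_smult[OF subalg_polys] k A P matfun_const[OF subalg_polys]) simp
qed

lemma N_local: "(\<And>i. i < n - 1 ==> c i = c' i) ==> NS c = NS c' \<and> NT c = NT c'"
proof -
 assume e: "\<And>i. i < n - 1 ==> c i = c' i"
 have z: "za c i = za c' i" if "i < n" for i
 proof (cases "i = n - 1")
  case False
  then have "i < n - 1" "odd i ==> even n ==> i + 1 < n - 1" using that by (auto elim!: evenE oddE, presburger)
  then show ?thesis using e by (auto simp: za_def)
 qed (simp add: za_def)
 have x: "xa c i = xa c' i" if "i < n" for i
 proof -
  have "(\<Sum>j<n - 1. (if j = 0 then 1 else if even j then 0 else c j) * za c j) = (\<Sum>j<n - 1. (if j = 0 then 1 else if even j then 0 else c' j) * za c' j)"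
   by (intro sum.cong refl) (auto simp: e z)
  moreover have "i \<noteq> n - 1 ==> i < n - 1" using that by simp
  ultimately show ?thesis using e by (auto simp: xa_def)
 qed
 have "NS c = NS c'" "NA c = NA c'" "NP c = NP c'"
  unfolding NS_def NA_def NP_def by (auto intro!: eq_matI simp: z x)
 then show ?thesis unfolding NT_def by simp
qed

text \<open>The words in \<open>S\<close> and \<open>A\<close> that produce the basis, applied to the projector \<open>P\<close> on the
 eigenline.\<close>
primrec kW :: "nat => ncp" where
 "kW 0 = pE e3"
| "kW (Suc j) = NMul (if even j then pS else pE e1) (kW j)"

text \<open>The columns are the basis vectors, with the first column of \<open>P\<close> as the starting vector on the
 eigenline.\<close>
definition KB :: "rep => complex mat" where
 "KB \<phi> = mat n n (\<lambda>(i,j). nev n \<phi> (kW j) $$ (i,0))"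

lemma KB_carrier [simp]: "KB \<phi> \<in> mats n"
 by (simp add: KB_def)

lemma KB_regular: "(\<lambda>\<phi>. det (KB \<phi>)) \<in> regular_fun n"
proof (rule matfun_det[OF subalg_regular])
 show "KB \<in> matfun (regular_fun n) n n" unfolding KB_def[abs_def]
  by (rule matfun_mat) (simp only: prod.case, rule matfunD(2)[OF nev_regular _ npos])
qed

lemma nev_kW_Suc:
 assumes "gamma_pair n S T"
 shows "nev n (stp S T) (kW 0) = proj n T e3"
  "nev n (stp S T) (kW (Suc j)) = (if even j then S else proj n T e1) * nev n (stp S T) (kW j)"
 using nev_generators[OF assms] by simp_all

lemma kW_mult:
 assumes g: "gamma_pair n S T"
 shows "S * nev n (stp S T) (kW j) = nev n (stp S T) (kW (sw j))"
  "proj n T e1 * nev n (stp S T) (kW j) = (if j = 0 then 0\<^sub>m n n else nev n (stp S T) (kW (up j)))"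
proof -
 note G = gamma_pairD[OF g] and tD = triD[OF tri]
 let ?W = "\<lambda>j. nev n (stp S T) (kW j)"
 have A: "proj n T e1 \<in> mats n" by (rule proj_carrier[OF G(2)])
 have WS: "even j ==> ?W (Suc j) = S * ?W j" "odd j ==> ?W (Suc j) = proj n T e1 * ?W j" for j
  unfolding nev_kW_Suc[OF g] by simp_all
 show "S * ?W j = ?W (sw j)"
 proof (cases "even j")
  case True
  then show ?thesis using WS(1) by (simp add: sw_def)
 next
  case False
  then obtain l where l: "j = Suc l" "even l" by (cases j) auto
  then show ?thesis using WS(1)[of l] G(5)[OF nev_carrier, of "stp S T" "kW l"] by (simp add: sw_def)
 qed
 show "proj n T e1 * ?W j = (if j = 0 then 0\<^sub>m n n else ?W (up j))"
 proof (cases "even j")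
  case False
  then show ?thesis using WS(2) by (auto simp: up_def)
 next
  case True
  show ?thesis
  proof (cases "j = 0")
   case True
   show ?thesis unfolding True nev_kW_Suc(1)[OF g] using proj_mult[OF G(2,4) tD(1,3)] tD(7) by simp
  next
   case False
   then obtain l where l: "j = Suc l" "odd l" using True by (cases j) auto
   have "proj n T e1 * (proj n T e1 * ?W l) = proj n T e1 * ?W l"
    using assoc_mult_mat[OF A A nev_carrier, of "stp S T" "kW l"] proj_mult[OF G(2,4) tD(1,1)] by simp
   then show ?thesis using True l WS(2)[of l] by (simp add: up_def)
  qed
 qed
qed

lemma kW_N:
 "j < n ==> nev n (stp (NS c) (NT c)) (kW j) = mat n n (\<lambda>(i,l). (if i = j then 1 else 0) * xa c l)"
 "nev n (stp (NS c) (NT c)) (kW n) = mat n n (\<lambda>(i,l). za c i * xa c l)"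
proof -
 let ?M = "\<lambda>u. mat n n (\<lambda>(i,l). u i * xa c l)"
 have e: "(X * ?M (\<lambda>i. if i = j then 1 else 0)) = ?M (\<lambda>i. X $$ (i,j))" if X: "X \<in> mats n" and j: "j < n" for X j
 proof (rule eq_matI)
  fix i l assume "i < dim_row (?M (\<lambda>i. X $$ (i,j)))" "l < dim_col (?M (\<lambda>i. X $$ (i,j)))"
  then have il: "i < n" "l < n" by auto
  have "(X * ?M (\<lambda>i. if i = j then 1 else 0)) $$ (i,l) = (\<Sum>m<n. X $$ (i,m) * ?M (\<lambda>i. if i = j then 1 else 0) $$ (m,l))"
   by (rule mult_idx[OF X _ il]) simp
  also have "\<dots> = (\<Sum>m<n. if m = j then X $$ (i,m) * xa c l else 0)" using il by (intro sum.cong refl) auto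
  finally show "(X * ?M (\<lambda>i. if i = j then 1 else 0)) $$ (i,l) = ?M (\<lambda>i. X $$ (i,j)) $$ (i,l)" using il j by simp
 qed (use X in auto)
 have step: "nev n (stp (NS c) (NT c)) (kW (Suc j)) = ?M (\<lambda>i. (if even j then NS c else NA c) $$ (i,j))"
  if "nev n (stp (NS c) (NT c)) (kW j) = ?M (\<lambda>i. if i = j then 1 else 0)" "j < n" for j
  unfolding nev_kW_Suc[OF N_gamma] N_proj that(1) by (rule e) (use that(2) in simp_all)
 have M: "?M u = ?M v" if "\<And>i. i < n ==> u i = v i" for u v using that by (auto intro!: eq_matI)
 show 1: "j < n ==> nev n (stp (NS c) (NT c)) (kW j) = ?M (\<lambda>i. if i = j then 1 else 0)" for j
 proof (induction j)
  case 0
  show ?case unfolding nev_kW_Suc[OF N_gamma] N_proj by (auto intro!: eq_matI simp: NP_def)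
 next
  case (Suc j)
  then have j: "j < n" "j < n - 1" by auto
  show ?case unfolding step[OF Suc.IH[OF j(1)] j(1)]
   by (rule M) (use j in \<open>auto simp: NS_entries NA_entries sw_def up_def dest: odd_pos\<close>)
 qed
 have "nev n (stp (NS c) (NT c)) (kW (Suc (n - 1))) = ?M (za c)"
 proof -
  have l: "n - 1 < n" using npos by simp
  show ?thesis unfolding step[OF 1[OF l] l]
   by (rule M) (use npos NS_entries(2) NA_entries(2) in \<open>cases "even n"; simp\<close>)
 qed
 then show "nev n (stp (NS c) (NT c)) (kW n) = ?M (za c)" using npos by simp
qed

lemma KB_N: "KB (stp (NS c) (NT c)) = 1\<^sub>m n"
 by (rule eq_matI) (use npos in \<open>auto simp: KB_def kW_N xa_def\<close>)

lemma last_diagonal: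
 fixes X Y :: "complex mat"
 assumes "X \<in> mats n" "Y \<in> mats n" "mtr X = mtr Y" "\<And>i. i < n - 1 ==> X $$ (i,i) = Y $$ (i,i)"
 shows "X $$ (n-1,n-1) = Y $$ (n-1,n-1)"
proof -
 have "mtr Z = (\<Sum>i<n - 1. Z $$ (i,i)) + Z $$ (n-1,n-1)" if "Z \<in> mats n" for Z :: "complex mat"
 proof -
  have "dim_row Z = Suc (n - 1)" using that npos by auto
  then show ?thesis unfolding mtr_def by (simp only: sum.lessThan_Suc)
 qed
 from this[OF assms(1)] this[OF assms(2)] assms(3,4) show ?thesis by simp
qed

text \<open>In the basis given by the columns of \<open>KB\<close> all columns of \<open>S\<close> and \<open>A\<close> but the last ones are
 known. The relations and the traces determine what remains up to the parameters.\<close>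
lemma normal_form_exists:
 assumes g: "gamma_pair n S T" and d: "dim_vector \<rho> (stp S T) = \<alpha>" and D: "det (KB (stp S T)) \<noteq> 0"
 shows "\<exists>c. rep_iso (stp S T) (stp (NS c) (NT c))"
proof -
 note G = gamma_pairD[OF g] and tD = triD[OF tri]
 define A P where "A = proj n T e1" and "P = proj n T e3"
 have C: "A \<in> mats n" "P \<in> mats n" unfolding A_def P_def using proj_carrier[OF G(2)] by auto
 have idem: "A * A = A" "P * P = P" "A * P = 0\<^sub>m n n" "P * A = 0\<^sub>m n n"
  unfolding A_def P_def using proj_mult[OF G(2,4)] tD by simp_all
 have tr: "mtr S = (if even n then 0 else 1)" "mtr A = of_nat (n div 2)" "mtr P = 1"
  using dims[OF g] d unfolding A_def P_def by auto
 define W where "W j = nev n (stp S T) (kW j)" for j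
 have WC: "W j \<in> mats n" for j by (simp add: W_def)
 have W0: "W 0 = P" unfolding W_def nev_kW_Suc[OF g] P_def ..
 have SW: "S * W j = W (sw j)" and AW: "j \<noteq> 0 ==> A * W j = W (up j)" for j
  unfolding W_def A_def kW_mult[OF g] by simp_all
 define B where "B = KB (stp S T)"
 have BC: "B \<in> mats n" by (simp add: B_def)
 have Bi: "B $$ (i,j) = W j $$ (i,0)" if "i < n" "j < n" for i j using that by (simp add: B_def KB_def W_def)
 obtain Q where Q: "Q \<in> mats n" "B * Q = 1\<^sub>m n" "Q * B = 1\<^sub>m n" using det_inverse_exists[OF BC] D unfolding B_def by blast
 define R where "R X = Q * X * B" for X
 have RC: "R X \<in> mats n" if "X \<in> mats n" for X using that Q BC unfolding R_def by simp
 have Rm: "R X * R Y = R (X * Y)" if "X \<in> mats n" "Y \<in> mats n" for X Y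
  unfolding R_def by (rule conj_mult[OF Q(1) BC Q(2) that])
 have Rt: "mtr (R X) = mtr X" if "X \<in> mats n" for X unfolding R_def by (rule mtr_conj[OF Q(1) BC Q(2) that])
 have BR: "B * R X = X * B" if X: "X \<in> mats n" for X
 proof -
  have XB: "X * B \<in> mats n" using X BC by simp
  show ?thesis unfolding R_def assoc_mult_mat[OF Q(1) X BC] by (rule cancel_left[OF BC Q(1,2) XB])
 qed
 have Rcol: "R X $$ (i,j) = (\<Sum>k<n. Q $$ (i,k) * (X * W j) $$ (k,0))" if X: "X \<in> mats n" and ij: "i < n" "j < n" for X i j
 proof -
  have XB: "X * B \<in> mats n" using X BC by simp
  have "(X * B) $$ (k,j) = (X * W j) $$ (k,0)" if "k < n" for k
   unfolding mult_idx[OF X BC that ij(2)] mult_idx[OF X WC that npos] using ij by (intro sum.cong refl) (simp add: Bi)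
  then show ?thesis unfolding R_def assoc_mult_mat[OF Q(1) X BC] mult_idx[OF Q(1) XB ij] by simp
 qed
 have Rdelta: "R X $$ (i,j) = (if i = l then 1 else 0)" if X: "X \<in> mats n" and ij: "i < n" "j < n" "l < n" and e: "X * W j = W l" for X i j l
 proof -
  have "R X $$ (i,j) = (Q * B) $$ (i,l)" unfolding Rcol[OF X ij(1,2)] e mult_idx[OF Q(1) BC ij(1,3)] using ij by (intro sum.cong refl) (simp add: Bi)
  then show ?thesis unfolding Q(3) using ij by simp
 qed
 have SR: "R S $$ (i,j) = (if i = sw j then 1 else 0)" if "i < n" "j < n" "\<not> (odd n \<and> j = n - 1)" for i j
  using Rdelta[OF G(1) that(1,2) _ SW] sw_less[OF that(2,3)] by blast
 have AR: "R A $$ (i,j) = (if j \<noteq> 0 \<and> i = up j then 1 else 0)" if "i < n" "j < n" "\<not> (even n \<and> j = n - 1)" for i j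
 proof (cases "j = 0")
  case True
  have "A * W 0 = 0\<^sub>m n n" by (simp add: W0 idem)
  then show ?thesis using True npos Rcol[OF C(1) that(1,2)] by simp
 next
  case False
  then show ?thesis using Rdelta[OF C(1) that(1,2) _ AW] up_less[OF that(2,3)] by simp
 qed
 have PR0: "R P $$ (i,0) = (if i = 0 then 1 else 0)" if "i < n" for i
  using Rdelta[OF C(2) that npos npos] by (simp add: W0 idem)
 define x where "x j = R P $$ (0,j)" for j
 \<comment> \<open>The projector \<open>R P\<close> has rank one and fixes the first basis vector, so that only its first row is non-zero.\<close>
 have PR: "R P $$ (i,j) = (if i = 0 then x j else 0)" if ij: "i < n" "j < n" for i j
 proof -
  have "R P * R P = R P" unfolding Rm[OF C(2,2)] idem ..
  then obtain r U V where U: "U \<in> carrier_mat n r" "V \<in> carrier_mat r n" "R P = U * V" "mtr (R P) = of_nat r"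
   using idempotent_factor[OF RC[OF C(2)]] by blast
  have "of_nat r = (1::complex)" using U(4) Rt[OF C(2)] tr by simp
  then have r1: "r = 1" by simp
  have e: "R P $$ (i,j) = U $$ (i,0) * V $$ (0,j)" if "i < n" "j < n" for i j
   unfolding U(3) mult_idx[OF U(1,2) that] r1 by simp
  have "U $$ (0,0) * V $$ (0,0) = 1" using PR0[OF npos] e[OF npos npos] by simp
  then have "V $$ (0,0) \<noteq> 0" by auto
  then have "i \<noteq> 0 ==> U $$ (i,0) = 0" using PR0[OF ij(1)] e[OF ij(1) npos] by simp
  then show ?thesis using e[OF ij] by (cases "i = 0") (simp add: x_def, simp)
 qed
 have PA: "(\<Sum>l<n. x l * R A $$ (l,j)) = 0" if j: "j < n" for j
 proof -
  have "R P * R A = R (0\<^sub>m n n)" unfolding Rm[OF C(2,1)] idem ..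
  also have "R (0\<^sub>m n n) = 0\<^sub>m n n" using Q BC by (simp add: R_def)
  finally have "(R P * R A) $$ (0,j) = 0" using npos j by simp
  then show ?thesis unfolding mult_idx[OF RC[OF C(2)] RC[OF C(1)] npos j] by (simp add: x_def)
 qed
 have xeven: "x j = 0" if "j < n" "even j" "j \<noteq> 0" for j
 proof -
  have u: "up j = j" "\<not> (even n \<and> j = n - 1)" using that npos by (auto simp: up_def)
  have "(\<Sum>l<n. x l * R A $$ (l,j)) = (\<Sum>l<n. if l = j then x l else 0)"
   using that u by (intro sum.cong refl) (auto simp: AR)
  then show ?thesis using PA[OF that(1)] that by simp
 qed
 define z where "z i = (if odd n then R S else R A) $$ (i,n-1)" for i
 define c where "c i = (if even i then z i else x i)" for i
 have l: "n - 1 < n" using npos by simp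
 \<comment> \<open>All other diagonal entries agree with those of the normal form, and so do the traces.\<close>
 have z1: "z (n - 1) = 1"
 proof (cases "even n")
  case False
  have "R S $$ (n-1,n-1) = NS c $$ (n-1,n-1)"
   by (rule last_diagonal[OF RC[OF G(1)] NC(1)]) (use Rt[OF G(1)] tr N_traces in \<open>auto simp: SR NS_entries\<close>)
  then show ?thesis using False NS_entries(2)[OF _ l] by (simp add: z_def za_def)
 next
  case True
  have "R A $$ (n-1,n-1) = NA c $$ (n-1,n-1)"
   by (rule last_diagonal[OF RC[OF C(1)] NC(2)]) (use Rt[OF C(1)] tr N_traces in \<open>auto simp: AR NA_entries\<close>)
  then show ?thesis using True NA_entries(2)[OF _ l] by (simp add: z_def za_def)
 qed
 have zz: "za c i = z i" if i: "i < n" for i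
 proof (cases "i = n - 1 \<or> even i")
  case True
  then show ?thesis using z1 by (auto simp: za_def c_def)
 next
  case False
  then have i1: "i \<noteq> n - 1" and o: "odd i" by auto
  show ?thesis
  proof (cases "even n")
   case n: False
   have i': "i - 1 < n" "i - 1 \<noteq> n - 1" "even (i - 1)" "sw (i - 1) = i" using i o by (auto simp: sw_def dest: odd_pos)
   have "(R S * R S) $$ (i - 1,n-1) = 0" unfolding Rm[OF G(1,1)] G(3) using Q i' l by (simp add: R_def)
   moreover have "(R S * R S) $$ (i - 1,n-1) = R S $$ (i - 1,n-1) * R S $$ (n-1,n-1) + (if i - 1 \<noteq> n - 1 then R S $$ (sw (i - 1),n-1) else 0)"
    by (rule swap_square[OF RC[OF G(1)] n i'(1)]) (use SR in auto)
   ultimately have "z (i - 1) + z i = 0" using i' n z1 by (simp add: z_def)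
   then have "z i = - z (i - 1)" by (simp add: eq_neg_iff_add_eq_0 add.commute)
   then show ?thesis using i1 o i' n by (simp add: za_def c_def)
  next
   case n: True
   have i': "i + 1 < n" using i i1 by simp
   have "(R A * R A) $$ (i + 1,n-1) = R A $$ (i + 1,n-1)" unfolding Rm[OF C(1,1)] idem ..
   moreover have "(R A * R A) $$ (i + 1,n-1) = R A $$ (i + 1,n-1) * R A $$ (n-1,n-1) + (if even (i + 1) \<and> i + 1 \<noteq> 0 then R A $$ (i + 1,n-1) + R A $$ (i + 1 - 1,n-1) else 0)"
    by (rule up_square[OF RC[OF C(1)] n i']) (use AR in auto)
   ultimately have "z (i + 1) + z i = 0" using o n z1 by (simp add: z_def)
   then have "z i = - z (i + 1)" by (simp add: eq_neg_iff_add_eq_0 add.commute)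
   then show ?thesis using i1 o n by (simp add: za_def c_def)
  qed
 qed
 have xx: "xa c j = x j" if j: "j < n" for j
 proof -
  have x0: "x 0 = 1" using PR0[OF npos] by (simp add: x_def)
  consider "j = 0" | "j \<noteq> 0" "even j" | "odd j" "j \<noteq> n - 1" | "odd j" "j = n - 1" by blast
  then show ?thesis
  proof cases
   case 4
   then have n: "even n" "n = Suc (n - 1)" using j by auto
   have "(\<Sum>l<n. x l * z l) = 0" using PA[OF l] n(1) unfolding z_def by simp
   then have "(\<Sum>l<n - 1. x l * z l) + x (n-1) * z (n-1) = 0" by (subst (asm) n(2)) (simp only: sum.lessThan_Suc)
   then have "x (n-1) = - (\<Sum>l<n - 1. x l * z l)" using z1 by (simp add: eq_neg_iff_add_eq_0 add.commute)
   moreover have "(\<Sum>l<n - 1. (if l = 0 then 1 else if even l then 0 else c l) * za c l) = (\<Sum>l<n - 1. x l * z l)"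
    by (intro sum.cong refl) (auto simp: zz x0 xeven c_def)
   ultimately show ?thesis using 4 odd_pos[OF 4(1)] by (simp add: xa_def)
  qed (use j xeven x0 in \<open>auto simp: xa_def c_def dest: odd_pos\<close>)
 qed
 have last: "j = n - 1 \<or> j < n - 1" if "j < n" for j using that by auto
 have S': "NS c = R S"
 proof (rule eq_matI)
  fix i j assume "i < dim_row (R S)" "j < dim_col (R S)"
  then have ij: "i < n" "j < n" using RC[OF G(1)] by auto
  show "NS c $$ (i,j) = R S $$ (i,j)"
   using ij zz[OF ij(1)] SR[OF ij] by (auto simp: NS_def z_def)
 qed (use carrier_matD[OF RC[OF G(1)]] carrier_matD[OF NC(1)] in simp_all)
 have A': "NA c = R A"
 proof (rule eq_matI)
  fix i j assume "i < dim_row (R A)" "j < dim_col (R A)"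
  then have ij: "i < n" "j < n" using RC[OF C(1)] by auto
  show "NA c $$ (i,j) = R A $$ (i,j)"
   using ij zz[OF ij(1)] AR[OF ij] by (auto simp: NA_def z_def)
 qed (use carrier_matD[OF RC[OF C(1)]] carrier_matD[OF NC(2)] in simp_all)
 have P': "NP c = R P"
 proof (rule eq_matI)
  fix i j assume "i < dim_row (R P)" "j < dim_col (R P)"
  then have ij: "i < n" "j < n" using RC[OF C(2)] by auto
  show "NP c $$ (i,j) = R P $$ (i,j)" using ij xx[OF ij(2)] PR[OF ij] by (simp add: NP_def)
 qed (use carrier_matD[OF RC[OF C(2)]] carrier_matD[OF NC(3)] in simp_all)
 have "rep_iso (stp S T) (stp (NS c) (NT c))"
 proof (rule stp_intertwine_iso[OF g N_gamma BC Q(1,2,3)])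
  show "S * B = B * NS c" unfolding S' BR[OF G(1)] ..
  have T: "T = e2 \<cdot>\<^sub>m 1\<^sub>m n + ((e1 - e2) \<cdot>\<^sub>m A + (e3 - e2) \<cdot>\<^sub>m P)"
   unfolding A_def P_def by (rule proj_sum(2)[OF tri G(2)])
  have "T * B = e2 \<cdot>\<^sub>m B + ((e1 - e2) \<cdot>\<^sub>m (A * B) + (e3 - e2) \<cdot>\<^sub>m (P * B))"
   unfolding T using C BC
   by (simp add: add_mult_distrib_mat[of _ n n _ _ n] mult_smult_assoc_mat[of _ n n _ n])
  also have "\<dots> = B * NT c" unfolding BR[OF C(1), symmetric] BR[OF C(2), symmetric] NT_def A' P' using RC[OF C(1)] RC[OF C(2)] BC
   by (simp add: mult_add_distrib_mat[of _ n n _ n] mult_smult_distrib[of _ n n _ n])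
  finally show "T * B = B * NT c" .
 qed
 then show ?thesis by (rule exI[of _ c])
qed

lemma rank_one_trace:
 fixes X :: "complex mat"
 assumes "X \<in> mats n"
 shows "mtr (X * mat n n (\<lambda>(i,l). u i * x l)) = (\<Sum>b<n. u b * (\<Sum>a<n. x a * X $$ (a,b)))"
proof -
 have "mtr (X * mat n n (\<lambda>(i,l). u i * x l)) = (\<Sum>a<n. \<Sum>b<n. u b * (x a * X $$ (a,b)))"
 proof -
  have "(X * mat n n (\<lambda>(i,l). u i * x l)) $$ (a,a) = (\<Sum>b<n. u b * (x a * X $$ (a,b)))" if "a < n" for a
   using that by (subst mult_idx[OF assms _ that that]) (auto intro!: sum.cong)
  then show ?thesis unfolding mtr_def using assms by (intro sum.cong) auto
 qed
 then show ?thesis by (subst (asm) sum.swap) (simp add: sum_distrib_left)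
qed

text \<open>The parameters are recovered by invariants. An odd one is the trace of \<open>kW j\<close>. An even one is
 a coordinate of the vector \<open>za c\<close> and is obtained by Cramer's rule from the traces of \<open>q i * kW
 l\<close>. The \<open>q i\<close> are chosen by Burnside's theorem such that the matrix of the linear system is the
 unit matrix at the base point \<open>c0\<close>.\<close>
lemma flag_exists:
 assumes s: "simple_rep n \<psi>" "\<psi> \<in> FG n \<alpha>"
 shows "\<exists>c0. simple_rep n (stp (NS c0) (NT c0)) \<and> (\<forall>j<n - 1. \<exists>f. releases n (\<lambda>c. stp (NS c) (NT c)) c0 j f)"
proof -
 let ?N = "\<lambda>c. stp (NS c) (NT c)"
 have NF: "?N c \<in> FG n \<alpha>" for c unfolding FG_def using N_gamma N_dim by blast
 have "det (KB (?N (\<lambda>_. 0))) \<noteq> 0" by (simp add: KB_N)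
 from FG_generic_simple[OF s KB_regular NF this] obtain \<chi> where x: "\<chi> \<in> FG n \<alpha>" "simple_rep n \<chi>" "det (KB \<chi>) \<noteq> 0" by blast
 then obtain c0 where "rep_iso \<chi> (?N c0)" using normal_form_exists unfolding FG_def by blast
 then have c0: "simple_rep n (?N c0)" using simple_iso[OF x(2) _ FG_rep[OF NF]] by blast
 have "\<forall>i. \<exists>p. nev n (?N c0) p = mat n n (\<lambda>(a,b). if a = 0 \<and> b = i then 1 else 0)"
  using burnside[OF c0] unfolding full_rep_def by simp
 then obtain q where q: "\<And>i. nev n (?N c0) (q i) = mat n n (\<lambda>(a,b). if a = 0 \<and> b = i then 1 else 0)" by metis
 define H where "H j \<phi> = mat n n (\<lambda>(i,l). ntrn n (NMul (q i) (kW (if l = j then n else l))) \<phi>)" for j \<phi>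
 have HI: "(\<lambda>\<phi>. det (H j \<phi>)) \<in> invariant_fun n" for j
 proof (rule matfun_det[OF subalg_invariant])
  show "H j \<in> matfun (invariant_fun n) n n" unfolding H_def[abs_def]
   by (rule matfun_mat) (simp only: prod.case ntrn_invariant)
 qed
 define R where "R c = mat n n (\<lambda>(i,l). \<Sum>a<n. xa c a * nev n (?N c) (q i) $$ (a,l))" for c
 have RC: "R c \<in> mats n" for c by (simp add: R_def)
 have t1: "ntrn n (NMul p (kW l)) (?N c) = (\<Sum>a<n. xa c a * nev n (?N c) p $$ (a,l))" if "l < n" for p l c
 proof -
  have "ntrn n (NMul p (kW l)) (?N c) = (\<Sum>b<n. (if b = l then 1 else 0) * (\<Sum>a<n. xa c a * nev n (?N c) p $$ (a,b)))"
   unfolding ntrn_def nev.simps kW_N(1)[OF that] by (rule rank_one_trace) simp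
  also have "\<dots> = (\<Sum>b<n. if b = l then (\<Sum>a<n. xa c a * nev n (?N c) p $$ (a,b)) else 0)"
   by (intro sum.cong refl) auto
  finally show ?thesis using that by simp
 qed
 have t2: "ntrn n (NMul p (kW n)) (?N c) = (\<Sum>b<n. za c b * (\<Sum>a<n. xa c a * nev n (?N c) p $$ (a,b)))" for p c
  unfolding ntrn_def nev.simps kW_N(2) by (rule rank_one_trace) simp
 have Hn: "H n (?N c) = R c" for c
  by (rule eq_matI) (auto simp: H_def R_def t1)
 have Hj: "det (H j (?N c)) = za c j * det (R c)" if j: "j < n" for j c
 proof -
  have "H j (?N c) = replace_col (R c) (R c *\<^sub>v vec n (za c)) j"
  proof (rule eq_matI)
   fix i l assume "i < dim_row (replace_col (R c) (R c *\<^sub>v vec n (za c)) j)" "l < dim_col (replace_col (R c) (R c *\<^sub>v vec n (za c)) j)"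
   then have il: "i < n" "l < n" by (auto simp: replace_col_def R_def)
   have "(R c *\<^sub>v vec n (za c)) $ i = (\<Sum>b<n. za c b * (\<Sum>a<n. xa c a * nev n (?N c) (q i) $$ (a,b)))"
    using mult_vec_idx[OF RC _ il(1), of "vec n (za c)" c] il by (simp add: R_def mult.commute)
   then show "H j (?N c) $$ (i,l) = replace_col (R c) (R c *\<^sub>v vec n (za c)) j $$ (i,l)"
    using il by (simp add: H_def replace_col_def t1 t2 R_def)
  qed (auto simp: H_def replace_col_def R_def)
  then show ?thesis using cramer_lemma_mat[OF RC _ j, of "vec n (za c)" c] j by simp
 qed
 have R0: "R c0 = 1\<^sub>m n"
 proof (rule eq_matI)
  fix i l assume "i < dim_row (1\<^sub>m n)" "l < dim_col (1\<^sub>m n)"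
  then have il: "i < n" "l < n" by auto
  have "R c0 $$ (i,l) = (\<Sum>a<n. if a = 0 then (if l = i then 1 else 0) else 0)"
  proof -
   have "R c0 $$ (i,l) = (\<Sum>a<n. xa c0 a * mat n n (\<lambda>(a,b). if a = 0 \<and> b = i then 1 else 0) $$ (a,l))"
    using il by (simp add: R_def q)
   also have "\<dots> = (\<Sum>a<n. if a = 0 then (if l = i then 1 else 0) else 0)"
    using il by (intro sum.cong refl) (auto simp: xa_def)
   finally show ?thesis .
  qed
  then show "R c0 $$ (i,l) = 1\<^sub>m n $$ (i,l)" using il npos by auto
 qed (simp_all add: R_def)
 have regp: "(\<lambda>c. det (H n (?N c))) \<in> polys"
 proof -
  have "R \<in> matfun polys n n"
  proof -
   have "(\<lambda>c. nev n (?N c) p) \<in> matfun polys n n" for p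
   proof (rule matfun_nev[OF subalg_polys])
    note M = matfun_mult[OF subalg_polys, of _ n n _ n]
    have "(\<lambda>c. fst (?N c)) \<in> matfun polys n n" "(\<lambda>c. snd (?N c)) \<in> matfun polys n n"
     unfolding stp_def fst_conv snd_conv using M[OF N_polys(2) M[OF N_polys(2,1)]] M[OF N_polys(1) M[OF N_polys(2,2)]] by simp_all
    then show "i < n ==> j < n ==> (\<lambda>c. fst (?N c) $$ (i,j)) \<in> polys" "i < n ==> j < n ==> (\<lambda>c. snd (?N c) $$ (i,j)) \<in> polys" for i j
     using matfunD(2) by blast+
   qed
   note nv = this
   show ?thesis unfolding R_def[abs_def]
    by (rule matfun_mat) (simp only: prod.case, intro subalg_sum[OF subalg_polys] subalg_mult[OF subalg_polys] xa_polys matfunD(2)[OF nv], auto)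
  qed
  then show ?thesis unfolding Hn by (rule matfun_det[OF subalg_polys])
 qed
 have "\<exists>f. releases n ?N c0 j f" if j: "j < n - 1" for j
 proof (cases "even j")
  case False
  define f where "f \<phi> = ntrn n (kW j) \<phi> - c0 j" for \<phi>
  have fI: "f \<in> invariant_fun n" unfolding f_def[abs_def]
   by (intro subalg_diff[OF subalg_invariant] ntrn_invariant subalg_const[OF subalg_invariant])
  have fN: "f (?N c) = c j - c0 j" for c
  proof -
   have "mtr (nev n (?N c) (kW j)) = (\<Sum>i<n. if i = j then xa c i else 0)"
    unfolding mtr_def using j by (intro sum.cong) (auto simp: kW_N(1))
   then show ?thesis using j False by (auto simp: f_def ntrn_def xa_def dest: odd_pos)
  qed
  show ?thesis unfolding releases_def
  proof (rule exI[of _ f], intro conjI fI)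
   show "\<forall>c. (\<forall>i. j \<le> i --> i < n - 1 --> c i = c0 i) --> f (?N c) = 0" using j by (simp add: fN)
   show "\<exists>c. (\<forall>i. j < i --> i < n - 1 --> c i = c0 i) \<and> f (?N c) \<noteq> 0"
    by (rule exI[of _ "c0(j := c0 j + 1)"]) (simp add: fN)
  qed
 next
  case True
  define f where "f \<phi> = det (H j \<phi>) - c0 j * det (H n \<phi>)" for \<phi>
  have fI: "f \<in> invariant_fun n" unfolding f_def[abs_def]
   by (intro subalg_diff[OF subalg_invariant] subalg_mult[OF subalg_invariant] HI subalg_const[OF subalg_invariant])
  have fN: "f (?N c) = (c j - c0 j) * det (H n (?N c))" for c
   using Hj[of j c] j True unfolding f_def Hn by (simp add: za_def algebra_simps)
  show ?thesis unfolding releases_def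
  proof (rule exI[of _ f], intro conjI fI)
   show "\<forall>c. (\<forall>i. j \<le> i --> i < n - 1 --> c i = c0 i) --> f (?N c) = 0" using j by (simp add: fN)
   have d0: "det (H n (?N c0)) \<noteq> 0" unfolding Hn R0 by simp
   obtain t where t: "t \<noteq> 0" "det (H n (?N (\<lambda>i. c0 i + t * ((c0(j := c0 j + 1)) i - c0 i)))) \<noteq> 0"
    using polys_generic[OF regp d0 subalg_const[OF subalg_polys, of 1], where c' = "c0(j := c0 j + 1)" and X = "{0}"] by auto
   have "(\<lambda>i. c0 i + t * ((c0(j := c0 j + 1)) i - c0 i)) = c0(j := c0 j + t)" by auto
   then show "\<exists>c. (\<forall>i. j < i --> i < n - 1 --> c i = c0 i) \<and> f (?N c) \<noteq> 0"
    using t by (intro exI[of _ "c0(j := c0 j + t)"]) (simp add: fN)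
  qed
 qed
 then show ?thesis using c0 by blast
qed

text \<open>The words of \<open>kW\<close> in reverse order.\<close>
primrec rW :: "nat => ncp" where
 "rW 0 = NC 1"
| "rW (Suc j) = NMul (rW j) (if even j then pS else pE e1)"

text \<open>The value of the invariant form on two basis vectors: since \<open>S\<close> and \<open>A\<close> have to be
 self-adjoint, the word of the first vector is moved to the second one in reverse order. The
 indices are unbounded because the recursion leaves the range of the basis.\<close>
definition form :: "(nat => complex) => nat => nat => complex" where
 "form c i j = (NP c * (nev n (stp (NS c) (NT c)) (rW i) * nev n (stp (NS c) (NT c)) (kW j))) $$ (0,0)"

lemma form_0: "form c 0 j = (if j = 0 then 1 else if even j then 0 else form c 0 j)"
proof -
 let ?W = "\<lambda>j. nev n (stp (NS c) (NT c)) (kW j)"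
 have one: "nev n (stp (NS c) (NT c)) (rW 0) * ?W j = ?W j" for j
 proof -
  have "1 \<cdot>\<^sub>m 1\<^sub>m n = (1\<^sub>m n :: complex mat)" by auto
  then show ?thesis by simp
 qed
 have "form c 0 j = 0" if j: "even j" "j \<noteq> 0"
 proof -
  obtain l where l: "j = Suc l" "odd l" using j by (cases j) auto
  have "NP c * ?W j = (NP c * NA c) * ?W l"
   unfolding l(1) nev_kW_Suc[OF N_gamma] N_proj using l(2) assoc_mult_mat[OF NC(3,2) nev_carrier] by simp
  also have "\<dots> = 0\<^sub>m n n" unfolding NP_NA by simp
  finally have "NP c * ?W j = 0\<^sub>m n n" .
  then show ?thesis unfolding form_def one using npos by simp
 qed
 moreover have "form c 0 0 = 1"
  unfolding form_def one unfolding nev_kW_Suc(1)[OF N_gamma] N_proj NP_square using npos by (simp add: NP_def xa_def)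
 ultimately show ?thesis by auto
qed

lemma form_Suc: "form c (Suc i) j = (if even i then form c i (sw j) else if j = 0 then 0 else form c i (up j))"
proof -
 let ?N = "stp (NS c) (NT c)"
 let ?X = "nev n ?N (rW i)" let ?F = "if even i then NS c else NA c"
 have F: "?F \<in> mats n" by simp
 have "nev n ?N (rW (Suc i)) = ?X * ?F" using nev_generators[OF N_gamma] N_proj by simp
 then have "nev n ?N (rW (Suc i)) * nev n ?N (kW j) = ?X * (?F * nev n ?N (kW j))"
  using assoc_mult_mat[OF nev_carrier F nev_carrier] by simp
 also have "?F * nev n ?N (kW j) = (if even i then nev n ?N (kW (sw j)) else if j = 0 then 0\<^sub>m n n else nev n ?N (kW (up j)))"
  using kW_mult[OF N_gamma, of c j] unfolding N_proj by simp
 finally have "nev n ?N (rW (Suc i)) * nev n ?N (kW j) = ?X * (if even i then nev n ?N (kW (sw j)) else if j = 0 then 0\<^sub>m n n else nev n ?N (kW (up j)))" .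
 then show ?thesis unfolding form_def using npos
  by (cases "even i"; cases "j = 0") (simp_all only: refl if_True if_False right_mult_zero_mat[OF nev_carrier] right_mult_zero_mat[OF NC(3)] index_zero_mat)
qed

text \<open>Moving one letter at a time from the first to the second word ends with a value that depends
 on the parities and the sum of the indices only, up to shifts; this makes the symmetry of the form
 visible.\<close>
lemma form_explicit:
 "form c i j = (if odd (i + j) then form c 0 (i + j) else if i = 0 \<or> j = 0 then (if i = j then 1 else 0)
   else if even i then form c 0 (i + j - 1) else if i = 1 \<or> j = 1 then (if i = j then 1 else 0) else form c 0 (i + j - 3))"
proof (induction i arbitrary: j)
 case 0
 show ?case using form_0[of c j] by auto
next
 case (Suc i)
 have nz: "odd m ==> m \<noteq> 0" for m :: nat by (rule odd_pos[THEN gr_implies_not0])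
 show ?case
 proof (cases "even i"; cases "even j")
  assume e: "even i" "even j"
  then show ?thesis unfolding form_Suc Suc.IH[of "sw j"] by (simp add: sw_def)
 next
  assume e: "even i" "odd j"
  then obtain l where "j = Suc l" "even l" by (cases j) auto
  then show ?thesis using e unfolding form_Suc Suc.IH[of "sw j"] by (auto simp: sw_def)
 next
  assume e: "odd i" "even j"
  then show ?thesis unfolding form_Suc Suc.IH[of "up j"] using nz[OF e(1)] by (auto simp: up_def)
 next
  assume e: "odd i" "odd j"
  then show ?thesis unfolding form_Suc Suc.IH[of "up j"] using nz[OF e(2)] by (simp add: up_def)
 qed
qed

lemma form_sym: "form c i j = form c j i"
 unfolding form_explicit[of c i j] form_explicit[of c j i] by (auto simp: add.commute)

text \<open>The matrix of \<open>form\<close> satisfies the hypotheses of \<open>self_adjoint_reversal\<close>. For \<open>S\<close> and \<open>A\<close> only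
 the last index is not covered by the permutations \<open>sw\<close> and \<open>up\<close>, and \<open>self_adjointI\<close> takes care of
 it.\<close>
lemma N_reversal:
 assumes s: "simple_rep n (stp (NS c) (NT c))"
 shows "ntrn n (nrev q) (stp (NS c) (NT c)) = ntrn n q (stp (NS c) (NT c))"
proof -
 let ?N = "stp (NS c) (NT c)"
 let ?X = "\<lambda>i. nev n ?N (rW i)"
 define D where "D = mat n n (\<lambda>(i,j). form c i j)"
 have DC: "D \<in> mats n" by (simp add: D_def)
 have Ds: "D $$ (i,j) = D $$ (j,i)" if "i < n" "j < n" for i j using that form_sym by (simp add: D_def)
 have NX: "NP c * ?X i \<in> mats n" for i using mult_carrier_mat[OF NC(3) nev_carrier] .
 have row: "D $$ (i,j) = (NP c * ?X i) $$ (0,j)" if ij: "i < n" "j < n" for i j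
 proof -
  have "form c i j = ((NP c * ?X i) * nev n ?N (kW j)) $$ (0,0)"
   unfolding form_def assoc_mult_mat[OF NC(3) nev_carrier nev_carrier] ..
  also have "\<dots> = (NP c * ?X i) $$ (0,j)"
   by (rule mult_delta_col[OF NX nev_carrier npos npos ij(2)]) (use kW_N(1)[OF ij(2), of c] npos in \<open>simp add: xa_def\<close>)
  finally show ?thesis using ij by (simp add: D_def)
 qed
 have DY: "(D * Y) $$ (i,j) = (NP c * (?X i * Y)) $$ (0,j)" if ij: "i < n" "j < n" and Y: "Y \<in> mats n" for i j Y
  unfolding assoc_mult_mat[OF NC(3) nev_carrier Y, symmetric] mult_idx[OF DC Y ij] mult_idx[OF NX Y npos ij(2)]
  using ij by (intro sum.cong refl) (simp add: row)
 have nP: "nev n ?N pS = NS c" "nev n ?N (pE e1) = NA c" using nev_generators[OF N_gamma] N_proj by simp_all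
 have XS: "?X i * NS c = ?X (sw i)" for i
 proof (cases "even i")
  case True
  then show ?thesis using nP by (simp add: sw_def)
 next
  case False
  then obtain l where l: "i = Suc l" "even l" by (cases i) auto
  then show ?thesis using nP assoc_mult_mat[OF nev_carrier[of n ?N "rW l"] NC(1)[of c] NC(1)[of c]] by (simp add: sw_def NS_square)
 qed
 have XA: "?X i * NA c = ?X (up i)" if i0: "i \<noteq> 0" for i
 proof (cases "even i")
  case False
  then show ?thesis using nP by (simp add: up_def)
 next
  case True
  then obtain l where l: "i = Suc l" "odd l" using i0 by (cases i) auto
  then show ?thesis using nP True assoc_mult_mat[OF nev_carrier[of n ?N "rW l"] NC(2)[of c] NC(2)[of c]] by (simp add: up_def NA_square)
 qed
 have X0: "?X 0 = 1\<^sub>m n" by auto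
 have dS: "(D * NS c) $$ (i,j) = (D * NS c) $$ (j,i)" if ij: "i < n" "j < n" and b: "\<not> (odd n \<and> i = n - 1)" for i j
 proof -
  note u = sw_less[OF ij(1) b]
  have "(D * NS c) $$ (i,j) = D $$ (sw i,j)" unfolding DY[OF ij NC(1)] XS using row u ij by simp
  also have "\<dots> = D $$ (j, sw i)" using Ds u ij by simp
  also have "\<dots> = (D * NS c) $$ (j,i)"
   by (rule mult_delta_col[OF DC NC(1) ij(2,1), symmetric]) (use u b ij in \<open>auto simp: NS_def\<close>)
  finally show ?thesis .
 qed
 have dA: "(D * NA c) $$ (i,j) = (D * NA c) $$ (j,i)" if ij: "i < n" "j < n" and b: "\<not> (even n \<and> i = n - 1)" for i j
 proof (cases "i = 0")
  case True
  have "NA c $$ (l,i) = 0" if "l < n" for l using True b that ij by (auto simp: NA_def)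
  then have "(D * NA c) $$ (j,i) = 0" unfolding mult_idx[OF DC NC(2) ij(2,1)] by simp
  moreover have "(D * NA c) $$ (i,j) = 0"
  proof -
   have "(D * NA c) $$ (i,j) = (NP c * (?X 0 * NA c)) $$ (0,j)" using DY[OF ij NC(2)] True by (simp only:)
   then show ?thesis unfolding X0 left_mult_one_mat[OF NC(2)] NP_NA using npos ij by simp
  qed
  ultimately show ?thesis by simp
 next
  case False
  note u = up_less[OF ij(1) b]
  have "(D * NA c) $$ (i,j) = D $$ (up i,j)" unfolding DY[OF ij NC(2)] XA[OF False] using row u ij by simp
  also have "\<dots> = D $$ (j, up i)" using Ds u ij by simp
  also have "\<dots> = (D * NA c) $$ (j,i)"
   by (rule mult_delta_col[OF DC NC(2) ij(2,1), symmetric]) (use u b ij False in \<open>auto simp: NA_def\<close>)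
  finally show ?thesis .
 qed
 have dA': "(D * NA c) $$ (i,j) = (D * NA c) $$ (j,i)" if ij: "i < n" "j < n" for i j
 proof (cases "even n \<and> i = n - 1")
  case True
  then show ?thesis using dA[OF ij(2,1)] ij by (cases "j = i") auto
 qed (rule dA[OF ij])
 have dP: "(D * NP c) $$ (i,j) = D $$ (0,i) * D $$ (0,j)" if ij: "i < n" "j < n" for i j
  unfolding mult_NP[OF DC ij] using Ds[OF ij(1) npos] row[OF npos ij(2)] X0 NC(3) npos ij by (simp add: NP_def)
 have T: "(D * NT c) $$ (i,j) = e2 * D $$ (i,j) + ((e1 - e2) * (D * NA c) $$ (i,j) + (e3 - e2) * (D * NP c) $$ (i,j))" if ij: "i < n" "j < n" for i j
 proof -
  have "D * NT c = e2 \<cdot>\<^sub>m D + ((e1 - e2) \<cdot>\<^sub>m (D * NA c) + (e3 - e2) \<cdot>\<^sub>m (D * NP c))" unfolding NT_def using NC(2,3)[of c] DC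
   by (simp add: mult_add_distrib_mat[of _ n n _ n] mult_smult_distrib[of _ n n _ n])
  then show ?thesis using ij by (simp add: carrier_matD[OF DC] carrier_matD[OF NC(2)] carrier_matD[OF NC(3)] del: index_mult_mat(1))
 qed
 show ?thesis
 proof (rule self_adjoint_reversal[OF N_gamma s DC])
  have "D $$ (0,0) = 1" using npos form_0[of c 0] by (simp add: D_def)
  then show "D \<noteq> 0\<^sub>m n n" using npos by auto
  show "D * NS c = transpose_mat (NS c) * D" by (rule self_adjointI[OF DC NC(1) Ds, of "n - 1"]) (use dS in auto)
  show "D * NT c = transpose_mat (NT c) * D"
   by (rule self_adjointI[OF DC NC(4) Ds, of n]) (auto simp: T dA' dP Ds simp del: index_mult_mat(1))
 qed
qed

lemma reversal_rank_one:
 assumes s: "simple_rep n \<psi>" "\<psi> \<in> FG n \<alpha>" and \<phi>: "\<phi> \<in> FG n \<alpha>"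
 shows "ntrn n (nrev q) \<phi> = ntrn n q \<phi>"
proof (rule reversal_by_density[OF s KB_regular _ _ _ \<phi>])
 have NF: "stp (NS c) (NT c) \<in> FG n \<alpha>" for c unfolding FG_def using N_gamma N_dim by blast
 show "stp (NS (\<lambda>_. 0)) (NT (\<lambda>_. 0)) \<in> FG n \<alpha>" "det (KB (stp (NS (\<lambda>_. 0)) (NT (\<lambda>_. 0)))) \<noteq> 0" by (rule NF, simp add: KB_N)
 fix \<chi> assume x: "\<chi> \<in> FG n \<alpha>" "simple_rep n \<chi>" "det (KB \<chi>) \<noteq> 0"
 then obtain c where c: "rep_iso \<chi> (stp (NS c) (NT c))" using normal_form_exists unfolding FG_def by blast
 have "ntrn n p \<chi> = ntrn n p (stp (NS c) (NT c))" for p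
  using ntrn_invariant c FG_rep[OF x(1)] FG_rep[OF NF] unfolding invariant_fun_def by blast
 then show "ntrn n (nrev q) \<chi> = ntrn n q \<chi>" using N_reversal[OF simple_iso[OF x(2) c FG_rep[OF NF]]] by simp
qed

lemma krull_dim_rank_one:
 assumes s: "simple_rep n \<psi>" "\<psi> \<in> FG n \<alpha>"
 shows "krull_dim (subtopology (zariski_iss n) (iss_comp \<rho> n \<alpha>)) = enat n"
proof -
 interpret normal_form \<rho> n \<alpha> NS NT
 proof
  show "n > 0" "NS \<in> matfun polys n n" "NT \<in> matfun polys n n" "gamma_pair n (NS c) (NT c)" "dim_vector \<rho> (stp (NS c) (NT c)) = \<alpha>" for c
   using npos N_polys N_gamma N_dim by auto
  show "(\<And>i. i < n - 1 ==> c i = c' i) ==> NS c = NS c' \<and> NT c = NT c'" for c c' by (rule N_local)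
  have "stp (NS (\<lambda>_. 0)) (NT (\<lambda>_. 0)) \<in> FG n \<alpha>" unfolding FG_def using N_gamma N_dim by blast
  then show "\<exists>g\<in>regular_fun n. (\<exists>\<phi>\<in>FG n \<alpha>. g \<phi> \<noteq> 0) \<and>
   (\<forall>\<phi>\<in>FG n \<alpha>. g \<phi> \<noteq> 0 --> (\<exists>c. rep_iso \<phi> (stp (NS c) (NT c))))"
   using normal_form_exists KB_N by (intro bexI[OF _ KB_regular] conjI bexI[of _ "stp (NS (\<lambda>_. 0)) (NT (\<lambda>_. 0))"]) (auto simp: FG_def)
  show "\<exists>c0. simple_rep n (stp (NS c0) (NT c0)) \<and> (\<forall>j<n - 1. \<exists>f. releases n (\<lambda>c. stp (NS c) (NT c)) c0 j f)" by (rule flag_exists[OF s])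
 qed
 show ?thesis by (rule krull_dim_eq)
qed

end

section \<open>The normal form for the dimension vector (4,2;2,2,2)\<close>

definition pQ :: ncp where "pQ = NMul (NC (1/2)) (NAdd (NC 1) (NMul (NC (-1)) pS))"

lemma mtr2: "A \<in> mats 2 ==> mtr A = A $$ (0,0) + A $$ (1,1)"
 by (auto simp: mtr_def numeral_2_eq_2)

lemma det_by_traces:
 assumes A: "A \<in> mats 2"
 shows "(mtr A)^2 - mtr (A * A) = 2 * (A $$ (0,0) * A $$ (1,1) - A $$ (0,1) * A $$ (1,0))"
proof -
 have AA: "A * A \<in> mats 2" using A by simp
 show ?thesis unfolding mtr2[OF A] mtr2[OF AA] by (simp add: mult22[OF A A] power2_eq_square algebra_simps del: index_mult_mat(1))
qed

lemma commutator_by_traces: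
 assumes A: "A \<in> mats 2" and B: "B \<in> mats 2"
 shows "mtr (B * (A * B) * A) - mtr (A * (B * B) * A) =
  (A $$ (0,1) * B $$ (1,0) - A $$ (1,0) * B $$ (0,1))^2
  + (A $$ (0,0) * B $$ (0,1) + A $$ (0,1) * B $$ (1,1) - B $$ (0,0) * A $$ (0,1) - B $$ (0,1) * A $$ (1,1))
  * (A $$ (1,0) * B $$ (0,0) + A $$ (1,1) * B $$ (1,0) - B $$ (1,0) * A $$ (0,0) - B $$ (1,1) * A $$ (1,0))"
proof -
 have C: "A * B \<in> mats 2" "B * B \<in> mats 2" using A B by auto
 have D: "B * (A * B) \<in> mats 2" "A * (B * B) \<in> mats 2" "B * (A * B) * A \<in> mats 2" "A * (B * B) * A \<in> mats 2" using A B by auto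
 show ?thesis unfolding mtr2[OF D(3)] mtr2[OF D(4)]
  by (simp add: mult22[OF D(1) A] mult22[OF D(2) A] mult22[OF B C(1)] mult22[OF A C(2)] mult22[OF A B] mult22[OF B B] power2_eq_square algebra_simps del: index_mult_mat(1))
qed

context cube_root
begin

definition cw :: "nat => ncp" where "cw m = NMul (pE (\<rho>^m)) pQ"

text \<open>Non-zero exactly if the three \<open>2 \<times> 2\<close> matrices induced by the spectral projectors of \<open>T\<close> on
 the \<open>-1\<close>-eigenspace of \<open>S\<close> are invertible and the first two have an invertible commutator; compare
 \<open>det_by_traces\<close> and \<open>commutator_by_traces\<close>.\<close>
definition g6 :: "rep => complex" where
 "g6 \<phi> = (\<Prod>m<3. (ntrn 6 (cw m) \<phi>)^2 - ntrn 6 (NMul (cw m) (cw m)) \<phi>) *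
   (ntrn 6 (NMul (cw 0) (NMul (cw 1) (NMul (cw 0) (cw 1)))) \<phi> - ntrn 6 (NMul (cw 0) (NMul (cw 0) (NMul (cw 1) (cw 1)))) \<phi>)"

lemma g6_regular: "g6 \<in> regular_fun 6"
 unfolding g6_def[abs_def]
 by (intro subalg_mult[OF subalg_regular] subalg_prod[OF subalg_regular] subalg_diff[OF subalg_regular] subalg_power[OF subalg_regular] ntrn_regular)

lemma rho_power_cube: "(\<rho>^m)^3 = 1"
 using rho3 by (metis power_commutes power_mult power_one mult.commute)

text \<open>With \<open>Q = U V\<close> a word in the projectors and \<open>Q\<close> has the same trace as the word in the \<open>2 \<times> 2\<close>
 matrices \<open>V P U\<close>.\<close>
lemma compressed_traces:
 fixes U V :: "complex mat"
 assumes g: "gamma_pair 6 S T" and U: "U \<in> carrier_mat 6 2" and V: "V \<in> carrier_mat 2 6"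
  and Q: "(1/2) \<cdot>\<^sub>m (1\<^sub>m 6 + (-1) \<cdot>\<^sub>m S) = U * V"
  and C: "\<And>m. C m = V * (proj 6 T (\<rho>^m) * U)"
 shows "ntrn 6 (cw m) (stp S T) = mtr (C m)" "ntrn 6 (NMul (cw m) (cw l)) (stp S T) = mtr (C l * C m)"
  "ntrn 6 (NMul (cw a) (NMul (cw b) (NMul (cw m) (cw l)))) (stp S T) = mtr (C b * (C m * C l) * C a)"
proof -
 note G = gamma_pairD[OF g]
 have P: "proj 6 T e \<in> mats 6" for e by (rule proj_carrier[OF G(2)])
 have X: "proj 6 T (\<rho>^m) * U \<in> carrier_mat 6 2" for m by (rule mult_carrier_mat[OF P U])
 have CC: "C m \<in> mats 2" for m unfolding C by (rule mult_carrier_mat[OF V X])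
 have S1: "1\<^sub>m 6 + (-1) \<cdot>\<^sub>m S \<in> mats 6" using G by simp
 have sm: "(c \<cdot>\<^sub>m 1\<^sub>m 6) * M = c \<cdot>\<^sub>m M" if "M \<in> mats 6" for c and M :: "complex mat"
  using that by (simp add: mult_smult_assoc_mat[of _ 6 6])
 have one: "1 \<cdot>\<^sub>m 1\<^sub>m 6 = (1\<^sub>m 6 :: complex mat)" by auto
 have q: "nev 6 (stp S T) pQ = U * V"
  unfolding pQ_def nev.simps nev_generators[OF g] sm[OF G(1)] one sm[OF S1] by (rule Q)
 have w: "nev 6 (stp S T) (cw m) = (proj 6 T (\<rho>^m) * U) * (1\<^sub>m 2 * V)" for m
  unfolding cw_def nev.simps nev_generators[OF g] q using assoc_mult_mat[OF P U V] V by simp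
 have st: "(proj 6 T (\<rho>^m) * U) * (1\<^sub>m 2 * V) * ((proj 6 T (\<rho>^l) * U) * (M * V)) = (proj 6 T (\<rho>^m) * U) * ((C l * M) * V)"
  if M: "M \<in> mats 2" for m l M
 proof -
  have MV: "M * V \<in> carrier_mat 2 6" using M V by simp
  have XMV: "(proj 6 T (\<rho>^l) * U) * (M * V) \<in> mats 6" by (rule mult_carrier_mat[OF X MV])
  have "V * ((proj 6 T (\<rho>^l) * U) * (M * V)) = (C l * M) * V"
   unfolding C using assoc_mult_mat[OF V X MV] assoc_mult_mat[OF CC[unfolded C] M V] by simp
  then show ?thesis using assoc_mult_mat[OF X V XMV] V by simp
 qed
 have tr: "mtr ((proj 6 T (\<rho>^m) * U) * (M * V)) = mtr (M * C m)" if M: "M \<in> mats 2" for m M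
 proof -
  have MV: "M * V \<in> carrier_mat 2 6" using M V by simp
  show ?thesis unfolding mtr_comm[OF X MV] assoc_mult_mat[OF M V X] C ..
 qed
 have i1: "1\<^sub>m 2 \<in> mats 2" by simp
 have CM: "C m * 1\<^sub>m 2 = C m" "1\<^sub>m 2 * C m = C m" for m by (rule right_mult_one_mat[OF CC] left_mult_one_mat[OF CC])+
 have C2: "C m * C l \<in> mats 2" for m l using CC by (meson mult_carrier_mat)
 have C3: "C b * (C m * C l) \<in> mats 2" for b m l using CC C2 by (meson mult_carrier_mat)
 show "ntrn 6 (cw m) (stp S T) = mtr (C m)" unfolding ntrn_def w tr[OF i1] CM ..
 have w2: "nev 6 (stp S T) (NMul (cw m) (cw l)) = (proj 6 T (\<rho>^m) * U) * (C l * V)" for m l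
  unfolding nev.simps(5) w st[OF i1] CM ..
 show "ntrn 6 (NMul (cw m) (cw l)) (stp S T) = mtr (C l * C m)" unfolding ntrn_def w2 by (rule tr[OF CC])
 have w3: "nev 6 (stp S T) (NMul (cw b) (NMul (cw m) (cw l))) = (proj 6 T (\<rho>^b) * U) * ((C m * C l) * V)" for b m l
  unfolding nev.simps(5)[of 6 _ "cw b"] w2 w st[OF CC] ..
 show "ntrn 6 (NMul (cw a) (NMul (cw b) (NMul (cw m) (cw l)))) (stp S T) = mtr (C b * (C m * C l) * C a)"
  unfolding ntrn_def nev.simps(5)[of 6 _ "cw a"] w3 w st[OF C2] by (rule tr[OF C3])
qed

text \<open>The rows of the \<open>2 \<times> 6\<close> matrix that lists the three \<open>2 \<times> 2\<close> matrices side by side. The first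
 has first column \<open>(0,1)\<close>, the second is upper triangular, and their sum is \<open>1\<close>. The parameters \<open>c
 3\<close> and \<open>c 4\<close> are determinant and trace of the first matrix; \<open>c 1\<close> and \<open>c 2\<close> are an eigenvalue and
 the trace of the second one.\<close>
definition K6 :: "(nat => complex) => nat => nat => complex" where
 "K6 c r j = (if r = 0 then [0, - c 3, c 1, c 0, 1 - c 1, c 3 - c 0] ! j
   else [1, c 4, 0, c 2 - c 1, -1, 1 - c 4 - (c 2 - c 1)] ! j)"

definition E6 :: "complex mat" where "E6 = mat 6 2 (\<lambda>(i,r). if r = i mod 2 then 1 else 0)"
definition V6 :: "(nat => complex) => complex mat" where "V6 c = mat 2 6 (\<lambda>(r,j). K6 c r j)"
definition NQ6 :: "(nat => complex) => complex mat" where "NQ6 c = mat 6 6 (\<lambda>(i,j). K6 c (i mod 2) j)"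
definition NS6 :: "(nat => complex) => complex mat" where "NS6 c = 1\<^sub>m 6 + (-2) \<cdot>\<^sub>m NQ6 c"
definition NT6 :: "complex mat" where "NT6 = mat 6 6 (\<lambda>(i,j). if i = j then \<rho> ^ (i div 2) else 0)"

lemma sum6: "(\<Sum>i<6::nat. f i) = f 0 + f 1 + f 2 + f 3 + f 4 + (f 5 :: complex)"
 by (simp add: eval_nat_numeral)

lemma NQ6_factor: "NQ6 c = E6 * V6 c" "V6 c * E6 = 1\<^sub>m 2"
proof -
 have C: "E6 \<in> carrier_mat 6 2" "V6 c \<in> carrier_mat 2 6" by (auto simp: E6_def V6_def)
 show "NQ6 c = E6 * V6 c"
 proof (rule eq_matI)
  fix i j assume "i < dim_row (E6 * V6 c)" "j < dim_col (E6 * V6 c)"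
  then have ij: "i < 6" "j < 6" using C by auto
  have "(E6 * V6 c) $$ (i,j) = (\<Sum>l<2. if l = i mod 2 then K6 c l j else 0)"
   unfolding mult_idx[OF C ij] using ij by (intro sum.cong refl) (auto simp: E6_def V6_def)
  then show "NQ6 c $$ (i,j) = (E6 * V6 c) $$ (i,j)" using ij by (simp add: NQ6_def)
 qed (auto simp: E6_def V6_def NQ6_def)
 show "V6 c * E6 = 1\<^sub>m 2"
 proof (rule eq_matI)
  fix i j assume "i < dim_row (1\<^sub>m 2)" "j < dim_col (1\<^sub>m 2)"
  then have ij: "i < 2" "j < 2" by auto
  have e: "(V6 c * E6) $$ (i,j) = (\<Sum>l<6. if j = l mod 2 then K6 c i l else 0)"
   unfolding mult_idx[OF C(2,1) ij] using ij by (intro sum.cong refl) (auto simp: E6_def V6_def)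
  have "i = 0 \<or> i = 1" "j = 0 \<or> j = 1" using ij by auto
  then show "(V6 c * E6) $$ (i,j) = 1\<^sub>m 2 $$ (i,j)"
   unfolding e sum6 by (elim disjE) (simp_all add: K6_def)
 qed (use C in auto)
qed

lemma N6_carrier: "NQ6 c \<in> mats 6" "NS6 c \<in> mats 6" "NT6 \<in> mats 6" "E6 \<in> carrier_mat 6 2" "V6 c \<in> carrier_mat 2 6"
 by (auto simp: NQ6_def NS6_def NT6_def E6_def V6_def)

lemma NQ6_NS6: "(1/2) \<cdot>\<^sub>m (1\<^sub>m 6 + (-1) \<cdot>\<^sub>m NS6 c) = E6 * V6 c"
 unfolding NQ6_factor(1)[symmetric] by (rule eq_matI) (auto simp: NS6_def NQ6_def)

lemma rho_power_simps: "\<rho> ^ 2 * \<rho> ^ 2 = \<rho>" "\<rho> * \<rho>^2 = 1" "\<rho>^2 * \<rho> = 1"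
proof -
 show "\<rho> * \<rho>^2 = 1" "\<rho>^2 * \<rho> = 1" using rho3 by (simp_all add: power3_eq_cube power2_eq_square mult.assoc)
 then show "\<rho> ^ 2 * \<rho> ^ 2 = \<rho>" by (simp add: power2_eq_square mult.assoc)
qed

lemma NT6_mult: "NT6 * NT6 = mat 6 6 (\<lambda>(i,j). if i = j then \<rho> ^ (i div 2) * \<rho> ^ (i div 2) else 0)"
 "M \<in> mats 6 ==> NT6 * M = mat 6 6 (\<lambda>(i,j). \<rho> ^ (i div 2) * M $$ (i,j))"
 "M \<in> mats 6 ==> M * NT6 = mat 6 6 (\<lambda>(i,j). M $$ (i,j) * \<rho> ^ (j div 2))"
proof -
 show 1: "NT6 * M = mat 6 6 (\<lambda>(i,j). \<rho> ^ (i div 2) * M $$ (i,j))" if M: "M \<in> mats 6" for M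
 proof (rule eq_matI)
  fix i j assume "i < dim_row (mat 6 6 (\<lambda>(i,j). \<rho> ^ (i div 2) * M $$ (i,j)))" "j < dim_col (mat 6 6 (\<lambda>(i,j). \<rho> ^ (i div 2) * M $$ (i,j)))"
  then have ij: "i < 6" "j < 6" by auto
  have "(NT6 * M) $$ (i,j) = (\<Sum>l<6. if l = i then \<rho> ^ (i div 2) * M $$ (l,j) else 0)"
   unfolding mult_idx[OF N6_carrier(3) M ij] using ij by (intro sum.cong refl) (auto simp: NT6_def)
  then show "(NT6 * M) $$ (i,j) = mat 6 6 (\<lambda>(i,j). \<rho> ^ (i div 2) * M $$ (i,j)) $$ (i,j)" using ij by simp
 qed (use M N6_carrier(3) in auto)
 show "NT6 * NT6 = mat 6 6 (\<lambda>(i,j). if i = j then \<rho> ^ (i div 2) * \<rho> ^ (i div 2) else 0)"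
  unfolding 1[OF N6_carrier(3)] by (auto simp: NT6_def intro!: eq_matI)
 show "M * NT6 = mat 6 6 (\<lambda>(i,j). M $$ (i,j) * \<rho> ^ (j div 2))" if M: "M \<in> mats 6" for M
 proof (rule eq_matI)
  fix i j assume "i < dim_row (mat 6 6 (\<lambda>(i,j). M $$ (i,j) * \<rho> ^ (j div 2)))" "j < dim_col (mat 6 6 (\<lambda>(i,j). M $$ (i,j) * \<rho> ^ (j div 2)))"
  then have ij: "i < 6" "j < 6" by auto
  have "(M * NT6) $$ (i,j) = (\<Sum>l<6. if l = j then M $$ (i,l) * \<rho> ^ (j div 2) else 0)"
   unfolding mult_idx[OF M N6_carrier(3) ij] using ij by (intro sum.cong refl) (auto simp: NT6_def)
  then show "(M * NT6) $$ (i,j) = mat 6 6 (\<lambda>(i,j). M $$ (i,j) * \<rho> ^ (j div 2)) $$ (i,j)" using ij by simp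
 qed (use M N6_carrier(3) in auto)
qed

lemma N6_gamma: "gamma_pair 6 (NS6 c) NT6"
 unfolding gamma_pair_def
proof (intro conjI N6_carrier)
 note C = N6_carrier(4,5)
 have QQ: "NQ6 c * NQ6 c = NQ6 c"
 proof -
  have "V6 c * (E6 * V6 c) = V6 c * E6 * V6 c" by (rule assoc_mult_mat[symmetric, OF C(2,1,2)])
  also have "\<dots> = V6 c" unfolding NQ6_factor(2) by (rule left_mult_one_mat[OF C(2)])
  finally have VE: "V6 c * (E6 * V6 c) = V6 c" .
  have EV: "E6 * V6 c \<in> mats 6" by (rule mult_carrier_mat[OF C])
  show ?thesis unfolding NQ6_factor(1) assoc_mult_mat[OF C EV] VE ..
 qed
 have Q2: "(-2) \<cdot>\<^sub>m NQ6 c \<in> mats 6" using N6_carrier(1) by simp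
 have "NS6 c * NS6 c = 1\<^sub>m 6 * NS6 c + ((-2) \<cdot>\<^sub>m NQ6 c) * NS6 c"
  by (subst (1) NS6_def) (rule add_mult_distrib_mat[OF one_carrier_mat Q2 N6_carrier(2)])
 also have "1\<^sub>m 6 * NS6 c = NS6 c" by (rule left_mult_one_mat[OF N6_carrier(2)])
 also have "((-2) \<cdot>\<^sub>m NQ6 c) * NS6 c = (-2) \<cdot>\<^sub>m NQ6 c + ((-2) \<cdot>\<^sub>m NQ6 c) * ((-2) \<cdot>\<^sub>m NQ6 c)"
  unfolding NS6_def mult_add_distrib_mat[OF Q2 one_carrier_mat Q2] right_mult_one_mat[OF Q2] ..
 also have "((-2) \<cdot>\<^sub>m NQ6 c) * ((-2) \<cdot>\<^sub>m NQ6 c) = 4 \<cdot>\<^sub>m NQ6 c"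
  unfolding smult_mult_smult[OF N6_carrier(1) N6_carrier(1)] QQ by simp
 also have "NS6 c + ((-2) \<cdot>\<^sub>m NQ6 c + 4 \<cdot>\<^sub>m NQ6 c) = 1\<^sub>m 6"
  by (rule eq_matI) (auto simp: NS6_def carrier_matD[OF N6_carrier(1)])
 finally show "NS6 c * NS6 c = 1\<^sub>m 6" .
 have T2: "NT6 * NT6 \<in> mats 6" using N6_carrier(3) by simp
 show "NT6 * (NT6 * NT6) = 1\<^sub>m 6"
  unfolding NT6_mult(2)[OF T2] unfolding NT6_mult(1)
 proof (rule eq_matI)
  fix i j assume "i < dim_row (1\<^sub>m 6)" "j < dim_col (1\<^sub>m 6)"
  then have ij: "i < 6" "j < 6" by auto
  have "\<rho> ^ m * (\<rho> ^ m * \<rho> ^ m) = 1" for m using rho_power_cube[of m] by (simp add: power3_eq_cube mult.assoc)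
  then show "mat 6 6 (\<lambda>(i, j). \<rho> ^ (i div 2) * mat 6 6 (\<lambda>(i, j). if i = j then \<rho> ^ (i div 2) * \<rho> ^ (i div 2) else 0) $$ (i, j)) $$ (i, j) = 1\<^sub>m 6 $$ (i, j)"
   using ij by auto
 qed auto
qed

lemma N6_proj:
 assumes "m < 3"
 shows "proj 6 NT6 (\<rho>^m) = mat 6 6 (\<lambda>(i,j). if i = j \<and> i div 2 = m then 1 else 0)"
proof (rule eq_matI)
 fix i j assume "i < dim_row (mat 6 6 (\<lambda>(i,j). if i = j \<and> i div 2 = m then 1 else 0 :: complex))" "j < dim_col (mat 6 6 (\<lambda>(i,j). if i = j \<and> i div 2 = m then 1 else 0 :: complex))"
 then have ij: "i < 6" "j < 6" by auto
 have l: "i div 2 < 3" using ij by simp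
 have r: "1 + ((\<rho>^m)^2 * \<rho>^k + \<rho>^m * (\<rho>^k * \<rho>^k)) = (if k = m then 3 else 0)" if "k < 3" for k
 proof -
  have "k = 0 \<or> k = 1 \<or> k = 2" "m = 0 \<or> m = 1 \<or> m = 2" using that assms by auto
  moreover have "\<rho> + \<rho>^2 = -1" "\<rho>^2 + \<rho> = -1" using rho2 by simp_all
  moreover have "\<rho> * \<rho> = \<rho>^2" "(\<rho>^2)^2 = \<rho>" using rho_power_simps(1) by (simp_all add: power2_eq_square)
  moreover have "\<rho> ^ 4 = \<rho>" using power_add[of \<rho> 3 1] rho3 by simp
  ultimately show ?thesis using rho_power_simps rho3 by (elim disjE) simp_all
 qed
 have "proj 6 NT6 (\<rho>^m) $$ (i,j) = (if i = j then 1/3 * (1 + ((\<rho>^m)^2 * \<rho>^(i div 2) + \<rho>^m * (\<rho>^(i div 2) * \<rho>^(i div 2)))) else 0)"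
  unfolding proj_idx[OF N6_carrier(3) ij] NT6_mult(1) using ij by (auto simp: NT6_def)
 then show "proj 6 NT6 (\<rho>^m) $$ (i,j) = mat 6 6 (\<lambda>(i,j). if i = j \<and> i div 2 = m then 1 else 0) $$ (i,j)"
  unfolding r[OF l] using ij by auto
qed (use proj_carrier[OF N6_carrier(3)] in auto)

lemma N6_dim: "dim_vector \<rho> (stp (NS6 c) NT6) = (4,2,2,2,2)"
proof (rule dims_from_traces[OF N6_gamma])
 have "mtr (NQ6 c) = 2"
  unfolding NQ6_factor(1) mtr_comm[OF N6_carrier(4,5)] NQ6_factor(2) by simp
 then have "mtr (NS6 c) = 6 + (-2) * 2"
  unfolding NS6_def using N6_carrier(1)[of c] by (simp add: mtr_add[of _ 6] mtr_smult[of _ 6])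
 then show "mtr (NS6 c) = of_nat 4 - of_nat 2" by simp
 show "mtr NT6 = of_nat 2 + of_nat 2 * \<rho> + of_nat 2 * \<rho>\<^sup>2"
  unfolding mtr_def using N6_carrier(3) by (simp add: NT6_def sum6)
 have r4: "\<rho> ^ 4 = \<rho>" using power_add[of \<rho> 3 1] rho3 by simp
 show "mtr (NT6 * NT6) = of_nat 2 + of_nat 2 * \<rho>\<^sup>2 + of_nat 2 * \<rho>"
  unfolding NT6_mult(1) mtr_def by (simp add: sum6 rho_power_simps) (simp add: r4 power2_eq_square)
qed simp_all

definition C6 :: "(nat => complex) => nat => complex mat" where
 "C6 c m = V6 c * (proj 6 NT6 (\<rho>^m) * E6)"

lemma C6_carrier: "C6 c m \<in> mats 2"
 unfolding C6_def by (rule mult_carrier_mat[OF N6_carrier(5) mult_carrier_mat[OF proj_carrier[OF N6_carrier(3)] N6_carrier(4)]])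

lemma C6_entries:
 assumes m: "m < 3" and rs: "r < 2" "s < 2"
 shows "C6 c m $$ (r,s) = K6 c r (2 * m + s)"
proof -
 have P: "proj 6 NT6 (\<rho>^m) \<in> mats 6" by (rule proj_carrier[OF N6_carrier(3)])
 have PE: "proj 6 NT6 (\<rho>^m) * E6 \<in> carrier_mat 6 2" by (rule mult_carrier_mat[OF P N6_carrier(4)])
 have k: "2 * m + s < 6" using m rs by simp
 have e: "(proj 6 NT6 (\<rho>^m) * E6) $$ (i,s) = (if i = 2 * m + s then 1 else 0)" if i: "i < 6" for i
 proof -
  have "(proj 6 NT6 (\<rho>^m) * E6) $$ (i,s) = (\<Sum>l<6. if l = i then (if i div 2 = m \<and> s = i mod 2 then 1 else 0) else 0)"
   unfolding mult_idx[OF P N6_carrier(4) i rs(2)] unfolding N6_proj[OF m] using i rs by (intro sum.cong refl) (auto simp: E6_def)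
  also have "\<dots> = (if i div 2 = m \<and> s = i mod 2 then 1 else 0)" using i by simp
  also have "(i div 2 = m \<and> s = i mod 2) = (i = 2 * m + s)" using rs by auto
  finally show ?thesis .
 qed
 have "C6 c m $$ (r,s) = (\<Sum>l<6. if l = 2 * m + s then K6 c r l else 0)"
  unfolding C6_def mult_idx[OF N6_carrier(5) PE rs] using rs by (intro sum.cong refl) (auto simp: e V6_def)
 then show ?thesis using k by simp
qed

lemmas N6_traces = compressed_traces[OF N6_gamma N6_carrier(4,5) NQ6_NS6 C6_def]

text \<open>At this point the three determinants are \<open>2\<close>, \<open>1\<close>, \<open>1\<close>, and the commutator has determinant
 \<open>-1\<close>.\<close>
lemma g6_nonzero: "g6 (stp (NS6 (\<lambda>i. [1,1,2,2,0] ! i)) NT6) \<noteq> 0"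
proof -
 have l: "{..<3} = {0,1,2::nat}" by auto
 show ?thesis
  unfolding g6_def N6_traces det_by_traces[OF C6_carrier] commutator_by_traces[OF C6_carrier C6_carrier] l
  by (simp add: C6_entries K6_def eval_nat_numeral)
qed

lemma K6_polys: "r < 2 ==> j < 6 ==> (\<lambda>c. K6 c r j) \<in> polys"
proof -
 assume "r < 2" "j < 6"
 then have "r = 0 \<or> r = 1" "j = 0 \<or> j = 1 \<or> j = 2 \<or> j = 3 \<or> j = 4 \<or> j = 5" by auto
 then show ?thesis unfolding K6_def
  by (elim disjE) (simp_all add: subalg_diff[OF subalg_polys] subalg_uminus[OF subalg_polys] subalg_const[OF subalg_polys] polys_coord)
qed

lemma N6_polys: "NS6 \<in> matfun polys 6 6" "(\<lambda>_. NT6) \<in> matfun polys 6 6"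
proof -
 note k = subalg_const[OF subalg_polys]
 have "NQ6 \<in> matfun polys 6 6" unfolding NQ6_def[abs_def]
  by (rule matfun_mat) (simp add: K6_polys)
 then show "NS6 \<in> matfun polys 6 6" unfolding NS6_def[abs_def]
  by (intro matfun_add[OF subalg_polys] matfun_smult[OF subalg_polys] k matfun_const[OF subalg_polys]) simp_all
 show "(\<lambda>_. NT6) \<in> matfun polys 6 6" by (rule matfun_const[OF subalg_polys N6_carrier(3)])
qed

lemma N6_local: "(\<And>i. i < 6 - 1 ==> c i = c' i) ==> NS6 c = NS6 c'"
proof -
 assume e: "\<And>i. i < 6 - 1 ==> c i = c' i"
 have "c 0 = c' 0" "c 1 = c' 1" "c 2 = c' 2" "c 3 = c' 3" "c 4 = c' 4" by (rule e, simp)+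
 then have "K6 c = K6 c'" unfolding K6_def by (intro ext) simp
 then show ?thesis unfolding NS6_def NQ6_def by simp
qed

text \<open>The parameters are freed in the order \<open>c 0, ..., c 4\<close>; with the later ones frozen, the
 invariants used are the trace of the product of the first two matrices, the determinant and the
 trace of the second one, and the determinant and the trace of the first one.\<close>
lemma flag6:
 assumes c0: "simple_rep 6 (stp (NS6 c0) NT6)" and j: "j < 6 - 1"
 shows "\<exists>f. releases 6 (\<lambda>c. stp (NS6 c) NT6) c0 j f"
proof -
 let ?N = "\<lambda>c. stp (NS6 c) NT6"
 define h where "h k \<phi> = (if k = 0 then ntrn 6 (NMul (cw 1) (cw 0)) \<phi> else if k = 1 then (ntrn 6 (cw 1) \<phi>)^2 - ntrn 6 (NMul (cw 1) (cw 1)) \<phi>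
  else if k = 2 then ntrn 6 (cw 1) \<phi> else if k = 3 then (ntrn 6 (cw 0) \<phi>)^2 - ntrn 6 (NMul (cw 0) (cw 0)) \<phi> else ntrn 6 (cw 0) \<phi>)" for k :: nat and \<phi>
 have hI: "(\<lambda>\<phi>. h k \<phi> - a) \<in> invariant_fun 6" for k a
  unfolding h_def
  by (cases "k = 0"; cases "k = 1"; cases "k = 2"; cases "k = 3")
    (auto intro!: subalg_diff[OF subalg_invariant] subalg_power[OF subalg_invariant] subalg_const[OF subalg_invariant] ntrn_invariant)
 have C2: "C6 c m * C6 c l \<in> mats 2" for c m l using C6_carrier by (meson mult_carrier_mat)
 have hv: "h 0 (?N c) = c 0 + c 4 * (c 2 - c 1)" "h 1 (?N c) = 2 * (c 1 * (c 2 - c 1))" "h 2 (?N c) = c 2" "h 3 (?N c) = 2 * c 3" "h 4 (?N c) = c 4" for c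
 proof -
  have "h 0 (?N c) = mtr (C6 c 0 * C6 c 1)" by (simp add: h_def N6_traces)
  also have "\<dots> = c 0 + c 4 * (c 2 - c 1)"
   unfolding mtr2[OF C2] by (simp add: mult22[OF C6_carrier C6_carrier] C6_entries K6_def eval_nat_numeral del: index_mult_mat(1))
  finally show "h 0 (?N c) = c 0 + c 4 * (c 2 - c 1)" .
  have "h 1 (?N c) = 2 * (C6 c 1 $$ (0,0) * C6 c 1 $$ (1,1) - C6 c 1 $$ (0,1) * C6 c 1 $$ (1,0))"
   using det_by_traces[OF C6_carrier] by (simp add: h_def N6_traces)
  then show "h 1 (?N c) = 2 * (c 1 * (c 2 - c 1))" by (simp add: C6_entries K6_def eval_nat_numeral)
  have "h 3 (?N c) = 2 * (C6 c 0 $$ (0,0) * C6 c 0 $$ (1,1) - C6 c 0 $$ (0,1) * C6 c 0 $$ (1,0))"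
   using det_by_traces[OF C6_carrier] by (simp add: h_def N6_traces)
  then show "h 3 (?N c) = 2 * c 3" by (simp add: C6_entries K6_def eval_nat_numeral)
  have "h 2 (?N c) = C6 c 1 $$ (0,0) + C6 c 1 $$ (1,1)" "h 4 (?N c) = C6 c 0 $$ (0,0) + C6 c 0 $$ (1,1)"
   by (simp_all add: h_def N6_traces mtr2[OF C6_carrier])
  then show "h 2 (?N c) = c 2" "h 4 (?N c) = c 4"
   by (simp_all add: C6_entries K6_def eval_nat_numeral)
 qed
 have d: "h j (?N (c0(j := c0 j + s))) - h j (?N c0) = s \<or> h j (?N (c0(j := c0 j + s))) - h j (?N c0) = 2 * s
   \<or> h j (?N (c0(j := c0 j + s))) - h j (?N c0) = 2 * s * (c0 2 - 2 * c0 1 - s)" for s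
 proof -
  have "j = 0 \<or> j = 1 \<or> j = 2 \<or> j = 3 \<or> j = 4" using j by auto
  then show ?thesis by (elim disjE) (simp_all add: hv hv[unfolded One_nat_def] algebra_simps)
 qed
 \<comment> \<open>The determinant of the second matrix is quadratic in \<open>c 1\<close>; this \<open>s\<close> is not a zero of its increment.\<close>
 define s where "s = (if c0 2 - 2 * c0 1 = 1 then 2 else 1 :: complex)"
 have nz: "h j (?N (c0(j := c0 j + s))) - h j (?N c0) \<noteq> 0"
 proof -
  have "s \<noteq> 0" "c0 2 - 2 * c0 1 - s \<noteq> 0" by (auto simp: s_def)
  then show ?thesis using d[of s] by auto
 qed
 have z: "h j (?N c) = h j (?N c0)" if e: "\<forall>i. j \<le> i --> i < 6 - 1 --> c i = c0 i" for c
 proof -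
  have "j = 0 \<or> j = 1 \<or> j = 2 \<or> j = 3 \<or> j = 4" using j by auto
  then show ?thesis using e by (elim disjE) (simp_all add: hv hv[unfolded One_nat_def])
 qed
 show ?thesis unfolding releases_def
 proof (rule exI[of _ "\<lambda>\<phi>. h j \<phi> - h j (?N c0)"], intro conjI hI)
  show "\<forall>c. (\<forall>i. j \<le> i --> i < 6 - 1 --> c i = c0 i) --> h j (?N c) - h j (?N c0) = 0"
  proof (intro allI impI)
   fix c assume "\<forall>i. j \<le> i --> i < 6 - 1 --> c i = c0 i"
   then have "h j (?N c) = h j (?N c0)" by (rule z)
   then show "h j (?N c) - h j (?N c0) = 0" by (simp only: diff_self)
  qed
  show "\<exists>c. (\<forall>i. j < i --> i < 6 - 1 --> c i = c0 i) \<and> h j (?N c) - h j (?N c0) \<noteq> 0"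
   by (rule exI[of _ "c0(j := c0 j + s)"], rule conjI[OF _ nz]) auto
 qed
qed

text \<open>An eigenvector of \<open>B\<close> and its image under \<open>A\<close> are independent: a common eigenvector of \<open>A\<close> and
 \<open>B\<close> would lie in the kernel of the commutator.\<close>
lemma good_frame:
 fixes A B :: "complex mat"
 assumes A: "A \<in> mats 2" and B: "B \<in> mats 2" and nz: "mtr (B * (A * B) * A) - mtr (A * (B * B) * A) \<noteq> 0"
 shows "\<exists>F G \<beta>. F \<in> mats 2 \<and> G \<in> mats 2 \<and> F * G = 1\<^sub>m 2 \<and> G * F = 1\<^sub>m 2 \<and>
  (G * (A * F)) $$ (0,0) = 0 \<and> (G * (A * F)) $$ (1,0) = 1 \<and> (G * (B * F)) $$ (0,0) = \<beta> \<and> (G * (B * F)) $$ (1,0) = 0"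
proof -
 obtain \<beta> where "\<beta> \<in> spectrum B" using spectrum_non_empty[OF B] by auto
 then obtain v where v: "v \<in> carrier_vec 2" "v \<noteq> 0\<^sub>v 2" "B *\<^sub>v v = \<beta> \<cdot>\<^sub>v v"
  using B unfolding spectrum_def eigenvalue_def eigenvector_def by auto
 define p q where "p = v $ 0" and "q = v $ 1"
 have mv: "(M *\<^sub>v v) $ i = M $$ (i,0) * p + M $$ (i,1) * q" if "M \<in> mats 2" "i < 2" for M i
  unfolding mult_vec_idx[OF that(1) v(1) that(2)] by (simp add: p_def q_def numeral_2_eq_2)
 have Be: "B $$ (0,0) * p + B $$ (0,1) * q = \<beta> * p" "B $$ (1,0) * p + B $$ (1,1) * q = \<beta> * q"
  using mv[OF B, of 0] mv[OF B, of 1] v(1) unfolding v(3) by (simp_all add: p_def q_def)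
 have pq: "p \<noteq> 0 \<or> q \<noteq> 0"
 proof (rule ccontr)
  assume "\<not> ?thesis"
  then have "v = 0\<^sub>v 2" using v(1) by (intro eq_vecI) (auto simp: p_def q_def less_2_cases_iff)
  then show False using v(2) by simp
 qed
 define r s where "r = A $$ (0,0) * p + A $$ (0,1) * q" and "s = A $$ (1,0) * p + A $$ (1,1) * q"
 define D where "D = p * s - q * r"
 have D0: "D \<noteq> 0"
 proof
  assume D: "D = 0"
  obtain \<mu> where m: "r = \<mu> * p" "s = \<mu> * q"
  proof (cases "p = 0")
   case False
   then show thesis using D by (intro that[of "r / p"]) (auto simp: D_def field_simps)
  next
   case True
   then show thesis using D pq by (intro that[of "s / q"]) (auto simp: D_def field_simps)
  qed
  let ?x00 = "A $$ (0,1) * B $$ (1,0) - A $$ (1,0) * B $$ (0,1)"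
  let ?x01 = "A $$ (0,0) * B $$ (0,1) + A $$ (0,1) * B $$ (1,1) - B $$ (0,0) * A $$ (0,1) - B $$ (0,1) * A $$ (1,1)"
  let ?x10 = "A $$ (1,0) * B $$ (0,0) + A $$ (1,1) * B $$ (1,0) - B $$ (1,0) * A $$ (0,0) - B $$ (1,1) * A $$ (1,0)"
  have "?x00 * p + ?x01 * q = (A $$ (0,0) * (B $$ (0,0) * p + B $$ (0,1) * q) + A $$ (0,1) * (B $$ (1,0) * p + B $$ (1,1) * q))
    - (B $$ (0,0) * r + B $$ (0,1) * s)" unfolding r_def s_def by (simp add: algebra_simps)
  also have "A $$ (0,0) * (B $$ (0,0) * p + B $$ (0,1) * q) + A $$ (0,1) * (B $$ (1,0) * p + B $$ (1,1) * q) = \<beta> * r"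
   unfolding Be r_def by (simp add: algebra_simps)
  also have "B $$ (0,0) * r + B $$ (0,1) * s = \<mu> * (B $$ (0,0) * p + B $$ (0,1) * q)" unfolding m by (simp add: algebra_simps)
  finally have 1: "?x00 * p + ?x01 * q = 0" unfolding Be m by simp
  have "?x10 * p - ?x00 * q = (A $$ (1,0) * (B $$ (0,0) * p + B $$ (0,1) * q) + A $$ (1,1) * (B $$ (1,0) * p + B $$ (1,1) * q))
    - (B $$ (1,0) * r + B $$ (1,1) * s)" unfolding r_def s_def by (simp add: algebra_simps)
  also have "A $$ (1,0) * (B $$ (0,0) * p + B $$ (0,1) * q) + A $$ (1,1) * (B $$ (1,0) * p + B $$ (1,1) * q) = \<beta> * s"
   unfolding Be s_def by (simp add: algebra_simps)
  also have "B $$ (1,0) * r + B $$ (1,1) * s = \<mu> * (B $$ (1,0) * p + B $$ (1,1) * q)" unfolding m by (simp add: algebra_simps)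
  finally have 2: "?x10 * p - ?x00 * q = 0" unfolding Be m by simp
  have "p * (?x00^2 + ?x01 * ?x10) = ?x00 * (?x00 * p + ?x01 * q) + ?x01 * (?x10 * p - ?x00 * q)"
   "q * (?x00^2 + ?x01 * ?x10) = ?x10 * (?x00 * p + ?x01 * q) - ?x00 * (?x10 * p - ?x00 * q)"
   by (simp_all only: power2_eq_square) (simp_all only: ring_distribs mult_ac add_ac, simp_all add: algebra_simps)
  then have "?x00^2 + ?x01 * ?x10 = 0" unfolding 1 2 using pq by auto
  then show False using nz unfolding commutator_by_traces[OF A B] by simp
 qed
 define F where "F = mat 2 2 (\<lambda>(i,j). if i = 0 then (if j = 0 then p else r) else (if j = 0 then q else s))"
 define G where "G = mat 2 2 (\<lambda>(i,j). if i = 0 then (if j = 0 then s / D else - r / D) else (if j = 0 then - q / D else p / D))"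
 have FC: "F \<in> mats 2" "G \<in> mats 2" by (auto simp: F_def G_def)
 have Fi: "F $$ (0,0) = p" "F $$ (0,1) = r" "F $$ (1,0) = q" "F $$ (1,1) = s"
  "G $$ (0,0) = s / D" "G $$ (0,1) = - r / D" "G $$ (1,0) = - q / D" "G $$ (1,1) = p / D" by (simp_all add: F_def G_def)
 have inv: "p * (s / D) + r * (- q / D) = 1" "q * (- r / D) + s * (p / D) = 1" "p * (- r / D) + r * (p / D) = 0" "q * (s / D) + s * (- q / D) = 0"
  "s / D * p + - r / D * q = 1" "- q / D * r + p / D * s = 1" "s / D * r + - r / D * s = 0" "- q / D * p + p / D * q = 0"
 proof -
  have "p * s = D + q * r" by (simp add: D_def)
  then show "p * (s / D) + r * (- q / D) = 1" "q * (- r / D) + s * (p / D) = 1" "p * (- r / D) + r * (p / D) = 0" "q * (s / D) + s * (- q / D) = 0"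
  "s / D * p + - r / D * q = 1" "- q / D * r + p / D * s = 1" "s / D * r + - r / D * s = 0" "- q / D * p + p / D * q = 0"
   using D0 by (simp_all add: field_simps)
 qed
 have FG: "F * G = 1\<^sub>m 2" "G * F = 1\<^sub>m 2"
  by (rule eq_matI; use FC in \<open>auto simp: less_2_cases_iff mult22[OF FC(1,2)] mult22[OF FC(2,1)] Fi Fi[unfolded One_nat_def] inv inv[simplified] simp del: index_mult_mat(1)\<close>)+
 have AF: "(A * F) $$ (0,0) = r" "(A * F) $$ (1,0) = s" by (simp_all add: mult22[OF A FC(1)] Fi Fi[unfolded One_nat_def] r_def s_def del: index_mult_mat(1))
 have BF: "(B * F) $$ (0,0) = \<beta> * p" "(B * F) $$ (1,0) = \<beta> * q" by (simp_all add: mult22[OF B FC(1)] Fi Fi[unfolded One_nat_def] Be Be[unfolded One_nat_def] del: index_mult_mat(1))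
 have AFC: "A * F \<in> mats 2" "B * F \<in> mats 2" using A B FC by auto
 have "(G * (A * F)) $$ (0,0) = 0" "(G * (A * F)) $$ (1,0) = 1"
  using inv(6,7) by (simp_all add: mult22[OF FC(2) AFC(1)] Fi Fi[unfolded One_nat_def] AF AF[unfolded One_nat_def] del: index_mult_mat(1))
 moreover have "(G * (B * F)) $$ (0,0) = \<beta>" "(G * (B * F)) $$ (1,0) = 0"
 proof -
  have "(G * (B * F)) $$ (0,0) = \<beta> * (s / D * p + - r / D * q)" by (simp add: mult22[OF FC(2) AFC(2)] Fi Fi[unfolded One_nat_def] BF BF[unfolded One_nat_def] algebra_simps del: index_mult_mat(1))
  then show "(G * (B * F)) $$ (0,0) = \<beta>" unfolding inv by simp
  show "(G * (B * F)) $$ (1,0) = 0" by (simp add: mult22[OF FC(2) AFC(2)] Fi Fi[unfolded One_nat_def] BF BF[unfolded One_nat_def] del: index_mult_mat(1))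
 qed
 ultimately show ?thesis using FC FG by blast
qed

text \<open>The basis consists of the images of the two vectors of \<open>good_frame\<close> under the three spectral
 projectors of \<open>T\<close>. They are independent because the three \<open>2 \<times> 2\<close> matrices are invertible.\<close>
lemma normal_form6:
 assumes g: "gamma_pair 6 S T" and d: "dim_vector \<rho> (stp S T) = (4,2,2,2,2)" and nz: "g6 (stp S T) \<noteq> 0"
 shows "\<exists>c. rep_iso (stp S T) (stp (NS6 c) NT6)"
proof -
 note G = gamma_pairD[OF g]
 define Q where "Q = (1/2) \<cdot>\<^sub>m (1\<^sub>m 6 + (-1) \<cdot>\<^sub>m S)"
 note iQ = involution_projector[OF G(1,3) Q_def]
 have QC: "Q \<in> mats 6" "Q * Q = Q" "mtr Q = 2" using iQ gamma_traces(3)[OF g d] by simp_all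
 obtain r U V where UV: "U \<in> carrier_mat 6 r" "V \<in> carrier_mat r 6" "Q = U * V" "V * U = 1\<^sub>m r" "mtr Q = of_nat r"
  using idempotent_factor[OF QC(1,2)] by blast
 have "of_nat r = (of_nat 2 :: complex)" using UV(5) QC(3) by simp
 then have r: "r = 2" by (simp only: of_nat_eq_iff)
 note UV = UV(1-4)[unfolded r]
 define P where "P m = proj 6 T (\<rho>^m)" for m
 have PC: "P m \<in> mats 6" for m unfolding P_def by (rule proj_carrier[OF G(2)])
 have frame: "\<exists>U V \<beta>. U \<in> carrier_mat 6 2 \<and> V \<in> carrier_mat 2 6 \<and> Q = U * V \<and> V * U = 1\<^sub>m 2 \<and>
   (V * (P 0 * U)) $$ (0,0) = 0 \<and> (V * (P 0 * U)) $$ (1,0) = 1 \<and> (V * (P 1 * U)) $$ (0,0) = \<beta> \<and> (V * (P 1 * U)) $$ (1,0) = 0"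
 proof -
  have CC: "V * (P m * U) \<in> mats 2" for m using mult_carrier_mat[OF UV(2) mult_carrier_mat[OF PC UV(1)]] .
  have nzc: "mtr (V * (P 1 * U) * (V * (P 0 * U) * (V * (P 1 * U))) * (V * (P 0 * U))) - mtr (V * (P 0 * U) * (V * (P 1 * U) * (V * (P 1 * U))) * (V * (P 0 * U))) \<noteq> 0"
   using nz compressed_traces(3)[OF g UV(1,2) UV(3)[unfolded Q_def], of "\<lambda>m. V * (P m * U)"] unfolding g6_def P_def by auto
  obtain F H \<beta> where F: "F \<in> mats 2" "H \<in> mats 2" "F * H = 1\<^sub>m 2" "H * F = 1\<^sub>m 2"
   "(H * (V * (P 0 * U) * F)) $$ (0,0) = 0" "(H * (V * (P 0 * U) * F)) $$ (1,0) = 1" "(H * (V * (P 1 * U) * F)) $$ (0,0) = \<beta>" "(H * (V * (P 1 * U) * F)) $$ (1,0) = 0"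
   using good_frame[OF CC CC nzc] by blast
  have UF: "U * F \<in> carrier_mat 6 2" "H * V \<in> carrier_mat 2 6" using UV(1,2) F(1,2) by auto
  have e: "H * V * (P m * (U * F)) = H * (V * (P m * U) * F)" for m
  proof -
   have PU: "P m * U \<in> carrier_mat 6 2" by (rule mult_carrier_mat[OF PC UV(1)])
   have PUF: "P m * U * F \<in> carrier_mat 6 2" by (rule mult_carrier_mat[OF PU F(1)])
   show ?thesis unfolding assoc_mult_mat[OF PC UV(1) F(1), symmetric] assoc_mult_mat[OF F(2) UV(2) PUF] assoc_mult_mat[OF UV(2) PU F(1)] ..
  qed
  have "F * (H * V) = V" using assoc_mult_mat[OF F(1,2) UV(2)] UV(2) unfolding F(3) by simp
  then have 1: "U * F * (H * V) = Q" unfolding assoc_mult_mat[OF UV(1) F(1) UF(2)] UV(3) by simp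
  have "V * (U * F) = F" using assoc_mult_mat[OF UV(2,1) F(1)] F(1) unfolding UV(4) by simp
  then have 2: "H * V * (U * F) = 1\<^sub>m 2" unfolding assoc_mult_mat[OF F(2) UV(2) UF(1)] F(4)[symmetric] by simp
  show ?thesis
   by (rule exI[of _ "U * F"], rule exI[of _ "H * V"], rule exI[of _ \<beta>]) (use UF 1 2 F(5-8) in \<open>simp only: e\<close>)
 qed
 obtain U V \<beta> where UV: "U \<in> carrier_mat 6 2" "V \<in> carrier_mat 2 6" "Q = U * V" "V * U = 1\<^sub>m 2"
  and fr: "(V * (P 0 * U)) $$ (0,0) = 0" "(V * (P 0 * U)) $$ (1,0) = 1" "(V * (P 1 * U)) $$ (0,0) = \<beta>" "(V * (P 1 * U)) $$ (1,0) = 0"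
  using frame by blast
 define C where "C m = V * (P m * U)" for m
 have PU: "P m * U \<in> carrier_mat 6 2" for m by (rule mult_carrier_mat[OF PC UV(1)])
 have CC: "C m \<in> mats 2" for m unfolding C_def by (rule mult_carrier_mat[OF UV(2) PU])
 note ct = compressed_traces[OF g UV(1,2) UV(3)[unfolded Q_def], of C, unfolded P_def[symmetric], OF C_def]
 have dC: "C m $$ (0,0) * C m $$ (1,1) - C m $$ (0,1) * C m $$ (1,0) \<noteq> 0" if "m < 3" for m
 proof -
  have "(ntrn 6 (cw m) (stp S T))^2 - ntrn 6 (NMul (cw m) (cw m)) (stp S T) \<noteq> 0"
   using nz that unfolding g6_def by auto
  then show ?thesis unfolding ct det_by_traces[OF CC] by simp
 qed
 have t: "tri 1 \<rho> (\<rho>\<^sup>2)" unfolding tri_def using rho_power_cube[of 2] rho3 rho_distinct by (metis power_one)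
 have l3: "m = 0 \<or> m = 1 \<or> m = 2" if "m < 3" for m :: nat using that by auto
 have Psum: "(\<Sum>m<3. P m $$ (i,j)) = (if i = j then 1 else 0)" if "i < 6" "j < 6" for i j
 proof -
  have "P 0 + (P 1 + P 2) = 1\<^sub>m 6" using proj_sum(1)[OF t G(2)] by (simp add: P_def)
  then have "(P 0 + (P 1 + P 2)) $$ (i,j) = 1\<^sub>m 6 $$ (i,j)" by simp
  then show ?thesis using that carrier_matD[OF PC] by (simp add: eval_nat_numeral add.assoc)
 qed
 have PP: "P m * P l = (if m = l then P l else 0\<^sub>m 6 6)" if "m < 3" "l < 3" for m l
 proof -
  have "\<rho>^m = \<rho>^l \<longleftrightarrow> m = l" using l3[OF that(1)] l3[OF that(2)] rho_distinct rho_distinct(1-3)[symmetric] by (elim disjE) simp_all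
  then show ?thesis unfolding P_def using proj_mult[OF G(2,4) rho_power_cube rho_power_cube, of m l] by simp
 qed
 have Usum: "(\<Sum>m<3. (P m * U) $$ (k,s)) = U $$ (k,s)" if "k < 6" "s < 2" for k s
 proof -
  have "(\<Sum>m<3. (P m * U) $$ (k,s)) = (\<Sum>l<6. (\<Sum>m<3. P m $$ (k,l)) * U $$ (l,s))"
   unfolding mult_idx[OF PC UV(1) that] by (subst sum.swap) (simp add: sum_distrib_right)
  also have "\<dots> = (\<Sum>l<6. if l = k then U $$ (l,s) else 0)" using that by (intro sum.cong refl) (auto simp: Psum)
  finally show ?thesis using that by simp
 qed
 have Csum: "(\<Sum>m<3. C m $$ (r,s)) = (if r = s then 1 else 0)" if "r < 2" "s < 2" for r s
 proof -
  have "(\<Sum>m<3. C m $$ (r,s)) = (\<Sum>l<6. V $$ (r,l) * (\<Sum>m<3. (P m * U) $$ (l,s)))"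
   unfolding C_def mult_idx[OF UV(2) PU that] by (subst sum.swap) (simp add: sum_distrib_left)
  also have "\<dots> = (V * U) $$ (r,s)" unfolding mult_idx[OF UV(2,1) that] using that by (intro sum.cong refl) (simp add: Usum)
  finally show ?thesis unfolding UV(4) using that by simp
 qed
 define c where "c i = [C 1 $$ (0,1), \<beta>, \<beta> + C 1 $$ (1,1), - C 0 $$ (0,1), C 0 $$ (1,1)] ! i" for i
 have KC: "K6 c r j = C (j div 2) $$ (r, j mod 2)" if "r < 2" "j < 6" for r j
 proof -
  have s3: "(\<Sum>m<3. f m) = f 0 + f 1 + f 2" for f :: "nat => complex" by (simp add: eval_nat_numeral)
  have "C 2 $$ (r,s) = (if r = s then 1 else 0) - C 0 $$ (r,s) - C 1 $$ (r,s)" if "r < 2" "s < 2" for r s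
   using Csum[OF that] unfolding s3 by (simp add: algebra_simps)
  note c2 = this
  note fr' = fr[folded C_def]
  have "r = 0 \<or> r = 1" "j = 0 \<or> j = 1 \<or> j = 2 \<or> j = 3 \<or> j = 4 \<or> j = 5" using that by auto
  then show ?thesis
   by (elim disjE) (simp_all add: K6_def c_def c2 fr' fr'[unfolded One_nat_def])
 qed
 define B where "B = mat 6 6 (\<lambda>(k,j). (P (j div 2) * U) $$ (k, j mod 2))"
 have BC: "B \<in> mats 6" by (simp add: B_def)
 have pair: "(\<Sum>j<6. f (j div 2) (j mod 2)) = (\<Sum>m<3. \<Sum>s<2. f m s :: complex)" for f :: "nat => nat => complex"
 proof -
  have "{..<3} = {0,1,2::nat}" "{..<2} = {0,1::nat}" by auto
  then show ?thesis unfolding sum6 by (simp add: add.assoc)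
 qed
 have "det B \<noteq> 0"
 proof
  assume "det B = 0"
  then obtain w where w: "w \<in> carrier_vec 6" "w \<noteq> 0\<^sub>v 6" "B *\<^sub>v w = 0\<^sub>v 6" using det_0_iff_vec_prod_zero[OF BC] by blast
  have z: "C m $$ (r,0) * w $ (2*m) + C m $$ (r,1) * w $ (2*m+1) = 0" if m: "m < 3" and r: "r < 2" for m r
  proof -
   have VP: "V * P m \<in> carrier_mat 2 6" using mult_carrier_mat[OF UV(2) PC] .
   have e: "(V * P m * (P l * U)) $$ (r,s) = (if l = m then C m $$ (r,s) else 0)" if "l < 3" "s < 2" for l s
   proof -
    have "V * P m * (P l * U) = V * ((P m * P l) * U)"
     unfolding assoc_mult_mat[OF UV(2) PC PU] assoc_mult_mat[OF PC PC UV(1)] ..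
    then show ?thesis unfolding PP[OF m that(1)] C_def using that r UV by (auto simp del: index_mult_mat(1))
   qed
   have "((V * P m) *\<^sub>v (B *\<^sub>v w)) $ r = (\<Sum>j<6. ((V * P m) * B) $$ (r,j) * w $ j)"
    using assoc_mult_mat_vec[OF VP BC w(1)] mult_vec_idx[OF mult_carrier_mat[OF VP BC] w(1) r] by simp
   also have "\<dots> = (\<Sum>j<6. (\<lambda>l s. (V * P m * (P l * U)) $$ (r,s) * w $ (2 * l + s)) (j div 2) (j mod 2))"
   proof (intro sum.cong refl)
    fix j :: nat assume "j \<in> {..<6}"
    then have j: "j < 6" "j mod 2 < 2" by auto
    have "((V * P m) * B) $$ (r,j) = (V * P m * (P (j div 2) * U)) $$ (r,j mod 2)"
     unfolding mult_idx[OF VP BC r j(1)] mult_idx[OF VP PU r j(2)] using j by (intro sum.cong refl) (simp add: B_def)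
    then show "((V * P m) * B) $$ (r,j) * w $ j = (\<lambda>l s. (V * P m * (P l * U)) $$ (r,s) * w $ (2 * l + s)) (j div 2) (j mod 2)" by simp
   qed
   also have "\<dots> = (\<Sum>l<3. \<Sum>s<2. (V * P m * (P l * U)) $$ (r,s) * w $ (2 * l + s))"
    by (rule pair[of "\<lambda>l s. (V * P m * (P l * U)) $$ (r,s) * w $ (2 * l + s)"])
   also have "\<dots> = (\<Sum>l<3. if l = m then (\<Sum>s<2. C m $$ (r,s) * w $ (2 * l + s)) else 0)"
    by (intro sum.cong refl) (simp add: e)
   also have "\<dots> = C m $$ (r,0) * w $ (2*m) + C m $$ (r,1) * w $ (2*m+1)" using m by (simp add: numeral_2_eq_2)
   also have "((V * P m) *\<^sub>v (B *\<^sub>v w)) $ r = 0" unfolding w(3) by (subst mult_vec_idx[OF VP _ r]) simp_all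
   finally show ?thesis by simp
  qed
  have w0: "w $ (2*m) = 0 \<and> w $ (2*m+1) = 0" if m: "m < 3" for m
  proof -
   let ?a = "C m $$ (0,0)" and ?b = "C m $$ (0,1)" and ?c = "C m $$ (1,0)" and ?d = "C m $$ (1,1)" and ?u = "w $ (2*m)" and ?v = "w $ (2*m+1)"
   have z1: "?a * ?u + ?b * ?v = 0" "?c * ?u + ?d * ?v = 0" using z[OF m] by simp_all
   have "(?a * ?d - ?b * ?c) * ?u = ?d * (?a * ?u + ?b * ?v) - ?b * (?c * ?u + ?d * ?v)"
    "(?a * ?d - ?b * ?c) * ?v = ?a * (?c * ?u + ?d * ?v) - ?c * (?a * ?u + ?b * ?v)" by (simp_all add: algebra_simps)
   then show ?thesis unfolding z1 using dC[OF m] by simp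
  qed
  have "w = 0\<^sub>v 6"
  proof (rule eq_vecI)
   fix i assume "i < dim_vec (0\<^sub>v 6 :: complex vec)"
   then have i: "i < 6" "i div 2 < 3" by auto
   have "i = 2 * (i div 2) \<or> i = 2 * (i div 2) + 1" by presburger
   then show "w $ i = 0\<^sub>v 6 $ i" using w0[OF i(2)] i(1) by auto
  qed (use w(1) in auto)
  then show False using w(2) by simp
 qed
 then obtain B' where B': "B' \<in> mats 6" "B * B' = 1\<^sub>m 6" "B' * B = 1\<^sub>m 6" using det_inverse_exists[OF BC] by blast
 have QB: "Q * B = B * NQ6 c"
 proof (rule eq_matI)
  fix k j assume "k < dim_row (B * NQ6 c)" "j < dim_col (B * NQ6 c)"
  then have kj: "k < 6" "j < 6" "j mod 2 < 2" using BC N6_carrier(1)[of c] by auto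
  have QPU: "Q * (P (j div 2) * U) = U * C (j div 2)" unfolding UV(3) C_def by (rule assoc_mult_mat[OF UV(1,2) PU])
  have "(Q * B) $$ (k,j) = (Q * (P (j div 2) * U)) $$ (k,j mod 2)"
   unfolding mult_idx[OF QC(1) BC kj(1,2)] mult_idx[OF QC(1) PU kj(1,3)] using kj by (intro sum.cong refl) (simp add: B_def)
  also have "\<dots> = (\<Sum>r<2. U $$ (k,r) * K6 c r j)"
   unfolding QPU mult_idx[OF UV(1) CC kj(1,3)] using kj by (intro sum.cong refl) (simp add: KC)
  also have "\<dots> = (\<Sum>m<3. \<Sum>r<2. (P m * U) $$ (k,r) * K6 c r j)"
   by (subst sum.swap) (intro sum.cong refl, simp add: Usum[symmetric] kj sum_distrib_right)
  also have "\<dots> = (\<Sum>l<6. (\<lambda>m r. (P m * U) $$ (k,r) * K6 c r j) (l div 2) (l mod 2))"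
   by (rule pair[of "\<lambda>m r. (P m * U) $$ (k,r) * K6 c r j", symmetric])
  also have "\<dots> = (B * NQ6 c) $$ (k,j)"
   unfolding mult_idx[OF BC N6_carrier(1) kj(1,2)] using kj by (intro sum.cong refl) (simp add: B_def NQ6_def)
  finally show "(Q * B) $$ (k,j) = (B * NQ6 c) $$ (k,j)" .
 qed (use QC(1) BC N6_carrier(1)[of c] in auto)
 have "rep_iso (stp S T) (stp (NS6 c) NT6)"
 proof (rule stp_intertwine_iso[OF g N6_gamma BC B'])
  have SQ: "S = 1\<^sub>m 6 + (-2) \<cdot>\<^sub>m Q" by (rule eq_matI) (use G(1) in \<open>auto simp: Q_def field_simps\<close>)
  have "S * B = B + (-2) \<cdot>\<^sub>m (Q * B)" unfolding SQ using QC(1) BC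
   by (simp add: add_mult_distrib_mat[of _ 6 6 _ _ 6] mult_smult_assoc_mat[of _ 6 6 _ 6])
  also have "\<dots> = B * NS6 c" unfolding QB NS6_def using N6_carrier(1)[of c] BC
   by (simp add: mult_add_distrib_mat[of _ 6 6 _ 6] mult_smult_distrib[of _ 6 6 _ 6])
  finally show "S * B = B * NS6 c" .
  show "T * B = B * NT6" unfolding NT6_mult(3)[OF BC]
  proof (rule eq_matI)
   fix k j assume "k < dim_row (mat 6 6 (\<lambda>(i,j). B $$ (i,j) * \<rho> ^ (j div 2)))" "j < dim_col (mat 6 6 (\<lambda>(i,j). B $$ (i,j) * \<rho> ^ (j div 2)))"
   then have kj: "k < 6" "j < 6" "j mod 2 < 2" by auto
   let ?m = "j div 2"
   have "T * (P ?m * U) = (T * P ?m) * U" by (rule assoc_mult_mat[OF G(2) PC UV(1), symmetric])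
   also have "T * P ?m = \<rho> ^ ?m \<cdot>\<^sub>m P ?m" unfolding P_def by (rule T_proj(1)[OF G(2,4) rho_power_cube])
   also have "(\<rho> ^ ?m \<cdot>\<^sub>m P ?m) * U = \<rho> ^ ?m \<cdot>\<^sub>m (P ?m * U)" by (rule mult_smult_assoc_mat[OF PC UV(1)])
   finally have TP: "T * (P ?m * U) = \<rho> ^ ?m \<cdot>\<^sub>m (P ?m * U)" .
   have "(T * B) $$ (k,j) = (T * (P ?m * U)) $$ (k,j mod 2)"
    unfolding mult_idx[OF G(2) BC kj(1,2)] mult_idx[OF G(2) PU kj(1,3)] using kj by (intro sum.cong refl) (simp add: B_def)
   also have "\<dots> = \<rho> ^ ?m * (P ?m * U) $$ (k, j mod 2)" unfolding TP using kj carrier_matD[OF PU] by (simp del: index_mult_mat(1))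
   finally show "(T * B) $$ (k,j) = mat 6 6 (\<lambda>(i,j). B $$ (i,j) * \<rho> ^ (j div 2)) $$ (k,j)" using kj by (simp add: B_def mult.commute del: index_mult_mat(1))
  qed (use G(2) BC in auto)
 qed
 then show ?thesis by (rule exI[of _ c])
qed

text \<open>The symmetric \<open>2 \<times> 2\<close> matrix \<open>M\<close> is chosen such that the products of \<open>M\<close> with the three
 matrices are symmetric; these products are the diagonal blocks of the form \<open>D\<close>. If \<open>D\<close> were zero,
 then the first two matrices would have a singular commutator.\<close>
lemma N6_reversal:
 assumes s: "simple_rep 6 (stp (NS6 c) NT6)" and nz: "g6 (stp (NS6 c) NT6) \<noteq> 0"
 shows "ntrn 6 (nrev q) (stp (NS6 c) NT6) = ntrn 6 q (stp (NS6 c) NT6)"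
proof -
 define m where "m = 2 * c 1 - c 2"
 define M where "M r s = (if r = 0 \<and> s = 0 then m else if r = 1 \<and> s = 1 then c 4 * c 0 - c 3 * m else c 0)" for r s :: nat
 define d where "d i j = K6 c 0 i * M 0 (j mod 2) + K6 c 1 i * M 1 (j mod 2)" for i j
 define D where "D = mat 6 6 (\<lambda>(i,j). if i div 2 = j div 2 then d i j else 0)"
 have DC: "D \<in> mats 6" by (simp add: D_def)
 have six: "i = 0 \<or> i = 1 \<or> i = 2 \<or> i = 3 \<or> i = 4 \<or> i = 5" if "i < 6" for i :: nat using that by auto
 have ds: "d i j = d j i" if "i < 6" "j < 6" "i div 2 = j div 2" for i j
  using six[OF that(1)] six[OF that(2)] that(3)
  by (elim disjE) (simp_all add: d_def M_def K6_def m_def algebra_simps)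
 have Ds: "D $$ (i,j) = D $$ (j,i)" if "i < 6" "j < 6" for i j using that ds by (simp add: D_def)
 have DQ: "(D * NQ6 c) $$ (i,j) = d i 0 * K6 c 0 j + d i 1 * K6 c 1 j" if ij: "i < 6" "j < 6" for i j
 proof -
  have "(D * NQ6 c) $$ (i,j) = (\<Sum>l<6. if i div 2 = l div 2 then d i l * K6 c (l mod 2) j else 0)"
   unfolding mult_idx[OF DC N6_carrier(1) ij] using ij by (intro sum.cong refl) (auto simp: D_def NQ6_def)
  also have "\<dots> = d i 0 * K6 c 0 j + d i 1 * K6 c 1 j"
   using six[OF ij(1)] unfolding sum6 by (elim disjE) (simp_all add: d_def)
  finally show ?thesis .
 qed
 have DNS: "(D * NS6 c) $$ (i,j) = D $$ (i,j) - 2 * (D * NQ6 c) $$ (i,j)" if ij: "i < 6" "j < 6" for i j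
 proof -
  have "D * NS6 c = D + (-2) \<cdot>\<^sub>m (D * NQ6 c)" unfolding NS6_def using N6_carrier(1)[of c] DC
   by (simp add: mult_add_distrib_mat[of _ 6 6 _ 6] mult_smult_distrib[of _ 6 6 _ 6])
  then show ?thesis using ij by (simp add: carrier_matD[OF DC] carrier_matD[OF N6_carrier(1)] del: index_mult_mat(1))
 qed
 show ?thesis
 proof (rule self_adjoint_reversal[OF N6_gamma s DC])
  show "D * NS6 c = transpose_mat (NS6 c) * D"
   by (rule self_adjointI[OF DC N6_carrier(2) Ds, of 6])
     (simp_all add: DNS DQ Ds d_def M_def algebra_simps del: index_mult_mat(1))
  show "D * NT6 = transpose_mat NT6 * D"
  proof (rule self_adjointI[OF DC N6_carrier(3) Ds, of 6])
   fix i j :: nat assume ij: "i < 6" "j < 6"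
   then have "(D * NT6) $$ (i,j) = D $$ (i,j) * \<rho> ^ (j div 2)" "(D * NT6) $$ (j,i) = D $$ (j,i) * \<rho> ^ (i div 2)"
    unfolding NT6_mult(3)[OF DC] by simp_all
   then show "(D * NT6) $$ (i,j) = (D * NT6) $$ (j,i)" using ij by (auto simp: D_def ds simp del: index_mult_mat(1))
  qed
  show "D \<noteq> 0\<^sub>m 6 6"
  proof
   assume D0: "D = 0\<^sub>m 6 6"
   have e: "d i j = 0" if "i < 6" "j < 6" "i div 2 = j div 2" for i j
   proof -
    have "D $$ (i,j) = d i j" using that by (simp add: D_def)
    then show ?thesis unfolding D0 using that by simp
   qed
   have "d 0 0 + d 2 2 + d 4 4 = 0" "d 0 1 + d 2 3 + d 4 5 = 0" by (simp_all add: e)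
   then have "m = 0" "c 0 = 0" by (simp_all add: d_def M_def K6_def algebra_simps)
   then have "mtr (C6 c 1 * (C6 c 0 * C6 c 1) * C6 c 0) - mtr (C6 c 0 * (C6 c 1 * C6 c 1) * C6 c 0) = 0"
    unfolding commutator_by_traces[OF C6_carrier C6_carrier] by (simp add: C6_entries K6_def m_def eval_nat_numeral)
   then show False using nz unfolding g6_def N6_traces by simp
  qed
 qed
qed

lemma reversal_six:
 assumes s: "simple_rep 6 \<psi>" "\<psi> \<in> FG 6 (4,2,2,2,2)" and \<phi>: "\<phi> \<in> FG 6 (4,2,2,2,2)"
 shows "ntrn 6 (nrev q) \<phi> = ntrn 6 q \<phi>"
proof (rule reversal_by_density[OF s g6_regular _ g6_nonzero _ \<phi>])
 have NF: "stp (NS6 c) NT6 \<in> FG 6 (4,2,2,2,2)" for c unfolding FG_def using N6_gamma N6_dim by blast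
 show "stp (NS6 (\<lambda>i. [1,1,2,2,0] ! i)) NT6 \<in> FG 6 (4,2,2,2,2)" by (rule NF)
 fix \<chi> assume x: "\<chi> \<in> FG 6 (4,2,2,2,2)" "simple_rep 6 \<chi>" "g6 \<chi> \<noteq> 0"
 then obtain c where c: "rep_iso \<chi> (stp (NS6 c) NT6)" using normal_form6 unfolding FG_def by blast
 have t: "ntrn 6 p \<chi> = ntrn 6 p (stp (NS6 c) NT6)" for p
  using ntrn_invariant c FG_rep[OF x(1)] FG_rep[OF NF] unfolding invariant_fun_def by blast
 have "g6 (stp (NS6 c) NT6) \<noteq> 0" using x(3) unfolding g6_def t .
 then show "ntrn 6 (nrev q) \<chi> = ntrn 6 q \<chi>" unfolding t by (rule N6_reversal[OF simple_iso[OF x(2) c FG_rep[OF NF]]])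
qed

lemma krull_dim_six:
 assumes s: "simple_rep 6 \<psi>" "\<psi> \<in> FG 6 (4,2,2,2,2)"
 shows "krull_dim (subtopology (zariski_iss 6) (iss_comp \<rho> 6 (4,2,2,2,2))) = enat 6"
proof -
 have NF: "stp (NS6 c) NT6 \<in> FG 6 (4,2,2,2,2)" for c unfolding FG_def using N6_gamma N6_dim by blast
 have nf: "\<exists>c. rep_iso \<phi> (stp (NS6 c) NT6)" if "\<phi> \<in> FG 6 (4,2,2,2,2)" "g6 \<phi> \<noteq> 0" for \<phi>
  using that normal_form6 unfolding FG_def by blast
 interpret normal_form \<rho> 6 "(4,2,2,2,2)" NS6 "\<lambda>_. NT6"
 proof
  show "(6::nat) > 0" "NS6 \<in> matfun polys 6 6" "(\<lambda>_. NT6) \<in> matfun polys 6 6" "gamma_pair 6 (NS6 c) NT6" "dim_vector \<rho> (stp (NS6 c) NT6) = (4,2,2,2,2)" for c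
   using N6_polys N6_gamma N6_dim by auto
  show "(\<And>i. i < 6 - 1 ==> c i = c' i) ==> NS6 c = NS6 c' \<and> NT6 = NT6" for c c' using N6_local by blast
  show "\<exists>g\<in>regular_fun 6. (\<exists>\<phi>\<in>FG 6 (4,2,2,2,2). g \<phi> \<noteq> 0) \<and> (\<forall>\<phi>\<in>FG 6 (4,2,2,2,2). g \<phi> \<noteq> 0 --> (\<exists>c. rep_iso \<phi> (stp (NS6 c) NT6)))"
   using g6_nonzero NF nf by (intro bexI[OF _ g6_regular]) blast
  obtain \<chi> where x: "\<chi> \<in> FG 6 (4,2,2,2,2)" "simple_rep 6 \<chi>" "g6 \<chi> \<noteq> 0" using FG_generic_simple[OF s g6_regular NF g6_nonzero] by blast
  obtain c0 where "rep_iso \<chi> (stp (NS6 c0) NT6)" using nf[OF x(1,3)] by blast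
  then have c0: "simple_rep 6 (stp (NS6 c0) NT6)" by (rule simple_iso[OF x(2) _ FG_rep[OF NF]])
  show "\<exists>c0. simple_rep 6 (stp (NS6 c0) NT6) \<and> (\<forall>j<6 - 1. \<exists>f. releases 6 (\<lambda>c. stp (NS6 c) NT6) c0 j f)"
   by (rule exI[of _ c0], rule conjI[OF c0], intro allI impI, rule flag6[OF c0])
 qed
 show ?thesis by (rule krull_dim_eq)
qed

end

section \<open>The classification\<close>

lemma nev_nrev_nscale:
 assumes p: "\<phi> \<in> pairs n"
 shows "nev n \<phi> (nrev (nscale c q)) = nev n \<phi> (nscale c (nrev q))"
proof -
 have e: "M * (c \<cdot>\<^sub>m 1\<^sub>m n) = c \<cdot>\<^sub>m 1\<^sub>m n * M" if M: "M \<in> mats n" for M :: "complex mat"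
  using mult_smult_distrib[OF M one_carrier_mat] mult_smult_assoc_mat[OF one_carrier_mat M] M by simp
 show ?thesis
 proof (induction q)
  case NX
  show ?case unfolding nscale.simps nrev.simps nev.simps(5) nev.simps(1) by (rule e) (rule nev_carrier)
 next
  case NY
  show ?case unfolding nscale.simps nrev.simps nev.simps(5) nev.simps(1) by (rule e) (rule nev_carrier)
 qed simp_all
qed

context cube_root
begin

lemma tau_trivial_if_reversal:
 assumes r: "\<And>S T q. gamma_pair n S T ==> dim_vector \<rho> (stp S T) = \<alpha> ==> ntrn n (nrev q) (stp S T) = ntrn n q (stp S T)"
  and C: "C \<in> iss_comp \<rho> n \<alpha>"
 shows "tau C = C"
proof (rule tau_trivial_if_traces[OF _ C])
 fix \<phi> q assume "\<phi> \<in> FS n \<alpha>"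
 then obtain \<mu> S T where f: "\<phi> = scale_rep \<mu> (stp S T)" and g: "gamma_pair n S T" "dim_vector \<rho> (stp S T) = \<alpha>"
  unfolding FS_def FG_def by blast
 note p = stp_rep(4)[OF g(1)]
 show "ntrn n (nrev q) \<phi> = ntrn n q \<phi>"
  using r[OF g, of "nscale \<mu> q"] unfolding f ntrn_def nev_scale[OF p] nev_nrev_nscale[OF p] .
qed

lemma rank_one_dims:
 assumes g: "gamma_pair n S T" and e: "e1^3 = 1" "e3^3 = 1"
 shows "mtr S = (if even n then 0 else 1) \<and> mtr (proj n T e1) = of_nat (n div 2) \<and> mtr (proj n T e3) = 1 \<longleftrightarrow>
  eigenspace_dim S 1 = n - n div 2 \<and> eigenspace_dim S (-1) = n div 2 \<and> eigenspace_dim T e1 = n div 2 \<and> eigenspace_dim T e3 = 1"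
proof -
 note G = gamma_pairD[OF g]
 define a b where "a = eigenspace_dim S 1" and "b = eigenspace_dim S (-1)"
 have t: "a + b = n" "mtr S = of_nat a - of_nat b"
  using gamma_traces(1,3)[OF g dim_vector_stp[OF g]] by (auto simp: a_def b_def)
 have "mtr S = (if even n then 0 else 1) \<longleftrightarrow> a = n - n div 2 \<and> b = n div 2"
 proof -
  have "mtr S = (if even n then 0 else 1) \<longleftrightarrow> (of_nat a :: complex) = of_nat (b + (if even n then 0 else 1))"
   unfolding t(2) by (simp add: algebra_simps)
  also have "\<dots> \<longleftrightarrow> a = b + (if even n then 0 else 1)" by (rule of_nat_eq_iff)
  also have "\<dots> \<longleftrightarrow> a = n - n div 2 \<and> b = n div 2"
  proof (cases "even n")
   case True
   then obtain k where "n = 2 * k" by (elim evenE)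
   then show ?thesis using t(1) by simp linarith
  next
   case False
   then obtain k where "n = 2 * k + 1" by (elim oddE)
   then show ?thesis using t(1) by simp linarith
  qed
  finally show ?thesis .
 qed
 moreover have "mtr (proj n T e1) = of_nat (n div 2) \<longleftrightarrow> eigenspace_dim T e1 = n div 2"
  unfolding mtr_proj[OF G(2,4) e(1)] by (rule of_nat_eq_iff)
 moreover have "mtr (proj n T e3) = 1 \<longleftrightarrow> eigenspace_dim T e3 = 1"
  unfolding mtr_proj[OF G(2,4) e(2)] by (metis of_nat_1 of_nat_eq_iff)
 ultimately show ?thesis unfolding a_def b_def by blast
qed

text \<open>The listed vectors other than \<open>(4,2;2,2,2)\<close> are those of \<open>rank_one_form\<close> for the three
 admissible positions of the simple eigenvalue.\<close>
lemma listed_cases: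
 assumes l: "(a,b,x,y,z) \<in> tau_trivial_list" and n: "n = a + b" "n = x + y + z" and n0: "n > 0"
 shows "(n = 6 \<and> (a,b,x,y,z) = (4,2,2,2,2)) \<or> (\<exists>e1 e2 e3. rank_one_form \<rho> n (a,b,x,y,z) e1 e2 e3)"
proof -
 have c3: "(\<rho>\<^sup>2) ^ 3 = 1" by (rule cube_roots[THEN iffD2]) simp
 have t: "tri 1 \<rho> (\<rho>\<^sup>2)" "tri 1 (\<rho>\<^sup>2) \<rho>" "tri \<rho> (\<rho>\<^sup>2) 1" unfolding tri_def using c3 rho3 rho_distinct by (metis power_one)+
 let ?P = "\<lambda>S T e1 e3. dim_vector \<rho> (stp S T) = (a,b,x,y,z) \<longleftrightarrow>
   eigenspace_dim S 1 = n - n div 2 \<and> eigenspace_dim S (-1) = n div 2 \<and> eigenspace_dim T e1 = n div 2 \<and> eigenspace_dim T e3 = 1"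
 have r: ?thesis if t: "tri e1 e2 e3" and d: "\<And>S T. gamma_pair n S T ==> ?P S T e1 e3" for e1 e2 e3
 proof -
  have "rank_one_form \<rho> n (a,b,x,y,z) e1 e2 e3" by unfold_locales (use n0 t d rank_one_dims triD[OF t] in auto)
  then show ?thesis by blast
 qed
 have s: "eigenspace_dim T 1 + eigenspace_dim T \<rho> + eigenspace_dim T (\<rho>\<^sup>2) = n" if "gamma_pair n S T" for S T
  using gamma_traces(2)[OF that dim_vector_stp[OF that]] .
 consider "(a,b,x,y,z) = (1,0,1,0,0)" | "(a,b,x,y,z) = (4,2,2,2,2)"
  | k where "k \<ge> 1" "(a,b,x,y,z) = (k,k,k,k-1,1)" | k where "k \<ge> 1" "(a,b,x,y,z) = (k,k,k,1,k-1)"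
  | k where "k \<ge> 1" "(a,b,x,y,z) = (k+1,k,k,k,1)" | k where "k \<ge> 1" "(a,b,x,y,z) = (k+1,k,k,1,k)"
  using l unfolding tau_trivial_list_def by blast
 then show ?thesis
 proof cases
  case 2
  then show ?thesis using n by simp
 next
  case 1
  have "?P S T \<rho> 1" if g: "gamma_pair n S T" for S T
   unfolding dim_vector_stp[OF g] using 1 n s[OF g] by auto
  then show ?thesis by (rule r[OF t(3)])
 next
  case 3
  have "?P S T 1 (\<rho>\<^sup>2)" if g: "gamma_pair n S T" for S T
   unfolding dim_vector_stp[OF g] using 3 n s[OF g] by auto
  then show ?thesis by (rule r[OF t(1)])
 next
  case 4
  have "?P S T 1 \<rho>" if g: "gamma_pair n S T" for S T
   unfolding dim_vector_stp[OF g] using 4 n s[OF g] by auto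
  then show ?thesis by (rule r[OF t(2)])
 next
  case 5
  have "?P S T 1 (\<rho>\<^sup>2)" if g: "gamma_pair n S T" for S T
   unfolding dim_vector_stp[OF g] using 5 n s[OF g] by auto
  then show ?thesis by (rule r[OF t(1)])
 next
  case 6
  have "?P S T 1 \<rho>" if g: "gamma_pair n S T" for S T
   unfolding dim_vector_stp[OF g] using 6 n s[OF g] by auto
  then show ?thesis by (rule r[OF t(2)])
 qed
qed

lemma listed_component:
 assumes l: "(a,b,x,y,z) \<in> tau_trivial_list" and n: "n = a + b" "n = x + y + z"
  and s: "simple_rep n \<psi>" "\<psi> \<in> FG n (a,b,x,y,z)"
 shows "(\<forall>C\<in>iss_comp \<rho> n (a,b,x,y,z). tau C = C) \<and>
  krull_dim (subtopology (zariski_iss n) (iss_comp \<rho> n (a,b,x,y,z))) = enat n"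
proof -
 have n0: "n > 0" using simple_repD(2)[OF s(1)] .
 from listed_cases[OF l n n0] show ?thesis
 proof (elim disjE exE)
  assume six: "n = 6 \<and> (a,b,x,y,z) = (4,2,2,2,2)"
  then have 6: "n = 6" "(a,b,x,y,z) = (4,2,2,2,2)" by auto
  have "tau C = C" if C: "C \<in> iss_comp \<rho> 6 (4,2,2,2,2)" for C
  proof (rule tau_trivial_if_reversal[OF _ C])
   show "ntrn 6 (nrev q) (stp S T) = ntrn 6 q (stp S T)" if "gamma_pair 6 S T" "dim_vector \<rho> (stp S T) = (4,2,2,2,2)" for S T q
    using reversal_six[OF s[unfolded 6]] that unfolding FG_def by blast
  qed
  then show ?thesis using krull_dim_six s unfolding 6 by blast
 next
  fix e1 e2 e3 assume "rank_one_form \<rho> n (a,b,x,y,z) e1 e2 e3"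
  then interpret rank_one_form \<rho> n "(a,b,x,y,z)" e1 e2 e3 .
  have "tau C = C" if C: "C \<in> iss_comp \<rho> n (a,b,x,y,z)" for C
  proof (rule tau_trivial_if_reversal[OF _ C])
   show "ntrn n (nrev q) (stp S T) = ntrn n q (stp S T)" if "gamma_pair n S T" "dim_vector \<rho> (stp S T) = (a,b,x,y,z)" for S T q
    using reversal_rank_one[OF s] that unfolding FG_def by blast
  qed
  then show ?thesis using krull_dim_rank_one[OF s] by blast
 qed
qed

end

theorem theorem1:
  fixes \<rho> :: complex and n a b x y z :: nat and \<alpha> :: dim_vec5
  assumes "\<rho> ^ 3 = 1" and "\<rho> \<noteq> 1"
    and "\<alpha> = (a, b, x, y, z)"
    and "n = a + b" and "n = x + y + z"
    and "a \<ge> b" and "x = Max {x, y, z}"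
    and "simple_Gamma_dim \<rho> n \<alpha>"
  shows "((\<forall>C \<in> iss_comp \<rho> n \<alpha>. tau C = C) \<longleftrightarrow> \<alpha> \<in> tau_trivial_list) \<and>
    (\<alpha> \<in> tau_trivial_list \<longrightarrow>
       krull_dim (subtopology (zariski_iss n) (iss_comp \<rho> n \<alpha>)) = enat n) \<and>
    (\<alpha> \<notin> tau_trivial_list \<longrightarrow>
       (\<exists>\<phi>. simple_rep n \<phi> \<and> iso_class n \<phi> \<in> iss_comp \<rho> n \<alpha> \<and>
            word_trace n \<phi> braid_w \<noteq> word_trace n \<phi> braid_w'))"
proof -
 interpret cube_root \<rho> by unfold_locales (fact assms(1), fact assms(2))
 obtain \<psi> where s: "simple_rep n \<psi>" "\<psi> \<in> FG n \<alpha>"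
  using assms(8) FG_simple[of n _ \<alpha>] unfolding simple_Gamma_dim_def by blast
 show ?thesis
 proof (cases "\<alpha> \<in> tau_trivial_list")
  case True
  then show ?thesis using listed_component[of a b x y z n \<psi>] assms(3-5) s by simp
 next
  case False
  obtain S T where g: "gamma_pair n S T" "dim_vector \<rho> (stp S T) = \<alpha>" "\<psi> = stp S T" using s(2) unfolding FG_def by blast
  have "y \<le> Max {x,y,z}" "z \<le> Max {x,y,z}" by (rule Max_ge; simp)+
  then have yz: "x \<ge> y" "x \<ge> z" using assms(7) by linarith+
  have "a \<ge> 3" "b \<ge> 3" "x \<ge> 2" "y \<ge> 2" "z \<ge> 2"
   using simple_non_list[OF g(1) s(1)[unfolded g(3)] g(2)[unfolded assms(3)] assms(6) yz False[unfolded assms(3)]] .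
  then have "detects n \<alpha>" unfolding assms(3) using assms(4,5) by (rule detects_large)
  from detects_simple[OF this s] obtain \<phi> where p: "simple_rep n \<phi>" "iso_class n \<phi> \<in> iss_comp \<rho> n \<alpha>"
   "word_trace n \<phi> braid_w \<noteq> word_trace n \<phi> braid_w'" "tau (iso_class n \<phi>) \<noteq> iso_class n \<phi>" by blast
  then show ?thesis using False by blast
 qed
qed

end
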